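(* Let $\pi:M\to W$ be a fibration of two compact manifolds and let $\mathcal F$ be the simple foliation of $M$ whose leaves are the fibres of $\pi$. If $\mathcal F'$ is a foliation on $M$ with $\mathcal F\subset\mathcal F'$, then $\mathcal F'$ projects to a foliation $\mathcal F_W$ on $W$. Furthermore, if $\mathcal F'$ is a Riemannian foliation, then $\mathcal F_W$ is also a Riemannian foliation.
   Context: Everything is smooth; foliations are assumed transversely orientable. The fibres of $\pi$ are connected, so that they are the leaves of $\mathcal F$ and the holonomy groupoid of $\mathcal F$ is $M\times_\pi M$. For a foliation $\mathcal F$, $T\mathcal F\subset TM$ is the subbundle of vectors tangent to the leaves and $\nu\mathcal F=TM/T\mathcal F$. $\mathcal F\subset\mathcal F'$ means that each leaf of $\mathcal F$ lies in a leaf of $\mathcal F'$, equivalently $T\mathcal F\subset T\mathcal F'$. A transverse metric of a foliation $\mathcal F$ is a positive definite fibre metric $g$ on $\nu\mathcal F$ with $\mathcal L_Xg=0$ for all vector fields $X$ tangent to $\mathcal F$; $\mathcal F$ is Riemannian if a transverse metric exists. "$\mathcal F'$ projects to a foliation $\mathcal F_W$ on $W$" means that $\mathcal F_W$ is a foliation of $W$ such that $d\pi_m(T_m\mathcal F')=T_{\pi(m)}\mathcal F_W$ for all $m\in M$. *)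

theory Defs
  imports "HOL-Analysis.Analysis" "HOL-Library.Disjoint_Sets"
begin

section \<open>Smooth maps between subsets of Euclidean spaces\<close>

primrec Ck_on :: "nat \<Rightarrow> 'a::euclidean_space set \<Rightarrow> ('a \<Rightarrow> 'b::euclidean_space) \<Rightarrow> bool" where
  "Ck_on 0 S f \<longleftrightarrow> continuous_on S f"
| "Ck_on (Suc k) S f \<longleftrightarrow> (\<forall>x\<in>S. f differentiable at x) \<and>
     (\<forall>v. Ck_on k S (\<lambda>x. frechet_derivative f (at x) v))"

(* On an arbitrary set, smooth means: locally the restriction of a smooth map on an open set. *)
definition smooth_on :: "'a::euclidean_space set \<Rightarrow> ('a \<Rightarrow> 'b::euclidean_space) \<Rightarrow> bool" where
  "smooth_on S f \<longleftrightarrow> (\<forall>x\<in>S. \<exists>U g. open U \<and> x \<in> U \<and> (\<forall>k. Ck_on k U g) \<and> (\<forall>y\<in>S \<inter> U. f y = g y))"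

(* Charts take values in a linear subspace, so f may be meaningful only on a relatively open
   subset of it; the directional derivative along a vector of that subspace is then still
   well defined. *)
definition dir_deriv :: "('a::real_normed_vector \<Rightarrow> 'b::real_normed_vector) \<Rightarrow> 'a \<Rightarrow> 'a \<Rightarrow> 'b" where
  "dir_deriv f x v = vector_derivative (\<lambda>t. f (x + t *\<^sub>R v)) (at 0)"


section \<open>Smooth manifolds\<close>

(* A chart is its domain together with a map, which is only meaningful on the domain. *)
type_synonym ('a, 'e) chart = "'a set \<times> ('a \<Rightarrow> 'e)"

definition chart_inv :: "('a, 'e) chart \<Rightarrow> 'e \<Rightarrow> 'a" where
  "chart_inv c = inv_into (fst c) (snd c)"

(* The model space is a linear subspace of a Euclidean space and plays the role of R^n. As the
   type class euclidean_space excludes dimension 0, this is what makes every n >= 0 available,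
   and it keeps all model spaces of dimension at most DIM('e) within one type. *)
record ('a, 'e) manifold =
  points :: "'a topology"
  model :: "'e set"
  atlas :: "('a, 'e) chart set"

definition is_chart :: "('a, 'e::euclidean_space, 'z) manifold_scheme \<Rightarrow> ('a, 'e) chart \<Rightarrow> bool" where
  "is_chart M c \<longleftrightarrow> openin (points M) (fst c) \<and>
     openin (top_of_set (model M)) (snd c ` fst c) \<and>
     homeomorphic_map (subtopology (points M) (fst c)) (top_of_set (snd c ` fst c)) (snd c)"

definition compatible :: "('a, 'e::euclidean_space) chart \<Rightarrow> ('a, 'e) chart \<Rightarrow> bool" where
  "compatible c d \<longleftrightarrow>
     smooth_on (snd c ` (fst c \<inter> fst d)) (snd d \<circ> chart_inv c) \<and>
     smooth_on (snd d ` (fst c \<inter> fst d)) (snd c \<circ> chart_inv d)"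

definition smooth_manifold :: "('a, 'e::euclidean_space) manifold \<Rightarrow> bool" where
  "smooth_manifold M \<longleftrightarrow>
     Hausdorff_space (points M) \<and> second_countable (points M) \<and> subspace (model M) \<and>
     (\<forall>c\<in>atlas M. is_chart M c) \<and> (\<Union>c\<in>atlas M. fst c) = topspace (points M) \<and>
     (\<forall>c\<in>atlas M. \<forall>d\<in>atlas M. compatible c d)"

definition compact_manifold :: "('a, 'e::euclidean_space) manifold \<Rightarrow> bool" where
  "compact_manifold M \<longleftrightarrow> smooth_manifold M \<and> compact_space (points M)"

(* The maximal atlas. *)
definition charts :: "('a, 'e::euclidean_space) manifold \<Rightarrow> ('a, 'e) chart set" where
  "charts M = {c. is_chart M c \<and> (\<forall>d\<in>atlas M. compatible c d)}"

definition charts_at :: "('a, 'e::euclidean_space) manifold \<Rightarrow> 'a \<Rightarrow> ('a, 'e) chart set" where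
  "charts_at M m = {c \<in> charts M. m \<in> fst c}"

definition open_submanifold ::
    "('a, 'e::euclidean_space) manifold \<Rightarrow> 'a set \<Rightarrow> ('a, 'e) manifold" where
  "open_submanifold M U =
     \<lparr>points = subtopology (points M) U, model = model M,
      atlas = (\<lambda>c. (fst c \<inter> U, snd c)) ` atlas M\<rparr>"

definition euclidean_manifold :: "('e::euclidean_space, 'e) manifold" where
  "euclidean_manifold = \<lparr>points = euclidean, model = UNIV, atlas = {(UNIV, \<lambda>x. x)}\<rparr>"

definition prod_manifold ::
    "('a, 'e::euclidean_space) manifold \<Rightarrow> ('b, 'f::euclidean_space) manifold
       \<Rightarrow> ('a \<times> 'b, 'e \<times> 'f) manifold" where
  "prod_manifold M N =
     \<lparr>points = prod_topology (points M) (points N), model = model M \<times> model N,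
      atlas = {(fst c \<times> fst d, map_prod (snd c) (snd d)) | c d. c \<in> atlas M \<and> d \<in> atlas N}\<rparr>"

definition smooth_map ::
    "('a, 'e::euclidean_space) manifold \<Rightarrow> ('b, 'f::euclidean_space) manifold \<Rightarrow> ('a \<Rightarrow> 'b) \<Rightarrow> bool"
  where
  "smooth_map M N h \<longleftrightarrow> continuous_map (points M) (points N) h \<and>
     (\<forall>c\<in>atlas M. \<forall>d\<in>atlas N.
        smooth_on (snd c ` (fst c \<inter> h -` fst d)) (snd d \<circ> h \<circ> chart_inv c))"

definition diffeomorphism ::
    "('a, 'e::euclidean_space) manifold \<Rightarrow> ('b, 'f::euclidean_space) manifold \<Rightarrow> ('a \<Rightarrow> 'b) \<Rightarrow> bool"
  where
  "diffeomorphism M N h \<longleftrightarrow>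
     bij_betw h (topspace (points M)) (topspace (points N)) \<and>
     smooth_map M N h \<and> smooth_map N M (inv_into (topspace (points M)) h)"

abbreviation smooth_fun :: "('a, 'e::euclidean_space) manifold \<Rightarrow> 'a set \<Rightarrow> ('a \<Rightarrow> real) \<Rightarrow> bool" where
  "smooth_fun M U f \<equiv> smooth_map (open_submanifold M U) euclidean_manifold f"


section \<open>Tangent vectors and vector fields\<close>

(* A tangent vector at m assigns to each chart around m its coordinate vector, subject to the
   usual transformation law; it is 0 on everything else, so that equality of tangent vectors
   is equality of functions. *)
type_synonym ('a, 'e) tvec = "('a, 'e) chart \<Rightarrow> 'e"

definition tangent_space ::
    "('a, 'e::euclidean_space) manifold \<Rightarrow> 'a \<Rightarrow> ('a, 'e) tvec set" where
  "tangent_space M m =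
     {v. (\<forall>c\<in>charts_at M m. v c \<in> model M) \<and>
         (\<forall>c\<in>charts_at M m. \<forall>d\<in>charts_at M m.
            v d = dir_deriv (snd d \<circ> chart_inv c) (snd c m) (v c)) \<and>
         (\<forall>c. c \<notin> charts_at M m \<longrightarrow> v c = 0)}"

definition lincomb ::
    "real \<Rightarrow> ('a, 'e::euclidean_space) tvec \<Rightarrow> real \<Rightarrow> ('a, 'e) tvec \<Rightarrow> ('a, 'e) tvec" where
  "lincomb a u b v = (\<lambda>c. a *\<^sub>R u c + b *\<^sub>R v c)"

(* The choice of c is immaterial when v is a tangent vector at m. *)
definition differential ::
    "('a, 'e::euclidean_space) manifold \<Rightarrow> ('b, 'f::euclidean_space) manifold \<Rightarrow> ('a \<Rightarrow> 'b)
       \<Rightarrow> 'a \<Rightarrow> ('a, 'e) tvec \<Rightarrow> ('b, 'f) tvec" where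
  "differential M N h m v =
     (let c = (SOME c. c \<in> atlas M \<and> m \<in> fst c)
      in (\<lambda>d. if d \<in> charts_at N (h m)
              then dir_deriv (snd d \<circ> h \<circ> chart_inv c) (snd c m) (v c) else 0))"

(* The derivative v(f) of a real function along a tangent vector. *)
definition deriv_along ::
    "('a, 'e::euclidean_space) manifold \<Rightarrow> 'a \<Rightarrow> ('a, 'e) tvec \<Rightarrow> ('a \<Rightarrow> real) \<Rightarrow> real" where
  "deriv_along M m v f = differential M euclidean_manifold f m v (UNIV, \<lambda>x. x)"

definition velocity ::
    "('a, 'e::euclidean_space) manifold \<Rightarrow> (real \<Rightarrow> 'a) \<Rightarrow> real \<Rightarrow> ('a, 'e) tvec" where
  "velocity M \<gamma> t =
     (\<lambda>c. if c \<in> charts_at M (\<gamma> t) then vector_derivative (snd c \<circ> \<gamma>) (at t) else 0)"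

definition vector_field_on ::
    "('a, 'e::euclidean_space) manifold \<Rightarrow> 'a set \<Rightarrow> ('a \<Rightarrow> ('a, 'e) tvec) \<Rightarrow> bool" where
  "vector_field_on M U X \<longleftrightarrow>
     (\<forall>m\<in>U. X m \<in> tangent_space M m) \<and>
     (\<forall>c\<in>charts M. smooth_on (snd c ` (fst c \<inter> U)) (\<lambda>z. X (chart_inv c z) c))"

definition lie_bracket ::
    "('a, 'e::euclidean_space) manifold \<Rightarrow> ('a \<Rightarrow> ('a, 'e) tvec) \<Rightarrow> ('a \<Rightarrow> ('a, 'e) tvec)
       \<Rightarrow> 'a \<Rightarrow> ('a, 'e) tvec" where
  "lie_bracket M X Y m =
     (\<lambda>c. if c \<in> charts_at M m
          then dir_deriv (\<lambda>z. Y (chart_inv c z) c) (snd c m) (X m c)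
             - dir_deriv (\<lambda>z. X (chart_inv c z) c) (snd c m) (Y m c)
          else 0)"


section \<open>Fibrations\<close>

definition fibre ::
    "('a, 'e::euclidean_space) manifold \<Rightarrow> ('a \<Rightarrow> 'b) \<Rightarrow> 'b \<Rightarrow> 'a set" where
  "fibre M \<pi> w = {m \<in> topspace (points M). \<pi> m = w}"

(* Smooth locally trivial fibre bundle. Any local fibre is diffeomorphic to a fibre of \<pi>, a
   submanifold of M of dimension at most dim M, hence taking it with point type 'a and
   model type 'e is no restriction. *)
definition fibration ::
    "('a, 'e::euclidean_space) manifold \<Rightarrow> ('b, 'f::euclidean_space) manifold \<Rightarrow> ('a \<Rightarrow> 'b) \<Rightarrow> bool"
  where
  "fibration M W \<pi> \<longleftrightarrow> smooth_map M W \<pi> \<and> \<pi> ` topspace (points M) = topspace (points W) \<and>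
     (\<forall>w\<in>topspace (points W). \<exists>V (N :: ('a, 'e) manifold) \<Phi>.
        openin (points W) V \<and> w \<in> V \<and> smooth_manifold N \<and>
        diffeomorphism (open_submanifold M {m \<in> topspace (points M). \<pi> m \<in> V})
                       (prod_manifold (open_submanifold W V) N) \<Phi> \<and>
        (\<forall>m\<in>topspace (points M). \<pi> m \<in> V \<longrightarrow> fst (\<Phi> m) = \<pi> m))"


section \<open>Foliations\<close>

(* A foliation of codimension q is given by its set of leaves: M is decomposed into path
   connected sets, and around each point there is a chart in which the path components of the
   intersections of the leaves with the chart domain are the slices by translates of a linear
   subspace of codimension q. *)
definition foliation ::
    "('a, 'e::euclidean_space) manifold \<Rightarrow> nat \<Rightarrow> 'a set set \<Rightarrow> bool" where
  "foliation M q F \<longleftrightarrow>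
     partition_on (topspace (points M)) F \<and>
     (\<forall>L\<in>F. path_connectedin (points M) L) \<and>
     (\<forall>m\<in>topspace (points M). \<exists>c\<in>charts_at M m. \<exists>V.
        subspace V \<and> V \<subseteq> model M \<and> dim V + q = dim (model M) \<and>
        (\<forall>L\<in>F. \<forall>x\<in>L \<inter> fst c.
           path_component_of_set (subtopology (points M) (L \<inter> fst c)) x
             = {y \<in> fst c. snd c y - snd c x \<in> V}))"

(* T_m F. Smooth curves of M running inside a leaf are also smooth for the leaf topology. *)
definition leaf_tangent ::
    "('a, 'e::euclidean_space) manifold \<Rightarrow> 'a set set \<Rightarrow> 'a \<Rightarrow> ('a, 'e) tvec set" where
  "leaf_tangent M F m =
     {velocity M \<gamma> 0 | \<gamma> \<epsilon> L. 0 < \<epsilon> \<and> L \<in> F \<and> \<gamma> 0 = m \<and> \<gamma> ` {-\<epsilon><..<\<epsilon>} \<subseteq> L \<and>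
        smooth_map (open_submanifold euclidean_manifold {-\<epsilon><..<\<epsilon>}) M \<gamma>}"

definition subfoliation :: "'a set set \<Rightarrow> 'a set set \<Rightarrow> bool" where
  "subfoliation F F' \<longleftrightarrow> (\<forall>L\<in>F. \<exists>L'\<in>F'. L \<subseteq> L')"

definition projects_to ::
    "('a, 'e::euclidean_space) manifold \<Rightarrow> ('b, 'f::euclidean_space) manifold \<Rightarrow> ('a \<Rightarrow> 'b)
       \<Rightarrow> 'a set set \<Rightarrow> 'b set set \<Rightarrow> bool" where
  "projects_to M W \<pi> F' FW \<longleftrightarrow>
     (\<forall>m\<in>topspace (points M).
        differential M W \<pi> m ` leaf_tangent M F' m = leaf_tangent W FW (\<pi> m))"


section \<open>The normal bundle, transverse orientations and transverse metrics\<close>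

(* The class of v in T_m M / T_m F, as a coset. *)
definition normal_class ::
    "('a, 'e::euclidean_space) manifold \<Rightarrow> 'a set set \<Rightarrow> 'a \<Rightarrow> ('a, 'e) tvec \<Rightarrow> ('a, 'e) tvec set"
  where
  "normal_class M F m v = {w \<in> tangent_space M m. lincomb 1 w (-1) v \<in> leaf_tangent M F m}"

definition normal_space ::
    "('a, 'e::euclidean_space) manifold \<Rightarrow> 'a set set \<Rightarrow> 'a \<Rightarrow> ('a, 'e) tvec set set" where
  "normal_space M F m = normal_class M F m ` tangent_space M m"

(* Smooth nowhere vanishing section of the top exterior power of the dual of the normal bundle
   of a foliation of codimension q. *)
definition transverse_volume_form ::
    "('a, 'e::euclidean_space) manifold \<Rightarrow> nat \<Rightarrow> 'a set set
       \<Rightarrow> ('a \<Rightarrow> ('a, 'e) tvec set list \<Rightarrow> real) \<Rightarrow> bool" where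
  "transverse_volume_form M q F \<omega> \<longleftrightarrow>
     (\<forall>m\<in>topspace (points M).
        (\<forall>ns. length ns = q \<and> set ns \<subseteq> normal_space M F m \<longrightarrow>
           (\<forall>i<q. \<forall>u\<in>tangent_space M m. \<forall>v\<in>tangent_space M m. \<forall>a b.
              \<omega> m (ns[i := normal_class M F m (lincomb a u b v)]) =
                a * \<omega> m (ns[i := normal_class M F m u]) + b * \<omega> m (ns[i := normal_class M F m v])) \<and>
           (\<forall>i<q. \<forall>j<q. i \<noteq> j \<and> ns ! i = ns ! j \<longrightarrow> \<omega> m ns = 0)) \<and>
        (\<exists>ns. length ns = q \<and> set ns \<subseteq> normal_space M F m \<and> \<omega> m ns \<noteq> 0)) \<and>
     (\<forall>U X. openin (points M) U \<and> (\<forall>i<q. vector_field_on M U (X i)) \<longrightarrow>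
        smooth_fun M U (\<lambda>m. \<omega> m (map (\<lambda>i. normal_class M F m (X i m)) [0..<q])))"

definition transversely_orientable ::
    "('a, 'e::euclidean_space) manifold \<Rightarrow> nat \<Rightarrow> 'a set set \<Rightarrow> bool" where
  "transversely_orientable M q F \<longleftrightarrow> (\<exists>\<omega>. transverse_volume_form M q F \<omega>)"

(* Smooth positive definite fibre metric on the normal bundle. *)
definition normal_metric ::
    "('a, 'e::euclidean_space) manifold \<Rightarrow> 'a set set
       \<Rightarrow> ('a \<Rightarrow> ('a, 'e) tvec set \<Rightarrow> ('a, 'e) tvec set \<Rightarrow> real) \<Rightarrow> bool" where
  "normal_metric M F g \<longleftrightarrow>
     (\<forall>m\<in>topspace (points M).
        (\<forall>u\<in>tangent_space M m. \<forall>v\<in>tangent_space M m. \<forall>w\<in>tangent_space M m. \<forall>a b.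
           g m (normal_class M F m (lincomb a u b v)) (normal_class M F m w) =
             a * g m (normal_class M F m u) (normal_class M F m w)
             + b * g m (normal_class M F m v) (normal_class M F m w)) \<and>
        (\<forall>n\<in>normal_space M F m. \<forall>n'\<in>normal_space M F m. g m n n' = g m n' n) \<and>
        (\<forall>n\<in>normal_space M F m. n \<noteq> normal_class M F m (\<lambda>c. 0) \<longrightarrow> 0 < g m n n)) \<and>
     (\<forall>U X Y. openin (points M) U \<and> vector_field_on M U X \<and> vector_field_on M U Y \<longrightarrow>
        smooth_fun M U (\<lambda>m. g m (normal_class M F m (X m)) (normal_class M F m (Y m))))"

(* (L_X g)(Y, Z) at m, for X tangent to F, with Y and Z representing sections of the normal
   bundle, on which L_X acts by the Lie bracket. *)
definition lie_deriv_metric ::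
    "('a, 'e::euclidean_space) manifold \<Rightarrow> 'a set set
       \<Rightarrow> ('a \<Rightarrow> ('a, 'e) tvec set \<Rightarrow> ('a, 'e) tvec set \<Rightarrow> real)
       \<Rightarrow> ('a \<Rightarrow> ('a, 'e) tvec) \<Rightarrow> ('a \<Rightarrow> ('a, 'e) tvec) \<Rightarrow> ('a \<Rightarrow> ('a, 'e) tvec) \<Rightarrow> 'a \<Rightarrow> real" where
  "lie_deriv_metric M F g X Y Z m =
     deriv_along M m (X m) (\<lambda>x. g x (normal_class M F x (Y x)) (normal_class M F x (Z x)))
     - g m (normal_class M F m (lie_bracket M X Y m)) (normal_class M F m (Z m))
     - g m (normal_class M F m (Y m)) (normal_class M F m (lie_bracket M X Z m))"

definition transverse_metric ::
    "('a, 'e::euclidean_space) manifold \<Rightarrow> 'a set set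
       \<Rightarrow> ('a \<Rightarrow> ('a, 'e) tvec set \<Rightarrow> ('a, 'e) tvec set \<Rightarrow> real) \<Rightarrow> bool" where
  "transverse_metric M F g \<longleftrightarrow> normal_metric M F g \<and>
     (\<forall>X. vector_field_on M (topspace (points M)) X \<and>
          (\<forall>m\<in>topspace (points M). X m \<in> leaf_tangent M F m) \<longrightarrow>
        (\<forall>U Y Z. openin (points M) U \<and> vector_field_on M U Y \<and> vector_field_on M U Z \<longrightarrow>
           (\<forall>m\<in>U. lie_deriv_metric M F g X Y Z m = 0)))"

definition riemannian_foliation ::
    "('a, 'e::euclidean_space) manifold \<Rightarrow> nat \<Rightarrow> 'a set set \<Rightarrow> bool" where
  "riemannian_foliation M q F \<longleftrightarrow> foliation M q F \<and> (\<exists>g. transverse_metric M F g)"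

end

theory Submission
  imports Defs
begin

text \<open>
  Each fibre of \<open>\<pi>\<close> lies in a leaf of \<open>F'\<close>, so the leaves of \<open>F'\<close> are unions of fibres and their
  images partition \<open>W\<close>. Composing a foliated chart of \<open>F'\<close> with a local section of \<open>\<pi>\<close> and
  straightening by the inverse function theorem gives foliated charts for these images, with the
  codimension of \<open>F'\<close>. The differential of \<open>\<pi>\<close> then induces isomorphisms between the normal spaces
  of \<open>F'\<close> and of the image foliation. A transverse metric \<open>g\<close> descends because \<open>L\<^sub>X g = 0\<close> for vertical
  \<open>X\<close> makes it constant along the connected fibres. A transverse volume form only has constant sign
  along a fibre, which suffices: finitely many of its pullbacks by local sections, taken with
  bump functions as weights, add up to a nonvanishing form on \<open>W\<close>.
\<close>

section \<open>Calculus of smooth functions on open sets\<close>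

text \<open>Charts take values in a linear subspace \<open>E\<close> of a Euclidean space, so a
  coordinate expression makes sense only along \<open>E\<close>: smoothness is tested on local
  extensions, and derivatives are taken with \<open>dir_deriv\<close>, which sees only values on
  relatively open subsets of \<open>E\<close>. Local triviality is exploited through charts in which
  \<open>\<pi>\<close> is a linear map \<open>p\<close> with a linear right inverse
  \<open>J\<close>. From \<open>J\<close> come affine local sections, and lifts of vectors whose
  coordinates are constant along the fibres. Two obstacles shape the rest. A foliated chart of
  \<open>W\<close> needs a function whose level sets are the plaques; it is built from one local
  section and must be shown not to depend on it, which uses that fibres in a convex coordinate ball
  stay in one plaque. Moreover, the condition on Lie derivatives concerns fields tangent to the
  leaves on all of \<open>M\<close>, whereas lifts exist only inside adapted charts; bump functions
  extend them without changing brackets near the point considered.\<close>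

lemma Ck_on_subset: "Ck_on k U f \<Longrightarrow> V \<subseteq> U \<Longrightarrow> Ck_on k V f"
  by (induction k arbitrary: f) (auto intro: continuous_on_subset)

lemma Ck_on_cong:
  assumes "open U" "\<And>x. x \<in> U \<Longrightarrow> f x = g x" "Ck_on k U f"
  shows "Ck_on k U g"
  using assms(2,3)
proof (induction k arbitrary: f g)
  case 0
  then show ?case by (simp cong: continuous_on_cong)
next
  case (Suc k)
  have d: "(g has_derivative frechet_derivative f (at x)) (at x)" if "x \<in> U" for x
  proof -
    have "(f has_derivative frechet_derivative f (at x)) (at x)"
      using Suc.prems that frechet_derivative_works by auto
    then show ?thesis
      using has_derivative_transform_within_open[OF _ assms(1) that] Suc.prems by blast
  qed
  have "frechet_derivative f (at x) = frechet_derivative g (at x)" if "x \<in> U" for x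
    using d[OF that] by (simp add: frechet_derivative_at)
  then show ?case
    using d Suc.IH[of "\<lambda>x. frechet_derivative f (at x) v" "\<lambda>x. frechet_derivative g (at x) v" for v] Suc.prems(2)
    unfolding Ck_on.simps differentiable_def by metis
qed

lemma Ck_on_SucI:
  assumes "open U" "\<And>x. x \<in> U \<Longrightarrow> (f has_derivative f' x) (at x)" "\<And>v. Ck_on k U (\<lambda>x. f' x v)"
  shows "Ck_on (Suc k) U f"
proof -
  have "f' x = frechet_derivative f (at x)" if "x \<in> U" for x
    using assms(2)[OF that] by (simp add: frechet_derivative_at)
  then have "Ck_on k U (\<lambda>x. frechet_derivative f (at x) v)" for v
    by (intro Ck_on_cong[OF assms(1) _ assms(3)[of v]]) auto
  then show ?thesis
    using assms(2) unfolding Ck_on.simps differentiable_def by blast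
qed

lemma Ck_on_Suc_has_derivative:
  "Ck_on (Suc k) U f \<Longrightarrow> x \<in> U \<Longrightarrow> (f has_derivative frechet_derivative f (at x)) (at x)"
  using frechet_derivative_works by auto

lemma Ck_on_SucD: "Ck_on (Suc k) U f \<Longrightarrow> Ck_on k U f"
proof (induction k arbitrary: f)
  case 0
  then show ?case
    by (auto intro!: continuous_at_imp_continuous_on differentiable_imp_continuous_within)
next
  case (Suc k)
  then show ?case by (auto simp del: Ck_on.simps(1) simp: Ck_on.simps(2))
qed

lemma Ck_on_continuous_on: "Ck_on k U f \<Longrightarrow> continuous_on U f"
proof (induction k)
  case (Suc k)
  then show ?case using Ck_on_SucD by blast
qed simp

lemma Ck_on_const: "open U \<Longrightarrow> Ck_on k U (\<lambda>x. c)"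
proof (induction k arbitrary: c)
  case (Suc k)
  then show ?case by (intro Ck_on_SucI[where f'="\<lambda>x v. 0"]) auto
qed simp

lemma Ck_on_bounded_linear_comp:
  assumes "open U" "bounded_linear L" "Ck_on k U f"
  shows "Ck_on k U (\<lambda>x. L (f x))"
  using assms(3)
proof (induction k arbitrary: f)
  case 0
  then show ?case by (simp add: assms bounded_linear.continuous_on)
next
  case (Suc k)
  show ?case
  proof (rule Ck_on_SucI[OF assms(1)])
    show "((\<lambda>x. L (f x)) has_derivative (\<lambda>v. L (frechet_derivative f (at x) v))) (at x)" if "x \<in> U" for x
      by (rule bounded_linear.has_derivative[OF assms(2) Ck_on_Suc_has_derivative[OF Suc.prems that]])
    show "Ck_on k U (\<lambda>x. L (frechet_derivative f (at x) v))" for v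
      using Suc by simp
  qed
qed

lemma Ck_on_bounded_linear: "open U \<Longrightarrow> bounded_linear L \<Longrightarrow> Ck_on k U L"
proof (induction k)
  case 0
  then show ?case by (simp add: linear_continuous_on)
next
  case (Suc k)
  then show ?case
    by (intro Ck_on_SucI[where f'="\<lambda>x. L"] Ck_on_const) (auto intro: bounded_linear_imp_has_derivative)
qed

lemma Ck_on_add:
  assumes "open U" "Ck_on k U f" "Ck_on k U g"
  shows "Ck_on k U (\<lambda>x. f x + g x)"
  using assms(2,3)
proof (induction k arbitrary: f g)
  case 0
  then show ?case by (simp add: continuous_on_add)
next
  case (Suc k)
  show ?case
  proof (rule Ck_on_SucI[OF assms(1)])
    show "((\<lambda>x. f x + g x) has_derivative (\<lambda>v. frechet_derivative f (at x) v + frechet_derivative g (at x) v)) (at x)"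
      if "x \<in> U" for x
      using Suc.prems that by (intro has_derivative_add Ck_on_Suc_has_derivative)
    show "Ck_on k U (\<lambda>x. frechet_derivative f (at x) v + frechet_derivative g (at x) v)" for v
      using Suc by simp
  qed
qed

lemma Ck_on_sum:
  assumes "open U" "finite I" "\<And>i. i \<in> I \<Longrightarrow> Ck_on k U (f i)"
  shows "Ck_on k U (\<lambda>x. \<Sum>i\<in>I. f i x)"
  using assms(2,3) by induction (auto intro: Ck_on_add Ck_on_const assms(1))

lemma Ck_on_bilinear:
  fixes prod :: "'a::euclidean_space \<Rightarrow> 'b::euclidean_space \<Rightarrow> 'c::euclidean_space"
    and f :: "'d::euclidean_space \<Rightarrow> 'a"
  assumes "bounded_bilinear prod" "open U" "Ck_on k U f" "Ck_on k U g"
  shows "Ck_on k U (\<lambda>x. prod (f x) (g x))"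
  using assms(3,4)
proof (induction k arbitrary: f g)
  case 0
  then show ?case by (simp add: bounded_bilinear.continuous_on[OF assms(1)])
next
  case (Suc k)
  show ?case
  proof (rule Ck_on_SucI[OF assms(2)])
    show "((\<lambda>x. prod (f x) (g x)) has_derivative (\<lambda>v. prod (f x) (frechet_derivative g (at x) v) + prod (frechet_derivative f (at x) v) (g x))) (at x)"
      if "x \<in> U" for x
      using Suc.prems that by (intro bounded_bilinear.FDERIV[OF assms(1)] Ck_on_Suc_has_derivative)
    show "Ck_on k U (\<lambda>x. prod (f x) (frechet_derivative g (at x) v) + prod (frechet_derivative f (at x) v) (g x))" for v
      using Suc.prems Ck_on_SucD[OF Suc.prems(1)] Ck_on_SucD[OF Suc.prems(2)]
      by (intro Ck_on_add Suc.IH assms(2)) auto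
  qed
qed

section \<open>Composition, inverse operators and smooth local inverses\<close>

lemma bounded_linear_expand:
  assumes "bounded_linear L"
  shows "L (v::'a::euclidean_space) = (\<Sum>b\<in>Basis. (v \<bullet> b) *\<^sub>R L b)"
proof -
  interpret bounded_linear L by fact
  have "L v = L (\<Sum>b\<in>Basis. (v \<bullet> b) *\<^sub>R b)"
    by (simp add: euclidean_representation)
  then show ?thesis by (simp add: sum scaleR)
qed

text \<open>The derivative of the composite is a linear map applied to a vector, both varying with
  the point. Expanding the vector in \<open>Basis\<close> turns this into a finite sum of products,
  so the bilinear rule and the induction hypothesis apply.\<close>

lemma Ck_on_comp:
  assumes "open U" "open V" "Ck_on k U f" "f ` U \<subseteq> V" "Ck_on k V g"
  shows "Ck_on k U (\<lambda>x. g (f x))"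
  using assms(3-5)
proof (induction k arbitrary: f g)
  case 0
  then show ?case using continuous_on_compose2 by auto
next
  case (Suc k)
  show ?case
  proof (rule Ck_on_SucI[OF assms(1)])
    let ?D = "\<lambda>x v. \<Sum>b\<in>Basis. (frechet_derivative f (at x) v \<bullet> b) *\<^sub>R frechet_derivative g (at (f x)) b"
    show "((\<lambda>x. g (f x)) has_derivative ?D x) (at x)" if "x \<in> U" for x
    proof -
      have g: "(g has_derivative frechet_derivative g (at (f x))) (at (f x))"
        using Ck_on_Suc_has_derivative[OF Suc.prems(3)] Suc.prems(2) that by auto
      have "((\<lambda>x. g (f x)) has_derivative (\<lambda>v. frechet_derivative g (at (f x)) (frechet_derivative f (at x) v))) (at x)"
        using diff_chain_at[OF Ck_on_Suc_has_derivative[OF Suc.prems(1) that] g] by (simp add: o_def)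
      moreover have "frechet_derivative g (at (f x)) (frechet_derivative f (at x) v) = ?D x v" for v
        using bounded_linear_expand[OF has_derivative_bounded_linear[OF g]] by blast
      ultimately show ?thesis by simp
    qed
    show "Ck_on k U (\<lambda>x. ?D x v)" for v
    proof (intro Ck_on_sum[OF assms(1)] Ck_on_bilinear[OF bounded_bilinear_scaleR assms(1)]
         Ck_on_bounded_linear_comp[OF assms(1) bounded_linear_inner_left] finite_Basis)
      show "Ck_on k U (\<lambda>x. frechet_derivative f (at x) v)" using Suc.prems by simp
      show "Ck_on k U (\<lambda>x. frechet_derivative g (at (f x)) b)" for b
        using Suc.prems Ck_on_SucD[OF Suc.prems(1)] by (intro Suc.IH) auto
    qed
  qed
qed

text \<open>Where the scalar factor vanishes, continuity of the other factor suffices for the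
  product rule: \<open>\<phi> y\<close> is of order \<open>norm (y - x)\<close> and
  \<open>\<psi> y - \<psi> x\<close> is small. This differentiates inverse operators before their
  differentiability is known.\<close>

lemma has_derivative_scaleR_vanishing:
  fixes \<phi> :: "'a::real_normed_vector \<Rightarrow> real" and \<psi> :: "'a \<Rightarrow> 'b::real_normed_vector"
  assumes "(\<phi> has_derivative \<phi>') (at x)" "\<phi> x = 0" "isCont \<psi> x"
  shows "((\<lambda>y. \<phi> y *\<^sub>R \<psi> y) has_derivative (\<lambda>v. \<phi>' v *\<^sub>R \<psi> x)) (at x)"
proof -
  have bl: "bounded_linear \<phi>'" using assms(1) by (rule has_derivative_bounded_linear)
  obtain K where K: "K > 0" "\<And>v. norm (\<phi>' v) \<le> norm v * K"
    using bounded_linear.pos_bounded[OF bl] by blast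
  have 0: "((\<lambda>y. \<phi> y *\<^sub>R (\<psi> y - \<psi> x)) has_derivative (\<lambda>v. 0)) (at x)"
    unfolding has_derivative_at_alt
  proof (intro conjI allI impI)
    fix e :: real assume e: "e > 0"
    obtain d1 where d1: "d1 > 0" "\<And>y. norm (y - x) < d1 \<Longrightarrow> norm (\<phi> y - \<phi> x - \<phi>' (y - x)) \<le> 1 * norm (y - x)"
      using assms(1) zero_less_one unfolding has_derivative_at_alt by blast
    \<comment> \<open>Near \<open>x\<close> the scalar factor is at most
      \<open>(K + 1) * norm (y - x)\<close>, whence this threshold.\<close>
    obtain d2 where d2: "d2 > 0" "\<And>y. dist y x < d2 \<Longrightarrow> dist (\<psi> y) (\<psi> x) < e / (K + 1)"
      using assms(3) e K(1) unfolding continuous_at_eps_delta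
      by (metis add_pos_pos divide_pos_pos zero_less_one)
    show "\<exists>d>0. \<forall>y. norm (y - x) < d \<longrightarrow> norm (\<phi> y *\<^sub>R (\<psi> y - \<psi> x) - \<phi> x *\<^sub>R (\<psi> x - \<psi> x) - 0) \<le> e * norm (y - x)"
    proof (intro exI[of _ "min d1 d2"] conjI allI impI)
      show "min d1 d2 > 0" using d1 d2 by simp
      fix y assume y: "norm (y - x) < min d1 d2"
      have "\<bar>\<phi> y\<bar> \<le> norm (\<phi> y - \<phi> x - \<phi>' (y - x)) + norm (\<phi>' (y - x))"
        using assms(2) by simp
      also have "\<dots> \<le> 1 * norm (y - x) + norm (y - x) * K"
        using d1(2)[of y] y K(2) by (intro add_mono) auto
      finally have 1: "\<bar>\<phi> y\<bar> \<le> (K + 1) * norm (y - x)" by (simp add: algebra_simps)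
      have 2: "norm (\<psi> y - \<psi> x) \<le> e / (K + 1)"
        using d2(2)[of y] y by (simp add: dist_norm less_imp_le)
      have "\<bar>\<phi> y\<bar> * norm (\<psi> y - \<psi> x) \<le> ((K + 1) * norm (y - x)) * (e / (K + 1))"
        using 1 2 K(1) by (intro mult_mono) auto
      also have "\<dots> = e * norm (y - x)" using K(1) by simp
      finally show "norm (\<phi> y *\<^sub>R (\<psi> y - \<psi> x) - \<phi> x *\<^sub>R (\<psi> x - \<psi> x) - 0) \<le> e * norm (y - x)" by simp
    qed
  qed simp
  have "((\<lambda>y. \<phi> y *\<^sub>R \<psi> x + \<phi> y *\<^sub>R (\<psi> y - \<psi> x)) has_derivative (\<lambda>v. \<phi>' v *\<^sub>R \<psi> x + 0)) (at x)"
    by (intro has_derivative_add 0 bounded_linear.has_derivative[OF bounded_linear_scaleR_left] assms(1))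
  then show ?thesis by (simp add: scaleR_diff_right)
qed

text \<open>The derivative of the inverse family is \<open>- B A' B\<close>, so smoothness of
  \<open>B\<close> at one order gives it at the next. Operators are handled vector by vector, which
  keeps all functions Euclidean-valued; the uniform bound \<open>C\<close> provides the continuity
  with which the induction starts.\<close>

lemma Ck_on_inverse_operator:
  fixes A B :: "'a::euclidean_space \<Rightarrow> 'b::euclidean_space \<Rightarrow> 'b"
  assumes "open U" and lin: "\<And>x. x \<in> U \<Longrightarrow> bounded_linear (A x)" "\<And>x. x \<in> U \<Longrightarrow> bounded_linear (B x)"
    and AB: "\<And>x v. x \<in> U \<Longrightarrow> A x (B x v) = v" and BA: "\<And>x v. x \<in> U \<Longrightarrow> B x (A x v) = v"
    and bd: "\<And>x v. x \<in> U \<Longrightarrow> norm (B x v) \<le> C * norm v"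
    and A: "\<And>v. Ck_on k U (\<lambda>x. A x v)"
  shows "Ck_on k U (\<lambda>x. B x v)"
  using A
proof (induction k arbitrary: v)
  case 0
  \<comment> \<open>The identity \<open>B x - B x0 = - B x (A x - A x0) B x0\<close>, which together
    with the bound on \<open>B x\<close> gives continuity at \<open>x0\<close>.\<close>
  have diff: "B x v - B x0 v = - B x (A x (B x0 v) - A x0 (B x0 v))" if "x \<in> U" "x0 \<in> U" for x x0
  proof -
    have "B x (A x (B x0 v) - A x0 (B x0 v)) = B x (A x (B x0 v)) - B x (A x0 (B x0 v))"
      by (rule linear_diff[OF bounded_linear.linear[OF lin(2)[OF that(1)]]])
    then show ?thesis by (simp only: AB[OF that(2)] BA[OF that(1)] minus_diff_eq)
  qed
  have "((\<lambda>x. B x v) \<longlongrightarrow> B x0 v) (at x0)" if "x0 \<in> U" for x0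
  proof -
    have "((\<lambda>x. A x (B x0 v)) \<longlongrightarrow> A x0 (B x0 v)) (at x0)"
      using 0 that assms(1) by (simp add: continuous_on_eq_continuous_at isCont_def)
    then have "((\<lambda>x. C * norm (A x (B x0 v) - A x0 (B x0 v))) \<longlongrightarrow> C * norm (A x0 (B x0 v) - A x0 (B x0 v))) (at x0)"
      by (intro tendsto_intros)
    then have "((\<lambda>x. C * norm (A x (B x0 v) - A x0 (B x0 v))) \<longlongrightarrow> 0) (at x0)" by simp
    moreover have "\<forall>\<^sub>F x in at x0. norm (B x v - B x0 v) \<le> C * norm (A x (B x0 v) - A x0 (B x0 v))"
      unfolding eventually_at_topological
    proof (intro exI[of _ U] conjI ballI impI)
      fix x assume "x \<in> U"
      then show "norm (B x v - B x0 v) \<le> C * norm (A x (B x0 v) - A x0 (B x0 v))"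
        unfolding diff[OF \<open>x \<in> U\<close> that] norm_minus_cancel by (rule bd)
    qed (use assms(1) that in auto)
    ultimately have "((\<lambda>x. B x v - B x0 v) \<longlongrightarrow> 0) (at x0)"
      by (rule Lim_null_comparison[rotated])
    then show ?thesis by (rule LIM_zero_cancel)
  qed
  then show ?case by (simp add: continuous_on_eq_continuous_at assms(1) isCont_def)
next
  case (Suc k)
  have Bk: "Ck_on k U (\<lambda>x. B x v)" for v
    by (rule Suc.IH[OF Ck_on_SucD[OF Suc.prems]])
  have B0: "continuous_on U (\<lambda>x. B x v)" for v
    using Bk[of v] by (rule Ck_on_continuous_on)
  define A' where "A' x b = frechet_derivative (\<lambda>x. A x b) (at x)" for x b
  have A': "((\<lambda>x. A x b) has_derivative A' x b) (at x)" if "x \<in> U" for x b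
    unfolding A'_def using Ck_on_Suc_has_derivative[OF Suc.prems that] .
  let ?D = "\<lambda>x w. - (\<Sum>b\<in>Basis. (B x v \<bullet> b) *\<^sub>R (\<Sum>c\<in>Basis. (A' x b w \<bullet> c) *\<^sub>R B x c))"
  show ?case
  proof (rule Ck_on_SucI[OF assms(1)])
    fix x assume x: "x \<in> U"
    define u where "u = B x v"
    \<comment> \<open>On \<open>U\<close> this is \<open>A y u - v\<close>, which vanishes at
      \<open>x\<close> because \<open>u = B x v\<close>; it is expanded in \<open>Basis\<close>
      because derivatives are known for the values of \<open>A\<close> at fixed vectors.\<close>
    define \<phi> where "\<phi> y = (\<Sum>b\<in>Basis. (u \<bullet> b) *\<^sub>R A y b) - v" for y
    have \<phi>': "(\<phi> has_derivative (\<lambda>w. \<Sum>b\<in>Basis. (u \<bullet> b) *\<^sub>R A' x b w)) (at x)"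
      unfolding \<phi>_def
      by (rule has_derivative_eq_rhs, (rule derivative_intros A'[OF x])+, simp)
    have \<phi>A: "\<phi> y = A y u - v" if "y \<in> U" for y
      unfolding \<phi>_def using bounded_linear_expand[OF lin(1)[OF that], of u] by simp
    have \<phi>0: "\<phi> x = 0" using \<phi>A[OF x] AB[OF x] by (simp add: u_def)
    \<comment> \<open>On \<open>U\<close> this is \<open>B x v - B y (\<phi> y)\<close>, that is,
      \<open>B y v\<close>. Since \<open>\<phi>\<close> vanishes at \<open>x\<close>, continuity of
      \<open>B\<close> is enough to differentiate it there.\<close>
    let ?r = "\<lambda>y. B x v - (\<Sum>c\<in>Basis. (\<phi> y \<bullet> c) *\<^sub>R B y c)"
    have eq: "?r y = B y v" if "y \<in> U" for y
    proof -
      have "(\<Sum>c\<in>Basis. (\<phi> y \<bullet> c) *\<^sub>R B y c) = B y (A y u - v)"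
        using bounded_linear_expand[OF lin(2)[OF that], of "\<phi> y"] \<phi>A[OF that] by simp
      also have "\<dots> = u - B y v"
        using linear_diff[OF bounded_linear.linear[OF lin(2)[OF that]], of "A y u" v] by (simp only: BA[OF that])
      finally show ?thesis by (simp add: u_def)
    qed
    have "(?r has_derivative (\<lambda>w. 0 - (\<Sum>c\<in>Basis. ((\<Sum>b\<in>Basis. (u \<bullet> b) *\<^sub>R A' x b w) \<bullet> c) *\<^sub>R B x c))) (at x)"
      using B0 x assms(1) \<phi>0
      by (intro has_derivative_diff has_derivative_const has_derivative_sum has_derivative_scaleR_vanishing
           bounded_linear.has_derivative[OF bounded_linear_inner_left] \<phi>')
         (auto simp: continuous_on_eq_continuous_at)
    moreover have "(\<lambda>w. 0 - (\<Sum>c\<in>Basis. ((\<Sum>b\<in>Basis. (u \<bullet> b) *\<^sub>R A' x b w) \<bullet> c) *\<^sub>R B x c)) = ?D x"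
      unfolding u_def
      by (rule ext) (simp add: inner_sum_left scaleR_sum_left scaleR_sum_right, subst sum.swap, rule refl)
    ultimately show "((\<lambda>x. B x v) has_derivative ?D x) (at x)"
      by (intro has_derivative_transform_within_open[OF _ assms(1) x eq]) (simp only:)
  next
    have "Ck_on k U (\<lambda>x. A' x b w)" for b w
      using Suc.prems[of b] by (simp add: A'_def)
    then show "Ck_on k U (\<lambda>x. ?D x w)" for w
      by (intro Ck_on_bounded_linear_comp[OF assms(1) bounded_linear_minus[OF bounded_linear_ident]] Ck_on_sum[OF assms(1)] Ck_on_bilinear[OF bounded_bilinear_scaleR assms(1)]
         Ck_on_bounded_linear_comp[OF assms(1) bounded_linear_inner_left] finite_Basis Bk)
  qed
qed

text \<open>The inverse function theorem supplies a differentiable inverse \<open>g\<close> whose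
  derivative at \<open>y\<close> is the inverse of the derivative of \<open>f\<close> at
  \<open>g y\<close>. If \<open>g\<close> is \<open>C^k\<close>, so is this expression, hence
  \<open>g\<close> is \<open>C^(k+1)\<close>. The identity as derivative at \<open>x0\<close> is a
  normalization that makes the bound on the inverse operators explicit.\<close>

lemma smooth_local_inverse:
  fixes f :: "'a::euclidean_space \<Rightarrow> 'a"
  assumes "open U" "\<And>k. Ck_on k U f" "x0 \<in> U" "(f has_derivative (\<lambda>v. v)) (at x0)"
  obtains U' V g where "open U'" "x0 \<in> U'" "U' \<subseteq> U" "open V" "homeomorphism U' V f g"
    "\<And>k. Ck_on k V g"
proof -
  define f' where "f' x = Blinfun (frechet_derivative f (at x))" for x
  have d: "(f has_derivative frechet_derivative f (at x)) (at x)" if "x \<in> U" for x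
    using Ck_on_Suc_has_derivative[OF assms(2) that] .
  have f'_app: "blinfun_apply (f' x) = frechet_derivative f (at x)" if "x \<in> U" for x
    unfolding f'_def using has_derivative_bounded_linear[OF d[OF that]] by (rule bounded_linear_Blinfun_apply)
  have cont: "continuous_on U f'"
  proof (rule continuous_on_blinfun_componentwise)
    fix i :: 'a
    have "continuous_on U (\<lambda>x. frechet_derivative f (at x) i)"
      using assms(2)[of "Suc 0"] by simp
    then show "continuous_on U (\<lambda>x. blinfun_apply (f' x) i)"
      using f'_app by (simp cong: continuous_on_cong)
  qed
  have f'0: "f' x0 = id_blinfun"
    using f'_app[OF assms(3)] frechet_derivative_at[OF assms(4)] by (intro blinfun_eqI) simp
  \<comment> \<open>At points of \<open>U1\<close> with inverse operator \<open>B x\<close>, one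
    gets \<open>norm (v - B x v) \<le> 1/2 * norm (B x v)\<close>, hence the uniform bound
    2.\<close>
  define U1 where "U1 = U \<inter> {x. dist (f' x) id_blinfun < 1/2}"
  have "open U1"
  proof -
    have "U1 = U \<inter> f' -` ball id_blinfun (1/2)" by (auto simp: U1_def dist_commute)
    then show ?thesis using cont assms(1) by (simp add: continuous_open_preimage)
  qed
  moreover have "x0 \<in> U1" using f'0 assms(3) by (simp add: U1_def)
  ultimately have U1: "open U1" "x0 \<in> U1" by auto
  obtain U' V g g' where *: "open U'" "U' \<subseteq> U1" "x0 \<in> U'" "open V" "f x0 \<in> V" "homeomorphism U' V f g"
    "\<And>y. y \<in> V \<Longrightarrow> (g has_derivative (g' y)) (at y)"
    "\<And>y. y \<in> V \<Longrightarrow> g' y = inv (blinfun_apply (f'(g y)))"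
    "\<And>y. y \<in> V \<Longrightarrow> bij (blinfun_apply (f'(g y)))"
  proof (rule inverse_function_theorem[of U1 f f' x0 id_blinfun])
    show "id_blinfun o\<^sub>L f' x0 = id_blinfun" using f'0 by (intro blinfun_eqI) simp
    show "(f has_derivative blinfun_apply (f' x)) (at x)" if "x \<in> U1" for x
      using that d f'_app by (simp add: U1_def)
    show "continuous_on U1 f'" using cont by (rule continuous_on_subset) (auto simp: U1_def)
  next
    fix U' V g g'
    assume "open U'" "U' \<subseteq> U1" "x0 \<in> U'" "open V" "f x0 \<in> V" "homeomorphism U' V f g"
      "\<And>y. y \<in> V \<Longrightarrow> (g has_derivative (g' y)) (at y)"
      "\<And>y. y \<in> V \<Longrightarrow> g' y = inv (blinfun_apply (f'(g y)))"
      "\<And>y. y \<in> V \<Longrightarrow> bij (blinfun_apply (f'(g y)))"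
    then show thesis by (rule that)
  qed (use U1 in auto)
  define B where "B x = inv (blinfun_apply (f' x))" for x
  have gU: "g y \<in> U'" if "y \<in> V" for y using *(6) that by (auto simp: homeomorphism_def)
  have xg: "\<exists>y\<in>V. x = g y" if "x \<in> U'" for x using *(6) that by (auto simp: homeomorphism_def)
  have bij: "bij (blinfun_apply (f' x))" if "x \<in> U'" for x
    using *(9) xg[OF that] by blast
  have AB: "blinfun_apply (f' x) (B x v) = v" "B x (blinfun_apply (f' x) v) = v" if "x \<in> U'" for x v
    unfolding B_def using surj_f_inv_f[OF bij_is_surj[OF bij[OF that]]] inv_f_f[OF bij_is_inj[OF bij[OF that]]] by blast+
  have U'U: "U' \<subseteq> U" using *(2) by (auto simp: U1_def)
  have blB: "bounded_linear (B x)" if x: "x \<in> U'" for x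
  proof -
    obtain y where y: "y \<in> V" "x = g y" using xg[OF x] by blast
    show ?thesis
      using has_derivative_bounded_linear[OF *(7)[OF y(1)]] *(8)[OF y(1)] y(2) by (simp add: B_def)
  qed
  have bd: "norm (B x v) \<le> 2 * norm v" if x: "x \<in> U'" for x v
  proof -
    have "norm (f' x - id_blinfun) \<le> 1/2" using *(2) x by (auto simp: U1_def dist_norm)
    then have "norm (blinfun_apply (f' x - id_blinfun) (B x v)) \<le> 1/2 * norm (B x v)"
      by (intro order_trans[OF norm_blinfun] mult_right_mono) simp_all
    then have "norm (v - B x v) \<le> 1/2 * norm (B x v)"
      using AB(1)[OF x] by (simp add: blinfun.diff_left)
    moreover have "norm (B x v) \<le> norm v + norm (v - B x v)"
      using norm_triangle_sub[of "B x v" v] norm_minus_commute[of v "B x v"] by linarith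
    ultimately show ?thesis by simp
  qed
  have BC: "Ck_on k U' (\<lambda>x. B x v)" for k v
  proof (rule Ck_on_inverse_operator[OF *(1) _ blB AB bd])
    show "bounded_linear (blinfun_apply (f' x))" for x by (rule blinfun.bounded_linear_right)
    show "Ck_on k U' (\<lambda>x. blinfun_apply (f' x) v)" for v
    proof (rule Ck_on_cong[OF *(1)])
      show "Ck_on k U' (\<lambda>x. frechet_derivative f (at x) v)"
        using Ck_on_subset[OF assms(2)[of "Suc k"] U'U] by simp
      show "frechet_derivative f (at x) v = blinfun_apply (f' x) v" if "x \<in> U'" for x
        using f'_app subsetD[OF U'U that] by simp
    qed
  qed
  have "Ck_on k V g" for k
  proof (induction k)
    case 0
    then show ?case using *(6) by (simp add: homeomorphism_def)
  next
    case (Suc k)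
    show ?case
    proof (rule Ck_on_SucI[OF *(4)])
      show "(g has_derivative B (g y)) (at y)" if "y \<in> V" for y
        using *(7,8)[OF that] by (simp add: B_def)
      show "Ck_on k V (\<lambda>y. B (g y) v)" for v
        using gU by (intro Ck_on_comp[OF *(4,1) Suc _ BC]) auto
    qed
  qed
  then show thesis by (rule that[OF *(1,3) U'U *(4,6)])
qed

section \<open>Symmetry of second derivatives\<close>

lemma Ck_on_frechet_derivative:
  assumes "\<And>k. Ck_on k U f"
  shows "Ck_on k U (\<lambda>x. frechet_derivative f (at x) v)"
  using assms[of "Suc k"] by simp

lemma mvt_from_zero:
  fixes \<phi> D :: "real \<Rightarrow> real"
  assumes "0 < s" "\<And>t. 0 \<le> t \<Longrightarrow> t \<le> s \<Longrightarrow> (\<phi> has_derivative (\<lambda>h. h * D t)) (at t)"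
  obtains \<theta> where "0 < \<theta>" "\<theta> < s" "\<phi> s - \<phi> 0 = s * D \<theta>"
proof -
  have d: "(\<phi> has_derivative (\<lambda>h. h * D t)) (at t within {0..s})" if "0 \<le> t" "t \<le> s" for t
    by (rule has_derivative_at_withinI[OF assms(2)[OF that]])
  have "\<exists>\<theta>\<in>{0<..<s}. \<phi> s - \<phi> 0 = (s - 0) * D \<theta>"
    by (rule mvt_simple[OF assms(1) d])
  then obtain \<theta> where "\<theta> \<in> {0<..<s}" "\<phi> s - \<phi> 0 = (s - 0) * D \<theta>" ..
  then show thesis by (intro that[of \<theta>]) simp_all
qed

text \<open>The second difference is an increment in the direction \<open>w\<close> of an increment
  in the direction \<open>v\<close>. Two applications of the mean value theorem turn it into the
  mixed derivative at an intermediate point, times the square of the step.\<close>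

lemma second_difference_mvt:
  fixes f :: "'a::euclidean_space \<Rightarrow> real"
  assumes "\<And>y. y \<in> ball x r \<Longrightarrow> f differentiable at y"
    and "\<And>y. y \<in> ball x r \<Longrightarrow> (\<lambda>y. frechet_derivative f (at y) v) differentiable at y"
    and s: "0 < s" "s * (norm v + norm w) < r"
  obtains z where "norm (z - x) \<le> s * (norm v + norm w)"
    "f (x + s *\<^sub>R v + s *\<^sub>R w) - f (x + s *\<^sub>R v) - f (x + s *\<^sub>R w) + f x
       = s * s * frechet_derivative (\<lambda>y. frechet_derivative f (at y) v) (at z) w"
proof -
  have in_ball: "x + a *\<^sub>R v + b *\<^sub>R w \<in> ball x r" "norm (a *\<^sub>R v + b *\<^sub>R w) \<le> s * (norm v + norm w)"
    if "0 \<le> a" "a \<le> s" "0 \<le> b" "b \<le> s" for a b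
  proof -
    have "norm (a *\<^sub>R v + b *\<^sub>R w) \<le> a * norm v + b * norm w"
      using norm_triangle_ineq[of "a *\<^sub>R v" "b *\<^sub>R w"] that by simp
    also have "\<dots> \<le> s * norm v + s * norm w"
      using that by (intro add_mono mult_right_mono) auto
    finally show *: "norm (a *\<^sub>R v + b *\<^sub>R w) \<le> s * (norm v + norm w)" by (simp add: algebra_simps)
    have "dist x (x + a *\<^sub>R v + b *\<^sub>R w) = norm (a *\<^sub>R v + b *\<^sub>R w)"
    proof -
      have "dist x (x + u) = norm u" for u by (simp add: dist_norm)
      then show ?thesis by (simp only: add.assoc)
    qed
    then show "x + a *\<^sub>R v + b *\<^sub>R w \<in> ball x r" using * s(2) by simp
  qed
  define D where "D y = frechet_derivative f (at y) v" for y
  have df: "(f has_derivative frechet_derivative f (at y)) (at y)" if "y \<in> ball x r" for y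
    using assms(1)[OF that] frechet_derivative_works by blast
  have dD: "(D has_derivative frechet_derivative D (at y)) (at y)" if "y \<in> ball x r" for y
    using assms(2)[OF that] frechet_derivative_works unfolding D_def by blast
  define \<phi> where "\<phi> t = f (x + t *\<^sub>R v + s *\<^sub>R w) - f (x + t *\<^sub>R v)" for t
  have \<phi>': "(\<phi> has_derivative (\<lambda>h. h * (D (x + t *\<^sub>R v + s *\<^sub>R w) - D (x + t *\<^sub>R v)))) (at t)" if "0 \<le> t" "t \<le> s" for t
  proof -
    let ?F = "\<lambda>y. frechet_derivative f (at y)"
    have 1: "x + t *\<^sub>R v + s *\<^sub>R w \<in> ball x r" "x + t *\<^sub>R v \<in> ball x r"
      using in_ball(1)[of t s] in_ball(1)[of t 0] that s(1) by auto
    have "((\<lambda>t. f (x + t *\<^sub>R v + s *\<^sub>R w)) has_derivative (\<lambda>h. ?F (x + t *\<^sub>R v + s *\<^sub>R w) (h *\<^sub>R v))) (at t)"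
      by (rule has_derivative_compose[where f="\<lambda>t. x + t *\<^sub>R v + s *\<^sub>R w", OF _ df[OF 1(1)]]) (auto intro!: derivative_eq_intros)
    moreover have "((\<lambda>t. f (x + t *\<^sub>R v)) has_derivative (\<lambda>h. ?F (x + t *\<^sub>R v) (h *\<^sub>R v))) (at t)"
      by (rule has_derivative_compose[where f="\<lambda>t. x + t *\<^sub>R v", OF _ df[OF 1(2)]]) (auto intro!: derivative_eq_intros)
    ultimately have "(\<phi> has_derivative (\<lambda>h. ?F (x + t *\<^sub>R v + s *\<^sub>R w) (h *\<^sub>R v) - ?F (x + t *\<^sub>R v) (h *\<^sub>R v))) (at t)"
      unfolding \<phi>_def by (rule has_derivative_diff)
    moreover have "?F y (h *\<^sub>R v) = h * D y" if "y \<in> ball x r" for y h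
      unfolding D_def using linear_scale[OF bounded_linear.linear[OF has_derivative_bounded_linear[OF df[OF that]]], of h v]
      by simp
    ultimately have "(\<phi> has_derivative (\<lambda>h. h * D (x + t *\<^sub>R v + s *\<^sub>R w) - h * D (x + t *\<^sub>R v))) (at t)"
      using 1 by simp
    then show ?thesis by (simp only: right_diff_distrib)
  qed
  obtain \<theta> where \<theta>: "0 < \<theta>" "\<theta> < s" "\<phi> s - \<phi> 0 = s * (D (x + \<theta> *\<^sub>R v + s *\<^sub>R w) - D (x + \<theta> *\<^sub>R v))"
    by (rule mvt_from_zero[of s \<phi> "\<lambda>t. D (x + t *\<^sub>R v + s *\<^sub>R w) - D (x + t *\<^sub>R v)"])
      (use s(1) \<phi>' in auto)
  define \<psi> where "\<psi> t = D (x + \<theta> *\<^sub>R v + t *\<^sub>R w)" for t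
  let ?G = "\<lambda>y. frechet_derivative D (at y)"
  have \<psi>': "(\<psi> has_derivative (\<lambda>h. h * ?G (x + \<theta> *\<^sub>R v + t *\<^sub>R w) w)) (at t)" if "0 \<le> t" "t \<le> s" for t
  proof -
    have 1: "x + \<theta> *\<^sub>R v + t *\<^sub>R w \<in> ball x r"
      using in_ball(1)[of \<theta> t] that \<theta> by auto
    have "(\<psi> has_derivative (\<lambda>h. ?G (x + \<theta> *\<^sub>R v + t *\<^sub>R w) (h *\<^sub>R w))) (at t)"
      unfolding \<psi>_def by (rule has_derivative_compose[where f="\<lambda>t. x + \<theta> *\<^sub>R v + t *\<^sub>R w", OF _ dD[OF 1]]) (auto intro!: derivative_eq_intros)
    moreover have "?G (x + \<theta> *\<^sub>R v + t *\<^sub>R w) (h *\<^sub>R w) = h * ?G (x + \<theta> *\<^sub>R v + t *\<^sub>R w) w" for h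
      using linear_scale[OF bounded_linear.linear[OF has_derivative_bounded_linear[OF dD[OF 1]]], of h w] by simp
    ultimately show ?thesis by (simp only:)
  qed
  obtain \<tau> where \<tau>: "0 < \<tau>" "\<tau> < s" "\<psi> s - \<psi> 0 = s * ?G (x + \<theta> *\<^sub>R v + \<tau> *\<^sub>R w) w"
    by (rule mvt_from_zero[of s \<psi> "\<lambda>t. ?G (x + \<theta> *\<^sub>R v + t *\<^sub>R w) w"])
      (use s(1) \<psi>' in auto)
  show ?thesis
  proof (rule that)
    show "norm (x + \<theta> *\<^sub>R v + \<tau> *\<^sub>R w - x) \<le> s * (norm v + norm w)"
      using in_ball(2)[of \<theta> \<tau>] \<theta> \<tau> by (simp add: add.assoc)
    have "f (x + s *\<^sub>R v + s *\<^sub>R w) - f (x + s *\<^sub>R v) - f (x + s *\<^sub>R w) + f x = \<phi> s - \<phi> 0"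
      by (simp add: \<phi>_def)
    also have "\<dots> = s * (\<psi> s - \<psi> 0)" using \<theta>(3) by (simp add: \<psi>_def)
    finally show "f (x + s *\<^sub>R v + s *\<^sub>R w) - f (x + s *\<^sub>R v) - f (x + s *\<^sub>R w) + f x
       = s * s * frechet_derivative (\<lambda>y. frechet_derivative f (at y) v) (at (x + \<theta> *\<^sub>R v + \<tau> *\<^sub>R w)) w"
      using \<tau>(3) by (simp add: D_def[abs_def])
  qed
qed

text \<open>The second difference is symmetric in \<open>v\<close> and \<open>w\<close>, and divided
  by \<open>s * s\<close> it is a value of either mixed derivative at a point close to
  \<open>x\<close>. By continuity at \<open>x\<close> the two mixed derivatives cannot
  differ.\<close>

lemma frechet_derivative_symmetric_real:
  fixes f :: "'a::euclidean_space \<Rightarrow> real"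
  assumes "open U" "x \<in> U" "Ck_on 2 U f"
  shows "frechet_derivative (\<lambda>y. frechet_derivative f (at y) v) (at x) w =
         frechet_derivative (\<lambda>y. frechet_derivative f (at y) w) (at x) v"
proof (rule ccontr)
  define D where "D v w z = frechet_derivative (\<lambda>y. frechet_derivative f (at y) v) (at z) w" for v w z
  assume "\<not> ?thesis"
  \<comment> \<open>Half the discrepancy: two errors below it cannot add up to the
    discrepancy.\<close>
  then have e: "\<bar>D v w x - D w v x\<bar> / 2 > 0" (is "?e > 0") by (simp add: D_def)
  have C: "Ck_on (Suc (Suc 0)) U f" using assms(3) by (simp add: numeral_2_eq_2)
  then have diff: "f differentiable at y" "(\<lambda>y. frechet_derivative f (at y) v) differentiable at y" if "y \<in> U" for y v
    using that by simp_all
  have cont: "continuous_on U (D v w)" for v w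
    using C by (simp add: D_def[abs_def])
  obtain r where r: "r > 0" "ball x r \<subseteq> U" using assms openE by blast
  have near: "\<exists>d>0. \<forall>z. dist z x < d \<longrightarrow> \<bar>D a b z - D a b x\<bar> < ?e" for a b
  proof -
    have "isCont (D a b) x" using cont[of a b] assms(1,2) by (simp add: continuous_on_eq_continuous_at)
    then show ?thesis using e unfolding continuous_at_eps_delta dist_real_def by presburger
  qed
  obtain d1 where d1: "d1 > 0" "\<And>z. dist z x < d1 \<Longrightarrow> \<bar>D v w z - D v w x\<bar> < ?e"
    using near[of v w] by blast
  obtain d2 where d2: "d2 > 0" "\<And>z. dist z x < d2 \<Longrightarrow> \<bar>D w v z - D w v x\<bar> < ?e"
    using near[of w v] by blast
  note d = d1(1) d2(1) d1(2) d2(2)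
  \<comment> \<open>The summand 1 keeps the denominator positive, and the whole denominator makes
    \<open>s * (norm v + norm w)\<close> strictly smaller than all three radii.\<close>
  define s where "s = min r (min d1 d2) / (2 * (norm v + norm w + 1))"
  have N: "norm v + norm w + 1 > 0" by (simp add: add_nonneg_pos)
  have s: "s > 0" using r d N by (simp add: s_def)
  have "s * (norm v + norm w) < s * (2 * (norm v + norm w + 1))" using s N
    by (intro mult_strict_left_mono) auto
  also have "\<dots> = min r (min d1 d2)" unfolding s_def using N by (simp add: field_simps)
  finally have sm: "s * (norm v + norm w) < r" "s * (norm v + norm w) < d1" "s * (norm v + norm w) < d2" by auto
  have sm': "s * (norm w + norm v) < r" using sm(1) by (simp add: add.commute)
  obtain z1 where z1: "norm (z1 - x) \<le> s * (norm v + norm w)"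
    "f (x + s *\<^sub>R v + s *\<^sub>R w) - f (x + s *\<^sub>R v) - f (x + s *\<^sub>R w) + f x = s * s * D v w z1"
    unfolding D_def by (rule second_difference_mvt[of x r f v s w, OF diff(1)[OF subsetD[OF r(2)]] diff(2)[OF subsetD[OF r(2)]] s sm(1)])
  obtain z2 where z2: "norm (z2 - x) \<le> s * (norm w + norm v)"
    "f (x + s *\<^sub>R w + s *\<^sub>R v) - f (x + s *\<^sub>R w) - f (x + s *\<^sub>R v) + f x = s * s * D w v z2"
    unfolding D_def by (rule second_difference_mvt[of x r f w s v, OF diff(1)[OF subsetD[OF r(2)]] diff(2)[OF subsetD[OF r(2)]] s sm'])
  have "s * s * D v w z1 = s * s * D w v z2"
    using z1(2) z2(2) by (simp add: algebra_simps)
  then have "D v w z1 = D w v z2" using s by simp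
  moreover have "\<bar>D v w z1 - D v w x\<bar> < ?e" using d(3)[of z1] z1(1) sm by (simp add: dist_norm)
  moreover have "\<bar>D w v z2 - D w v x\<bar> < ?e" using d(4)[of z2] z2(1) sm by (simp add: dist_norm add.commute)
  ultimately show False using abs_triangle_ineq4[of "D v w z1 - D w v x" "D v w z1 - D v w x"] by simp
qed

lemma frechet_derivative_symmetric:
  fixes f :: "'a::euclidean_space \<Rightarrow> 'b::euclidean_space"
  assumes "open U" "x \<in> U" "\<And>k. Ck_on k U f"
  shows "frechet_derivative (\<lambda>y. frechet_derivative f (at y) v) (at x) w =
         frechet_derivative (\<lambda>y. frechet_derivative f (at y) w) (at x) v"
proof (rule euclidean_eqI)
  fix b :: 'b
  let ?fb = "\<lambda>y. f y \<bullet> b"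
  have 1: "frechet_derivative (\<lambda>y. f y \<bullet> b) (at y) v = frechet_derivative f (at y) v \<bullet> b" if "y \<in> U" for y v
  proof -
    have "(f has_derivative frechet_derivative f (at y)) (at y)"
      by (rule Ck_on_Suc_has_derivative[OF assms(3) that])
    then have "(?fb has_derivative (\<lambda>v. frechet_derivative f (at y) v \<bullet> b)) (at y)"
      by (rule has_derivative_inner_left)
    from fun_cong[OF frechet_derivative_at[OF this], of v] show ?thesis by (rule sym)
  qed
  have 2: "frechet_derivative (\<lambda>y. frechet_derivative ?fb (at y) v) (at x) w
      = frechet_derivative (\<lambda>y. frechet_derivative f (at y) v) (at x) w \<bullet> b" for v w
  proof -
    let ?g = "\<lambda>y. frechet_derivative f (at y) v"
    have "Ck_on (Suc 0) U ?g" by (rule Ck_on_frechet_derivative[OF assms(3)])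
    then have "(?g has_derivative frechet_derivative ?g (at x)) (at x)"
      using assms(2) by (rule Ck_on_Suc_has_derivative)
    then have "((\<lambda>y. ?g y \<bullet> b) has_derivative (\<lambda>w. frechet_derivative ?g (at x) w \<bullet> b)) (at x)"
      by (rule has_derivative_inner_left)
    then have "((\<lambda>y. frechet_derivative ?fb (at y) v) has_derivative (\<lambda>w. frechet_derivative ?g (at x) w \<bullet> b)) (at x)"
      by (rule has_derivative_transform_within_open[OF _ assms(1,2) 1[symmetric]])
    from fun_cong[OF frechet_derivative_at[OF this], of w] show ?thesis by (rule sym)
  qed
  have "Ck_on 2 U ?fb" by (rule Ck_on_bounded_linear_comp[OF assms(1) bounded_linear_inner_left assms(3)])
  from frechet_derivative_symmetric_real[OF assms(1,2) this, of v w]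
  show "frechet_derivative (\<lambda>y. frechet_derivative f (at y) v) (at x) w \<bullet> b =
         frechet_derivative (\<lambda>y. frechet_derivative f (at y) w) (at x) v \<bullet> b"
    unfolding 2 .
qed

section \<open>Smooth functions on relatively open sets\<close>

lemma smooth_onE:
  assumes "smooth_on S f" "x \<in> S"
  obtains U g where "open U" "x \<in> U" "\<forall>k. Ck_on k U g" "\<forall>y\<in>S \<inter> U. f y = g y"
  using assms unfolding smooth_on_def by blast

lemma smooth_onI:
  assumes "\<And>x. x \<in> S \<Longrightarrow> \<exists>U g. open U \<and> x \<in> U \<and> (\<forall>k. Ck_on k U g) \<and> (\<forall>y\<in>S \<inter> U. f y = g y)"
  shows "smooth_on S f"
  using assms unfolding smooth_on_def by blast

lemma smooth_on_open: "open U \<Longrightarrow> (\<And>k. Ck_on k U f) \<Longrightarrow> smooth_on U f"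
  by (intro smooth_onI exI[of _ U] exI[of _ f]) auto

lemma smooth_on_subset: "smooth_on S f \<Longrightarrow> T \<subseteq> S \<Longrightarrow> smooth_on T f"
  unfolding smooth_on_def by (meson Int_mono order_refl subset_iff)

lemma smooth_on_cong:
  assumes "smooth_on S f" "\<And>x. x \<in> S \<Longrightarrow> g x = f x"
  shows "smooth_on S g"
  using assms unfolding smooth_on_def by simp

lemma smooth_on_local:
  assumes "\<And>x. x \<in> S \<Longrightarrow> \<exists>U. open U \<and> x \<in> U \<and> smooth_on (S \<inter> U) f"
  shows "smooth_on S f"
proof (rule smooth_onI)
  fix x assume x: "x \<in> S"
  obtain U where U: "open U" "x \<in> U" "smooth_on (S \<inter> U) f" using assms[OF x] by blast
  obtain V g where V': "open V" "x \<in> V" "\<forall>k. Ck_on k V g" "\<forall>y\<in>S \<inter> U \<inter> V. f y = g y"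
    by (rule smooth_onE[OF U(3), of x]) (use x U in auto)
  note V = V'(1,2) V'(3)[rule_format] V'(4)[rule_format, OF IntI]
  show "\<exists>U g. open U \<and> x \<in> U \<and> (\<forall>k. Ck_on k U g) \<and> (\<forall>y\<in>S \<inter> U. f y = g y)"
  proof (intro exI[of _ "U \<inter> V"] exI[of _ g] conjI allI)
    show "Ck_on k (U \<inter> V) g" for k by (rule Ck_on_subset[OF V(3)]) auto
  qed (use U V in auto)
qed

lemma smooth_on_continuous_on:
  assumes "smooth_on S f"
  shows "continuous_on S f"
  unfolding continuous_on_eq_continuous_within
proof
  fix x assume x: "x \<in> S"
  obtain U g where U': "open U" "x \<in> U" "\<forall>k. Ck_on k U g" "\<forall>y\<in>S \<inter> U. f y = g y"
    by (rule smooth_onE[OF assms x])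
  note U = U'(1,2) U'(3)[rule_format] U'(4)[rule_format, OF IntI]
  have "continuous_on (S \<inter> U) f"
    using continuous_on_cong[OF refl U(4), of "S \<inter> U"] continuous_on_subset[OF Ck_on_continuous_on[OF U(3)[of 0]], of "S \<inter> U"]
    by simp
  then have "continuous (at x within S \<inter> U) f"
    using x U(2) by (simp add: continuous_on_eq_continuous_within)
  moreover have "at x within S \<inter> U = at x within S"
    by (rule at_within_nhd[OF U(2,1)]) auto
  ultimately show "continuous (at x within S) f" by simp
qed

lemma smooth_on_comp:
  assumes "smooth_on S f" "smooth_on T g" "\<And>x. x \<in> S \<Longrightarrow> f x \<in> T"
  shows "smooth_on S (\<lambda>x. g (f x))"
proof (rule smooth_onI)
  fix x assume x: "x \<in> S"
  obtain U f1 where U': "open U" "x \<in> U" "\<forall>k. Ck_on k U f1" "\<forall>y\<in>S \<inter> U. f y = f1 y"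
    by (rule smooth_onE[OF assms(1) x])
  note U = U'(1,2) U'(3)[rule_format] U'(4)[rule_format, OF IntI]
  obtain V g1 where V': "open V" "f x \<in> V" "\<forall>k. Ck_on k V g1" "\<forall>y\<in>T \<inter> V. g y = g1 y"
    by (rule smooth_onE[OF assms(2) assms(3)[OF x]])
  note V = V'(1,2) V'(3)[rule_format] V'(4)[rule_format, OF IntI]
  have op: "open (U \<inter> f1 -` V)"
    by (rule continuous_open_preimage[OF Ck_on_continuous_on[OF U(3)[of 0]] U(1) V(1)])
  show "\<exists>U g'. open U \<and> x \<in> U \<and> (\<forall>k. Ck_on k U g') \<and> (\<forall>y\<in>S \<inter> U. g (f y) = g' y)"
  proof (intro exI[of _ "U \<inter> f1 -` V"] exI[of _ "\<lambda>x. g1 (f1 x)"] conjI allI)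
    show "Ck_on k (U \<inter> f1 -` V) (\<lambda>x. g1 (f1 x))" for k
      by (rule Ck_on_comp[OF op V(1) Ck_on_subset[OF U(3)] _ V(3)]) auto
    show "\<forall>y\<in>S \<inter> (U \<inter> f1 -` V). g (f y) = g1 (f1 y)"
    proof
      fix y assume "y \<in> S \<inter> (U \<inter> f1 -` V)"
      then show "g (f y) = g1 (f1 y)" using U(4)[of y] V(4)[of "f y"] assms(3)[of y] by simp
    qed
  qed (use op U V x in auto)
qed

lemma smooth_on_const: "smooth_on S (\<lambda>x. c)"
  by (intro smooth_onI exI[of _ UNIV] exI[of _ "\<lambda>x. c"]) (auto intro: Ck_on_const)

lemma smooth_on_bounded_linear: "bounded_linear L \<Longrightarrow> smooth_on S L"
  by (intro smooth_onI exI[of _ UNIV] exI[of _ L]) (auto intro: Ck_on_bounded_linear)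

lemma smooth_on_id: "smooth_on S (\<lambda>x. x)"
  by (rule smooth_on_bounded_linear[OF bounded_linear_ident])

lemma smooth_on_bounded_linear_comp:
  assumes "bounded_linear L" "smooth_on S f"
  shows "smooth_on S (\<lambda>x. L (f x))"
  by (rule smooth_on_comp[OF assms(2) smooth_on_bounded_linear[OF assms(1), of UNIV]]) simp

lemma smooth_on_combine:
  fixes S :: "'a::euclidean_space set"
  assumes "smooth_on S f" "smooth_on S g"
    and "\<And>(U :: 'a set) f1 g1 k. open U \<Longrightarrow> Ck_on k U f1 \<Longrightarrow> Ck_on k U g1 \<Longrightarrow> Ck_on k U (\<lambda>x. h (f1 x) (g1 x))"
  shows "smooth_on S (\<lambda>x. h (f x) (g x))"
proof (rule smooth_onI)
  fix x assume x: "x \<in> S"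
  obtain U f1 where U': "open U" "x \<in> U" "\<forall>k. Ck_on k U f1" "\<forall>y\<in>S \<inter> U. f y = f1 y"
    by (rule smooth_onE[OF assms(1) x])
  note U = U'(1,2) U'(3)[rule_format] U'(4)[rule_format, OF IntI]
  obtain V g1 where V': "open V" "x \<in> V" "\<forall>k. Ck_on k V g1" "\<forall>y\<in>S \<inter> V. g y = g1 y"
    by (rule smooth_onE[OF assms(2) x])
  note V = V'(1,2) V'(3)[rule_format] V'(4)[rule_format, OF IntI]
  show "\<exists>U h'. open U \<and> x \<in> U \<and> (\<forall>k. Ck_on k U h') \<and> (\<forall>y\<in>S \<inter> U. h (f y) (g y) = h' y)"
  proof (intro exI[of _ "U \<inter> V"] exI[of _ "\<lambda>x. h (f1 x) (g1 x)"] conjI allI)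
    show "Ck_on k (U \<inter> V) (\<lambda>x. h (f1 x) (g1 x))" for k
      by (rule assms(3)[OF open_Int[OF U(1) V(1)] Ck_on_subset[OF U(3)] Ck_on_subset[OF V(3)]]) auto
  qed (use U V in auto)
qed

lemma smooth_on_add: "smooth_on S f \<Longrightarrow> smooth_on S g \<Longrightarrow> smooth_on S (\<lambda>x. f x + g x)"
  by (rule smooth_on_combine[where h="(+)", OF _ _ Ck_on_add])

lemma smooth_on_bilinear:
  "bounded_bilinear h \<Longrightarrow> smooth_on S f \<Longrightarrow> smooth_on S g \<Longrightarrow> smooth_on S (\<lambda>x. h (f x) (g x))"
  by (rule smooth_on_combine[where h=h]) (assumption, assumption, rule Ck_on_bilinear[where prod=h])

lemma smooth_on_diff:
  assumes "smooth_on S f" "smooth_on S g"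
  shows "smooth_on S (\<lambda>x. f x - g x)"
  using smooth_on_add[OF assms(1) smooth_on_bounded_linear_comp[OF bounded_linear_minus[OF bounded_linear_ident] assms(2)]]
  by simp

lemma smooth_on_sum:
  assumes "finite I" "\<And>i. i \<in> I \<Longrightarrow> smooth_on S (f i)"
  shows "smooth_on S (\<lambda>x. \<Sum>i\<in>I. f i x)"
  using assms by induction (auto intro: smooth_on_add smooth_on_const)

lemma smooth_on_Pair:
  assumes "smooth_on S f" "smooth_on S g"
  shows "smooth_on S (\<lambda>x. (f x, g x))"
proof -
  have "smooth_on S (\<lambda>x. (f x, 0) + (0, g x))"
    by (intro smooth_on_add smooth_on_bounded_linear_comp[where L="\<lambda>x. (x, 0)"]
      smooth_on_bounded_linear_comp[where L="\<lambda>x. (0, x)"] assms bounded_linear_Pair bounded_linear_ident bounded_linear_zero)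
  then show ?thesis by simp
qed

text \<open>Composition with such a projection extends functions from a subspace to the ambient
  space, and detects whether derivatives stay in a subspace.\<close>

lemma linear_projection_exists:
  fixes E :: "'a::euclidean_space set"
  assumes "subspace E"
  obtains p where "bounded_linear p" "\<And>x. p x \<in> E" "\<And>x. x \<in> E \<Longrightarrow> p x = x"
proof -
  obtain g where "range g \<subseteq> E" "linear g" "\<forall>v\<in>(\<lambda>x. x) ` E. g v = v"
    using linear_exists_right_inverse_on[OF linear_ident assms] by auto
  then show thesis by (intro that[of g]) (auto simp: linear_conv_bounded_linear)
qed

section \<open>Directional derivatives along the model subspace\<close>

lemma eventually_line_in:
  fixes E :: "'a::real_normed_vector set"
  assumes "subspace E" "openin (top_of_set E) S" "x \<in> S" "v \<in> E"
  shows "\<forall>\<^sub>F t in nhds (0::real). x + t *\<^sub>R v \<in> S"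
proof -
  obtain T where T: "open T" "S = E \<inter> T" using assms(2) openin_open by blast
  have "open ((\<lambda>t::real. x + t *\<^sub>R v) -` T)"
    by (intro continuous_open_vimage T) (auto intro!: continuous_intros)
  moreover have "x + t *\<^sub>R v \<in> E" for t
    using assms T by (intro subspace_add subspace_scale) auto
  ultimately show ?thesis
    unfolding eventually_nhds using assms(3) T
    by (intro exI[of _ "(\<lambda>t::real. x + t *\<^sub>R v) -` T"]) auto
qed

lemma dir_deriv_cong:
  assumes "subspace E" "openin (top_of_set E) S" "x \<in> S" "v \<in> E" "\<And>y. y \<in> S \<Longrightarrow> f y = g y"
  shows "dir_deriv f x v = dir_deriv g x v"
  unfolding dir_deriv_def
proof (rule vector_derivative_cong_eq)
  show "\<forall>\<^sub>F t in nhds 0. t \<in> UNIV \<longrightarrow> f (x + t *\<^sub>R v) = g (x + t *\<^sub>R v)"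
    using eventually_line_in[OF assms(1-4)] by eventually_elim (use assms(5) in auto)
qed (use assms in auto)

text \<open>A derivative within \<open>S\<close> is not unique in directions transverse to
  \<open>E\<close>. In directions of \<open>E\<close> the line stays in \<open>S\<close> for small
  times, so there every choice of \<open>L\<close> has the directional derivatives as
  values.\<close>

lemma has_derivative_along_line:
  assumes "subspace E" "openin (top_of_set E) S" "x \<in> S" "v \<in> E"
    and "(f has_derivative L) (at x within S)"
  shows "((\<lambda>t. f (x + t *\<^sub>R v)) has_vector_derivative L v) (at 0)" "dir_deriv f x v = L v"
proof -
  obtain A where A: "open A" "(0::real) \<in> A" "\<And>t. t \<in> A \<Longrightarrow> x + t *\<^sub>R v \<in> S"
    using eventually_line_in[OF assms(1-4)] unfolding eventually_nhds by blast
  have "((\<lambda>t. x + t *\<^sub>R v) has_derivative (\<lambda>t. t *\<^sub>R v)) (at 0 within A)"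
    by (auto intro!: derivative_eq_intros)
  moreover have "(f has_derivative L) (at (x + 0 *\<^sub>R v) within (\<lambda>t. x + t *\<^sub>R v) ` A)"
    using A(3) by (intro has_derivative_subset[OF _ image_subsetI, of _ _ _ S]) (use assms(5) in auto)
  ultimately have "(f \<circ> (\<lambda>t. x + t *\<^sub>R v) has_derivative L \<circ> (\<lambda>t. t *\<^sub>R v)) (at 0 within A)"
    by (rule diff_chain_within)
  then have "((\<lambda>t. f (x + t *\<^sub>R v)) has_derivative (\<lambda>t. L (t *\<^sub>R v))) (at 0)"
    using at_within_open[OF A(2,1)] by (simp add: o_def)
  moreover have "L (t *\<^sub>R v) = t *\<^sub>R L v" for t
    using assms(5) by (simp add: bounded_linear.linear[OF has_derivative_bounded_linear] linear_scale)
  ultimately show 1: "((\<lambda>t. f (x + t *\<^sub>R v)) has_vector_derivative L v) (at 0)"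
    by (simp add: has_vector_derivative_def)
  show "dir_deriv f x v = L v"
    unfolding dir_deriv_def by (rule vector_derivative_at[OF 1])
qed

lemma has_derivative_extension:
  assumes "open U" "x \<in> U" "\<And>k. Ck_on k U g" "x \<in> S" "\<And>y. y \<in> S \<Longrightarrow> y \<in> U \<Longrightarrow> f y = g y"
  shows "(f has_derivative frechet_derivative g (at x)) (at x within S)"
proof -
  obtain d where d: "d > 0" "ball x d \<subseteq> U" using assms(1,2) openE by blast
  have "(g has_derivative frechet_derivative g (at x)) (at x within S)"
    by (rule has_derivative_at_withinI[OF Ck_on_Suc_has_derivative[OF assms(3) assms(2)]])
  then show ?thesis
    by (rule has_derivative_transform_within[OF _ d(1) assms(4)])
      (use d(2) assms(5) in \<open>auto simp: subset_iff dist_commute\<close>)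
qed

lemma smooth_on_has_derivative:
  assumes "smooth_on S f" "x \<in> S"
  obtains L where "(f has_derivative L) (at x within S)"
proof -
  obtain U g where U': "open U" "x \<in> U" "\<forall>k. Ck_on k U g" "\<forall>y\<in>S \<inter> U. f y = g y"
    by (rule smooth_onE[OF assms])
  note U = U'(1,2) U'(3)[rule_format] U'(4)[rule_format, OF IntI]
  show thesis by (rule that[OF has_derivative_extension[OF U(1-3) assms(2) U(4)]])
qed

lemma dir_deriv_extension:
  assumes "subspace E" "openin (top_of_set E) S" "x \<in> S" "v \<in> E"
    and "open U" "x \<in> U" "\<And>k. Ck_on k U g" "\<And>y. y \<in> S \<Longrightarrow> y \<in> U \<Longrightarrow> f y = g y"
  shows "dir_deriv f x v = frechet_derivative g (at x) v"
  by (rule has_derivative_along_line(2)[OF assms(1-4) has_derivative_extension[OF assms(5-7,3,8)]])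

lemma dir_deriv_linear:
  assumes "subspace E" "openin (top_of_set E) S" "x \<in> S" "smooth_on S f" "u \<in> E" "v \<in> E"
  shows "dir_deriv f x (a *\<^sub>R u + b *\<^sub>R v) = a *\<^sub>R dir_deriv f x u + b *\<^sub>R dir_deriv f x v"
proof -
  obtain L where L: "(f has_derivative L) (at x within S)"
    by (rule smooth_on_has_derivative[OF assms(4,3)])
  have lin: "linear L" by (rule bounded_linear.linear[OF has_derivative_bounded_linear[OF L]])
  have "a *\<^sub>R u + b *\<^sub>R v \<in> E" using assms by (intro subspace_add subspace_scale)
  then show ?thesis
    using has_derivative_along_line(2)[OF assms(1-3) _ L] assms(5,6)
    by (simp add: linear_add[OF lin] linear_scale[OF lin])
qed

lemma dir_deriv_comp:
  assumes "subspace E" "openin (top_of_set E) S" "x \<in> S" "v \<in> E" "smooth_on S f"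
    and "subspace E'" "openin (top_of_set E') T" "smooth_on T g" "\<And>y. y \<in> S \<Longrightarrow> f y \<in> T"
    and "dir_deriv f x v \<in> E'"
  shows "dir_deriv (\<lambda>y. g (f y)) x v = dir_deriv g (f x) (dir_deriv f x v)"
proof -
  obtain L where L: "(f has_derivative L) (at x within S)"
    by (rule smooth_on_has_derivative[OF assms(5,3)])
  obtain L' where L': "(g has_derivative L') (at (f x) within T)"
    by (rule smooth_on_has_derivative[OF assms(8) assms(9)[OF assms(3)]])
  have "(g has_derivative L') (at (f x) within f ` S)"
    by (rule has_derivative_subset[OF L']) (use assms(9) in auto)
  then have "((\<lambda>y. g (f y)) has_derivative (\<lambda>v. L' (L v))) (at x within S)"
    using diff_chain_within[OF L] by (simp add: o_def)
  then show ?thesis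
    using has_derivative_along_line(2)[OF assms(1-4), of "\<lambda>y. g (f y)"] has_derivative_along_line(2)[OF assms(1-4) L]
      has_derivative_along_line(2)[OF assms(6,7) assms(9)[OF assms(3)] assms(10) L'] by simp
qed

lemma dir_deriv_bounded_linear_comp:
  assumes "subspace E" "openin (top_of_set E) S" "x \<in> S" "v \<in> E" "smooth_on S f" "bounded_linear L"
  shows "dir_deriv (\<lambda>y. L (f y)) x v = L (dir_deriv f x v)"
proof -
  obtain D where D: "(f has_derivative D) (at x within S)"
    by (rule smooth_on_has_derivative[OF assms(5,3)])
  show ?thesis
    using has_derivative_along_line(2)[OF assms(1-4) D]
      has_derivative_along_line(2)[OF assms(1-4) bounded_linear.has_derivative[OF assms(6) D]] by simp
qed

lemma dir_deriv_bounded_linear: "bounded_linear L \<Longrightarrow> dir_deriv L x v = L v"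
  by (rule has_derivative_along_line(2)[of UNIV UNIV]) (auto intro: bounded_linear_imp_has_derivative)

text \<open>A linear projection onto \<open>E'\<close> fixes the values of \<open>f\<close> on
  \<open>S\<close>, hence also the derivative.\<close>

lemma dir_deriv_mem:
  assumes "subspace E" "openin (top_of_set E) S" "x \<in> S" "v \<in> E" "smooth_on S f"
    and "subspace E'" "\<And>y. y \<in> S \<Longrightarrow> f y \<in> E'"
  shows "dir_deriv f x v \<in> E'"
proof -
  obtain p where p: "bounded_linear p" "\<And>x. p x \<in> E'" "\<And>x. x \<in> E' \<Longrightarrow> p x = x"
    by (rule linear_projection_exists[OF assms(6)]) blast
  have "dir_deriv f x v = dir_deriv (\<lambda>y. p (f y)) x v"
    by (rule dir_deriv_cong[OF assms(1-4)]) (use assms(7) p(3) in auto)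
  also have "\<dots> = p (dir_deriv f x v)"
    by (rule dir_deriv_bounded_linear_comp[OF assms(1-5) p(1)])
  finally show ?thesis using p(2)[of "dir_deriv f x v"] by simp
qed

text \<open>Joint smoothness in base point and direction is shown on \<open>S \<times> E\<close>, by
  expanding the derivative of a local extension in \<open>Basis\<close>; then \<open>h\<close> and
  \<open>X\<close> are substituted.\<close>

lemma smooth_on_dir_deriv:
  assumes "subspace E" "openin (top_of_set E) S" "smooth_on S f"
    and "smooth_on T h" "smooth_on T X" "\<And>x. x \<in> T \<Longrightarrow> h x \<in> S" "\<And>x. x \<in> T \<Longrightarrow> X x \<in> E"
  shows "smooth_on T (\<lambda>x. dir_deriv f (h x) (X x))"
proof -
  have "smooth_on (S \<times> E) (\<lambda>z. dir_deriv f (fst z) (snd z))"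
  proof (rule smooth_onI)
    fix z assume z: "z \<in> S \<times> E"
    then have z1: "fst z \<in> S" by auto
    obtain U g where U': "open U" "fst z \<in> U" "\<forall>k. Ck_on k U g" "\<forall>y\<in>S \<inter> U. f y = g y"
      by (rule smooth_onE[OF assms(3) z1])
  note U = U'(1,2) U'(3)[rule_format] U'(4)[rule_format, OF IntI]
    let ?G = "\<lambda>z. \<Sum>b\<in>Basis. (snd z \<bullet> b) *\<^sub>R frechet_derivative g (at (fst z)) b"
    have op: "open (U \<times> (UNIV::'a set))" using U(1) by (simp add: open_Times)
    show "\<exists>U g. open U \<and> z \<in> U \<and> (\<forall>k. Ck_on k U g) \<and> (\<forall>y\<in>S \<times> E \<inter> U. dir_deriv f (fst y) (snd y) = g y)"
    proof (intro exI[of _ "U \<times> UNIV"] exI[of _ ?G] conjI allI ballI)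
      show "Ck_on k (U \<times> UNIV) ?G" for k
      proof (intro Ck_on_sum[OF op finite_Basis] Ck_on_bilinear[OF bounded_bilinear_scaleR op]
          Ck_on_bounded_linear_comp[OF op bounded_linear_inner_left])
        show "Ck_on k (U \<times> (UNIV::'a set)) snd" by (rule Ck_on_bounded_linear[OF op bounded_linear_snd])
        show "Ck_on k (U \<times> (UNIV::'a set)) (\<lambda>x. frechet_derivative g (at (fst x)) b)" for b
          by (rule Ck_on_comp[OF op U(1) Ck_on_bounded_linear[OF op bounded_linear_fst] _ Ck_on_frechet_derivative[OF U(3)]]) auto
      qed
      fix y assume y: "y \<in> S \<times> E \<inter> U \<times> UNIV"
      have "bounded_linear (frechet_derivative g (at (fst y)))"
        using Ck_on_Suc_has_derivative[OF U(3), of "fst y"] y has_derivative_bounded_linear by auto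
      then show "dir_deriv f (fst y) (snd y) = ?G y"
        using bounded_linear_expand[of "frechet_derivative g (at (fst y))" "snd y"]
          dir_deriv_extension[OF assms(1,2) _ _ U(1) _ U(3,4), of "fst y" "snd y"] y by auto
    qed (use op U z in auto)
  qed
  from smooth_on_comp[OF smooth_on_Pair[OF assms(4,5)] this] show ?thesis
    using assms(6,7) by simp
qed

lemma dir_deriv_symmetric:
  assumes "subspace E" "openin (top_of_set E) S" "x \<in> S" "smooth_on S f" "u \<in> E" "v \<in> E"
  shows "dir_deriv (\<lambda>y. dir_deriv f y u) x v = dir_deriv (\<lambda>y. dir_deriv f y v) x u"
proof -
  obtain U g where U': "open U" "x \<in> U" "\<forall>k. Ck_on k U g" "\<forall>y\<in>S \<inter> U. f y = g y"
    by (rule smooth_onE[OF assms(4,3)])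
  note U = U'(1,2) U'(3)[rule_format] U'(4)[rule_format, OF IntI]
  have "dir_deriv (\<lambda>y. dir_deriv f y u) x v = frechet_derivative (\<lambda>y. frechet_derivative g (at y) u) (at x) v"
    if "u \<in> E" "v \<in> E" for u v
    by (rule dir_deriv_extension[OF assms(1-3) that(2) U(1,2) Ck_on_frechet_derivative[OF U(3)]
      dir_deriv_extension[OF assms(1,2) _ that(1) U(1) _ U(3,4)]])
  then show ?thesis using frechet_derivative_symmetric[OF U(1-3)] assms(5,6) by simp
qed

text \<open>Product rule for a field inserted into the derivative of \<open>f\<close>. With
  \<open>Y\<close> frozen at \<open>x\<close> the first term is a second derivative of
  \<open>f\<close>, symmetric in its two directions; this is the term that cancels in Lie
  brackets.\<close>

lemma dir_deriv_along_field:
  assumes "subspace E" "openin (top_of_set E) S" "x \<in> S" "smooth_on S f" "smooth_on S Y"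
    "\<And>y. y \<in> S \<Longrightarrow> Y y \<in> E" "v \<in> E"
  shows "dir_deriv (\<lambda>y. dir_deriv f y (Y y)) x v
    = dir_deriv (\<lambda>y. dir_deriv f y (Y x)) x v + dir_deriv f x (dir_deriv Y x v)"
proof -
  obtain U g where U': "open U" "x \<in> U" "\<forall>k. Ck_on k U g" "\<forall>y\<in>S \<inter> U. f y = g y"
    by (rule smooth_onE[OF assms(4,3)])
  note U = U'(1,2) U'(3)[rule_format] U'(4)[rule_format, OF IntI]
  let ?D = "\<lambda>y. frechet_derivative g (at y)"
  have fD: "dir_deriv f y w = ?D y w" if "y \<in> S" "y \<in> U" "w \<in> E" for y w
    by (rule dir_deriv_extension[OF assms(1,2) that(1,3) U(1) that(2) U(3,4)])
  have bl: "bounded_linear (?D y)" if "y \<in> U" for y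
    by (rule has_derivative_bounded_linear[OF Ck_on_Suc_has_derivative[OF U(3) that]])
  obtain L where L: "(Y has_derivative L) (at x within S)"
    by (rule smooth_on_has_derivative[OF assms(5,3)])
  have Yv: "dir_deriv Y x v = L v" by (rule has_derivative_along_line(2)[OF assms(1-3,7) L])
  have Lv: "L v \<in> E" using dir_deriv_mem[OF assms(1-3,7,5,1,6)] Yv by simp
  have D': "((\<lambda>y. ?D y b) has_derivative frechet_derivative (\<lambda>y. ?D y b) (at x)) (at x within S)" for b
    by (rule has_derivative_at_withinI[OF Ck_on_Suc_has_derivative[OF Ck_on_frechet_derivative[OF U(3)] U(2)]])
  let ?F = "\<lambda>b. frechet_derivative (\<lambda>y. ?D y b) (at x)"
  have expand: "?D y w = (\<Sum>b\<in>Basis. (w \<bullet> b) *\<^sub>R ?D y b)" if "y \<in> U" for y w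
    by (rule bounded_linear_expand[OF bl[OF that]])
  have 1: "((\<lambda>y. \<Sum>b\<in>Basis. (Y y \<bullet> b) *\<^sub>R ?D y b) has_derivative
      (\<lambda>w. \<Sum>b\<in>Basis. (Y x \<bullet> b) *\<^sub>R ?F b w + (L w \<bullet> b) *\<^sub>R ?D x b)) (at x within S)"
    by (intro has_derivative_sum has_derivative_scaleR has_derivative_inner_left L D')
  have 2: "((\<lambda>y. \<Sum>b\<in>Basis. (Y x \<bullet> b) *\<^sub>R ?D y b) has_derivative
      (\<lambda>w. \<Sum>b\<in>Basis. (Y x \<bullet> b) *\<^sub>R ?F b w)) (at x within S)"
    by (intro has_derivative_sum bounded_linear.has_derivative[OF bounded_linear_scaleR_right] D')
  have SU: "openin (top_of_set E) (S \<inter> U)" "x \<in> S \<inter> U"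
    using assms(2,3) U by (auto intro: openin_Int_open)
  have "dir_deriv (\<lambda>y. dir_deriv f y (Y y)) x v = dir_deriv (\<lambda>y. \<Sum>b\<in>Basis. (Y y \<bullet> b) *\<^sub>R ?D y b) x v"
    by (rule dir_deriv_cong[OF assms(1) SU assms(7)]) (use fD assms(6) expand in auto)
  moreover have "dir_deriv (\<lambda>y. dir_deriv f y (Y x)) x v = dir_deriv (\<lambda>y. \<Sum>b\<in>Basis. (Y x \<bullet> b) *\<^sub>R ?D y b) x v"
    by (rule dir_deriv_cong[OF assms(1) SU assms(7)]) (use fD assms(3,6) expand in auto)
  ultimately show ?thesis
    using has_derivative_along_line(2)[OF assms(1-3,7) 1] has_derivative_along_line(2)[OF assms(1-3,7) 2] fD[OF assms(3) U(2) Lv] expand[OF U(2), of "L v"]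
    by (simp add: Yv sum.distrib)
qed

section \<open>Bump functions\<close>

text \<open>For \<open>n = 0\<close> the standard flat function \<open>exp (-1/t)\<close> on
  positive \<open>t\<close>. The powers of \<open>1/t\<close> are those that differentiation
  produces, so the family is closed under it up to linear combinations.\<close>

definition flat_exp :: "nat \<Rightarrow> real \<Rightarrow> real" where
  "flat_exp n t = (if t \<le> 0 then 0 else inverse t ^ n * exp (- inverse t))"

text \<open>With \<open>x = 1/t\<close> this is the decay of \<open>x^n / exp x\<close> at
  infinity.\<close>

lemma flat_exp_tendsto_0: "(flat_exp n \<longlongrightarrow> 0) (at_right 0)"
proof -
  have "((\<lambda>x. x ^ n / exp x) \<longlongrightarrow> 0) (at_top :: real filter)" by (rule tendsto_power_div_exp_0)
  then have "((\<lambda>t. inverse t ^ n / exp (inverse t)) \<longlongrightarrow> 0) (at_right (0::real))"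
    by (rule filterlim_compose[OF _ filterlim_inverse_at_top_right])
  moreover have "\<forall>\<^sub>F t in at_right 0. inverse t ^ n / exp (inverse t) = flat_exp n t"
    by (auto simp: eventually_at_right_less flat_exp_def exp_minus field_simps
      intro!: eventually_mono[OF eventually_at_right_less[of 0]])
  ultimately show ?thesis by (rule Lim_transform_eventually)
qed

lemma flat_exp_has_derivative:
  "(flat_exp n has_real_derivative flat_exp (n + 2) t - real n * flat_exp (n + 1) t) (at t)"
proof -
  consider "t < 0" | "t = 0" | "t > 0" by linarith
  then show ?thesis
  proof cases
    case 1
    have "((\<lambda>t. 0) has_real_derivative 0) (at t)" by simp
    then have "(flat_exp n has_real_derivative 0) (at t)"
      by (rule has_field_derivative_transform_within_open[of _ _ _ "{..<0}"]) (use 1 in \<open>auto simp: flat_exp_def\<close>)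
    then show ?thesis using 1 by (simp add: flat_exp_def)
  next
    case 2
    \<comment> \<open>At 0 the difference quotient is \<open>flat_exp (Suc n) h\<close> for positive
      \<open>h\<close> and 0 for negative \<open>h\<close>.\<close>
    have "((\<lambda>h. flat_exp n h / h) \<longlongrightarrow> 0) (at 0)"
    proof (rule filterlim_split_at)
      show "((\<lambda>h. flat_exp n h / h) \<longlongrightarrow> 0) (at_left 0)"
        by (rule tendsto_eventually) (auto simp: flat_exp_def eventually_at_left_field intro!: exI[of _ "-1"])
      have "\<forall>\<^sub>F h in at_right 0. flat_exp (Suc n) h = flat_exp n h / h"
        by (rule eventually_mono[OF eventually_at_right_less[of 0]]) (simp add: flat_exp_def divide_inverse ac_simps)
      then show "((\<lambda>h. flat_exp n h / h) \<longlongrightarrow> 0) (at_right 0)"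
        by (rule Lim_transform_eventually[OF flat_exp_tendsto_0])
    qed
    then show ?thesis using 2 by (simp add: DERIV_def flat_exp_def)
  next
    case 3
    have "((\<lambda>t. inverse t ^ n * exp (- inverse t)) has_real_derivative
        flat_exp (n + 2) t - real n * flat_exp (n + 1) t) (at t)"
      using 3 by (auto intro!: derivative_eq_intros simp: flat_exp_def)
        (cases n; simp add: field_simps power2_eq_square)
    then show ?thesis
      by (rule has_field_derivative_transform_within_open[of _ _ _ "{0<..}"]) (use 3 in \<open>auto simp: flat_exp_def\<close>)
  qed
qed

lemma Ck_on_flat_exp: "Ck_on k UNIV (flat_exp n)"
proof (induction k arbitrary: n)
  case 0
  have "isCont (flat_exp n) t" for t by (rule DERIV_isCont[OF flat_exp_has_derivative])
  then show ?case by (simp add: continuous_on_eq_continuous_at)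
next
  case (Suc k)
  show ?case
  proof (rule Ck_on_SucI[OF open_UNIV])
    show "(flat_exp n has_derivative (\<lambda>v. v * (flat_exp (n + 2) t + (- real n) * flat_exp (n + 1) t))) (at t)" for t
      using flat_exp_has_derivative[of n t] by (simp add: has_field_derivative_def mult_commute_abs)
    show "Ck_on k UNIV (\<lambda>t. v * (flat_exp (n + 2) t + (- real n) * flat_exp (n + 1) t))" for v
      by (intro Ck_on_bounded_linear_comp[OF open_UNIV bounded_linear_mult_right] Ck_on_add[OF open_UNIV] Suc.IH)
  qed
qed

text \<open>Again a family closed under differentiation up to constants; its case
  \<open>n = 1\<close> is the reciprocal in the smooth step.\<close>

lemma Ck_on_inverse_power: "Ck_on k {0<..} (\<lambda>x::real. inverse x ^ n)"
proof (induction k arbitrary: n)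
  case 0
  show ?case by (auto intro!: continuous_intros)
next
  case (Suc k)
  show ?case
  proof (rule Ck_on_SucI[OF open_greaterThan])
    fix x :: real assume x: "x \<in> {0<..}"
    have "((\<lambda>x. inverse x ^ n) has_real_derivative (- real n) * inverse x ^ (n + 1)) (at x)"
      using x by (auto intro!: derivative_eq_intros) (cases n; simp add: field_simps power2_eq_square)
    then show "((\<lambda>x. inverse x ^ n) has_derivative (\<lambda>v. v * ((- real n) * inverse x ^ (n + 1)))) (at x)"
      unfolding has_field_derivative_def mult_commute_abs .
  next
    show "Ck_on k {0<..} (\<lambda>x. v * ((- real n) * inverse x ^ (n + 1)))" for v
      by (intro Ck_on_bounded_linear_comp[OF open_greaterThan bounded_linear_mult_right] Suc.IH)
  qed
qed

text \<open>The quotient \<open>f t / (f t + f (1 - t))\<close> with \<open>f = flat_exp 0\<close>.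
  Its denominator is positive since \<open>t\<close> and \<open>1 - t\<close> are never both at most
  0.\<close>

lemma smooth_step_exists:
  obtains \<eta> :: "real \<Rightarrow> real" where "\<forall>k. Ck_on k UNIV \<eta>" "\<forall>t\<le>0. \<eta> t = 0" "\<forall>t\<ge>1. \<eta> t = 1"
    "\<forall>t. \<eta> t \<ge> 0"
proof -
  let ?f = "flat_exp 0"
  define D where "D t = ?f t + ?f (1 + (-1) * t)" for t :: real
  have D: "D t > 0" for t
    unfolding D_def flat_exp_def by (auto intro!: add_pos_pos)
  have "Ck_on k UNIV (\<lambda>t::real. 1 + (-1) * t)" for k
    by (intro Ck_on_add[OF open_UNIV] Ck_on_const[OF open_UNIV] Ck_on_bounded_linear[OF open_UNIV] bounded_linear_mult_right)
  from Ck_on_comp[OF open_UNIV open_UNIV this _ Ck_on_flat_exp]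
  have "Ck_on k UNIV (\<lambda>t. ?f (1 + (-1) * t))" for k by blast
  then have "Ck_on k UNIV D" for k
    unfolding D_def by (rule Ck_on_add[OF open_UNIV Ck_on_flat_exp])
  then have "Ck_on k UNIV (\<lambda>t. inverse (D t) ^ 1)" for k
    by (rule Ck_on_comp[OF open_UNIV open_greaterThan _ _ Ck_on_inverse_power]) (use D in auto)
  then have "Ck_on k UNIV (\<lambda>t. ?f t * inverse (D t))" for k
    using Ck_on_bilinear[OF bounded_bilinear_mult open_UNIV Ck_on_flat_exp, of k "\<lambda>t. inverse (D t) ^ 1" 0] by simp
  moreover have "?f t * inverse (D t) = 0" if "t \<le> 0" for t using that by (simp add: flat_exp_def)
  moreover have "?f t * inverse (D t) = 1" if "t \<ge> 1" for t using that by (simp add: flat_exp_def D_def)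
  moreover have "?f t * inverse (D t) \<ge> 0" for t using D[of t] by (simp add: flat_exp_def)
  ultimately show thesis by (intro that[of "\<lambda>t. ?f t * inverse (D t)"]) auto
qed

lemma bump_exists:
  fixes z0 :: "'a::euclidean_space"
  assumes "r > 0"
  obtains b :: "'a \<Rightarrow> real" where "\<forall>k. Ck_on k UNIV b" "\<forall>z\<in>ball z0 r. b z = 1"
    "\<forall>z. z \<notin> cball z0 (2 * r) \<longrightarrow> b z = 0" "\<forall>z. b z \<ge> 0"
proof -
  obtain \<eta> :: "real \<Rightarrow> real" where \<eta>': "\<forall>k. Ck_on k UNIV \<eta>" "\<forall>t\<le>0. \<eta> t = 0" "\<forall>t\<ge>1. \<eta> t = 1"
    "\<forall>t. \<eta> t \<ge> 0" by (rule smooth_step_exists)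
  note \<eta> = \<eta>'[rule_format]
  \<comment> \<open>Equal to \<open>2 - (dist z0 z / r)^2\<close>: at least 1 on the ball of radius
    \<open>r\<close> and negative from radius \<open>2 * r\<close> on, which fits the thresholds 1
    and 0 of the step. The squared distance is smooth also at \<open>z0\<close>.\<close>
  define Q where "Q z = 2 + (- inverse (r\<^sup>2)) * ((z + (- z0)) \<bullet> (z + (- z0)))" for z
  have "Ck_on k UNIV (\<lambda>z. z + (- z0))" for k
    by (intro Ck_on_add[OF open_UNIV] Ck_on_const[OF open_UNIV] Ck_on_bounded_linear[OF open_UNIV] bounded_linear_ident)
  note sq = Ck_on_bilinear[OF bounded_bilinear_inner open_UNIV this this]
  have "Ck_on k UNIV Q" for k
    unfolding Q_def by (intro Ck_on_add[OF open_UNIV Ck_on_const[OF open_UNIV]]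
      Ck_on_bounded_linear_comp[OF open_UNIV bounded_linear_mult_right] sq)
  then have 1: "Ck_on k UNIV (\<lambda>z. \<eta> (Q z))" for k
    by (rule Ck_on_comp[OF open_UNIV open_UNIV _ _ \<eta>(1)]) auto
  have Q: "Q z = 2 - (dist z0 z / r)\<^sup>2" for z
    unfolding Q_def by (simp add: dist_norm norm_minus_commute power_divide power2_norm_eq_inner[symmetric] divide_inverse power_mult_distrib power_inverse)
  have 2: "\<eta> (Q z) = 1" if "z \<in> ball z0 r" for z
  proof (rule \<eta>(3))
    have "(dist z0 z / r)\<^sup>2 \<le> 1" using that assms by (intro power_le_one) auto
    then show "1 \<le> Q z" unfolding Q by simp
  qed
  have 3: "\<eta> (Q z) = 0" if "z \<notin> cball z0 (2 * r)" for z
  proof (rule \<eta>(2))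
    have "2 \<le> dist z0 z / r" using that assms by (simp add: field_simps)
    then have "2\<^sup>2 \<le> (dist z0 z / r)\<^sup>2" by (intro power_mono) auto
    then show "Q z \<le> 0" unfolding Q by simp
  qed
  show thesis by (rule that[of "\<lambda>z. \<eta> (Q z)"]) (use 1 2 3 \<eta>(4) in auto)
qed

section \<open>Charts and tangent vectors\<close>

lemma smooth_on_local_rel:
  assumes "S \<subseteq> E" "\<And>x. x \<in> S \<Longrightarrow> \<exists>T. openin (top_of_set E) T \<and> x \<in> T \<and> smooth_on (S \<inter> T) f"
  shows "smooth_on S f"
proof (rule smooth_on_local)
  fix x assume "x \<in> S"
  then obtain T where T: "openin (top_of_set E) T" "x \<in> T" "smooth_on (S \<inter> T) f"
    using assms(2) by blast
  obtain U where U: "open U" "T = E \<inter> U" using T(1) openin_open by blast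
  have "S \<inter> T = S \<inter> U" using U assms(1) by auto
  then show "\<exists>U. open U \<and> x \<in> U \<and> smooth_on (S \<inter> U) f" using U T by auto
qed

lemma chart_inv_left: "inj_on (snd c) (fst c) \<Longrightarrow> x \<in> fst c \<Longrightarrow> chart_inv c (snd c x) = x"
  by (simp add: chart_inv_def)

lemma chart_inv_right: "z \<in> snd c ` A \<Longrightarrow> A \<subseteq> fst c \<Longrightarrow> snd c (chart_inv c z) = z"
  unfolding chart_inv_def by (rule f_inv_into_f) auto

lemma is_chartD:
  assumes "is_chart M c"
  shows is_chart_open: "openin (points M) (fst c)"
    and is_chart_image: "openin (top_of_set (model M)) (snd c ` fst c)"
    and is_chart_inj: "inj_on (snd c) (fst c)"
    and is_chart_cont: "continuous_map (subtopology (points M) (fst c)) euclidean (snd c)"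
    and is_chart_inv_cont: "continuous_map (top_of_set (snd c ` fst c)) (points M) (chart_inv c)"
proof -
  show 1: "openin (points M) (fst c)" "openin (top_of_set (model M)) (snd c ` fst c)"
    using assms by (auto simp: is_chart_def)
  have top: "topspace (subtopology (points M) (fst c)) = fst c"
    using openin_subset[OF 1(1)] by (simp add: topspace_subtopology Int_absorb1)
  have h: "homeomorphic_map (subtopology (points M) (fst c)) (top_of_set (snd c ` fst c)) (snd c)"
    using assms by (simp add: is_chart_def)
  show inj: "inj_on (snd c) (fst c)" using homeomorphic_imp_injective_map[OF h] top by simp
  show "continuous_map (subtopology (points M) (fst c)) euclidean (snd c)"
    using homeomorphic_imp_continuous_map[OF h] continuous_map_in_subtopology by blast
  obtain g where g: "homeomorphic_maps (subtopology (points M) (fst c)) (top_of_set (snd c ` fst c)) (snd c) g"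
    using h homeomorphic_map_maps by blast
  have eq: "g y = chart_inv c y" if "y \<in> topspace (top_of_set (snd c ` fst c))" for y
    using that g inj top by (auto simp: homeomorphic_maps_def chart_inv_left)
  have "continuous_map (top_of_set (snd c ` fst c)) (points M) g"
    using g by (auto simp: homeomorphic_maps_def continuous_map_in_subtopology)
  then show "continuous_map (top_of_set (snd c ` fst c)) (points M) (chart_inv c)"
    by (rule continuous_map_eq[OF _ eq])
qed

lemma is_chart_open_image:
  assumes "is_chart M c" "openin (points M) A"
  shows "openin (top_of_set (model M)) (snd c ` (fst c \<inter> A))"
proof -
  have "snd c ` (fst c \<inter> A) = {z \<in> topspace (top_of_set (snd c ` fst c)). chart_inv c z \<in> A}"
    using is_chart_inj[OF assms(1)] by (auto simp: chart_inv_left)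
  moreover have "openin (top_of_set (snd c ` fst c)) \<dots>"
    by (rule openin_continuous_map_preimage[OF is_chart_inv_cont[OF assms(1)] assms(2)])
  ultimately show ?thesis
    using openin_trans[OF _ is_chart_image[OF assms(1)]] by simp
qed

lemma is_chart_open_preimage:
  assumes "is_chart M c" "openin (top_of_set (model M)) T"
  shows "openin (points M) {x \<in> fst c. snd c x \<in> T}"
proof -
  obtain U where U: "open U" "T = model M \<inter> U" using assms(2) openin_open by blast
  have top: "topspace (subtopology (points M) (fst c)) = fst c"
    using openin_subset[OF is_chart_open[OF assms(1)]] by (simp add: topspace_subtopology Int_absorb1)
  have "snd c ` fst c \<subseteq> model M" using openin_imp_subset[OF is_chart_image[OF assms(1)]] .
  then have "{x \<in> fst c. snd c x \<in> T} = {x \<in> topspace (subtopology (points M) (fst c)). snd c x \<in> U}"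
    using U top by auto
  moreover have "openin (subtopology (points M) (fst c)) \<dots>"
    by (rule openin_continuous_map_preimage[OF is_chart_cont[OF assms(1)]]) (use U in simp)
  ultimately show ?thesis
    using openin_trans_full[OF _ is_chart_open[OF assms(1)]] by simp
qed

locale smooth_mfd =
  fixes M :: "('a, 'e::euclidean_space) manifold"
  assumes smooth_mfd: "smooth_manifold M"
begin

abbreviation "E \<equiv> model M"
abbreviation "X \<equiv> topspace (points M)"

lemma subspace_E: "subspace E"
  using smooth_mfd by (simp add: smooth_manifold_def)

lemma zero_E: "0 \<in> E" by (rule subspace_0[OF subspace_E])

lemma atlas_charts: "c \<in> atlas M \<Longrightarrow> c \<in> charts M"
  using smooth_mfd by (simp add: smooth_manifold_def charts_def)

lemma chart: "c \<in> charts M \<Longrightarrow> is_chart M c"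
  by (simp add: charts_def)

lemma charts_at_chart: "c \<in> charts_at M m \<Longrightarrow> c \<in> charts M" "c \<in> charts_at M m \<Longrightarrow> m \<in> fst c"
  by (auto simp: charts_at_def)

lemma charts_atI: "c \<in> charts M \<Longrightarrow> m \<in> fst c \<Longrightarrow> c \<in> charts_at M m"
  by (auto simp: charts_at_def)

lemmas c_open = is_chart_open[OF chart]
lemmas c_image = is_chart_image[OF chart]
lemmas c_inj = is_chart_inj[OF chart]
lemmas c_left = chart_inv_left[OF c_inj]
lemmas c_inv_cont = is_chart_inv_cont[OF chart]
lemmas c_cont = is_chart_cont[OF chart]
lemmas c_open_image = is_chart_open_image[OF chart]
lemmas c_open_preimage = is_chart_open_preimage[OF chart]

lemma c_subset: "c \<in> charts M \<Longrightarrow> fst c \<subseteq> X"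
  by (rule openin_subset[OF c_open])

lemma c_model: "c \<in> charts M \<Longrightarrow> x \<in> fst c \<Longrightarrow> snd c x \<in> E"
  using openin_imp_subset[OF c_image] by blast

lemma c_inv_mem:
  assumes "c \<in> charts M" "z \<in> snd c ` A" "A \<subseteq> fst c"
  shows "chart_inv c z \<in> A"
  using c_left[OF assms(1)] assms(2,3) by auto

lemma atlas_at: "m \<in> X \<Longrightarrow> \<exists>c\<in>atlas M. m \<in> fst c"
  using smooth_mfd by (auto simp: smooth_manifold_def)

lemma ex_chart_at: "m \<in> X \<Longrightarrow> \<exists>c. c \<in> charts_at M m"
  unfolding charts_at_def using atlas_at[of m] atlas_charts by blast

lemma smooth_rep_change:
  assumes c: "c \<in> charts M" and d: "d \<in> charts M" and cd: "smooth_on (snd d ` (fst c \<inter> fst d)) (\<lambda>z. snd c (chart_inv d z))"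
    and A: "A \<subseteq> fst c" "A \<subseteq> fst d" and f: "smooth_on (snd c ` A) (\<lambda>z. f (chart_inv c z))"
  shows "smooth_on (snd d ` A) (\<lambda>z. f (chart_inv d z))"
proof -
  have sub: "snd d ` A \<subseteq> snd d ` (fst c \<inter> fst d)" using A by auto
  have "smooth_on (snd d ` A) (\<lambda>z. f (chart_inv c (snd c (chart_inv d z))))"
    by (rule smooth_on_comp[OF smooth_on_subset[OF cd sub] f]) (use c_inv_mem[OF d _ A(2)] in auto)
  then show ?thesis
  proof (rule smooth_on_cong)
    fix z assume "z \<in> snd d ` A"
    then have "chart_inv d z \<in> fst c" using c_inv_mem[OF d _ A(2)] A by auto
    then show "f (chart_inv d z) = f (chart_inv c (snd c (chart_inv d z)))" using c_left[OF c] by simp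
  qed
qed

text \<open>Charts of the maximal atlas are by definition compatible with the atlas only. Around
  each point the transition between two of them factors through an atlas chart
  \<open>a\<close>.\<close>

lemma smooth_transition:
  assumes c: "c \<in> charts M" and d: "d \<in> charts M"
  shows "smooth_on (snd c ` (fst c \<inter> fst d)) (\<lambda>z. snd d (chart_inv c z))"
proof (rule smooth_on_local_rel[where E=E])
  show "snd c ` (fst c \<inter> fst d) \<subseteq> E" using c_model[OF c] by auto
  fix z assume "z \<in> snd c ` (fst c \<inter> fst d)"
  then obtain x where x: "x \<in> fst c" "x \<in> fst d" "z = snd c x" by auto
  obtain a where a: "a \<in> atlas M" "x \<in> fst a"
    using atlas_at[OF subsetD[OF c_subset[OF c] x(1)]] by blast
  have ca: "compatible c a" and da: "compatible d a" using c d a by (auto simp: charts_def)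
  let ?A = "fst c \<inter> fst d \<inter> fst a"
  have 1: "smooth_on (snd a ` ?A) (\<lambda>z. snd d (chart_inv a z))"
    using da unfolding compatible_def o_def by (elim conjE smooth_on_subset) auto
  have 2: "smooth_on (snd c ` (fst a \<inter> fst c)) (\<lambda>z. snd a (chart_inv c z))"
    using ca unfolding compatible_def o_def by (simp add: Int_commute)
  have 3: "smooth_on (snd c ` ?A) (\<lambda>z. snd d (chart_inv c z))"
    by (rule smooth_rep_change[OF atlas_charts[OF a(1)] c 2 _ _ 1]) auto
  have "snd c ` (fst c \<inter> fst d) \<inter> snd c ` (fst c \<inter> fst a) = snd c ` ?A"
    using c_inj[OF c] by (auto simp: inj_on_def)
  then show "\<exists>T. openin (top_of_set E) T \<and> z \<in> T \<and> smooth_on (snd c ` (fst c \<inter> fst d) \<inter> T) (\<lambda>z. snd d (chart_inv c z))"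
    using c_open_image[OF c c_open[OF atlas_charts[OF a(1)]]] x a 3 by (intro exI[of _ "snd c ` (fst c \<inter> fst a)"]) auto
qed

lemma smooth_rep:
  assumes "c \<in> charts M" "d \<in> charts M" "A \<subseteq> fst c" "A \<subseteq> fst d" "smooth_on (snd c ` A) (\<lambda>z. f (chart_inv c z))"
  shows "smooth_on (snd d ` A) (\<lambda>z. f (chart_inv d z))"
  using smooth_rep_change[OF assms(1,2) _ assms(3-5)] smooth_transition[OF assms(2,1)]
  by (simp add: Int_commute)

text \<open>A function may be tested near each point in a chart of convenience; transition maps
  carry the result over to \<open>c\<close>.\<close>

lemma smooth_rep_local:
  assumes c: "c \<in> charts M" and A: "A \<subseteq> fst c"
    and loc: "\<And>m. m \<in> A \<Longrightarrow> \<exists>d B. d \<in> charts_at M m \<and> openin (points M) B \<and> m \<in> B \<and> 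
      smooth_on (snd d ` (fst d \<inter> A \<inter> B)) (\<lambda>z. f (chart_inv d z))"
  shows "smooth_on (snd c ` A) (\<lambda>z. f (chart_inv c z))"
proof (rule smooth_on_local_rel[where E=E])
  show "snd c ` A \<subseteq> E" using c_model[OF c] A by auto
  fix z assume "z \<in> snd c ` A"
  then obtain x where x: "x \<in> A" "z = snd c x" by auto
  obtain d B where d: "d \<in> charts_at M x" "openin (points M) B" "x \<in> B"
    "smooth_on (snd d ` (fst d \<inter> A \<inter> B)) (\<lambda>z. f (chart_inv d z))" using loc[OF x(1)] by blast
  have dM: "d \<in> charts M" "x \<in> fst d" using charts_at_chart[OF d(1)] .
  have 3: "smooth_on (snd c ` (fst d \<inter> A \<inter> B)) (\<lambda>z. f (chart_inv c z))"
    by (rule smooth_rep[OF dM(1) c _ _ d(4)]) (use A in auto)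
  have "snd c ` A \<inter> snd c ` (fst c \<inter> (fst d \<inter> B)) = snd c ` (fst d \<inter> A \<inter> B)"
    using c_inj[OF c] A by (auto simp: inj_on_def)
  then show "\<exists>T. openin (top_of_set E) T \<and> z \<in> T \<and> smooth_on (snd c ` A \<inter> T) (\<lambda>z. f (chart_inv c z))"
    using c_open_image[OF c openin_Int[OF c_open[OF dM(1)] d(2)]] x d dM A 3
    by (intro exI[of _ "snd c ` (fst c \<inter> (fst d \<inter> B))"]) auto
qed

lemma chart_inv_restrict:
  assumes "c \<in> charts M" "z \<in> snd c ` (fst c \<inter> A)"
  shows "chart_inv (fst c \<inter> A, snd c) z = chart_inv c z"
proof -
  obtain x where x: "x \<in> fst c \<inter> A" "z = snd c x" using assms(2) by auto
  have "inj_on (snd c) (fst c \<inter> A)" using c_inj[OF assms(1)] inj_on_subset by blast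
  then show ?thesis using x c_left[OF assms(1)] chart_inv_left[of "(fst c \<inter> A, snd c)" x] by simp
qed

text \<open>Composing a chart with a diffeomorphism between relatively open subsets of the model
  space stays inside the maximal atlas. The charts adapted to \<open>\<pi>\<close> and the foliated
  charts of \<open>W\<close> both arise this way.\<close>

lemma chart_change:
  assumes c: "c \<in> charts M" and S: "openin (top_of_set E) S" "S \<subseteq> snd c ` fst c"
    and T: "openin (top_of_set E) T" "\<theta> ` S = T" and g: "\<And>z. z \<in> S \<Longrightarrow> g (\<theta> z) = z"
    and sm: "smooth_on S \<theta>" "smooth_on T g"
  shows "({x \<in> fst c. snd c x \<in> S}, \<lambda>x. \<theta> (snd c x)) \<in> charts M" (is "?d \<in> _")
proof -
  let ?A = "{x \<in> fst c. snd c x \<in> S}"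
  have Aop: "openin (points M) ?A" by (rule c_open_preimage[OF c S(1)])
  have cA: "snd c ` ?A = S" using S(2) by auto
  have dA: "snd ?d ` ?A = T" using T(2) cA by (auto simp: image_image[symmetric])
  have topA: "topspace (subtopology (points M) ?A) = ?A"
    using openin_subset[OF Aop] by (simp add: topspace_subtopology Int_absorb1)
  have ginv: "chart_inv c (g y) \<in> ?A" "snd c (chart_inv c (g y)) = g y" "\<theta> (g y) = y" "g y \<in> S" if "y \<in> T" for y
  proof -
    obtain z where z: "z \<in> S" "y = \<theta> z" using T(2) \<open>y \<in> T\<close> by auto
    then show gS: "g y \<in> S" "\<theta> (g y) = y" using g by auto
    show "snd c (chart_inv c (g y)) = g y" using chart_inv_right[of "g y" c "fst c"] S(2) gS by auto
    then show "chart_inv c (g y) \<in> ?A" using c_inv_mem[OF c, of "g y" "fst c"] gS S(2) by auto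
  qed
  have hm: "homeomorphic_maps (subtopology (points M) ?A) (top_of_set T) (\<lambda>x. \<theta> (snd c x)) (\<lambda>y. chart_inv c (g y))"
    unfolding homeomorphic_maps_def
  proof (intro conjI ballI)
    have 1: "continuous_map (subtopology (points M) ?A) (top_of_set S) (snd c)"
      using continuous_map_from_subtopology_mono[OF c_cont[OF c], of ?A] cA topA
      by (auto simp: continuous_map_in_subtopology)
    have 2: "continuous_map (top_of_set S) (top_of_set T) \<theta>"
      using smooth_on_continuous_on[OF sm(1)] T(2) by auto
    show "continuous_map (subtopology (points M) ?A) (top_of_set T) (\<lambda>x. \<theta> (snd c x))"
      using continuous_map_compose[OF 1 2] by (simp add: o_def)
    have 3: "continuous_map (top_of_set T) (top_of_set (snd c ` fst c)) g"
      using smooth_on_continuous_on[OF sm(2)] ginv(4) S(2) by auto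
    then have "continuous_map (top_of_set T) (points M) (\<lambda>y. chart_inv c (g y))"
      using continuous_map_compose[OF 3 c_inv_cont[OF c]] by (simp add: o_def)
    then show "continuous_map (top_of_set T) (subtopology (points M) ?A) (\<lambda>y. chart_inv c (g y))"
      using ginv(1) by (auto simp: continuous_map_in_subtopology)
    show "chart_inv c (g (\<theta> (snd c x))) = x" if "x \<in> topspace (subtopology (points M) ?A)" for x
      using that topA g c_left[OF c] by auto
    show "\<theta> (snd c (chart_inv c (g y))) = y" if "y \<in> topspace (top_of_set T)" for y
      using that ginv by auto
  qed
  have ch: "is_chart M ?d"
  proof -
    have "homeomorphic_map (subtopology (points M) ?A) (top_of_set T) (\<lambda>x. \<theta> (snd c x))"
      unfolding homeomorphic_map_maps using hm by blast
    moreover have "(\<lambda>x. \<theta> (snd c x)) ` ?A = T" using dA by simp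
    ultimately show ?thesis
      unfolding is_chart_def fst_conv snd_conv using Aop T(1) by simp
  qed
  have inv_eq: "chart_inv ?d y = chart_inv c (g y)" if "y \<in> T" for y
  proof -
    have "y = snd ?d (chart_inv c (g y))" using ginv that by simp
    then show ?thesis using chart_inv_left[OF is_chart_inj[OF ch], of "chart_inv c (g y)"] ginv(1)[OF that] by simp
  qed
  have "compatible ?d a" if a: "a \<in> atlas M" for a
    unfolding compatible_def o_def
  proof
    have aM: "a \<in> charts M" by (rule atlas_charts[OF a])
    let ?B = "fst ?d \<inter> fst a"
    have subT: "snd ?d ` ?B \<subseteq> T" using dA by auto
    have "smooth_on (snd ?d ` ?B) (\<lambda>y. snd a (chart_inv c (g y)))"
    proof (rule smooth_on_comp[OF smooth_on_subset[OF sm(2) subT] smooth_transition[OF c aM]])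
      fix y assume "y \<in> snd ?d ` ?B"
      then show "g y \<in> snd c ` (fst c \<inter> fst a)" using g by auto
    qed
    then show "smooth_on (snd ?d ` ?B) (\<lambda>y. snd a (chart_inv ?d y))"
      by (rule smooth_on_cong) (use inv_eq subT in auto)
    have sub: "snd a ` ?B \<subseteq> snd a ` (fst a \<inter> fst c)" by auto
    have "smooth_on (snd a ` ?B) (\<lambda>z. \<theta> (snd c (chart_inv a z)))"
    proof (rule smooth_on_comp[OF smooth_on_subset[OF smooth_transition[OF aM c] sub] sm(1)])
      fix y assume "y \<in> snd a ` ?B"
      then show "snd c (chart_inv a y) \<in> S" using c_left[OF aM] by auto
    qed
    then show "smooth_on (snd a ` ?B) (\<lambda>z. snd ?d (chart_inv a z))" by simp
  qed
  then show ?thesis using ch by (simp add: charts_def)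
qed

section \<open>Tangent vectors in coordinates\<close>

lemma rep_domain:
  assumes "c \<in> charts_at M m" "openin (points M) A" "m \<in> A"
  shows "openin (top_of_set E) (snd c ` (fst c \<inter> A))" "snd c m \<in> snd c ` (fst c \<inter> A)"
  using c_open_image[OF charts_at_chart(1)[OF assms(1)] assms(2)] charts_at_chart(2)[OF assms(1)] assms(3) by blast+

lemma trans_mem:
  assumes "c \<in> charts_at M m" "d \<in> charts_at M m" "x \<in> E"
  shows "dir_deriv (\<lambda>z. snd d (chart_inv c z)) (snd c m) x \<in> E"
proof (rule dir_deriv_mem[OF subspace_E _ _ assms(3) _ subspace_E])
  note c = charts_at_chart[OF assms(1)] and d = charts_at_chart[OF assms(2)]
  let ?S = "snd c ` (fst c \<inter> fst d)"
  show "openin (top_of_set E) ?S" "snd c m \<in> ?S"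
    using rep_domain[OF assms(1) c_open[OF d(1)] d(2)] .
  show "smooth_on ?S (\<lambda>z. snd d (chart_inv c z))" by (rule smooth_transition[OF c(1) d(1)])
  fix y assume "y \<in> ?S"
  then show "snd d (chart_inv c y) \<in> E"
    using c_model[OF d(1)] c_left[OF c(1)] by auto
qed

lemma trans_id:
  assumes "c \<in> charts_at M m" "x \<in> E"
  shows "dir_deriv (\<lambda>z. snd c (chart_inv c z)) (snd c m) x = x"
proof -
  note c = charts_at_chart[OF assms(1)]
  let ?S = "snd c ` (fst c \<inter> fst c)"
  have "dir_deriv (\<lambda>z. snd c (chart_inv c z)) (snd c m) x = dir_deriv (\<lambda>z. z) (snd c m) x"
    by (rule dir_deriv_cong[OF subspace_E rep_domain[OF assms(1) c_open[OF c(1)] c(2)] assms(2)])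
      (use c_left[OF c(1)] in auto)
  then show ?thesis by (simp only: dir_deriv_bounded_linear[OF bounded_linear_ident])
qed

lemma trans_comp:
  assumes "c \<in> charts_at M m" "d \<in> charts_at M m" "x \<in> E" "openin (points M) A" "m \<in> A"
    and f: "smooth_on (snd d ` (fst d \<inter> A)) (\<lambda>z. f (chart_inv d z))"
  shows "dir_deriv (\<lambda>z. f (chart_inv c z)) (snd c m) x
    = dir_deriv (\<lambda>z. f (chart_inv d z)) (snd d m) (dir_deriv (\<lambda>z. snd d (chart_inv c z)) (snd c m) x)"
proof -
  note c = charts_at_chart[OF assms(1)] and d = charts_at_chart[OF assms(2)]
  let ?S = "snd c ` (fst c \<inter> (fst d \<inter> A))" and ?T = "snd d ` (fst d \<inter> A)"
  have S: "openin (top_of_set E) ?S" "snd c m \<in> ?S"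
    using rep_domain[OF assms(1) openin_Int[OF c_open[OF d(1)] assms(4)]] d(2) assms(5) by blast+
  have T: "openin (top_of_set E) ?T" using rep_domain[OF assms(2,4,5)] by blast
  have "smooth_on ?S (\<lambda>z. snd d (chart_inv c z))"
    by (rule smooth_on_subset[OF smooth_transition[OF c(1) d(1)]]) auto
  moreover have "snd d (chart_inv c y) \<in> ?T" if "y \<in> ?S" for y using that c_left[OF c(1)] by auto
  ultimately have "dir_deriv (\<lambda>z. f (chart_inv d (snd d (chart_inv c z)))) (snd c m) x
    = dir_deriv (\<lambda>z. f (chart_inv d z)) (snd d (chart_inv c (snd c m))) (dir_deriv (\<lambda>z. snd d (chart_inv c z)) (snd c m) x)"
    by (intro dir_deriv_comp[OF subspace_E S assms(3) _ subspace_E T f _ trans_mem[OF assms(1-3)]])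
  moreover have "dir_deriv (\<lambda>z. f (chart_inv c z)) (snd c m) x = dir_deriv (\<lambda>z. f (chart_inv d (snd d (chart_inv c z)))) (snd c m) x"
    by (rule dir_deriv_cong[OF subspace_E S assms(3)]) (use c_left[OF c(1)] c_left[OF d(1)] in auto)
  ultimately show ?thesis unfolding c_left[OF c] by (rule trans[rotated])
qed

lemma trans_trans:
  assumes "c \<in> charts_at M m" "d \<in> charts_at M m" "e \<in> charts_at M m" "x \<in> E"
  shows "dir_deriv (\<lambda>z. snd e (chart_inv c z)) (snd c m) x
    = dir_deriv (\<lambda>z. snd e (chart_inv d z)) (snd d m) (dir_deriv (\<lambda>z. snd d (chart_inv c z)) (snd c m) x)"
  by (rule trans_comp[where f="snd e", OF assms(1,2,4) c_open[OF charts_at_chart(1)[OF assms(3)]] charts_at_chart(2)[OF assms(3)]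
      smooth_transition[OF charts_at_chart(1)[OF assms(2)] charts_at_chart(1)[OF assms(3)]]])

text \<open>The tangent vector at \<open>m\<close> with coordinate vector \<open>x\<close> in the
  chart \<open>c\<close>, so a right inverse to evaluation at \<open>c\<close>; it lets a single
  chart decide equality of tangent vectors.\<close>

definition vec :: "'a \<Rightarrow> ('a, 'e) chart \<Rightarrow> 'e \<Rightarrow> ('a, 'e) tvec" where
  "vec m c x = (\<lambda>d. if d \<in> charts_at M m then dir_deriv (\<lambda>z. snd d (chart_inv c z)) (snd c m) x else 0)"

lemma tangentD:
  assumes "v \<in> tangent_space M m"
  shows tangent_mem: "c \<in> charts_at M m \<Longrightarrow> v c \<in> E"
    and tangent_trans: "c \<in> charts_at M m \<Longrightarrow> d \<in> charts_at M m \<Longrightarrow> v d = dir_deriv (\<lambda>z. snd d (chart_inv c z)) (snd c m) (v c)"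
    and tangent_zero: "c \<notin> charts_at M m \<Longrightarrow> v c = 0"
  using assms unfolding tangent_space_def o_def by blast+

lemma tangent_vec:
  assumes "v \<in> tangent_space M m" "c \<in> charts_at M m"
  shows "v = vec m c (v c)"
proof (rule ext)
  fix d show "v d = vec m c (v c) d"
    using tangent_trans[OF assms(1,2), of d] tangent_zero[OF assms(1), of d] by (simp only: vec_def split: if_split) blast
qed

lemma tangent_eqI:
  assumes "u \<in> tangent_space M m" "v \<in> tangent_space M m" "c \<in> charts_at M m" "u c = v c"
  shows "u = v"
  by (subst tangent_vec[OF assms(1,3)], subst tangent_vec[OF assms(2,3)], subst assms(4)) (rule refl)

lemma vec_tangent:
  assumes "c \<in> charts_at M m" "x \<in> E"
  shows "vec m c x \<in> tangent_space M m" "vec m c x c = x"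
proof -
  show "vec m c x \<in> tangent_space M m"
    unfolding tangent_space_def o_def
  proof (intro CollectI conjI ballI allI impI)
    show "vec m c x d \<in> E" if "d \<in> charts_at M m" for d
      unfolding vec_def using that trans_mem[OF assms(1) that assms(2)] by simp
    show "vec m c x e = dir_deriv (\<lambda>z. snd e (chart_inv d z)) (snd d m) (vec m c x d)"
      if "d \<in> charts_at M m" "e \<in> charts_at M m" for d e
      unfolding vec_def using trans_trans[OF assms(1) that assms(2)] that by (simp only: if_True)
    show "vec m c x d = 0" if "d \<notin> charts_at M m" for d using that by (simp add: vec_def)
  qed
  show "vec m c x c = x" unfolding vec_def using trans_id[OF assms] assms(1) by simp
qed

lemma vec_lincomb:
  assumes "c \<in> charts_at M m" "x \<in> E" "y \<in> E"
  shows "vec m c (a *\<^sub>R x + b *\<^sub>R y) = lincomb a (vec m c x) b (vec m c y)"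
proof (rule ext)
  fix d show "vec m c (a *\<^sub>R x + b *\<^sub>R y) d = lincomb a (vec m c x) b (vec m c y) d"
  proof (cases "d \<in> charts_at M m")
    case True
    note cc = charts_at_chart[OF assms(1)] and dd = charts_at_chart[OF True]
    show ?thesis
      using dir_deriv_linear[OF subspace_E rep_domain[OF assms(1) c_open[OF dd(1)] dd(2)] smooth_transition[OF cc(1) dd(1)] assms(2,3)] True
      by (simp add: vec_def lincomb_def)
  qed (simp add: vec_def lincomb_def)
qed

lemma lincomb_tangent:
  assumes "u \<in> tangent_space M m" "v \<in> tangent_space M m" "m \<in> X"
  shows "lincomb a u b v \<in> tangent_space M m"
proof -
  obtain c where c: "c \<in> charts_at M m" using ex_chart_at[OF assms(3)] by blast
  have "lincomb a u b v = vec m c (a *\<^sub>R u c + b *\<^sub>R v c)"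
    using vec_lincomb[OF c tangent_mem[OF assms(1) c] tangent_mem[OF assms(2) c]]
      tangent_vec[OF assms(1) c, symmetric] tangent_vec[OF assms(2) c, symmetric] by simp
  then show ?thesis
    using vec_tangent(1)[OF c subspace_add[OF subspace_E subspace_scale[OF subspace_E tangent_mem[OF assms(1) c]]
      subspace_scale[OF subspace_E tangent_mem[OF assms(2) c]]]] by simp
qed

lemma zero_tangent: "m \<in> X \<Longrightarrow> (\<lambda>c. 0) \<in> tangent_space M m"
proof -
  assume m: "m \<in> X"
  then obtain c where c: "c \<in> charts_at M m" using ex_chart_at by blast
  have "lincomb 0 (vec m c 0) 0 (vec m c 0) \<in> tangent_space M m"
    by (rule lincomb_tangent[OF vec_tangent(1)[OF c zero_E] vec_tangent(1)[OF c zero_E] m])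
  then show ?thesis by (simp add: lincomb_def)
qed

lemma rep_deriv_indep:
  assumes "c \<in> charts_at M m" "d \<in> charts_at M m" "v \<in> tangent_space M m" "openin (points M) A" "m \<in> A"
    and "smooth_on (snd d ` (fst d \<inter> A)) (\<lambda>z. f (chart_inv d z))"
  shows "dir_deriv (\<lambda>z. f (chart_inv c z)) (snd c m) (v c) = dir_deriv (\<lambda>z. f (chart_inv d z)) (snd d m) (v d)"
  using trans_comp[OF assms(1,2) tangent_mem[OF assms(3,1)] assms(4-6)] tangent_trans[OF assms(3,1,2)] by simp

text \<open>The chart picked by \<open>SOME\<close> inside \<open>differential\<close> can be
  replaced by any chart around \<open>m\<close>: the transformation law of \<open>v\<close> and the
  chain rule compensate each other.\<close>

lemma differential_rep:
  assumes "v \<in> tangent_space M m" "c \<in> charts_at M m" "openin (points M) A" "m \<in> A"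
    and "d \<in> charts_at N (h m)"
    and "smooth_on (snd c ` (fst c \<inter> A)) (\<lambda>z. snd d (h (chart_inv c z)))"
  shows "differential M N h m v d = dir_deriv (\<lambda>z. snd d (h (chart_inv c z))) (snd c m) (v c)"
proof -
  define c0 where "c0 = (SOME c. c \<in> atlas M \<and> m \<in> fst c)"
  have "m \<in> X" using c_subset[OF charts_at_chart(1)[OF assms(2)]] charts_at_chart(2)[OF assms(2)] by blast
  then have "\<exists>c. c \<in> atlas M \<and> m \<in> fst c" using atlas_at by blast
  then have "c0 \<in> atlas M \<and> m \<in> fst c0" unfolding c0_def by (rule someI_ex)
  then have "c0 \<in> charts_at M m" using charts_atI[OF atlas_charts] by blast
  from rep_deriv_indep[where f="\<lambda>x. snd d (h x)", OF this assms(2,1,3,4,6)]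
  show ?thesis using assms(5) by (simp add: differential_def Let_def c0_def[symmetric] o_def)
qed

section \<open>Smooth functions and vector fields in charts\<close>

lemma smooth_fun_rep:
  assumes "smooth_fun M U f" "openin (points M) U" "c \<in> charts M"
  shows "smooth_on (snd c ` (fst c \<inter> U)) (\<lambda>z. f (chart_inv c z))"
proof (rule smooth_rep_local[OF assms(3)])
  fix m assume m: "m \<in> fst c \<inter> U"
  then have "m \<in> X" using c_subset[OF assms(3)] by auto
  then obtain a where a: "a \<in> atlas M" "m \<in> fst a" using atlas_at by blast
  note aM = atlas_charts[OF a(1)]
  have "smooth_on (snd a ` (fst a \<inter> U)) ((\<lambda>x. x) \<circ> f \<circ> chart_inv (fst a \<inter> U, snd a))"
    using assms(1) a(1) unfolding smooth_map_def open_submanifold_def euclidean_manifold_def by simp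
  then have "smooth_on (snd a ` (fst a \<inter> U)) (\<lambda>z. f (chart_inv a z))"
    by (rule smooth_on_cong) (simp add: chart_inv_restrict[OF aM])
  then show "\<exists>d B. d \<in> charts_at M m \<and> openin (points M) B \<and> m \<in> B \<and>
      smooth_on (snd d ` (fst d \<inter> (fst c \<inter> U) \<inter> B)) (\<lambda>z. f (chart_inv d z))"
    using charts_atI[OF aM a(2)] openin_topspace \<open>m \<in> X\<close>
    by (intro exI[of _ a] exI[of _ X]) (auto elim: smooth_on_subset)
qed auto

text \<open>\<open>smooth_map\<close> also demands continuity, which is recovered from the
  coordinate expressions through the chart homeomorphisms.\<close>

lemma smooth_funI:
  assumes U: "openin (points M) U"
    and loc: "\<And>m. m \<in> U \<Longrightarrow> \<exists>d B. d \<in> charts_at M m \<and> openin (points M) B \<and> m \<in> B \<and>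
      smooth_on (snd d ` (fst d \<inter> U \<inter> B)) (\<lambda>z. f (chart_inv d z))"
  shows "smooth_fun M U f"
proof -
  have rep: "smooth_on (snd c ` (fst c \<inter> U)) (\<lambda>z. f (chart_inv c z))" if c: "c \<in> charts M" for c
  proof (rule smooth_rep_local[OF c])
    fix m assume m: "m \<in> fst c \<inter> U"
    then obtain d B where "d \<in> charts_at M m \<and> openin (points M) B \<and> m \<in> B \<and>
      smooth_on (snd d ` (fst d \<inter> U \<inter> B)) (\<lambda>z. f (chart_inv d z))" using loc by blast
    then show "\<exists>d B. d \<in> charts_at M m \<and> openin (points M) B \<and> m \<in> B \<and>
      smooth_on (snd d ` (fst d \<inter> (fst c \<inter> U) \<inter> B)) (\<lambda>z. f (chart_inv d z))"
      by (intro exI[of _ d] exI[of _ B]) (auto elim: smooth_on_subset)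
  qed auto
  have "continuous_map (subtopology (points M) U) euclidean f"
    unfolding continuous_map_atin
  proof -
    show "\<forall>x\<in>topspace (subtopology (points M) U). limitin euclidean f (f x) (atin (subtopology (points M) U) x)"
    proof
      fix m assume "m \<in> topspace (subtopology (points M) U)"
      then have m: "m \<in> U" "m \<in> X" by (auto simp: topspace_subtopology)
      obtain c where cc: "c \<in> charts_at M m" using ex_chart_at[OF m(2)] by blast
      note c = charts_at_chart[OF cc]
      let ?S = "snd c ` (fst c \<inter> U)"
      have cont: "continuous_on ?S (\<lambda>z. f (chart_inv c z))" by (rule smooth_on_continuous_on[OF rep[OF c(1)]])
      show "limitin euclidean f (f m) (atin (subtopology (points M) U) m)"
        unfolding limitin_def
      proof (intro conjI allI impI)
        fix T assume T: "openin euclidean T \<and> f m \<in> T"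
        have "openin (top_of_set ?S) (?S \<inter> (\<lambda>z. f (chart_inv c z)) -` T)"
          using continuous_openin_preimage_gen[OF cont] T by simp
        then have "openin (top_of_set E) (?S \<inter> (\<lambda>z. f (chart_inv c z)) -` T)"
          using openin_trans rep_domain(1)[OF cc U m(1)] by blast
        then have op: "openin (points M) {x \<in> fst c. snd c x \<in> ?S \<inter> (\<lambda>z. f (chart_inv c z)) -` T}" (is "openin _ ?A")
          by (rule c_open_preimage[OF c(1)])
        have "m \<in> ?A" using c m(1) T c_left[OF c] by auto
        moreover have "f x \<in> T" if "x \<in> ?A" for x
        proof -
          have "x \<in> fst c" "f (chart_inv c (snd c x)) \<in> T" using that by blast+
          then show ?thesis by (simp only: c_left[OF c(1)])
        qed
        moreover have "?A \<subseteq> U" using c_inj[OF c(1)] by (auto simp: inj_on_def)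
        moreover have "openin (subtopology (points M) U) ?A"
          using op \<open>?A \<subseteq> U\<close> by (simp add: openin_open_subtopology[OF U])
        ultimately have "openin (subtopology (points M) U) ?A \<and> m \<in> ?A \<and> (\<forall>x\<in>?A - {m}. f x \<in> T)"
          by (intro conjI ballI) blast+
        then show "\<forall>\<^sub>F x in atin (subtopology (points M) U) m. f x \<in> T"
          unfolding eventually_atin by (intro disjI2 exI)
      qed simp
    qed
  qed
  moreover have "smooth_on (snd c ` (fst c \<inter> U)) ((\<lambda>x. x) \<circ> f \<circ> chart_inv (fst c \<inter> U, snd c))" if "c \<in> atlas M" for c
    by (rule smooth_on_cong[OF rep[OF atlas_charts[OF that]]]) (simp add: chart_inv_restrict[OF atlas_charts[OF that]])
  ultimately show ?thesis
    unfolding smooth_map_def open_submanifold_def euclidean_manifold_def by simp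
qed

lemma deriv_along_rep:
  assumes "v \<in> tangent_space M m" "c \<in> charts_at M m" "openin (points M) A" "m \<in> A"
    and "smooth_on (snd c ` (fst c \<inter> A)) (\<lambda>z. f (chart_inv c z))"
  shows "deriv_along M m v f = dir_deriv (\<lambda>z. f (chart_inv c z)) (snd c m) (v c)"
proof -
  have at: "(UNIV, \<lambda>x. x) \<in> charts_at (euclidean_manifold :: (real, real) manifold) (f m)"
  proof -
    have "homeomorphic_map (subtopology euclidean (UNIV :: real set)) (top_of_set (range (\<lambda>x. x))) (\<lambda>x. x)"
      unfolding homeomorphic_map_maps homeomorphic_maps_def by (rule exI[of _ "\<lambda>x. x"]) simp
    then have ch: "is_chart euclidean_manifold (UNIV :: real set, \<lambda>x. x)"
      unfolding is_chart_def by (simp add: euclidean_manifold_def)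
    have "chart_inv (UNIV :: real set, \<lambda>x. x) = (\<lambda>x. x)"
      using chart_inv_left[of "(UNIV :: real set, \<lambda>x. x)"] by auto
    then have "compatible (UNIV :: real set, \<lambda>x. x) (UNIV, \<lambda>x. x)"
      by (simp add: compatible_def o_def smooth_on_id)
    then show ?thesis using ch by (simp add: charts_at_def charts_def, simp add: euclidean_manifold_def)
  qed
  show ?thesis
    unfolding deriv_along_def
    using differential_rep[where h=f, OF assms(1-4) at] assms(5) by simp
qed

text \<open>Coordinates in an arbitrary chart \<open>c\<close> arise from those in a convenient
  chart \<open>d\<close> by the derivative of the transition map, which is smooth jointly in the
  point and the vector.\<close>

lemma vector_fieldI:
  assumes "openin (points M) U" and XT: "\<And>m. m \<in> U \<Longrightarrow> Y m \<in> tangent_space M m"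
    and loc: "\<And>m. m \<in> U \<Longrightarrow> \<exists>d B. d \<in> charts_at M m \<and> openin (points M) B \<and> m \<in> B \<and>
      smooth_on (snd d ` (fst d \<inter> U \<inter> B)) (\<lambda>z. Y (chart_inv d z) d)"
  shows "vector_field_on M U Y"
  unfolding vector_field_on_def
proof (intro conjI ballI XT)
  fix c assume c: "c \<in> charts M"
  show "smooth_on (snd c ` (fst c \<inter> U)) (\<lambda>z. Y (chart_inv c z) c)"
  proof (rule smooth_rep_local[OF c, of _ "\<lambda>x. Y x c"])
    fix m assume m: "m \<in> fst c \<inter> U"
    then obtain d B where d: "d \<in> charts_at M m" "openin (points M) B" "m \<in> B"
      "smooth_on (snd d ` (fst d \<inter> U \<inter> B)) (\<lambda>z. Y (chart_inv d z) d)" using loc by blast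
    note dM = charts_at_chart[OF d(1)]
    let ?A = "fst d \<inter> (fst c \<inter> U) \<inter> B"
    have "smooth_on (snd d ` ?A) (\<lambda>z. dir_deriv (\<lambda>z. snd c (chart_inv d z)) z (Y (chart_inv d z) d))"
    proof (rule smooth_on_dir_deriv[OF subspace_E _ smooth_transition[OF dM(1) c] smooth_on_id smooth_on_subset[OF d(4)]])
      show "openin (top_of_set E) (snd d ` (fst d \<inter> fst c))" by (rule c_open_image[OF dM(1) c_open[OF c]])
      fix z assume "z \<in> snd d ` ?A"
      then obtain x where x: "x \<in> ?A" "z = snd d x" by blast
      then show "Y (chart_inv d z) d \<in> E"
        using c_left[OF dM(1), of x] tangent_mem[OF XT[of x], of d] charts_atI[OF dM(1), of x] by simp
    qed auto
    then have "smooth_on (snd d ` ?A) (\<lambda>z. Y (chart_inv d z) c)"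
    proof (rule smooth_on_cong)
      fix z assume "z \<in> snd d ` ?A"
      then obtain x where x: "x \<in> ?A" "z = snd d x" by blast
      then show "Y (chart_inv d z) c = dir_deriv (\<lambda>z. snd c (chart_inv d z)) z (Y (chart_inv d z) d)"
        using c_left[OF dM(1), of x] tangent_trans[OF XT[of x], of d c] charts_atI[OF dM(1), of x] charts_atI[OF c, of x] by simp
    qed
    then show "\<exists>d B. d \<in> charts_at M m \<and> openin (points M) B \<and> m \<in> B \<and>
      smooth_on (snd d ` (fst d \<inter> (fst c \<inter> U) \<inter> B)) (\<lambda>z. Y (chart_inv d z) c)"
      using d by blast
  qed auto
qed

lemma vector_field_tangent: "vector_field_on M U Y \<Longrightarrow> m \<in> U \<Longrightarrow> Y m \<in> tangent_space M m"
  by (simp add: vector_field_on_def)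

lemma vector_field_rep:
  "vector_field_on M U Y \<Longrightarrow> c \<in> charts M \<Longrightarrow> smooth_on (snd c ` (fst c \<inter> U)) (\<lambda>z. Y (chart_inv c z) c)"
  by (simp add: vector_field_on_def)

lemma vector_field_subset: 
  assumes "vector_field_on M U Y" "V \<subseteq> U"
  shows "vector_field_on M V Y"
  unfolding vector_field_on_def
proof (intro conjI ballI)
  show "Y m \<in> tangent_space M m" if "m \<in> V" for m using vector_field_tangent assms that by blast
  show "smooth_on (snd c ` (fst c \<inter> V)) (\<lambda>z. Y (chart_inv c z) c)" if "c \<in> charts M" for c
    by (rule smooth_on_subset[OF vector_field_rep[OF assms(1) that]]) (use assms(2) in auto)
qed

text \<open>Constant \<open>\<xi>\<close> gives the commuting coordinate fields of the
  chart.\<close>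

lemma coordinate_field:
  assumes c: "c \<in> charts M" and A: "openin (points M) A" "A \<subseteq> fst c"
    and \<xi>: "smooth_on (snd c ` A) \<xi>" "\<And>z. z \<in> snd c ` A \<Longrightarrow> \<xi> z \<in> E"
  shows "vector_field_on M A (\<lambda>m. vec m c (\<xi> (snd c m)))"
proof (rule vector_fieldI[OF A(1)])
  fix m assume m: "m \<in> A"
  have cm: "c \<in> charts_at M x" if "x \<in> A" for x using A(2) that c charts_atI by blast
  show "vec m c (\<xi> (snd c m)) \<in> tangent_space M m"
    using vec_tangent(1)[OF cm[OF m] \<xi>(2)] m by blast
  have "smooth_on (snd c ` A) (\<lambda>z. vec (chart_inv c z) c (\<xi> (snd c (chart_inv c z))) c)"
  proof (rule smooth_on_cong[OF \<xi>(1)])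
    fix z assume "z \<in> snd c ` A"
    then obtain x where x: "x \<in> A" "z = snd c x" by blast
    then show "vec (chart_inv c z) c (\<xi> (snd c (chart_inv c z))) c = \<xi> z"
      using c_left[OF c, of x] A(2) vec_tangent(2)[OF cm \<xi>(2)] by auto
  qed
  moreover have "fst c \<inter> A \<inter> A = A" using A(2) by auto
  ultimately show "\<exists>d B. d \<in> charts_at M m \<and> openin (points M) B \<and> m \<in> B \<and>
      smooth_on (snd d ` (fst d \<inter> A \<inter> B)) (\<lambda>z. vec (chart_inv d z) c (\<xi> (snd c (chart_inv d z))) d)"
    using cm[OF m] A(1) m by (intro exI[of _ c] exI[of _ A]) simp
qed

lemma lie_bracket_rep:
  assumes "c \<in> charts_at M m"
  shows "lie_bracket M Y Z m c = dir_deriv (\<lambda>z. Z (chart_inv c z) c) (snd c m) (Y m c)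
     - dir_deriv (\<lambda>z. Y (chart_inv c z) c) (snd c m) (Z m c)"
  using assms by (simp add: lie_bracket_def)

text \<open>Transforming the derivative of a field to another chart adds a second derivative of the
  transition map. It is symmetric in the two fields, so it drops out of the difference that defines
  the bracket, and the bracket obeys the transformation law.\<close>

lemma lie_bracket_tangent:
  assumes U: "openin (points M) U" "m \<in> U" and Y: "vector_field_on M U Y" and Z: "vector_field_on M U Z"
  shows "lie_bracket M Y Z m \<in> tangent_space M m"
proof -
  \<comment> \<open>One half of the bracket in the chart \<open>d\<close>: the transformed half in
    the chart \<open>c\<close> plus the second-order term.\<close>
  have half: "dir_deriv (\<lambda>z. Z (chart_inv d z) d) (snd d m) (Y m d)
      = dir_deriv (\<lambda>z. dir_deriv (\<lambda>z. snd d (chart_inv c z)) z (Z m c)) (snd c m) (Y m c)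
        + dir_deriv (\<lambda>z. snd d (chart_inv c z)) (snd c m) (dir_deriv (\<lambda>z. Z (chart_inv c z) c) (snd c m) (Y m c))"
    if cc: "c \<in> charts_at M m" and dd: "d \<in> charts_at M m" and Y: "vector_field_on M U Y" and Z: "vector_field_on M U Z" for c d Y Z
  proof -
    note c = charts_at_chart[OF cc] and d = charts_at_chart[OF dd]
    let ?A = "fst d \<inter> U"
    let ?S = "snd c ` (fst c \<inter> ?A)"
    have S: "openin (top_of_set E) ?S" "snd c m \<in> ?S"
      using rep_domain[OF cc openin_Int[OF c_open[OF d(1)] U(1)]] d(2) U(2) by blast+
    have Ym: "Y m c \<in> E" by (rule tangent_mem[OF vector_field_tangent[OF Y U(2)] cc])
    have sm: "smooth_on ?S (\<lambda>z. snd d (chart_inv c z))" "smooth_on ?S (\<lambda>z. Z (chart_inv c z) c)"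
      by (rule smooth_on_subset[OF smooth_transition[OF c(1) d(1)]], auto)
        (rule smooth_on_subset[OF vector_field_rep[OF Z c(1)]], auto)
    have ZE: "Z (chart_inv c z) c \<in> E" if zS: "z \<in> ?S" for z
    proof -
      obtain x where x: "x \<in> fst c" "x \<in> U" "z = snd c x" using zS by blast
      then show ?thesis using tangent_mem[OF vector_field_tangent[OF Z x(2)] charts_atI[OF c(1) x(1)]] c_left[OF c(1)] by simp
    qed
    have "dir_deriv (\<lambda>z. Z (chart_inv d z) d) (snd d m) (Y m d) = dir_deriv (\<lambda>z. Z (chart_inv c z) d) (snd c m) (Y m c)"
      by (rule rep_deriv_indep[where f="\<lambda>x. Z x d", OF cc dd vector_field_tangent[OF Y U(2)] U vector_field_rep[OF Z d(1)], symmetric])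
    also have "\<dots> = dir_deriv (\<lambda>z. dir_deriv (\<lambda>z. snd d (chart_inv c z)) z (Z (chart_inv c z) c)) (snd c m) (Y m c)"
    proof (rule dir_deriv_cong[OF subspace_E S Ym])
      fix z assume "z \<in> ?S"
      then obtain x where x: "x \<in> fst c" "x \<in> U" "x \<in> fst d" "z = snd c x" by blast
      then show "Z (chart_inv c z) d = dir_deriv (\<lambda>z. snd d (chart_inv c z)) z (Z (chart_inv c z) c)"
        using tangent_trans[OF vector_field_tangent[OF Z x(2)] charts_atI[OF c(1) x(1)] charts_atI[OF d(1) x(3)]] c_left[OF c(1)] by simp
    qed
    also have "\<dots> = dir_deriv (\<lambda>z. dir_deriv (\<lambda>z. snd d (chart_inv c z)) z (Z (chart_inv c (snd c m)) c)) (snd c m) (Y m c)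
        + dir_deriv (\<lambda>z. snd d (chart_inv c z)) (snd c m) (dir_deriv (\<lambda>z. Z (chart_inv c z) c) (snd c m) (Y m c))"
      by (rule dir_deriv_along_field[OF subspace_E S sm ZE Ym])
    finally show ?thesis using c_left[OF c] by simp
  qed
  have mem: "dir_deriv (\<lambda>z. Z (chart_inv c z) c) (snd c m) (Y m c) \<in> E"
    if cc: "c \<in> charts_at M m" and Y: "vector_field_on M U Y" and Z: "vector_field_on M U Z" for c Y Z
  proof (rule dir_deriv_mem[OF subspace_E rep_domain[OF cc U] _ vector_field_rep[OF Z charts_at_chart(1)[OF cc]] subspace_E])
    show "Y m c \<in> E" by (rule tangent_mem[OF vector_field_tangent[OF Y U(2)] cc])
    fix z assume "z \<in> snd c ` (fst c \<inter> U)"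
    then obtain x where x: "x \<in> fst c" "x \<in> U" "z = snd c x" by blast
    note c = charts_at_chart[OF cc]
    from x show "Z (chart_inv c z) c \<in> E"
      using tangent_mem[OF vector_field_tangent[OF Z x(2)] charts_atI[OF c(1) x(1)]] c_left[OF c(1)] by simp
  qed
  have trans: "lie_bracket M Y Z m d = dir_deriv (\<lambda>z. snd d (chart_inv c z)) (snd c m) (lie_bracket M Y Z m c)"
    if cc: "c \<in> charts_at M m" and dd: "d \<in> charts_at M m" for c d
  proof -
    note c = charts_at_chart[OF cc] and d = charts_at_chart[OF dd]
    note dom = rep_domain[OF cc c_open[OF d(1)] d(2)]
    let ?D = "dir_deriv (\<lambda>z. snd d (chart_inv c z)) (snd c m)"
    let ?a = "dir_deriv (\<lambda>z. Z (chart_inv c z) c) (snd c m) (Y m c)" and ?b = "dir_deriv (\<lambda>z. Y (chart_inv c z) c) (snd c m) (Z m c)"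
    have "dir_deriv (\<lambda>z. dir_deriv (\<lambda>z. snd d (chart_inv c z)) z (Z m c)) (snd c m) (Y m c)
       = dir_deriv (\<lambda>z. dir_deriv (\<lambda>z. snd d (chart_inv c z)) z (Y m c)) (snd c m) (Z m c)"
      by (rule dir_deriv_symmetric[OF subspace_E dom smooth_transition[OF c(1) d(1)]
        tangent_mem[OF vector_field_tangent[OF Z U(2)] cc] tangent_mem[OF vector_field_tangent[OF Y U(2)] cc]])
    then have "lie_bracket M Y Z m d = ?D ?a - ?D ?b"
      using half[OF cc dd Y Z] half[OF cc dd Z Y] lie_bracket_rep[OF dd] by simp
    also have "\<dots> = ?D (?a - ?b)"
      using dir_deriv_linear[OF subspace_E dom smooth_transition[OF c(1) d(1)] mem[OF cc Y Z] mem[OF cc Z Y], of 1 "-1"] by simp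
    finally show ?thesis using lie_bracket_rep[OF cc] by simp
  qed
  show ?thesis
    unfolding tangent_space_def o_def
  proof (intro CollectI conjI ballI allI impI)
    fix c assume cc: "c \<in> charts_at M m"
    show "lie_bracket M Y Z m c \<in> E"
      unfolding lie_bracket_rep[OF cc] by (rule subspace_diff[OF subspace_E mem[OF cc Y Z] mem[OF cc Z Y]])
  next
    show "lie_bracket M Y Z m d = dir_deriv (\<lambda>z. snd d (chart_inv c z)) (snd c m) (lie_bracket M Y Z m c)"
      if "c \<in> charts_at M m" "d \<in> charts_at M m" for c d by (rule trans[OF that])
    show "lie_bracket M Y Z m c = 0" if "c \<notin> charts_at M m" for c using that by (simp add: lie_bracket_def)
  qed
qed

end

section \<open>Curves and leaf tangent spaces\<close>

locale smooth_mfd_map = M: smooth_mfd M + W: smooth_mfd W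
  for M :: "('a, 'e::euclidean_space) manifold" and W :: "('b, 'f::euclidean_space) manifold" +
  fixes h :: "'a \<Rightarrow> 'b"
  assumes smooth_h: "smooth_map M W h"
begin

lemma h_cont: "continuous_map (points M) (points W) h"
  using smooth_h by (simp add: smooth_map_def)

lemma h_mem: "m \<in> M.X \<Longrightarrow> h m \<in> W.X"
  using h_cont by (auto simp: continuous_map_def)

lemma h_preimage: "openin (points W) B \<Longrightarrow> openin (points M) {m \<in> M.X. h m \<in> B}"
  by (rule openin_continuous_map_preimage[OF h_cont])

lemma h_rep:
  assumes c: "c \<in> charts M" and d: "d \<in> charts W"
  shows "smooth_on (snd c ` (fst c \<inter> {m \<in> M.X. h m \<in> fst d})) (\<lambda>z. snd d (h (chart_inv c z)))"
proof (rule M.smooth_rep_local[where f="\<lambda>x. snd d (h x)", OF c])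
  fix m assume m: "m \<in> fst c \<inter> {m \<in> M.X. h m \<in> fst d}"
  obtain a where a: "a \<in> atlas M" "m \<in> fst a" using M.atlas_at m by blast
  obtain e where e: "e \<in> atlas W" "h m \<in> fst e" using W.atlas_at h_mem m by blast
  note aM = M.atlas_charts[OF a(1)] and eW = W.atlas_charts[OF e(1)]
  let ?B = "{m \<in> M.X. h m \<in> fst e}"
  let ?C = "fst a \<inter> (fst c \<inter> {m \<in> M.X. h m \<in> fst d}) \<inter> ?B"
  have 1: "smooth_on (snd a ` (fst a \<inter> h -` fst e)) (\<lambda>z. snd e (h (chart_inv a z)))"
    using smooth_h a(1) e(1) unfolding smooth_map_def o_def by blast
  have 2: "smooth_on (snd a ` ?C) (\<lambda>z. snd e (h (chart_inv a z)))"
    by (rule smooth_on_subset[OF 1]) auto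
  have "smooth_on (snd a ` ?C) (\<lambda>z. snd d (chart_inv e (snd e (h (chart_inv a z)))))"
  proof (rule smooth_on_comp[OF 2 W.smooth_transition[OF eW d]])
    fix z assume "z \<in> snd a ` ?C"
    then obtain x where "x \<in> ?C" "z = snd a x" by blast
    then show "snd e (h (chart_inv a z)) \<in> snd e ` (fst e \<inter> fst d)" using M.c_left[OF aM, of x] by auto
  qed
  then have "smooth_on (snd a ` ?C) (\<lambda>z. snd d (h (chart_inv a z)))"
  proof (rule smooth_on_cong)
    fix z assume "z \<in> snd a ` ?C"
    then obtain x where "x \<in> ?C" "z = snd a x" by blast
    then show "snd d (h (chart_inv a z)) = snd d (chart_inv e (snd e (h (chart_inv a z))))"
      using M.c_left[OF aM, of x] W.c_left[OF eW, of "h x"] by simp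
  qed
  then show "\<exists>d' B. d' \<in> charts_at M m \<and> openin (points M) B \<and> m \<in> B \<and>
      smooth_on (snd d' ` (fst d' \<inter> (fst c \<inter> {m \<in> M.X. h m \<in> fst d}) \<inter> B)) (\<lambda>z. snd d (h (chart_inv d' z)))"
    using M.charts_atI[OF aM a(2)] h_preimage[OF W.c_open[OF eW]] m e(2) by (intro exI[of _ a] exI[of _ ?B]) simp
qed auto

lemma h_rep_domain:
  assumes c: "c \<in> charts_at M m" and d: "d \<in> charts_at W (h m)"
  shows "openin (top_of_set M.E) (snd c ` (fst c \<inter> {m \<in> M.X. h m \<in> fst d}))"
    "snd c m \<in> snd c ` (fst c \<inter> {m \<in> M.X. h m \<in> fst d})"
proof -
  have "m \<in> {m \<in> M.X. h m \<in> fst d}"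
    using M.charts_at_chart[OF c] M.c_subset W.charts_at_chart[OF d] by blast
  then show "openin (top_of_set M.E) (snd c ` (fst c \<inter> {m \<in> M.X. h m \<in> fst d}))"
    "snd c m \<in> snd c ` (fst c \<inter> {m \<in> M.X. h m \<in> fst d})"
    using M.rep_domain[OF c h_preimage[OF W.c_open[OF W.charts_at_chart(1)[OF d]]]] by blast+
qed

lemma dh_rep:
  assumes v: "v \<in> tangent_space M m" and c: "c \<in> charts_at M m" and d: "d \<in> charts_at W (h m)"
  shows "differential M W h m v d = dir_deriv (\<lambda>z. snd d (h (chart_inv c z))) (snd c m) (v c)"
proof (rule M.differential_rep[OF v c _ _ d h_rep[OF M.charts_at_chart(1)[OF c] W.charts_at_chart(1)[OF d]]])
  show "openin (points M) {m \<in> M.X. h m \<in> fst d}" by (rule h_preimage[OF W.c_open[OF W.charts_at_chart(1)[OF d]]])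
  show "m \<in> {m \<in> M.X. h m \<in> fst d}"
    using M.charts_at_chart[OF c] M.c_subset W.charts_at_chart[OF d] by blast
qed

lemma dh_mem:
  assumes v: "x \<in> M.E" and c: "c \<in> charts_at M m" and d: "d \<in> charts_at W (h m)"
  shows "dir_deriv (\<lambda>z. snd d (h (chart_inv c z))) (snd c m) x \<in> W.E"
proof (rule dir_deriv_mem[OF M.subspace_E h_rep_domain[OF c d] v
    h_rep[OF M.charts_at_chart(1)[OF c] W.charts_at_chart(1)[OF d]] W.subspace_E])
  fix y assume "y \<in> snd c ` (fst c \<inter> {m \<in> M.X. h m \<in> fst d})"
  then obtain x where "x \<in> fst c" "h x \<in> fst d" "y = snd c x" by blast
  then show "snd d (h (chart_inv c y)) \<in> W.E"
    using M.c_left[OF M.charts_at_chart(1)[OF c], of x] W.c_model[OF W.charts_at_chart(1)[OF d], of "h x"] by simp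
qed

lemma dh_tangent:
  assumes v: "v \<in> tangent_space M m" and m: "m \<in> M.X"
  shows "differential M W h m v \<in> tangent_space W (h m)"
proof -
  obtain c where cc: "c \<in> charts_at M m" using M.ex_chart_at[OF m] by blast
  note c = M.charts_at_chart[OF cc]
  have vc: "v c \<in> M.E" by (rule M.tangent_mem[OF v cc])
  show ?thesis
    unfolding tangent_space_def o_def
  proof (intro CollectI conjI ballI allI impI)
    show "differential M W h m v d \<in> W.E" if "d \<in> charts_at W (h m)" for d
      unfolding dh_rep[OF v cc that] by (rule dh_mem[OF vc cc that])
    show "differential M W h m v d = 0" if "d \<notin> charts_at W (h m)" for d
      using that by (simp add: differential_def Let_def)
    fix d e assume dd: "d \<in> charts_at W (h m)" and ee: "e \<in> charts_at W (h m)"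
    note d = W.charts_at_chart[OF dd] and e = W.charts_at_chart[OF ee]
    let ?S = "snd c ` (fst c \<inter> {m \<in> M.X. h m \<in> fst d \<inter> fst e})"
    have S: "openin (top_of_set M.E) ?S" "snd c m \<in> ?S"
      using M.rep_domain[OF cc h_preimage[OF openin_Int[OF W.c_open[OF d(1)] W.c_open[OF e(1)]]]] m d(2) e(2) by blast+
    have 1: "smooth_on ?S (\<lambda>z. snd d (h (chart_inv c z)))"
      by (rule smooth_on_subset[OF h_rep[OF c(1) d(1)]]) auto
    have 2: "snd d (h (chart_inv c y)) \<in> snd d ` (fst d \<inter> fst e)"
      "snd e (chart_inv d (snd d (h (chart_inv c y)))) = snd e (h (chart_inv c y))" if y: "y \<in> ?S" for y
    proof -
      obtain x where "x \<in> fst c" "h x \<in> fst d" "h x \<in> fst e" "y = snd c x" using y by blast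
      then show "snd d (h (chart_inv c y)) \<in> snd d ` (fst d \<inter> fst e)"
        "snd e (chart_inv d (snd d (h (chart_inv c y)))) = snd e (h (chart_inv c y))"
        using M.c_left[OF c(1), of x] W.c_left[OF d(1), of "h x"] by auto
    qed
    have "dir_deriv (\<lambda>z. snd e (h (chart_inv c z))) (snd c m) (v c)
      = dir_deriv (\<lambda>z. snd e (chart_inv d (snd d (h (chart_inv c z))))) (snd c m) (v c)"
      by (rule dir_deriv_cong[OF M.subspace_E S vc 2(2)[symmetric]])
    also have "\<dots> = dir_deriv (\<lambda>z. snd e (chart_inv d z)) (snd d (h (chart_inv c (snd c m))))
        (dir_deriv (\<lambda>z. snd d (h (chart_inv c z))) (snd c m) (v c))"
      by (rule dir_deriv_comp[OF M.subspace_E S vc 1 W.subspace_E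
          W.c_open_image[OF d(1) W.c_open[OF e(1)]] W.smooth_transition[OF d(1) e(1)] 2(1) dh_mem[OF vc cc dd]])
    finally show "differential M W h m v e = dir_deriv (\<lambda>z. snd e (chart_inv d z)) (snd d (h m)) (differential M W h m v d)"
      unfolding dh_rep[OF v cc dd] dh_rep[OF v cc ee] M.c_left[OF c] .
  qed
qed

lemma dh_lincomb:
  assumes u: "u \<in> tangent_space M m" and v: "v \<in> tangent_space M m" and m: "m \<in> M.X"
  shows "differential M W h m (lincomb a u b v) = lincomb a (differential M W h m u) b (differential M W h m v)"
proof -
  obtain c where cc: "c \<in> charts_at M m" using M.ex_chart_at[OF m] by blast
  obtain d where dd: "d \<in> charts_at W (h m)" using W.ex_chart_at[OF h_mem[OF m]] by blast
  show ?thesis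
  proof (rule W.tangent_eqI[OF _ _ dd])
    show "differential M W h m (lincomb a u b v) \<in> tangent_space W (h m)"
      by (rule dh_tangent[OF M.lincomb_tangent[OF u v m] m])
    show "lincomb a (differential M W h m u) b (differential M W h m v) \<in> tangent_space W (h m)"
      by (rule W.lincomb_tangent[OF dh_tangent[OF u m] dh_tangent[OF v m] h_mem[OF m]])
    show "differential M W h m (lincomb a u b v) d = lincomb a (differential M W h m u) b (differential M W h m v) d"
      unfolding lincomb_def dh_rep[OF M.lincomb_tangent[OF u v m, unfolded lincomb_def] cc dd] dh_rep[OF u cc dd] dh_rep[OF v cc dd]
      by (rule dir_deriv_linear[OF M.subspace_E h_rep_domain[OF cc dd] h_rep[OF M.charts_at_chart(1)[OF cc] W.charts_at_chart(1)[OF dd]]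
          M.tangent_mem[OF u cc] M.tangent_mem[OF v cc]])
  qed
qed

end

definition smooth_curve :: "('a, 'e::euclidean_space) manifold \<Rightarrow> real set \<Rightarrow> (real \<Rightarrow> 'a) \<Rightarrow> bool" where
  "smooth_curve M I \<gamma> \<longleftrightarrow> continuous_map (top_of_set I) (points M) \<gamma> \<and>
     (\<forall>c\<in>charts M. smooth_on {t \<in> I. \<gamma> t \<in> fst c} (\<lambda>t. snd c (\<gamma> t)))"

lemma open_curve_preimage:
  assumes "continuous_map (top_of_set I) (points M) \<gamma>" "open I" "openin (points M) U"
  shows "open {t \<in> I. \<gamma> t \<in> U}"
proof -
  have "openin (top_of_set I) {t \<in> topspace (top_of_set I). \<gamma> t \<in> U}"
    by (rule openin_continuous_map_preimage[OF assms(1,3)])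
  then show ?thesis using openin_open_eq[OF assms(2)] by simp
qed

section \<open>Smooth curves, their velocities and foliated charts\<close>

context smooth_mfd
begin

lemma smooth_curveI:
  assumes cont: "continuous_map (top_of_set I) (points M) \<gamma>" and I: "open I"
    and loc: "\<And>t. t \<in> I \<Longrightarrow> \<exists>d. d \<in> charts_at M (\<gamma> t) \<and> smooth_on {t \<in> I. \<gamma> t \<in> fst d} (\<lambda>t. snd d (\<gamma> t))"
  shows "smooth_curve M I \<gamma>"
  unfolding smooth_curve_def
proof (intro conjI cont ballI)
  fix c assume c: "c \<in> charts M"
  show "smooth_on {t \<in> I. \<gamma> t \<in> fst c} (\<lambda>t. snd c (\<gamma> t))"
  proof (rule smooth_on_local)
    fix t assume t: "t \<in> {t \<in> I. \<gamma> t \<in> fst c}"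
    then obtain d where dd: "d \<in> charts_at M (\<gamma> t)" and sm: "smooth_on {t \<in> I. \<gamma> t \<in> fst d} (\<lambda>t. snd d (\<gamma> t))"
      using loc by blast
    note d = charts_at_chart[OF dd]
    let ?S = "{t \<in> I. \<gamma> t \<in> fst c} \<inter> {t \<in> I. \<gamma> t \<in> fst d}"
    have 1: "smooth_on ?S (\<lambda>t. snd d (\<gamma> t))" by (rule smooth_on_subset[OF sm]) auto
    have "smooth_on ?S (\<lambda>t. snd c (chart_inv d (snd d (\<gamma> t))))"
      by (rule smooth_on_comp[OF 1 smooth_transition[OF d(1) c]]) auto
    then have "smooth_on ?S (\<lambda>t. snd c (\<gamma> t))"
      by (rule smooth_on_cong) (simp add: c_left[OF d(1)])
    then show "\<exists>U. open U \<and> t \<in> U \<and> smooth_on ({t \<in> I. \<gamma> t \<in> fst c} \<inter> U) (\<lambda>t. snd c (\<gamma> t))"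
      using open_curve_preimage[OF cont I c_open[OF d(1)]] t d(2)
      by (intro exI[of _ "{t \<in> I. \<gamma> t \<in> fst d}"]) simp
  qed
qed

lemma smooth_curve_chartI:
  assumes c: "c \<in> charts M" and I: "open I" and g: "\<And>t. t \<in> I \<Longrightarrow> g t \<in> snd c ` fst c" and sm: "smooth_on I g"
  shows "smooth_curve M I (\<lambda>t. chart_inv c (g t))"
proof -
  have mem: "chart_inv c (g t) \<in> fst c" if "t \<in> I" for t using c_inv_mem[OF c g[OF that]] by simp
  have eq: "snd c (chart_inv c (g t)) = g t" if "t \<in> I" for t using chart_inv_right[OF g[OF that]] by simp
  show ?thesis
  proof (rule smooth_curveI[OF _ I])
    have "continuous_map (top_of_set I) (top_of_set (snd c ` fst c)) g"
      using smooth_on_continuous_on[OF sm] g by auto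
    then show "continuous_map (top_of_set I) (points M) (\<lambda>t. chart_inv c (g t))"
      using continuous_map_compose[OF _ c_inv_cont[OF c]] unfolding o_def by blast
    fix t assume t: "t \<in> I"
    have "smooth_on {t \<in> I. chart_inv c (g t) \<in> fst c} (\<lambda>t. snd c (chart_inv c (g t)))"
      by (rule smooth_on_cong[OF smooth_on_subset[OF sm]]) (use eq in auto)
    then show "\<exists>d. d \<in> charts_at M (chart_inv c (g t)) \<and>
        smooth_on {t \<in> I. chart_inv c (g t) \<in> fst d} (\<lambda>t. snd d (chart_inv c (g t)))"
      using charts_atI[OF c mem[OF t]] by blast
  qed
qed

lemma smooth_curve_iff:
  assumes I: "open I"
  shows "smooth_map (open_submanifold euclidean_manifold I) M \<gamma> \<longleftrightarrow> smooth_curve M I \<gamma>"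
proof -
  have inv: "chart_inv (I, \<lambda>x. x) t = t" if "t \<in> I" for t
    using chart_inv_left[of "(I, \<lambda>x. x)" t] that by simp
  have "smooth_on (I \<inter> \<gamma> -` fst d) (snd d \<circ> \<gamma> \<circ> chart_inv (I, \<lambda>x. x)) \<longleftrightarrow>
      smooth_on {t \<in> I. \<gamma> t \<in> fst d} (\<lambda>t. snd d (\<gamma> t))" for d :: "('a, 'e) chart"
  proof -
    have eq: "I \<inter> \<gamma> -` fst d = {t \<in> I. \<gamma> t \<in> fst d}" by auto
    show ?thesis
      unfolding eq by (rule iffI; erule smooth_on_cong) (simp_all add: inv)
  qed
  then have "smooth_map (open_submanifold euclidean_manifold I) M \<gamma> \<longleftrightarrow> continuous_map (top_of_set I) (points M) \<gamma> \<and>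
     (\<forall>c\<in>atlas M. smooth_on {t \<in> I. \<gamma> t \<in> fst c} (\<lambda>t. snd c (\<gamma> t)))"
    unfolding smooth_map_def open_submanifold_def euclidean_manifold_def by simp
  moreover have "\<dots> \<longleftrightarrow> smooth_curve M I \<gamma>"
  proof
    assume *: "continuous_map (top_of_set I) (points M) \<gamma> \<and>
     (\<forall>c\<in>atlas M. smooth_on {t \<in> I. \<gamma> t \<in> fst c} (\<lambda>t. snd c (\<gamma> t)))"
    show "smooth_curve M I \<gamma>"
    proof (rule smooth_curveI[OF conjunct1[OF *] I])
      fix t assume "t \<in> I"
      then have "\<gamma> t \<in> X" using conjunct1[OF *] by (auto simp: continuous_map_def)
      then obtain c where "c \<in> atlas M" "\<gamma> t \<in> fst c" using atlas_at by blast
      then show "\<exists>d. d \<in> charts_at M (\<gamma> t) \<and> smooth_on {t \<in> I. \<gamma> t \<in> fst d} (\<lambda>t. snd d (\<gamma> t))"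
        using * charts_atI[OF atlas_charts] by blast
    qed
  next
    assume "smooth_curve M I \<gamma>"
    then show "continuous_map (top_of_set I) (points M) \<gamma> \<and>
     (\<forall>c\<in>atlas M. smooth_on {t \<in> I. \<gamma> t \<in> fst c} (\<lambda>t. snd c (\<gamma> t)))"
      unfolding smooth_curve_def using atlas_charts by blast
  qed
  ultimately show ?thesis by simp
qed

lemma velocity_rep: "c \<in> charts_at M (\<gamma> 0) \<Longrightarrow> velocity M \<gamma> 0 c = dir_deriv (\<lambda>t. snd c (\<gamma> t)) 0 1"
  by (simp add: velocity_def dir_deriv_def o_def)

lemma velocity_domain:
  assumes "smooth_curve M I \<gamma>" "open I" "0 \<in> I" "c \<in> charts_at M (\<gamma> 0)"
  shows "openin (top_of_set UNIV) {t \<in> I. \<gamma> t \<in> fst c}" "0 \<in> {t \<in> I. \<gamma> t \<in> fst c}"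
    "smooth_on {t \<in> I. \<gamma> t \<in> fst c} (\<lambda>t. snd c (\<gamma> t))"
  using assms(1) open_curve_preimage[of I M \<gamma> "fst c", OF _ assms(2) c_open[OF charts_at_chart(1)[OF assms(4)]]]
    assms(3) charts_at_chart[OF assms(4)] unfolding smooth_curve_def by auto

lemma velocity_tangent:
  assumes \<gamma>: "smooth_curve M I \<gamma>" "open I" "0 \<in> I"
  shows "velocity M \<gamma> 0 \<in> tangent_space M (\<gamma> 0)"
proof -
  have mem: "velocity M \<gamma> 0 c \<in> E" if cc: "c \<in> charts_at M (\<gamma> 0)" for c
    unfolding velocity_rep[of c \<gamma>, OF cc]
    by (rule dir_deriv_mem[OF subspace_UNIV velocity_domain(1,2)[OF \<gamma> cc] UNIV_I velocity_domain(3)[OF \<gamma> cc] subspace_E])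
      (use c_model[OF charts_at_chart(1)[OF cc]] in blast)
  show ?thesis
    unfolding tangent_space_def o_def
  proof (intro CollectI conjI ballI allI impI mem)
    show "velocity M \<gamma> 0 d = 0" if "d \<notin> charts_at M (\<gamma> 0)" for d using that by (simp add: velocity_def)
    fix c d assume cc: "c \<in> charts_at M (\<gamma> 0)" and dd: "d \<in> charts_at M (\<gamma> 0)"
    note c = charts_at_chart[OF cc] and d = charts_at_chart[OF dd]
    let ?S = "{t \<in> I. \<gamma> t \<in> fst c} \<inter> {t \<in> I. \<gamma> t \<in> fst d}"
    have S: "openin (top_of_set UNIV) ?S" "0 \<in> ?S"
      using openin_Int[OF velocity_domain(1)[OF \<gamma> cc] velocity_domain(1)[OF \<gamma> dd]] velocity_domain(2)[OF \<gamma> cc] d(2) by auto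
    have sm: "smooth_on ?S (\<lambda>t. snd c (\<gamma> t))" by (rule smooth_on_subset[OF velocity_domain(3)[OF \<gamma> cc]]) auto
    have "dir_deriv (\<lambda>t. snd d (\<gamma> t)) 0 1 = dir_deriv (\<lambda>t. snd d (chart_inv c (snd c (\<gamma> t)))) 0 1"
      by (rule dir_deriv_cong[OF subspace_UNIV S UNIV_I]) (simp add: c_left[OF c(1)])
    also have "\<dots> = dir_deriv (\<lambda>z. snd d (chart_inv c z)) (snd c (\<gamma> 0)) (dir_deriv (\<lambda>t. snd c (\<gamma> t)) 0 1)"
      by (rule dir_deriv_comp[OF subspace_UNIV S UNIV_I sm subspace_E c_open_image[OF c(1) c_open[OF d(1)]] smooth_transition[OF c(1) d(1)]])
        (use mem[OF cc] velocity_rep[of c \<gamma>, OF cc] in auto)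
    finally show "velocity M \<gamma> 0 d = dir_deriv (\<lambda>z. snd d (chart_inv c z)) (snd c (\<gamma> 0)) (velocity M \<gamma> 0 c)"
      unfolding velocity_rep[of c \<gamma>, OF cc] velocity_rep[of d \<gamma>, OF dd] .
  qed
qed

lemma smooth_curve_subset: "smooth_curve M I \<gamma> \<Longrightarrow> J \<subseteq> I \<Longrightarrow> smooth_curve M J \<gamma>"
  unfolding smooth_curve_def
  by (auto intro: continuous_map_from_subtopology_mono elim!: smooth_on_subset)

text \<open>The chart clause of \<open>foliation\<close>, separated from the dimension count. The
  slices by translates of \<open>V\<close> are the plaques.\<close>

definition foliated_chart :: "'a set set \<Rightarrow> ('a, 'e) chart \<Rightarrow> 'e set \<Rightarrow> bool" where
  "foliated_chart F c V \<longleftrightarrow> c \<in> charts M \<and> subspace V \<and> V \<subseteq> E \<and>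
     (\<forall>L\<in>F. \<forall>x\<in>L \<inter> fst c.
           path_component_of_set (subtopology (points M) (L \<inter> fst c)) x = {y \<in> fst c. snd c y - snd c x \<in> V})"

lemma foliated_chart_leaf:
  assumes "foliated_chart F c V" "L \<in> F" "x \<in> L" "x \<in> fst c" "y \<in> fst c" "snd c y - snd c x \<in> V"
  shows "y \<in> L"
proof -
  have "y \<in> path_component_of_set (subtopology (points M) (L \<inter> fst c)) x"
    using assms unfolding foliated_chart_def by blast
  then have "y \<in> topspace (subtopology (points M) (L \<inter> fst c))"
    using path_component_of_subset_topspace by fastforce
  then show ?thesis by simp
qed

text \<open>A leaf may return to the chart domain in many plaques, but these are its path components
  there, so a path connected part of it stays in one.\<close>

lemma foliated_chart_connected:
  assumes "foliated_chart F c V" "L \<in> F" "path_connectedin (points M) S" "S \<subseteq> L \<inter> fst c" "x \<in> S" "y \<in> S"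
  shows "snd c y - snd c x \<in> V"
proof -
  have "path_connectedin (subtopology (points M) (L \<inter> fst c)) S"
    using assms(3,4) by (simp add: path_connectedin_subtopology)
  then have "S \<subseteq> path_component_of_set (subtopology (points M) (L \<inter> fst c)) x"
    using assms(5) by (rule path_component_of_maximal)
  then show ?thesis using assms unfolding foliated_chart_def by blast
qed

lemma curve_segment:
  fixes \<gamma> :: "real \<Rightarrow> 'a"
  assumes "continuous_map (top_of_set I) (points M) \<gamma>" "open I" "0 \<in> I" "openin (points M) U" "\<gamma> 0 \<in> U"
  obtains \<delta> where "\<delta> > 0" "{-\<delta><..<\<delta>} \<subseteq> I" "\<gamma> ` {-\<delta><..<\<delta>} \<subseteq> U"
proof -
  have "open {t \<in> I. \<gamma> t \<in> U}" "0 \<in> {t \<in> I. \<gamma> t \<in> U}"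
    using open_curve_preimage[OF assms(1,2,4)] assms(3,5) by auto
  then obtain \<delta> where "\<delta> > 0" "ball 0 \<delta> \<subseteq> {t \<in> I. \<gamma> t \<in> U}" using openE by blast
  moreover have "ball 0 \<delta> = {-\<delta><..<\<delta>}" by (auto simp: dist_real_def)
  ultimately show thesis by (intro that[of \<delta>]) auto
qed

lemma leaf_tangent_iff:
  "v \<in> leaf_tangent M F m \<longleftrightarrow> (\<exists>\<gamma> \<epsilon> L. v = velocity M \<gamma> 0 \<and> 0 < \<epsilon> \<and> L \<in> F \<and> \<gamma> 0 = m \<and> \<gamma> ` {-\<epsilon><..<\<epsilon>} \<subseteq> L \<and>
     smooth_curve M {-\<epsilon><..<\<epsilon>} \<gamma>)"
  unfolding leaf_tangent_def by (simp add: smooth_curve_iff)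

text \<open>Straight coordinate lines realize every tangent vector as a velocity; their explicit
  coordinates later decide whether they stay in a leaf or in a fibre.\<close>

lemma line_curve:
  assumes cc: "c \<in> charts_at M m" and v: "v \<in> tangent_space M m"
  obtains \<gamma> \<delta> where "0 < \<delta>" "smooth_curve M {-\<delta><..<\<delta>} \<gamma>" "\<gamma> 0 = m" "velocity M \<gamma> 0 = v"
    "\<forall>t\<in>{-\<delta><..<\<delta>}. \<gamma> t \<in> fst c \<and> snd c (\<gamma> t) = snd c m + t *\<^sub>R v c"
proof -
  note c = charts_at_chart[OF cc]
  have vE: "v c \<in> E" by (rule tangent_mem[OF v cc])
  let ?g = "\<lambda>t::real. snd c m + t *\<^sub>R v c"
  have "snd c m \<in> snd c ` fst c" using c(2) by blast
  from eventually_line_in[OF subspace_E c_image[OF c(1)] this vE]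
  obtain A where A: "open A" "0 \<in> A" "\<forall>t\<in>A. ?g t \<in> snd c ` fst c"
    unfolding eventually_nhds by blast
  obtain \<delta> where \<delta>: "\<delta> > 0" "ball 0 \<delta> \<subseteq> A" using A openE by blast
  let ?J = "{-\<delta><..<\<delta>}"
  have "ball 0 \<delta> = ?J" by (auto simp: dist_real_def)
  then have J: "open ?J" "0 \<in> ?J" "\<And>t. t \<in> ?J \<Longrightarrow> ?g t \<in> snd c ` fst c" using \<delta> A(3) by auto
  have lin: "bounded_linear (\<lambda>t::real. t *\<^sub>R v c)" by (rule bounded_linear_scaleR_left)
  have smg: "smooth_on ?J ?g" by (intro smooth_on_add smooth_on_const smooth_on_bounded_linear lin)
  let ?\<gamma> = "\<lambda>t. chart_inv c (?g t)"
  have sm: "smooth_curve M ?J ?\<gamma>" by (rule smooth_curve_chartI[OF c(1) J(1,3) smg])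
  have \<gamma>0: "?\<gamma> 0 = m" using c_left[OF c] by simp
  have cg: "snd c (?\<gamma> t) = ?g t" if "t \<in> ?J" for t using chart_inv_right[OF J(3)[OF that]] by simp
  have gc: "?\<gamma> t \<in> fst c" if "t \<in> ?J" for t using c_inv_mem[OF c(1) J(3)[OF that]] by simp
  have "velocity M ?\<gamma> 0 = v"
  proof (rule tangent_eqI[OF _ v cc])
    show "velocity M ?\<gamma> 0 \<in> tangent_space M m" using velocity_tangent[OF sm J(1,2)] \<gamma>0 by simp
    have "c \<in> charts_at M (?\<gamma> 0)" using cc \<gamma>0 by simp
    then have "velocity M ?\<gamma> 0 c = dir_deriv (\<lambda>t. snd c (?\<gamma> t)) 0 1" by (rule velocity_rep[of c ?\<gamma>])
    also have "\<dots> = dir_deriv ?g 0 1"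
      by (rule dir_deriv_cong[OF subspace_UNIV _ J(2) UNIV_I cg]) (use J in auto)
    also have "\<dots> = v c"
    proof -
      have D: "(?g has_derivative (\<lambda>t. t *\<^sub>R v c)) (at 0 within UNIV)"
        by (auto intro!: derivative_eq_intros)
      show ?thesis using has_derivative_along_line(2)[OF subspace_UNIV _ UNIV_I UNIV_I D, of 1] by simp
    qed
    finally show "velocity M ?\<gamma> 0 c = v c" .
  qed
  then show thesis
    by (intro that[of \<delta> ?\<gamma>]) (use \<delta>(1) sm \<gamma>0 cg gc in auto)
qed

text \<open>A short piece of a curve in a leaf is path connected, so its coordinates move in a
  translate of \<open>V\<close> and its velocity lies in \<open>V\<close>; conversely a coordinate
  line in a direction of \<open>V\<close> stays in the plaque. In particular the velocities form a
  linear subspace, which their definition by curves does not show.\<close>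

lemma leaf_tangent_foliated_chart:
  assumes cc: "c \<in> charts_at M m" and fc: "foliated_chart F c V" and mF: "m \<in> \<Union>F"
  shows "leaf_tangent M F m = {v \<in> tangent_space M m. v c \<in> V}"
proof (intro equalityI subsetI)
  note c = charts_at_chart[OF cc]
  have V: "subspace V" "V \<subseteq> E" using fc by (auto simp: foliated_chart_def)
  fix v assume "v \<in> leaf_tangent M F m"
  then obtain \<gamma> \<epsilon> L where \<gamma>: "v = velocity M \<gamma> 0" "0 < \<epsilon>" "L \<in> F" "\<gamma> 0 = m" "\<gamma> ` {-\<epsilon><..<\<epsilon>} \<subseteq> L"
     "smooth_curve M {-\<epsilon><..<\<epsilon>} \<gamma>"
    unfolding leaf_tangent_iff by blast
  have cont: "continuous_map (top_of_set {-\<epsilon><..<\<epsilon>}) (points M) \<gamma>" using \<gamma>(6) by (simp add: smooth_curve_def)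
  obtain \<delta> where \<delta>: "\<delta> > 0" "{-\<delta><..<\<delta>} \<subseteq> {-\<epsilon><..<\<epsilon>}" "\<gamma> ` {-\<delta><..<\<delta>} \<subseteq> fst c"
    by (rule curve_segment[OF cont _ _ c_open[OF c(1)]]) (use \<gamma> c in auto)
  let ?J = "{-\<delta><..<\<delta>}"
  have J: "open ?J" "0 \<in> ?J" using \<delta> by auto
  have sm: "smooth_curve M ?J \<gamma>" by (rule smooth_curve_subset[OF \<gamma>(6) \<delta>(2)])
  have pc: "path_connectedin (points M) (\<gamma> ` ?J)"
  proof (rule path_connectedin_continuous_map_image)
    show "continuous_map (top_of_set ?J) (points M) \<gamma>" using sm by (simp add: smooth_curve_def)
    show "path_connectedin (top_of_set ?J) ?J"
      by (simp add: path_connectedin_subtopology path_connectedin_euclidean convex_imp_path_connected)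
  qed
  have inV: "snd c (\<gamma> t) - snd c m \<in> V" if "t \<in> ?J" for t
    by (rule foliated_chart_connected[OF fc \<gamma>(3) pc]) (use \<delta> \<gamma> that J in auto)
  have sm1: "smooth_on ?J (\<lambda>t. snd c (\<gamma> t))"
  proof -
    have "{t \<in> ?J. \<gamma> t \<in> fst c} = ?J" using \<delta>(3) by blast
    moreover have "smooth_on {t \<in> ?J. \<gamma> t \<in> fst c} (\<lambda>t. snd c (\<gamma> t))" using sm c(1) unfolding smooth_curve_def by blast
    ultimately show ?thesis by (simp only:)
  qed
  have cc': "c \<in> charts_at M (\<gamma> 0)" using cc \<gamma>(4) by simp
  have "dir_deriv (\<lambda>t. snd c (\<gamma> t) - snd c m) 0 1 \<in> V"
    by (rule dir_deriv_mem[OF subspace_UNIV _ J(2) UNIV_I smooth_on_diff[OF sm1 smooth_on_const] V(1) inV]) (use J in auto)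
  moreover have "dir_deriv (\<lambda>t. snd c (\<gamma> t)) 0 1 = dir_deriv (\<lambda>t. (snd c (\<gamma> t) - snd c m) + snd c m) 0 1" by simp
  moreover have "\<dots> = dir_deriv (\<lambda>t. snd c (\<gamma> t) - snd c m) 0 1"
  proof -
    obtain D where D: "((\<lambda>t. snd c (\<gamma> t) - snd c m) has_derivative D) (at 0 within ?J)"
      by (rule smooth_on_has_derivative[OF smooth_on_diff[OF sm1 smooth_on_const] J(2)])
    have D': "((\<lambda>t. (snd c (\<gamma> t) - snd c m) + snd c m) has_derivative D) (at 0 within ?J)"
      using has_derivative_add[OF D has_derivative_const[of "snd c m"]] by simp
    have o: "openin (top_of_set UNIV) ?J" using J by simp
    show ?thesis
      using has_derivative_along_line(2)[OF subspace_UNIV o J(2) UNIV_I D, of 1]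
        has_derivative_along_line(2)[OF subspace_UNIV o J(2) UNIV_I D', of 1] by simp
  qed
  ultimately have "velocity M \<gamma> 0 c \<in> V" using velocity_rep[of c \<gamma>, OF cc'] by simp
  moreover have "velocity M \<gamma> 0 \<in> tangent_space M m" using velocity_tangent[OF sm J] \<gamma>(4) by simp
  ultimately show "v \<in> {v \<in> tangent_space M m. v c \<in> V}" using \<gamma>(1) by simp
next
  note c = charts_at_chart[OF cc]
  have V: "subspace V" "V \<subseteq> E" using fc by (auto simp: foliated_chart_def)
  fix v assume v: "v \<in> {v \<in> tangent_space M m. v c \<in> V}"
  obtain L where L: "L \<in> F" "m \<in> L" using mF by blast
  obtain \<gamma> \<delta> where \<gamma>: "0 < \<delta>" "smooth_curve M {-\<delta><..<\<delta>} \<gamma>" "\<gamma> 0 = m" "velocity M \<gamma> 0 = v"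
      "\<forall>t\<in>{-\<delta><..<\<delta>}. \<gamma> t \<in> fst c \<and> snd c (\<gamma> t) = snd c m + t *\<^sub>R v c"
    by (rule line_curve[OF cc, of v]) (use v in auto)
  have "\<gamma> ` {-\<delta><..<\<delta>} \<subseteq> L"
  proof
    fix y assume "y \<in> \<gamma> ` {-\<delta><..<\<delta>}"
    then obtain t where t: "t \<in> {-\<delta><..<\<delta>}" "y = \<gamma> t" by blast
    have y: "y \<in> fst c" "snd c y = snd c m + t *\<^sub>R v c" using bspec[OF \<gamma>(5) t(1)] t(2) by simp_all
    have "snd c y - snd c m \<in> V" using y(2) subspace_scale[OF V(1)] v by simp
    then show "y \<in> L" using foliated_chart_leaf[OF fc L c(2)] y(1) by blast
  qed
  then show "v \<in> leaf_tangent M F m"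
    unfolding leaf_tangent_iff using \<gamma>(1-4) L(1)
    by (intro exI[of _ \<gamma>] exI[of _ \<delta>] exI[of _ L]) simp
qed

end

context smooth_mfd_map
begin

lemma h_curve:
  assumes \<gamma>: "smooth_curve M I \<gamma>" "open I"
  shows "smooth_curve W I (\<lambda>t. h (\<gamma> t))"
proof (rule W.smooth_curveI[OF _ assms(2)])
  have cont: "continuous_map (top_of_set I) (points M) \<gamma>" using \<gamma> by (simp add: smooth_curve_def)
  then show "continuous_map (top_of_set I) (points W) (\<lambda>t. h (\<gamma> t))"
    using continuous_map_compose[OF _ h_cont] unfolding o_def by blast
  fix t assume t: "t \<in> I"
  have X: "\<gamma> t \<in> M.X" if "t \<in> I" for t using cont that by (auto simp: continuous_map_def)
  obtain d where dd: "d \<in> charts_at W (h (\<gamma> t))" using W.ex_chart_at[OF h_mem[OF X[OF t]]] by blast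
  note d = W.charts_at_chart[OF dd]
  have "smooth_on {t \<in> I. h (\<gamma> t) \<in> fst d} (\<lambda>t. snd d (h (\<gamma> t)))"
  proof (rule smooth_on_local)
    fix s assume s: "s \<in> {t \<in> I. h (\<gamma> t) \<in> fst d}"
    then obtain c where cc: "c \<in> charts_at M (\<gamma> s)" using M.ex_chart_at X by blast
    note c = M.charts_at_chart[OF cc]
    let ?S = "{t \<in> I. h (\<gamma> t) \<in> fst d} \<inter> {t \<in> I. \<gamma> t \<in> fst c}"
    have 1: "smooth_on ?S (\<lambda>t. snd c (\<gamma> t))"
      using \<gamma>(1) c(1) unfolding smooth_curve_def by (elim conjE ballE[of _ _ c] smooth_on_subset) auto
    have "smooth_on ?S (\<lambda>t. snd d (h (chart_inv c (snd c (\<gamma> t)))))"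
      by (rule smooth_on_comp[OF 1 h_rep[OF c(1) d(1)]]) (use X in auto)
    then have "smooth_on ?S (\<lambda>t. snd d (h (\<gamma> t)))"
      by (rule smooth_on_cong) (simp add: M.c_left[OF c(1)])
    then show "\<exists>U. open U \<and> s \<in> U \<and> smooth_on ({t \<in> I. h (\<gamma> t) \<in> fst d} \<inter> U) (\<lambda>t. snd d (h (\<gamma> t)))"
      using open_curve_preimage[OF cont assms(2) M.c_open[OF c(1)]] s c(2)
      by (intro exI[of _ "{t \<in> I. \<gamma> t \<in> fst c}"]) simp
  qed
  then show "\<exists>d. d \<in> charts_at W (h (\<gamma> t)) \<and> smooth_on {t \<in> I. h (\<gamma> t) \<in> fst d} (\<lambda>t. snd d (h (\<gamma> t)))"
    using dd by blast
qed

lemma dh_velocity: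
  assumes \<gamma>: "smooth_curve M I \<gamma>" "open I" "0 \<in> I"
  shows "differential M W h (\<gamma> 0) (velocity M \<gamma> 0) = velocity W (\<lambda>t. h (\<gamma> t)) 0"
proof -
  have cont: "continuous_map (top_of_set I) (points M) \<gamma>" using \<gamma> by (simp add: smooth_curve_def)
  then have X: "\<gamma> t \<in> M.X" if "t \<in> I" for t using that by (auto simp: continuous_map_def)
  note X0 = X[OF \<gamma>(3)]
  obtain c where cc: "c \<in> charts_at M (\<gamma> 0)" using M.ex_chart_at[OF X0] by blast
  obtain d where dd: "d \<in> charts_at W (h (\<gamma> 0))" using W.ex_chart_at[OF h_mem[OF X0]] by blast
  note c = M.charts_at_chart[OF cc] and d = W.charts_at_chart[OF dd]
  note V = M.velocity_tangent[OF \<gamma>]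
  show ?thesis
  proof (rule W.tangent_eqI[OF dh_tangent[OF V X0] W.velocity_tangent[OF h_curve[OF \<gamma>(1,2)] \<gamma>(2,3)] dd])
    let ?S = "{t \<in> I. h (\<gamma> t) \<in> fst d} \<inter> {t \<in> I. \<gamma> t \<in> fst c}"
    have S: "openin (top_of_set UNIV) ?S" "0 \<in> ?S"
      using openin_Int[OF W.velocity_domain(1)[OF h_curve[OF \<gamma>(1,2)] \<gamma>(2,3) dd] M.velocity_domain(1)[OF \<gamma> cc]] \<gamma>(3) c(2) d(2) by auto
    have sm: "smooth_on ?S (\<lambda>t. snd c (\<gamma> t))" by (rule smooth_on_subset[OF M.velocity_domain(3)[OF \<gamma> cc]]) auto
    have "differential M W h (\<gamma> 0) (velocity M \<gamma> 0) d
      = dir_deriv (\<lambda>z. snd d (h (chart_inv c z))) (snd c (\<gamma> 0)) (dir_deriv (\<lambda>t. snd c (\<gamma> t)) 0 1)"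
      unfolding dh_rep[OF V cc dd] M.velocity_rep[of c \<gamma>, OF cc] ..
    also have "\<dots> = dir_deriv (\<lambda>t. snd d (h (chart_inv c (snd c (\<gamma> t))))) 0 1"
    proof (rule dir_deriv_comp[OF subspace_UNIV S UNIV_I sm M.subspace_E h_rep_domain(1)[OF cc dd] h_rep[OF c(1) d(1)], symmetric])
      show "snd c (\<gamma> t) \<in> snd c ` (fst c \<inter> {m \<in> M.X. h m \<in> fst d})" if "t \<in> ?S" for t using that X by blast
      show "dir_deriv (\<lambda>t. snd c (\<gamma> t)) 0 1 \<in> M.E"
        using M.tangent_mem[OF V cc] unfolding M.velocity_rep[of c \<gamma>, OF cc] .
    qed
    also have "\<dots> = dir_deriv (\<lambda>t. snd d (h (\<gamma> t))) 0 1"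
      by (rule dir_deriv_cong[OF subspace_UNIV S UNIV_I]) (simp add: M.c_left[OF c(1)])
    also have "\<dots> = velocity W (\<lambda>t. h (\<gamma> t)) 0 d" by (rule W.velocity_rep[of d "\<lambda>t. h (\<gamma> t)", OF dd, symmetric])
    finally show "differential M W h (\<gamma> 0) (velocity M \<gamma> 0) d = velocity W (\<lambda>t. h (\<gamma> t)) 0 d" .
  qed
qed

end

section \<open>Submersions in adapted charts\<close>

text \<open>The derivatives within \<open>S\<close> and \<open>T\<close> are determined only along
  \<open>E\<close> and \<open>E'\<close>; there the chain rule makes them mutually inverse. The two
  subspaces may belong to different types.\<close>

lemma inverse_derivatives:
  assumes E: "subspace E" "openin (top_of_set E) S" "x \<in> S" and E': "subspace E'" "openin (top_of_set E') T"
    and f: "smooth_on S f" "\<And>y. y \<in> S \<Longrightarrow> f y \<in> T" and g: "smooth_on T g" "\<And>y. y \<in> T \<Longrightarrow> g y \<in> S"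
    and gf: "\<And>y. y \<in> S \<Longrightarrow> g (f y) = y" and fg: "\<And>y. y \<in> T \<Longrightarrow> f (g y) = y"
  obtains D D' where "bounded_linear D" "bounded_linear D'" "\<forall>v\<in>E. D v \<in> E' \<and> D' (D v) = v"
    "\<forall>v\<in>E'. D' v \<in> E \<and> D (D' v) = v"
proof -
  have SE: "S \<subseteq> E" "T \<subseteq> E'" using openin_imp_subset E(2) E'(2) by blast+
  have fx: "f x \<in> T" by (rule f(2)[OF E(3)])
  obtain D where D: "(f has_derivative D) (at x within S)" by (rule smooth_on_has_derivative[OF f(1) E(3)])
  obtain D' where D': "(g has_derivative D') (at (f x) within T)" by (rule smooth_on_has_derivative[OF g(1) fx])
  have Dv: "D v = dir_deriv f x v" if "v \<in> E" for v
    by (rule has_derivative_along_line(2)[OF E that D, symmetric])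
  have D'v: "D' v = dir_deriv g (f x) v" if "v \<in> E'" for v
    by (rule has_derivative_along_line(2)[OF E' fx that D', symmetric])
  have DE: "D v \<in> E'" if "v \<in> E" for v
    unfolding Dv[OF that] by (rule dir_deriv_mem[OF E that f(1) E'(1)]) (use f(2) SE in blast)
  have DE': "D' v \<in> E" if "v \<in> E'" for v
    unfolding D'v[OF that] by (rule dir_deriv_mem[OF E' fx that g(1) E(1)]) (use g(2) SE in blast)
  have 1: "D' (D v) = v" if "v \<in> E" for v
  proof -
    have "D' (D v) = dir_deriv g (f x) (dir_deriv f x v)" using D'v[OF DE[OF that]] Dv[OF that] by simp
    also have "\<dots> = dir_deriv (\<lambda>y. g (f y)) x v"
      using dir_deriv_comp[OF E that f(1) E' g(1) f(2)] DE[OF that] Dv[OF that] by simp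
    also have "\<dots> = dir_deriv (\<lambda>y. y) x v" by (rule dir_deriv_cong[OF E that gf])
    also have "\<dots> = v" by (rule dir_deriv_bounded_linear[OF bounded_linear_ident])
    finally show ?thesis .
  qed
  have 2: "D (D' v) = v" if "v \<in> E'" for v
  proof -
    have "D (D' v) = dir_deriv f (g (f x)) (dir_deriv g (f x) v)"
      using Dv[OF DE'[OF that]] D'v[OF that] gf[OF E(3)] by simp
    also have "\<dots> = dir_deriv (\<lambda>y. f (g y)) (f x) v"
      using dir_deriv_comp[OF E' fx that g(1) E(1,2) f(1) g(2)] DE'[OF that] D'v[OF that] by simp
    also have "\<dots> = dir_deriv (\<lambda>y. y) (f x) v" by (rule dir_deriv_cong[OF E' fx that fg])
    also have "\<dots> = v" by (rule dir_deriv_bounded_linear[OF bounded_linear_ident])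
    finally show ?thesis .
  qed
  show thesis
    by (rule that[OF has_derivative_bounded_linear[OF D] has_derivative_bounded_linear[OF D']]) (use DE DE' 1 2 in auto)
qed

text \<open>In these charts the map is the linear surjection \<open>p\<close> of model spaces. The
  right inverse \<open>J\<close> is recorded because it yields both local sections and lifts of
  tangent vectors; it sends every vector of the type into \<open>model M\<close>, which removes side
  conditions.\<close>

definition submersion_form :: "('a, 'e::euclidean_space) manifold \<Rightarrow> ('b, 'f::euclidean_space) manifold \<Rightarrow> ('a \<Rightarrow> 'b)
    \<Rightarrow> ('a, 'e) chart \<Rightarrow> ('b, 'f) chart \<Rightarrow> ('e \<Rightarrow> 'f) \<Rightarrow> ('f \<Rightarrow> 'e) \<Rightarrow> bool" where
  "submersion_form M W \<pi> c d p J \<longleftrightarrow> c \<in> charts M \<and> d \<in> charts W \<and> bounded_linear p \<and> bounded_linear J \<and>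
     p ` model M \<subseteq> model W \<and> (\<forall>y. J y \<in> model M) \<and> (\<forall>y\<in>model W. p (J y) = y) \<and>
     (\<forall>x\<in>fst c. \<pi> x \<in> fst d \<and> snd d (\<pi> x) = p (snd c x))"

text \<open>A local trivialization followed by a product of charts makes \<open>\<pi>\<close> a
  projection, but its coordinates lie in a product of model spaces and not in that of
  \<open>M\<close>. The linear map \<open>D'\<close>, derivative of the inverse coordinate change,
  carries them into \<open>model M\<close>, where \<open>\<pi>\<close> becomes \<open>fst\<close>
  after \<open>D\<close>.\<close>

lemma fibration_submersion_form:
  fixes M :: "('a, 'e::euclidean_space) manifold" and W :: "('b, 'f::euclidean_space) manifold"
  assumes M: "smooth_manifold M" and W: "smooth_manifold W" and fib: "fibration M W \<pi>"
    and m: "m \<in> topspace (points M)"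
  obtains c d p J where "submersion_form M W \<pi> c d p J" "m \<in> fst c"
proof -
  interpret M: smooth_mfd M by unfold_locales (rule M)
  interpret W: smooth_mfd W by unfold_locales (rule W)
  have pm: "\<pi> m \<in> W.X" using fib m unfolding fibration_def by blast
  obtain V and N :: "('a, 'e) manifold" and \<Phi> where V: "openin (points W) V" "\<pi> m \<in> V" and N0: "smooth_manifold N"
    and diff: "diffeomorphism (open_submanifold M {m \<in> M.X. \<pi> m \<in> V}) (prod_manifold (open_submanifold W V) N) \<Phi>"
    and fst\<Phi>: "\<forall>m\<in>M.X. \<pi> m \<in> V \<longrightarrow> fst (\<Phi> m) = \<pi> m"
    using fib pm unfolding fibration_def by blast
  interpret N: smooth_mfd N by unfold_locales (rule N0)
  define P where "P = {m \<in> M.X. \<pi> m \<in> V}"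
  have \<pi>cont: "continuous_map (points M) (points W) \<pi>" using fib by (simp add: fibration_def smooth_map_def)
  have Pop: "openin (points M) P" unfolding P_def by (rule openin_continuous_map_preimage[OF \<pi>cont V(1)])
  have mP: "m \<in> P" using m V by (simp add: P_def)
  have PX: "P \<subseteq> M.X" by (auto simp: P_def)
  have VX: "V \<subseteq> W.X" by (rule openin_subset[OF V(1)])
  define \<Psi> where "\<Psi> = inv_into P \<Phi>"
  have tsP: "topspace (points (open_submanifold M P)) = P"
    using PX by (auto simp: open_submanifold_def topspace_subtopology)
  have tsQ: "topspace (points (prod_manifold (open_submanifold W V) N)) = V \<times> N.X"
    using VX by (auto simp: open_submanifold_def prod_manifold_def topspace_subtopology)
  have bij: "bij_betw \<Phi> P (V \<times> N.X)"
    and sm\<Phi>: "smooth_map (open_submanifold M P) (prod_manifold (open_submanifold W V) N) \<Phi>"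
    and sm\<Psi>: "smooth_map (prod_manifold (open_submanifold W V) N) (open_submanifold M P) \<Psi>"
    using diff unfolding diffeomorphism_def P_def[symmetric] tsP tsQ \<Psi>_def by blast+
  have \<Psi>\<Phi>: "\<Psi> (\<Phi> x) = x" if "x \<in> P" for x
    unfolding \<Psi>_def using bij that by (simp add: bij_betw_def inv_into_f_f)
  have \<Phi>\<Psi>: "\<Phi> (\<Psi> y) = y" "\<Psi> y \<in> P" if "y \<in> V \<times> N.X" for y
  proof -
    have y: "y \<in> \<Phi> ` P" using bij that by (simp add: bij_betw_def)
    show "\<Phi> (\<Psi> y) = y" unfolding \<Psi>_def by (rule f_inv_into_f[OF y])
    show "\<Psi> y \<in> P" unfolding \<Psi>_def by (rule inv_into_into[OF y])
  qed
  have \<Phi>mem: "\<Phi> x \<in> V \<times> N.X" if "x \<in> P" for x using bij that by (auto simp: bij_betw_def)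
  have fst\<Phi>': "fst (\<Phi> x) = \<pi> x" if "x \<in> P" for x using fst\<Phi> that by (simp add: P_def)
  define n where "n = snd (\<Phi> m)"
  have nX: "n \<in> N.X" using \<Phi>mem[OF mP] by (auto simp: n_def)
  obtain a where a: "a \<in> atlas W" "\<pi> m \<in> fst a" using W.atlas_at[OF pm] by blast
  obtain b where b: "b \<in> atlas N" "n \<in> fst b" using N.atlas_at[OF nX] by blast
  obtain c0 where c0: "c0 \<in> atlas M" "m \<in> fst c0" using M.atlas_at[OF m] by blast
  note aW = W.atlas_charts[OF a(1)] and bN = N.atlas_charts[OF b(1)] and cM = M.atlas_charts[OF c0(1)]
  define R0 where "R0 = (fst a \<inter> V) \<times> fst b"
  define ab where "ab = map_prod (snd a) (snd b)"
  define R where "R = ab ` R0"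
  have R: "R = snd a ` (fst a \<inter> V) \<times> snd b ` fst b"
    unfolding R_def R0_def ab_def by (rule map_prod_surj_on) auto
  define ic where "ic y = (chart_inv a (fst y), chart_inv b (snd y))" for y
  have ic_ab: "ic (ab z) = z" if "z \<in> R0" for z
    using that W.c_left[OF aW, of "fst z"] N.c_left[OF bN, of "snd z"] by (auto simp: ic_def ab_def R0_def)
  have R0sub: "R0 \<subseteq> V \<times> N.X" using N.c_subset[OF bN] by (auto simp: R0_def)
  have abinj: "inj_on ab R0" by (rule inj_on_inverseI[where g=ic]) (rule ic_ab)
  have ab_inv: "chart_inv (R0, ab) y = ic y" if "y \<in> R" for y
    using that ic_ab chart_inv_left[of "(R0, ab)"] abinj by (auto simp: R_def)
  define \<Gamma> where "\<Gamma> y = \<Psi> (ic y)" for y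
  \<comment> \<open>\<open>\<alpha>\<close> is the coordinate expression of \<open>\<Phi>\<close>
    from the chart \<open>c0\<close> to the product chart \<open>ab\<close>, and
    \<open>\<beta>\<close> that of its inverse; they are mutually inverse between \<open>S\<close>
    and \<open>Q\<close>.\<close>
  define \<alpha> where "\<alpha> z = ab (\<Phi> (chart_inv c0 z))" for z
  define \<beta> where "\<beta> y = snd c0 (\<Gamma> y)" for y
  define A where "A = {x \<in> fst c0 \<inter> P. \<Phi> x \<in> R0}"
  define S where "S = snd c0 ` A"
  define Q where "Q = {y \<in> R. \<Gamma> y \<in> fst c0}"
  have AC: "A \<subseteq> fst c0" by (auto simp: A_def)
  have mA: "m \<in> A" using c0(2) mP a(2) V(2) b(2) \<Phi>mem[OF mP] fst\<Phi>'[OF mP]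
    unfolding A_def R0_def n_def by (auto simp: mem_Times_iff)
  have atP: "(fst c0 \<inter> P, snd c0) \<in> atlas (open_submanifold M P)"
    using c0(1) by (auto simp: open_submanifold_def)
  have atQ: "(R0, ab) \<in> atlas (prod_manifold (open_submanifold W V) N)"
  proof -
    have "(fst a \<inter> V, snd a) \<in> atlas (open_submanifold W V)" using a(1) by (auto simp: open_submanifold_def)
    then have "\<exists>c d. (R0, ab) = (fst c \<times> fst d, map_prod (snd c) (snd d)) \<and> c \<in> atlas (open_submanifold W V) \<and> d \<in> atlas N"
      using b(1) by (intro exI[of _ "(fst a \<inter> V, snd a)"] exI[of _ b]) (simp add: R0_def ab_def)
    then show ?thesis unfolding prod_manifold_def by (simp only: manifold.select_convs mem_Collect_eq)
  qed
  have "continuous_map (points (open_submanifold M P)) (points (prod_manifold (open_submanifold W V) N)) \<Phi>"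
    using sm\<Phi> by (simp add: smooth_map_def)
  then have cont\<Phi>: "continuous_map (subtopology (points M) P) (prod_topology (subtopology (points W) V) (points N)) \<Phi>"
    by (simp add: open_submanifold_def prod_manifold_def)
  have "continuous_map (points (prod_manifold (open_submanifold W V) N)) (points (open_submanifold M P)) \<Psi>"
    using sm\<Psi> by (simp add: smooth_map_def)
  then have cont\<Psi>: "continuous_map (prod_topology (subtopology (points W) V) (points N)) (points M) \<Psi>"
    by (simp add: open_submanifold_def prod_manifold_def continuous_map_in_subtopology)
  have sm\<alpha>: "smooth_on S \<alpha>"
  proof -
    have 1: "smooth_on (snd c0 ` ((fst c0 \<inter> P) \<inter> \<Phi> -` R0)) (ab \<circ> \<Phi> \<circ> chart_inv (fst c0 \<inter> P, snd c0))"
      using bspec[OF bspec[OF conjunct2[OF sm\<Phi>[unfolded smooth_map_def]] atP] atQ] by (simp only: fst_conv snd_conv)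
    have SA: "S = snd c0 ` ((fst c0 \<inter> P) \<inter> \<Phi> -` R0)" unfolding S_def A_def by (rule arg_cong[where f="image (snd c0)"]) auto
    show ?thesis
      unfolding SA by (rule smooth_on_cong[OF 1]) (auto simp: \<alpha>_def M.chart_inv_restrict[OF cM])
  qed
  have sm\<beta>: "smooth_on Q \<beta>"
  proof -
    have 1: "smooth_on (ab ` (R0 \<inter> \<Psi> -` (fst c0 \<inter> P))) (snd c0 \<circ> \<Psi> \<circ> chart_inv (R0, ab))"
      using bspec[OF bspec[OF conjunct2[OF sm\<Psi>[unfolded smooth_map_def]] atQ] atP] by (simp only: fst_conv snd_conv)
    have sub: "Q \<subseteq> ab ` (R0 \<inter> \<Psi> -` (fst c0 \<inter> P))"
    proof
      fix y assume "y \<in> Q"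
      then obtain z where z: "z \<in> R0" "y = ab z" "\<Psi> z \<in> fst c0" unfolding Q_def R_def \<Gamma>_def using ic_ab by auto
      then show "y \<in> ab ` (R0 \<inter> \<Psi> -` (fst c0 \<inter> P))" using \<Phi>\<Psi>(2)[of z] R0sub by blast
    qed
    show ?thesis
      by (rule smooth_on_cong[OF smooth_on_subset[OF 1 sub]]) (auto simp: \<beta>_def \<Gamma>_def Q_def ab_inv)
  qed
  have \<alpha>A: "\<alpha> (snd c0 x) = ab (\<Phi> x)" if "x \<in> A" for x
    using M.c_left[OF cM, of x] that AC by (auto simp: \<alpha>_def)
  have \<Gamma>\<alpha>: "\<Gamma> (ab (\<Phi> x)) = x" if "x \<in> A" for x
    using that ic_ab \<Psi>\<Phi> by (simp add: \<Gamma>_def A_def)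
  have \<alpha>Q: "\<alpha> z \<in> Q" and \<beta>\<alpha>: "\<beta> (\<alpha> z) = z" if zS: "z \<in> S" for z
  proof -
    obtain x where x: "x \<in> A" "z = snd c0 x" using zS unfolding S_def by blast
    show "\<beta> (\<alpha> z) = z" using \<alpha>A[OF x(1)] \<Gamma>\<alpha>[OF x(1)] x(2) by (simp add: \<beta>_def)
    show "\<alpha> z \<in> Q" using \<alpha>A[OF x(1)] \<Gamma>\<alpha>[OF x(1)] x by (simp add: Q_def R_def A_def)
  qed
  have \<beta>S: "\<beta> y \<in> S" and \<alpha>\<beta>: "\<alpha> (\<beta> y) = y" if yQ: "y \<in> Q" for y
  proof -
    obtain z where z: "z \<in> R0" "y = ab z" "\<Psi> z \<in> fst c0" using yQ unfolding Q_def R_def \<Gamma>_def using ic_ab by auto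
    have zV: "z \<in> V \<times> N.X" using R0sub z(1) by blast
    have G: "\<Gamma> y = \<Psi> z" using z ic_ab by (simp add: \<Gamma>_def)
    have "\<Psi> z \<in> A" using z \<Phi>\<Psi>[OF zV] by (simp add: A_def)
    then show "\<beta> y \<in> S" unfolding \<beta>_def S_def G by (rule imageI)
    show "\<alpha> (\<beta> y) = y" unfolding \<beta>_def G \<alpha>A[OF \<open>\<Psi> z \<in> A\<close>] \<Phi>\<Psi>(1)[OF zV] using z(2) by simp
  qed
  have Aop: "openin (points M) A"
  proof -
    have "openin (points W) (fst a \<inter> V)" by (rule openin_Int[OF W.c_open[OF aW] V(1)])
    then have "openin (subtopology (points W) V) (fst a \<inter> V)" by (simp add: openin_open_subtopology[OF V(1)])
    then have "openin (prod_topology (subtopology (points W) V) (points N)) R0"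
      unfolding R0_def by (simp add: openin_prod_Times_iff N.c_open[OF bN])
    then have "openin (subtopology (points M) P) {x \<in> topspace (subtopology (points M) P). \<Phi> x \<in> R0}"
      by (rule openin_continuous_map_preimage[OF cont\<Phi>])
    then have 1: "openin (points M) {x \<in> topspace (subtopology (points M) P). \<Phi> x \<in> R0}"
      by (rule openin_trans_full[OF _ Pop])
    have "A = fst c0 \<inter> {x \<in> topspace (subtopology (points M) P). \<Phi> x \<in> R0}"
      using PX by (auto simp: A_def topspace_subtopology)
    then show ?thesis using openin_Int[OF M.c_open[OF cM] 1] by simp
  qed
  have Sop: "openin (top_of_set M.E) S"
    using M.c_open_image[OF cM Aop] AC by (simp add: S_def Int_absorb1)
  have EE: "subspace (W.E \<times> N.E)" by (rule subspace_Times[OF W.subspace_E N.subspace_E])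
  have Rop: "openin (top_of_set (W.E \<times> N.E)) R"
    unfolding R using W.c_open_image[OF aW V(1)] N.c_image[OF bN] by (rule openin_Times)
  have Qop: "openin (top_of_set (W.E \<times> N.E)) Q"
  proof -
    have fstR: "continuous_map (top_of_set R) (top_of_set (snd a ` fst a)) fst"
      unfolding R by (auto intro!: continuous_intros)
    have sndR: "continuous_map (top_of_set R) (top_of_set (snd b ` fst b)) snd"
      unfolding R by (auto intro!: continuous_intros)
    have 1: "continuous_map (top_of_set R) (points W) (\<lambda>y. chart_inv a (fst y))"
      using continuous_map_compose[OF fstR W.c_inv_cont[OF aW]] by (simp only: o_def)
    have 2: "continuous_map (top_of_set R) (points N) (\<lambda>y. chart_inv b (snd y))"
      using continuous_map_compose[OF sndR N.c_inv_cont[OF bN]] by (simp only: o_def)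
    have icR0: "ic y \<in> R0" if "y \<in> R" for y using that ic_ab unfolding R_def by auto
    have 3: "continuous_map (top_of_set R) (subtopology (points W) V) (\<lambda>y. chart_inv a (fst y))"
      unfolding continuous_map_in_subtopology using 1 icR0 by (auto simp: ic_def R0_def)
    have "continuous_map (top_of_set R) (prod_topology (subtopology (points W) V) (points N)) ic"
      using 3 2 unfolding ic_def by (rule continuous_map_pairedI)
    then have "continuous_map (top_of_set R) (points M) \<Gamma>"
      using continuous_map_compose[OF _ cont\<Psi>] unfolding \<Gamma>_def o_def by blast
    then have "openin (top_of_set R) {y \<in> topspace (top_of_set R). \<Gamma> y \<in> fst c0}"
      by (rule openin_continuous_map_preimage[OF _ M.c_open[OF cM]])
    then have "openin (top_of_set R) Q" by (simp add: Q_def)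
    then show ?thesis by (rule openin_trans[OF _ Rop])
  qed
  have xS: "snd c0 m \<in> S" using mA by (simp add: S_def)
  obtain D D' where D: "bounded_linear D" "bounded_linear D'" "\<forall>v\<in>M.E. D v \<in> W.E \<times> N.E \<and> D' (D v) = v"
    "\<forall>v\<in>W.E \<times> N.E. D' v \<in> M.E \<and> D (D' v) = v"
    by (rule inverse_derivatives[OF M.subspace_E Sop xS EE Qop sm\<alpha> \<alpha>Q sm\<beta> \<beta>S \<beta>\<alpha> \<alpha>\<beta>])
  have QE: "Q \<subseteq> W.E \<times> N.E" by (rule openin_imp_subset[OF Qop])
  let ?T = "D' ` Q"
  have Top: "openin (top_of_set M.E) ?T"
  proof -
    obtain O' where O': "open O'" "Q = (W.E \<times> N.E) \<inter> O'" using Qop openin_open by blast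
    have "?T = M.E \<inter> D -` O'"
    proof (intro equalityI subsetI)
      fix y assume "y \<in> D' ` Q"
      then obtain q where "q \<in> Q" "y = D' q" by blast
      then show "y \<in> M.E \<inter> D -` O'" using D(4) O'(2) by auto
    next
      fix y assume y: "y \<in> M.E \<inter> D -` O'"
      then have "D y \<in> Q" "y = D' (D y)" using D(3) O'(2) by auto
      then show "y \<in> D' ` Q" by blast
    qed
    moreover have "open (D -` O')" by (rule continuous_open_vimage[OF O'(1)]) (rule linear_continuous_at[OF D(1)])
    ultimately show ?thesis by (auto simp: openin_open)
  qed
  have \<alpha>S: "\<alpha> ` S = Q" using \<alpha>Q \<beta>S \<alpha>\<beta> by (metis image_eqI subsetI subset_antisym image_subsetI)
  \<comment> \<open>The derivative at the single point \<open>snd c0 m\<close> serves as a linear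
    isomorphism of model spaces; the new chart consists of the product coordinates transported by
    it.\<close>
  let ?c = "({x \<in> fst c0. snd c0 x \<in> S}, \<lambda>x. D' (\<alpha> (snd c0 x)))"
  have "?c \<in> charts M"
  proof (rule M.chart_change[OF cM Sop _ Top])
    show "S \<subseteq> snd c0 ` fst c0" using AC by (auto simp: S_def)
    show "(\<lambda>z. D' (\<alpha> z)) ` S = D' ` Q" using \<alpha>S by (simp add: image_image[symmetric])
    show "\<beta> (D (D' (\<alpha> z))) = z" if "z \<in> S" for z using \<beta>\<alpha>[OF that] D(4) \<alpha>Q[OF that] QE by auto
    show "smooth_on S (\<lambda>z. D' (\<alpha> z))" by (rule smooth_on_bounded_linear_comp[OF D(2) sm\<alpha>])
    show "smooth_on (D' ` Q) (\<lambda>y. \<beta> (D y))"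
      by (rule smooth_on_comp[OF smooth_on_bounded_linear[OF D(1)] sm\<beta>]) (use D(4) QE in auto)
  qed
  moreover have "m \<in> fst ?c" using c0(2) xS by simp
  \<comment> \<open>\<open>D'\<close> is controlled only on the product of model spaces, so
    \<open>J\<close> first projects to that of \<open>W\<close> by \<open>W_proj\<close>.\<close>
  moreover have "submersion_form M W \<pi> ?c a (\<lambda>v. fst (D v)) (\<lambda>y. D' (W_proj y, 0))"
    if W_proj: "bounded_linear W_proj" "\<And>y. W_proj y \<in> W.E" "\<And>y. y \<in> W.E \<Longrightarrow> W_proj y = y" for W_proj
    unfolding submersion_form_def
  proof (intro conjI ballI allI)
    have z: "(W_proj y, 0) \<in> W.E \<times> N.E" for y using W_proj(2) N.zero_E by simp
    show "?c \<in> charts M" by fact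
    show "bounded_linear (\<lambda>v. fst (D v))" by (rule bounded_linear_compose[OF bounded_linear_fst D(1)])
    have "bounded_linear (\<lambda>y. (W_proj y, 0))" by (intro bounded_linear_Pair W_proj(1) bounded_linear_zero)
    then show "bounded_linear (\<lambda>y. D' (W_proj y, 0))" by (rule bounded_linear_compose[OF D(2)])
    show "(\<lambda>v. fst (D v)) ` M.E \<subseteq> W.E" using D(3) by auto
    show "D' (W_proj y, 0) \<in> M.E" for y using D(4) z by blast
    show "fst (D (D' (W_proj y, 0))) = y" if "y \<in> W.E" for y using D(4) z[of y] W_proj(3)[OF that] by simp
    fix x assume "x \<in> fst ?c"
    then have "x \<in> fst c0" "snd c0 x \<in> S" by auto
    then obtain x' where "x' \<in> A" "snd c0 x = snd c0 x'" by (auto simp: S_def)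
    then have xA: "x \<in> A" using M.c_left[OF cM, of x] M.c_left[OF cM, of x'] \<open>x \<in> fst c0\<close> AC by auto
    have xP: "x \<in> P" "\<Phi> x \<in> R0" using xA by (auto simp: A_def)
    show "\<pi> x \<in> fst a" using xP fst\<Phi>'[OF xP(1)] by (auto simp: R0_def)
    have "D (D' (\<alpha> (snd c0 x))) = \<alpha> (snd c0 x)" using D(4) \<alpha>Q[OF \<open>snd c0 x \<in> S\<close>] QE by blast
    then show "snd a (\<pi> x) = fst (D (snd ?c x))"
      unfolding snd_conv using \<alpha>A[OF xA] fst\<Phi>'[OF xP(1)] by (simp add: ab_def)
  qed (fact aW)
  moreover obtain W_proj where "bounded_linear W_proj" "\<And>y. W_proj y \<in> W.E" "\<And>y. y \<in> W.E \<Longrightarrow> W_proj y = y"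
    by (rule linear_projection_exists[OF W.subspace_E]) blast
  ultimately show thesis using that by blast
qed

lemma (in smooth_mfd) vector_field_cong:
  assumes Y: "vector_field_on M U Y" and eq: "\<And>m. m \<in> U \<Longrightarrow> Y m = Z m" and U: "openin (points M) U"
  shows "vector_field_on M U Z"
  unfolding vector_field_on_def
proof (intro conjI ballI)
  show "Z m \<in> tangent_space M m" if "m \<in> U" for m
    using vector_field_tangent[OF Y that] eq[OF that] by simp
  fix c assume c: "c \<in> charts M"
  show "smooth_on (snd c ` (fst c \<inter> U)) (\<lambda>z. Z (chart_inv c z) c)"
  proof (rule smooth_on_cong[OF vector_field_rep[OF Y c]])
    fix z assume "z \<in> snd c ` (fst c \<inter> U)"
    then have "chart_inv c z \<in> U" using c_inv_mem[OF c, of z "fst c \<inter> U"] by blast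
    then show "Z (chart_inv c z) c = Y (chart_inv c z) c" using eq by simp
  qed
qed

text \<open>What is retained of the fibration: surjectivity and, around each point, charts in which
  the map is linear.\<close>

locale submersion = smooth_mfd_map M W h
  for M :: "('a, 'e::euclidean_space) manifold" and W :: "('b, 'f::euclidean_space) manifold" and h :: "'a \<Rightarrow> 'b" +
  assumes surj: "h ` topspace (points M) = topspace (points W)"
    and form_at: "m \<in> topspace (points M) \<Longrightarrow> \<exists>c d p J. submersion_form M W h c d p J \<and> m \<in> fst c"
begin

end

locale submersion_chart = submersion M W h
  for M :: "('a, 'e::euclidean_space) manifold" and W :: "('b, 'f::euclidean_space) manifold" and h :: "'a \<Rightarrow> 'b" +
  fixes c d p J
  assumes form: "submersion_form M W h c d p J"
begin

lemma c: "c \<in> charts M" and d: "d \<in> charts W" and p: "bounded_linear p" and J: "bounded_linear J"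
  and p_mem: "v \<in> M.E \<Longrightarrow> p v \<in> W.E" and J_mem: "J y \<in> M.E" and pJ: "y \<in> W.E \<Longrightarrow> p (J y) = y"
  and h_fst: "x \<in> fst c \<Longrightarrow> h x \<in> fst d" and h_snd: "x \<in> fst c \<Longrightarrow> snd d (h x) = p (snd c x)"
  using form unfolding submersion_form_def by blast+

lemma c_at: "m \<in> fst c \<Longrightarrow> c \<in> charts_at M m" by (rule M.charts_atI[OF c])
lemma d_at: "m \<in> fst c \<Longrightarrow> d \<in> charts_at W (h m)" by (rule W.charts_atI[OF d h_fst])

lemma in_X: "m \<in> fst c \<Longrightarrow> m \<in> M.X" using M.c_subset[OF c] by blast

lemma dh_chart:
  assumes v: "v \<in> tangent_space M m" and m: "m \<in> fst c"
  shows "differential M W h m v d = p (v c)"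
proof -
  have vE: "v c \<in> M.E" by (rule M.tangent_mem[OF v c_at[OF m]])
  have "differential M W h m v d = dir_deriv (\<lambda>z. snd d (h (chart_inv c z))) (snd c m) (v c)"
    by (rule dh_rep[OF v c_at[OF m] d_at[OF m]])
  also have "\<dots> = dir_deriv p (snd c m) (v c)"
  proof (rule dir_deriv_cong[OF M.subspace_E M.c_image[OF c] _ vE])
    show "snd c m \<in> snd c ` fst c" using m by blast
    fix z assume "z \<in> snd c ` fst c"
    then obtain x where x: "x \<in> fst c" "z = snd c x" by blast
    show "snd d (h (chart_inv c z)) = p z" using h_snd[OF x(1)] M.c_left[OF c x(1)] x(2) by simp
  qed
  also have "\<dots> = p (v c)" by (rule dir_deriv_bounded_linear[OF p])
  finally show ?thesis .
qed

text \<open>Depends on the chart, but only up to vectors killed by the differential.\<close>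

definition lift :: "'a \<Rightarrow> ('b, 'f) tvec \<Rightarrow> ('a, 'e) tvec" where
  "lift m u = M.vec m c (J (u d))"

lemma lift_tangent: "m \<in> fst c \<Longrightarrow> lift m u \<in> tangent_space M m"
  unfolding lift_def by (rule M.vec_tangent(1)[OF c_at J_mem])

lemma lift_c: "m \<in> fst c \<Longrightarrow> lift m u c = J (u d)"
  unfolding lift_def by (rule M.vec_tangent(2)[OF c_at J_mem])

lemma dh_lift:
  assumes m: "m \<in> fst c" and u: "u \<in> tangent_space W (h m)"
  shows "differential M W h m (lift m u) = u"
proof (rule W.tangent_eqI[OF dh_tangent[OF lift_tangent[OF m] in_X[OF m]] u d_at[OF m]])
  show "differential M W h m (lift m u) d = u d"
    unfolding dh_chart[OF lift_tangent[OF m] m] lift_c[OF m] by (rule pJ[OF W.tangent_mem[OF u d_at[OF m]]])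
qed

lemma lift_field:
  assumes U: "openin (points W) U" and Y: "vector_field_on W U Y" and A: "openin (points M) A" "A \<subseteq> fst c" "h ` A \<subseteq> U"
  shows "vector_field_on M A (\<lambda>m. lift m (Y (h m)))"
proof -
  let ?\<xi> = "\<lambda>z. J (Y (h (chart_inv c z)) d)"
  have "smooth_on (snd c ` A) (\<lambda>z. J (Y (chart_inv d (p z)) d))"
  proof (rule smooth_on_bounded_linear_comp[OF J smooth_on_comp[OF smooth_on_bounded_linear[OF p] W.vector_field_rep[OF Y d]]])
    fix z assume "z \<in> snd c ` A"
    then obtain x where x: "x \<in> A" "z = snd c x" by blast
    have "x \<in> fst c" "h x \<in> U" using x A by auto
    then show "p z \<in> snd d ` (fst d \<inter> U)" using h_snd[of x] h_fst[of x] x(2) by (metis IntI imageI)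
  qed
  then have "smooth_on (snd c ` A) ?\<xi>"
  proof (rule smooth_on_cong)
    fix z assume "z \<in> snd c ` A"
    then obtain x where x: "x \<in> A" "z = snd c x" by blast
    then have xc: "x \<in> fst c" using A by blast
    then show "?\<xi> z = J (Y (chart_inv d (p z)) d)"
      using h_snd[OF xc] W.c_left[OF d h_fst[OF xc]] M.c_left[OF c xc] x(2) by simp
  qed
  then have vf: "vector_field_on M A (\<lambda>m. M.vec m c (?\<xi> (snd c m)))"
  proof (intro M.coordinate_field[where \<xi>="?\<xi>"] c A(1,2))
    show "?\<xi> z \<in> M.E" for z by (rule J_mem)
  qed
  have eq: "M.vec m c (?\<xi> (snd c m)) = lift m (Y (h m))" if "m \<in> A" for m
  proof -
    have "m \<in> fst c" using that A by blast
    then show ?thesis using M.c_left[OF c] by (simp add: lift_def)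
  qed
  show ?thesis by (rule M.vector_field_cong[OF vf eq A(1)])
qed

text \<open>The local section through \<open>m0\<close> that is affine in the adapted charts.\<close>

definition sec :: "'a \<Rightarrow> 'f \<Rightarrow> 'e" where
  "sec m0 z = snd c m0 + J (z - snd d (h m0))"

definition sdom :: "'a \<Rightarrow> 'a set \<Rightarrow> 'b set" where
  "sdom m0 A = {w \<in> fst d. sec m0 (snd d w) \<in> snd c ` (fst c \<inter> A)}"

definition section_at :: "'a \<Rightarrow> 'b \<Rightarrow> 'a" where
  "section_at m0 w = chart_inv c (sec m0 (snd d w))"

lemma sec_mem: "m0 \<in> fst c \<Longrightarrow> sec m0 z \<in> M.E"
  unfolding sec_def by (rule subspace_add[OF M.subspace_E M.c_model[OF c] J_mem])

lemma sec_smooth: "smooth_on S (sec m0)"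
  unfolding sec_def
  by (intro smooth_on_add smooth_on_const smooth_on_bounded_linear_comp[OF J] smooth_on_diff smooth_on_id)

lemma p_sec:
  assumes "m0 \<in> fst c" "z \<in> W.E"
  shows "p (sec m0 z) = z"
proof -
  have "z - snd d (h m0) \<in> W.E" by (rule subspace_diff[OF W.subspace_E assms(2) W.c_model[OF d h_fst[OF assms(1)]]])
  then have "p (sec m0 z) = p (snd c m0) + (z - snd d (h m0))"
    unfolding sec_def using pJ by (simp add: linear_add[OF bounded_linear.linear[OF p]])
  then show ?thesis using h_snd[OF assms(1)] by simp
qed

lemma section_at:
  assumes m0: "m0 \<in> fst c" and w: "w \<in> sdom m0 A"
  shows "section_at m0 w \<in> fst c" "section_at m0 w \<in> A" "h (section_at m0 w) = w"
    "snd c (section_at m0 w) = sec m0 (snd d w)" "w \<in> fst d"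
proof -
  have wd: "w \<in> fst d" and sc: "sec m0 (snd d w) \<in> snd c ` (fst c \<inter> A)" using w by (auto simp: sdom_def)
  have *: "section_at m0 w \<in> fst c \<inter> A"
    unfolding section_at_def by (rule M.c_inv_mem[OF c sc]) blast
  then show 1: "section_at m0 w \<in> fst c" "section_at m0 w \<in> A" by auto
  show 2: "snd c (section_at m0 w) = sec m0 (snd d w)"
    unfolding section_at_def by (rule chart_inv_right[OF sc]) blast
  have "snd d (h (section_at m0 w)) = snd d w"
    unfolding h_snd[OF 1(1)] 2 by (rule p_sec[OF m0 W.c_model[OF d wd]])
  then show "h (section_at m0 w) = w"
    using W.c_inj[OF d] h_fst[OF 1(1)] wd by (auto dest: inj_onD)
  show "w \<in> fst d" by fact
qed

lemma sec_base: "sec m0 (snd d (h m0)) = snd c m0"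
  unfolding sec_def using linear_0[OF bounded_linear.linear[OF J]] by simp

lemma section_base: "m0 \<in> fst c \<Longrightarrow> section_at m0 (h m0) = m0"
  unfolding section_at_def sec_base by (rule M.c_left[OF c])

lemma sdom_base: "m0 \<in> fst c \<Longrightarrow> m0 \<in> A \<Longrightarrow> h m0 \<in> sdom m0 A"
  unfolding sdom_def using h_fst sec_base by auto

lemma sec_preimage_open:
  assumes m0: "m0 \<in> fst c" and T: "openin (top_of_set M.E) T"
  shows "openin (top_of_set W.E) {z \<in> W.E. sec m0 z \<in> T}"
proof -
  have "continuous_map (top_of_set W.E) (top_of_set M.E) (sec m0)"
    using smooth_on_continuous_on[OF sec_smooth[of W.E m0]] sec_mem[OF m0] by auto
  from openin_continuous_map_preimage[OF this T] show ?thesis by simp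
qed

lemma sdom_open:
  assumes m0: "m0 \<in> fst c" and A: "openin (points M) A"
  shows "openin (points W) (sdom m0 A)"
proof -
  have "sdom m0 A = {w \<in> fst d. snd d w \<in> {z \<in> W.E. sec m0 z \<in> snd c ` (fst c \<inter> A)}}"
    unfolding sdom_def using W.c_model[OF d] by blast
  then show ?thesis
    using W.c_open_preimage[OF d sec_preimage_open[OF m0 M.c_open_image[OF c A]]] by simp
qed

lemma section_smooth_fun:
  assumes m0: "m0 \<in> fst c" and A: "openin (points M) A" and G: "smooth_fun M A G"
  shows "smooth_on (snd d ` sdom m0 A) (\<lambda>z. G (section_at m0 (chart_inv d z)))"
proof -
  have 1: "smooth_on (snd c ` (fst c \<inter> A)) (\<lambda>z. G (chart_inv c z))" by (rule M.smooth_fun_rep[OF G A c])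
  have "smooth_on (snd d ` sdom m0 A) (\<lambda>z. G (chart_inv c (sec m0 z)))"
    by (rule smooth_on_comp[OF sec_smooth 1]) (auto simp: sdom_def)
  then show ?thesis
  proof (rule smooth_on_cong)
    fix z assume "z \<in> snd d ` sdom m0 A"
    then obtain w where "w \<in> sdom m0 A" "z = snd d w" by blast
    then show "G (section_at m0 (chart_inv d z)) = G (chart_inv c (sec m0 z))"
      using W.c_left[OF d, of w] by (simp add: section_at_def sdom_def)
  qed
qed

end

section \<open>The projected foliation\<close>

lemma Ck_on_local:
  assumes "\<And>x. x \<in> U \<Longrightarrow> \<exists>V. open V \<and> x \<in> V \<and> Ck_on k V f"
  shows "Ck_on k U f"
  using assms
proof (induction k arbitrary: f)
  case 0
  show ?case
    unfolding Ck_on.simps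
  proof (rule continuous_at_imp_continuous_on, rule ballI)
    fix x assume "x \<in> U"
    then obtain V where "open V" "x \<in> V" "continuous_on V f" using 0 by force
    then show "isCont f x" by (simp add: continuous_on_eq_continuous_at)
  qed
next
  case (Suc k)
  show ?case
    unfolding Ck_on.simps
  proof (intro conjI ballI allI)
    show "f differentiable at x" if "x \<in> U" for x
      using Suc.prems[OF that] by auto
    show "Ck_on k U (\<lambda>x. frechet_derivative f (at x) v)" for v
    proof (rule Suc.IH)
      fix x assume "x \<in> U"
      from Suc.prems[OF this] show "\<exists>V. open V \<and> x \<in> V \<and> Ck_on k V (\<lambda>x. frechet_derivative f (at x) v)" by auto
    qed
  qed
qed

lemma smooth_on_open_Ck_on:
  assumes "smooth_on U f" "open U"
  shows "Ck_on k U f"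
proof (rule Ck_on_local)
  fix x assume x: "x \<in> U"
  obtain V g where V: "open V" "x \<in> V" "\<forall>k. Ck_on k V g" "\<forall>y\<in>U \<inter> V. f y = g y"
    by (rule smooth_onE[OF assms(1) x])
  have "Ck_on k (U \<inter> V) f"
    by (rule Ck_on_cong[OF open_Int[OF assms(2) V(1)] _ Ck_on_subset[OF V(3)[rule_format, of k]]]) (use V(4) in auto)
  then show "\<exists>V. open V \<and> x \<in> V \<and> Ck_on k V f"
    using x V assms(2) by (intro exI[of _ "U \<inter> V"]) auto
qed

text \<open>The correction \<open>R (\<eta> z - A z)\<close> has derivative 0 at \<open>z0\<close>,
  since \<open>A\<close> is the derivative of \<open>\<eta>\<close> there, so the map is locally
  invertible. When \<open>R\<close> inverts \<open>A\<close> from the right on the values concerned,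
  applying \<open>A\<close> to the image of \<open>z\<close> returns \<open>\<eta> z\<close>: level
  sets of \<open>\<eta>\<close> become level sets of a linear map. \<open>T1\<close> is taken convex
  so that its linear slices are connected.\<close>

lemma smooth_straightening:
  fixes E :: "'e::euclidean_space set"
  assumes E: "subspace E" and S: "openin (top_of_set E) S" "z0 \<in> S" and \<eta>: "smooth_on S \<eta>"
    and R: "bounded_linear R" "\<And>y. R y \<in> E"
    and A: "bounded_linear A" "\<And>v. v \<in> E \<Longrightarrow> A v = dir_deriv \<eta> z0 v"
  obtains S1 T1 g where "openin (top_of_set E) S1" "z0 \<in> S1" "S1 \<subseteq> S" "openin (top_of_set E) T1" "convex T1"
    "(\<lambda>z. z + R (\<eta> z - A z)) ` S1 = T1" "\<forall>z\<in>S1. g (z + R (\<eta> z - A z)) = z" "smooth_on T1 g"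
proof -
  obtain P where P: "bounded_linear P" "\<forall>x. P x \<in> E" "\<forall>x\<in>E. P x = x"
    by (rule linear_projection_exists[OF E]) blast
  have SE: "S \<subseteq> E" by (rule openin_imp_subset[OF S(1)])
  obtain O1 where O1: "open O1" "S = E \<inter> O1" using S(1) openin_open by blast
  \<comment> \<open>Precomposition with the projection \<open>P\<close> extends the map from
    \<open>S\<close> to an open set of the ambient space, where the inverse function theorem
    applies.\<close>
  define U where "U = P -` O1"
  have U: "open U" unfolding U_def by (rule continuous_open_vimage[OF O1(1)]) (rule linear_continuous_at[OF P(1)])
  have PU: "P x \<in> S" if "x \<in> U" for x using that P(2) O1(2) by (simp add: U_def)
  have SU: "S \<subseteq> U" using O1(2) P(3) by (auto simp: U_def)
  have z0U: "z0 \<in> U" using SU S(2) by blast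
  define \<theta> where "\<theta> x = x + R (\<eta> (P x) - A (P x))" for x
  have \<theta>S: "\<theta> z = z + R (\<eta> z - A z)" if "z \<in> E" for z using P(3) that by (simp add: \<theta>_def)
  have sm: "smooth_on U \<theta>"
    unfolding \<theta>_def
    by (intro smooth_on_add smooth_on_id smooth_on_bounded_linear_comp[OF R(1)] smooth_on_diff
        smooth_on_comp[OF smooth_on_bounded_linear[OF P(1)] \<eta>] smooth_on_bounded_linear_comp[OF A(1)] smooth_on_bounded_linear[OF P(1)])
      (rule PU)
  have Ck: "Ck_on k U \<theta>" for k by (rule smooth_on_open_Ck_on[OF sm U])
  have der: "(\<theta> has_derivative (\<lambda>v. v)) (at z0)"
  proof -
    obtain D where D: "(\<eta> has_derivative D) (at z0 within S)" by (rule smooth_on_has_derivative[OF \<eta> S(2)])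
    have DA: "D (P v) = A (P v)" for v
      using has_derivative_along_line(2)[OF E S _ D, of "P v"] A(2)[of "P v"] P(2) by simp
    have Pz: "P z0 = z0" using P(3) S(2) SE by blast
    have "(\<eta> has_derivative D) (at (P z0) within P ` U)"
      unfolding Pz by (rule has_derivative_subset[OF D]) (use PU in blast)
    from diff_chain_within[OF bounded_linear_imp_has_derivative[OF P(1)] this]
    have "((\<lambda>x. \<eta> (P x)) has_derivative (\<lambda>v. D (P v))) (at z0)"
      using at_within_open[OF z0U U] by (simp add: o_def)
    moreover have "((\<lambda>x. A (P x)) has_derivative (\<lambda>v. A (P v))) (at z0)"
      by (rule bounded_linear_imp_has_derivative[OF bounded_linear_compose[OF A(1) P(1)]])
    ultimately have "((\<lambda>x. \<eta> (P x) - A (P x)) has_derivative (\<lambda>v. D (P v) - A (P v))) (at z0)"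
      by (rule has_derivative_diff)
    from has_derivative_add[OF has_derivative_ident bounded_linear.has_derivative[OF R(1) this]]
    show ?thesis unfolding \<theta>_def using DA linear_0[OF bounded_linear.linear[OF R(1)]] by simp
  qed
  obtain U' V g where V: "open U'" "z0 \<in> U'" "U' \<subseteq> U" "open V" "homeomorphism U' V \<theta> g" "\<forall>k. Ck_on k V g"
    by (rule smooth_local_inverse[OF U Ck z0U der]) blast
  have hom: "g (\<theta> x) = x" "\<theta> x \<in> V" if "x \<in> U'" for x using V(5) that by (auto simp: homeomorphism_def)
  have hom': "\<theta> (g y) = y" "g y \<in> U'" if "y \<in> V" for y using V(5) that by (auto simp: homeomorphism_def)
  \<comment> \<open>\<open>R\<close> takes values in \<open>E\<close>, so the extended map preserves
    both \<open>E\<close> and its complement, and its local inverse restricts to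
    \<open>E\<close>.\<close>
  have \<theta>E: "\<theta> x \<in> E \<longleftrightarrow> x \<in> E" for x
  proof
    assume "\<theta> x \<in> E"
    then have "\<theta> x - R (\<eta> (P x) - A (P x)) \<in> E" using R(2) by (rule subspace_diff[OF E])
    then show "x \<in> E" by (simp add: \<theta>_def)
  next
    assume "x \<in> E"
    then show "\<theta> x \<in> E" unfolding \<theta>_def using R(2) by (rule subspace_add[OF E])
  qed
  obtain r where r: "r > 0" "ball (\<theta> z0) r \<subseteq> V" using V(4) hom(2)[OF V(2)] openE by blast
  define T1 where "T1 = E \<inter> ball (\<theta> z0) r"
  define S1 where "S1 = E \<inter> (U' \<inter> \<theta> -` ball (\<theta> z0) r)"
  have T1V: "T1 \<subseteq> V" using r(2) by (auto simp: T1_def)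
  have z0E: "z0 \<in> E" using S(2) SE by blast
  show thesis
  proof
    show "openin (top_of_set E) S1"
    proof -
      have "open (U' \<inter> \<theta> -` ball (\<theta> z0) r)"
        by (rule continuous_open_preimage[OF continuous_on_subset[OF smooth_on_continuous_on[OF sm] V(3)] V(1) open_ball])
      then show ?thesis unfolding S1_def by (rule openin_open_Int)
    qed
    show "z0 \<in> S1" using z0E V(2) r(1) by (simp add: S1_def)
    show "S1 \<subseteq> S"
    proof
      fix z assume "z \<in> S1"
      then have "z \<in> E" "z \<in> U" using V(3) by (auto simp: S1_def)
      then show "z \<in> S" using PU[of z] P(3) by simp
    qed
    show "openin (top_of_set E) T1" unfolding T1_def by (rule openin_open_Int[OF open_ball])
    show "convex T1" unfolding T1_def by (rule convex_Int[OF subspace_imp_convex[OF E] convex_ball])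
    show "(\<lambda>z. z + R (\<eta> z - A z)) ` S1 = T1"
    proof (intro equalityI subsetI)
      fix y assume "y \<in> (\<lambda>z. z + R (\<eta> z - A z)) ` S1"
      then obtain z where z: "z \<in> S1" "y = z + R (\<eta> z - A z)" by blast
      then have "z \<in> E" "\<theta> z \<in> ball (\<theta> z0) r" by (auto simp: S1_def)
      then show "y \<in> T1" using \<theta>S[of z] \<theta>E[of z] z(2) by (simp add: T1_def)
    next
      fix y assume y: "y \<in> T1"
      then have yV: "y \<in> V" using T1V by blast
      have "g y \<in> E" using \<theta>E[of "g y"] hom'(1)[OF yV] y by (simp add: T1_def)
      moreover have "g y \<in> S1" using hom'[OF yV] y \<open>g y \<in> E\<close> by (simp add: S1_def T1_def)
      ultimately show "y \<in> (\<lambda>z. z + R (\<eta> z - A z)) ` S1" using \<theta>S[OF \<open>g y \<in> E\<close>] hom'(1)[OF yV] by (intro image_eqI[of _ _ "g y"]) simp_all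
    qed
    show "\<forall>z\<in>S1. g (z + R (\<eta> z - A z)) = z"
    proof
      fix z assume "z \<in> S1"
      then have "z \<in> E" "z \<in> U'" by (auto simp: S1_def)
      then show "g (z + R (\<eta> z - A z)) = z" by (simp only: \<theta>S[symmetric] hom(1))
    qed
    show "smooth_on T1 g" by (rule smooth_on_subset[OF smooth_on_open[OF V(4) V(6)[rule_format]] T1V])
  qed
qed

text \<open>On the orthogonal complement of its kernel within \<open>E\<close>, the map
  \<open>A\<close> is injective and has the same image as on \<open>E\<close>.\<close>

lemma rank_nullity_subspace:
  fixes A :: "'e::euclidean_space \<Rightarrow> 'f::euclidean_space"
  assumes "subspace E" "bounded_linear A"
  shows "dim {x \<in> E. A x = 0} + dim (A ` E) = dim E"
proof -
  have lin: "linear A" by (rule bounded_linear.linear[OF assms(2)])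
  define K where "K = {x \<in> E. A x = 0}"
  define C where "C = {y \<in> E. \<forall>x\<in>K. orthogonal x y}"
  have K: "subspace K"
    unfolding K_def using assms(1) by (auto simp: subspace_def linear_0[OF lin] linear_add[OF lin] linear_scale[OF lin])
  have C: "subspace C"
    unfolding C_def using assms(1) by (auto simp: subspace_def orthogonal_def inner_right_distrib)
  have "dim C + dim K = dim E"
    unfolding C_def by (rule dim_subspace_orthogonal_to_vectors[OF K assms(1)]) (auto simp: K_def)
  moreover have "inj_on A C"
  proof (rule inj_onI)
    fix x y assume xy: "x \<in> C" "y \<in> C" "A x = A y"
    have 1: "x - y \<in> C" by (rule subspace_diff[OF C xy(1,2)])
    then have "x - y \<in> K" using xy(3) by (simp add: K_def C_def linear_diff[OF lin])
    then have "orthogonal (x - y) (x - y)" using 1 by (simp add: C_def)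
    then show "x = y" by (simp add: orthogonal_def)
  qed
  then have "dim (A ` C) = dim C" using C by (intro dim_image_eq[OF lin]) (simp add: span_eq_iff[THEN iffD2])
  moreover have "A ` C = A ` E"
  proof (intro equalityI subsetI)
    fix y assume "y \<in> A ` E"
    then obtain e where e: "e \<in> E" "y = A e" by blast
    obtain u z where uz: "u \<in> span K" "\<forall>w\<in>span K. orthogonal z w" "e = u + z"
      by (rule orthogonal_subspace_decomp_exists[of K e]) blast
    have u: "u \<in> K" using uz(1) K by (simp add: span_eq_iff[THEN iffD2])
    have "z = e - u" using uz(3) by simp
    then have "z \<in> E" "A z = y" using u e subspace_diff[OF assms(1)] by (auto simp: K_def linear_diff[OF lin])
    moreover have "\<forall>x\<in>K. orthogonal x z" using uz(2) span_base orthogonal_commute by blast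
    ultimately show "y \<in> A ` C" by (auto simp: C_def)
  qed (auto simp: C_def)
  ultimately show ?thesis by (simp add: K_def)
qed

text \<open>\<open>sat\<close> says that a leaf contains every fibre it meets; in this form the
  inclusion of the fibres in the leaves enters. \<open>h\<close> stands for
  \<open>\<pi>\<close>.\<close>

locale saturated_foliation = submersion M W h
  for M :: "('a, 'e::euclidean_space) manifold" and W :: "('b, 'f::euclidean_space) manifold" and h :: "'a \<Rightarrow> 'b" +
  fixes F :: "'a set set" and q :: nat
  assumes fol: "foliation M q F"
    and sat: "L \<in> F \<Longrightarrow> x \<in> L \<Longrightarrow> y \<in> topspace (points M) \<Longrightarrow> h y = h x \<Longrightarrow> y \<in> L"
begin

lemma part: "partition_on M.X F" using fol by (simp add: foliation_def)

lemma leaf_pc: "L \<in> F \<Longrightarrow> path_connectedin (points M) L" using fol by (simp add: foliation_def)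

lemma leaf_X: "L \<in> F \<Longrightarrow> L \<subseteq> M.X" using part by (auto simp: partition_on_def)

lemma leaf_exists: "m \<in> M.X \<Longrightarrow> \<exists>L\<in>F. m \<in> L" using part by (auto simp: partition_on_def)

lemma leaf_disjoint: "L \<in> F \<Longrightarrow> L' \<in> F \<Longrightarrow> x \<in> L \<Longrightarrow> x \<in> L' \<Longrightarrow> L = L'"
  using part unfolding partition_on_def disjoint_def by blast

lemma foliated_chart_at:
  assumes "m \<in> M.X"
  obtains k V where "k \<in> charts_at M m" "M.foliated_chart F k V" "dim V + q = dim M.E"
proof -
  obtain k V where "k \<in> charts_at M m" "subspace V \<and> V \<subseteq> model M \<and> dim V + q = dim (model M) \<and>
        (\<forall>L\<in>F. \<forall>x\<in>L \<inter> fst k.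
           path_component_of_set (subtopology (points M) (L \<inter> fst k)) x
             = {y \<in> fst k. snd k y - snd k x \<in> V})"
    using fol assms unfolding foliation_def by blast
  then show thesis using that[of k V] M.charts_at_chart(1)[of k m] unfolding M.foliated_chart_def by blast
qed

definition FW :: "'b set set" where "FW = (\<lambda>L. h ` L) ` F"

lemma in_image_leaf: "L \<in> F \<Longrightarrow> y \<in> M.X \<Longrightarrow> h y \<in> h ` L \<Longrightarrow> y \<in> L"
  using sat by blast

lemma FW_partition: "partition_on W.X FW"
proof (rule partition_onI)
  have "\<Union>FW = h ` \<Union>F" unfolding FW_def by auto
  then show "\<Union>FW = W.X" using surj part by (simp add: partition_on_def)
  show "{} \<notin> FW"
    using part unfolding FW_def partition_on_def by auto
  fix p p' assume p: "p \<in> FW" "p' \<in> FW" "p \<noteq> p'"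
  then obtain L L' where L: "L \<in> F" "p = h ` L" "L' \<in> F" "p' = h ` L'" unfolding FW_def by blast
  show "disjnt p p'"
    unfolding disjnt_def
  proof (rule ccontr)
    assume "p \<inter> p' \<noteq> {}"
    then obtain x where x: "x \<in> L" "h x \<in> h ` L'" using L by blast
    then have "x \<in> L'" using in_image_leaf[OF L(3)] leaf_X[OF L(1)] by blast
    then have "L = L'" by (rule leaf_disjoint[OF L(1,3) x(1)])
    then show False using L p by simp
  qed
qed

lemma FW_path_connected: "p \<in> FW \<Longrightarrow> path_connectedin (points W) p"
  unfolding FW_def using path_connectedin_continuous_map_image[OF h_cont leaf_pc] by blast

text \<open>The plaques near \<open>w\<close> are level sets of \<open>\<eta>\<close>: follow a
  local section, pass to a foliated chart of \<open>M\<close>, and divide by \<open>V\<close>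
  through \<open>\<rho>\<close>. As \<open>\<eta> (p z)\<close> agrees with the plaque function
  \<open>\<rho> (\<phi> z)\<close> of \<open>M\<close>, the choice of section is immaterial and the
  derivative \<open>A0\<close> of \<open>\<eta>\<close> has rank \<open>q\<close>. Straightening
  \<open>\<eta>\<close> to \<open>A0\<close> yields slices by the kernel \<open>K\<close> of
  \<open>A0\<close>.\<close>

lemma foliated_chart_image:
  assumes w: "w \<in> W.X"
  obtains d' K where "d' \<in> charts_at W w" "W.foliated_chart FW d' K" "dim K + q = dim W.E"
proof -
  obtain m where m: "m \<in> M.X" "h m = w" using surj w by (metis imageE)
  obtain c d p J where sf: "submersion_form M W h c d p J" "m \<in> fst c" using form_at[OF m(1)] by blast
  interpret sc: submersion_chart M W h c d p J by unfold_locales (rule sf(1))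
  obtain k V where kk: "k \<in> charts_at M m" and fk: "M.foliated_chart F k V" and dimV: "dim V + q = dim M.E"
    by (rule foliated_chart_at[OF m(1)])
  note k = M.charts_at_chart[OF kk]
  have V: "subspace V" "V \<subseteq> M.E" using fk by (auto simp: M.foliated_chart_def)
  define Z where "Z = snd c m"
  define z0 where "z0 = snd d w"
  have ck: "openin (top_of_set M.E) (snd c ` (fst c \<inter> fst k))" by (rule M.c_open_image[OF sc.c M.c_open[OF k(1)]])
  obtain O1 where O1: "open O1" "snd c ` (fst c \<inter> fst k) = M.E \<inter> O1" using ck openin_open by blast
  have "Z \<in> snd c ` (fst c \<inter> fst k)" unfolding Z_def using sf(2) k(2) by blast
  then have "Z \<in> O1" using O1(2) by blast
  \<comment> \<open>A ball makes \<open>BE\<close> convex, so it contains the segment between any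
    two of its points.\<close>
  then obtain r where r: "r > 0" "ball Z r \<subseteq> O1" using O1(1) openE by blast
  define BE where "BE = M.E \<inter> ball Z r"
  have BEck: "BE \<subseteq> snd c ` (fst c \<inter> fst k)" using r(2) O1(2) by (auto simp: BE_def)
  have BEop: "openin (top_of_set M.E) BE" unfolding BE_def by (rule openin_open_Int[OF open_ball])
  have ZB: "Z \<in> BE" using r(1) M.c_model[OF sc.c sf(2)] by (simp add: BE_def Z_def)
  have ciB: "chart_inv c z \<in> fst c" "chart_inv c z \<in> fst k" "snd c (chart_inv c z) = z" if "z \<in> BE" for z
  proof -
    have zi: "z \<in> snd c ` (fst c \<inter> fst k)" using that BEck by blast
    show "chart_inv c z \<in> fst c" "chart_inv c z \<in> fst k" using M.c_inv_mem[OF sc.c zi] by auto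
    show "snd c (chart_inv c z) = z" using chart_inv_right[OF zi] by auto
  qed
  \<comment> \<open>Fibres of \<open>h\<close> inside a convex coordinate ball are connected, hence lie in single plaques of \<open>F\<close>.\<close>
  have plaque: "snd k (chart_inv c z') - snd k (chart_inv c z) \<in> V" if z: "z \<in> BE" "z' \<in> BE" "p z = p z'" for z z'
  proof -
    obtain L where L: "L \<in> F" "chart_inv c z \<in> L"
      using leaf_exists[of "chart_inv c z"] sc.in_X[OF ciB(1)[OF z(1)]] by blast
    have cvx: "closed_segment z z' \<subseteq> BE"
      unfolding BE_def
      by (rule closed_segment_subset) (use z convex_Int[OF subspace_imp_convex[OF M.subspace_E] convex_ball[of Z r]] in \<open>auto simp: BE_def\<close>)
    have lin: "linear p" by (rule bounded_linear.linear[OF sc.p])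
    have peq: "p y = p z" if yz: "y \<in> closed_segment z z'" for y
    proof -
      obtain u where "y = (1 - u) *\<^sub>R z + u *\<^sub>R z'" using yz by (auto simp: closed_segment_def)
      then show ?thesis using z(3) by (simp add: linear_add[OF lin] linear_scale[OF lin] scaleR_left_distrib[symmetric])
    qed
    have "h (chart_inv c y) = h (chart_inv c z)" if "y \<in> closed_segment z z'" for y
    proof -
      have y: "y \<in> BE" using that cvx by blast
      have "snd d (h (chart_inv c y)) = snd d (h (chart_inv c z))"
        using sc.h_snd[OF ciB(1)[OF y]] sc.h_snd[OF ciB(1)[OF z(1)]] ciB(3)[OF y] ciB(3)[OF z(1)] peq[OF that] by simp
      then show ?thesis using inj_onD[OF W.c_inj[OF sc.d]] sc.h_fst ciB(1)[OF y] ciB(1)[OF z(1)] by blast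
    qed
    then have inL: "chart_inv c y \<in> L" if "y \<in> closed_segment z z'" for y
      using sat[OF L sc.in_X[OF ciB(1)]] that cvx by blast
    have "path_connectedin (points M) (chart_inv c ` closed_segment z z')"
    proof (rule path_connectedin_continuous_map_image[OF M.c_inv_cont[OF sc.c]])
      show "path_connectedin (top_of_set (snd c ` fst c)) (closed_segment z z')"
        using cvx BEck by (auto simp: path_connectedin_subtopology path_connectedin_euclidean intro!: convex_imp_path_connected)
    qed
    then show ?thesis
      by (rule M.foliated_chart_connected[OF fk L(1)]) (use inL ciB cvx in auto)
  qed
  obtain pV where pV: "bounded_linear pV" "\<forall>x. pV x \<in> V" "\<forall>x\<in>V. pV x = x"
    by (rule linear_projection_exists[OF V(1)]) blast
  \<comment> \<open>A linear map with kernel exactly \<open>V\<close>: it represents reduction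
    modulo \<open>V\<close> inside the same Euclidean space.\<close>
  define \<rho> where "\<rho> v = v - pV v" for v
  have l: "bounded_linear \<rho>" unfolding \<rho>_def by (rule bounded_linear_sub[OF bounded_linear_ident pV(1)])
  have lV: "\<rho> v = 0 \<longleftrightarrow> v \<in> V" for v using pV(2,3) unfolding \<rho>_def by (metis eq_iff_diff_eq_0)
  note ll = bounded_linear.linear[OF l]
  define \<phi> where "\<phi> z = snd k (chart_inv c z)" for z
  have sm\<phi>: "smooth_on BE \<phi>"
    unfolding \<phi>_def by (rule smooth_on_subset[OF M.smooth_transition[OF sc.c k(1)] BEck])
  define \<eta> where "\<eta> z = \<rho> (\<phi> (sc.sec m z))" for z
  define S where "S = {z \<in> W.E. sc.sec m z \<in> BE}"
  have Sop: "openin (top_of_set W.E) S" unfolding S_def by (rule sc.sec_preimage_open[OF sf(2) BEop])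
  have z0E: "z0 \<in> W.E" unfolding z0_def m(2)[symmetric] by (rule W.c_model[OF sc.d sc.h_fst[OF sf(2)]])
  have secz0: "sc.sec m z0 = Z" unfolding z0_def Z_def m(2)[symmetric] by (rule sc.sec_base)
  have z0S: "z0 \<in> S" using z0E secz0 ZB by (simp add: S_def)
  have sm\<eta>: "smooth_on S \<eta>"
    unfolding \<eta>_def
    by (rule smooth_on_bounded_linear_comp[OF l smooth_on_comp[OF sc.sec_smooth sm\<phi>]]) (simp add: S_def)
  \<comment> \<open>\<open>z\<close> and \<open>sc.sec m (p z)\<close> have the same image under
    \<open>p\<close>, so they belong to one fibre and hence to one plaque.\<close>
  have \<eta>p: "\<eta> (p z) = \<rho> (\<phi> z)" if z: "z \<in> BE" "p z \<in> S" for z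
  proof -
    have "sc.sec m (p z) \<in> BE" "p z \<in> W.E" using z(2) by (auto simp: S_def)
    then have "\<phi> (sc.sec m (p z)) - \<phi> z \<in> V"
      unfolding \<phi>_def using plaque[OF z(1), of "sc.sec m (p z)"] sc.p_sec[OF sf(2), of "p z"] by simp
    then have "\<rho> (\<phi> (sc.sec m (p z)) - \<phi> z) = 0" using lV by blast
    then show ?thesis unfolding \<eta>_def by (simp add: linear_diff[OF ll])
  qed
  obtain A0 where A0: "(\<eta> has_derivative A0) (at z0 within S)" by (rule smooth_on_has_derivative[OF sm\<eta> z0S])
  note A = has_derivative_bounded_linear[OF A0]
  have Av: "A0 v = dir_deriv \<eta> z0 v" if "v \<in> W.E" for v
    by (rule has_derivative_along_line(2)[OF W.subspace_E Sop z0S that A0, symmetric])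
  note lA = bounded_linear.linear[OF A]
  let ?D\<phi> = "\<lambda>v. dir_deriv \<phi> Z v"
  \<comment> \<open>Derivative of \<open>\<eta> (p z) = \<rho> (\<phi> z)\<close> at
    \<open>Z\<close>. As \<open>p\<close> is onto and the derivative of the transition map is onto,
    \<open>A0\<close> will have the same image as \<open>\<rho>\<close>.\<close>
  have Ap: "A0 (p v) = \<rho> (?D\<phi> v)" if v: "v \<in> M.E" for v
  proof -
    have pz: "p Z = z0" unfolding z0_def m(2)[symmetric] Z_def by (rule sc.h_snd[OF sf(2), symmetric])
    obtain O2 where O2: "open O2" "S = W.E \<inter> O2" using Sop openin_open by blast
    have "open (p -` O2)" by (rule continuous_open_vimage[OF O2(1)]) (rule linear_continuous_at[OF sc.p])
    then have BSop: "openin (top_of_set M.E) (BE \<inter> p -` O2)" by (rule openin_Int_open[OF BEop])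
    have ZBS: "Z \<in> BE \<inter> p -` O2" using ZB pz z0S O2 by simp
    have inS: "p z \<in> S" if "z \<in> BE \<inter> p -` O2" for z using that O2 sc.p_mem[of z] by (auto simp: BE_def)
    have "A0 (p v) = dir_deriv \<eta> (p Z) (dir_deriv p Z v)"
      using Av[OF sc.p_mem[OF v]] pz dir_deriv_bounded_linear[OF sc.p] by simp
    also have "\<dots> = dir_deriv (\<lambda>z. \<eta> (p z)) Z v"
      by (rule dir_deriv_comp[OF M.subspace_E BSop ZBS v smooth_on_bounded_linear[OF sc.p] W.subspace_E Sop sm\<eta> inS, symmetric])
        (use dir_deriv_bounded_linear[OF sc.p] sc.p_mem[OF v] in simp_all)
    also have "\<dots> = dir_deriv (\<lambda>z. \<rho> (\<phi> z)) Z v"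
      by (rule dir_deriv_cong[OF M.subspace_E BSop ZBS v]) (use \<eta>p inS in blast)
    also have "\<dots> = \<rho> (?D\<phi> v)"
      by (rule dir_deriv_bounded_linear_comp[OF M.subspace_E BEop ZB v sm\<phi> l])
    finally show ?thesis .
  qed
  have D\<phi>: "?D\<phi> ` M.E = M.E"
  proof (intro equalityI subsetI)
    note tr = M.trans_mem[OF sc.c_at[OF sf(2)] kk] M.trans_mem[OF kk sc.c_at[OF sf(2)]] M.trans_trans[OF kk sc.c_at[OF sf(2)] kk] M.trans_id[OF kk]
    show "y \<in> M.E" if "y \<in> ?D\<phi> ` M.E" for y using that tr(1) unfolding \<phi>_def Z_def by blast
    fix y assume y: "y \<in> M.E"
    have "y = ?D\<phi> (dir_deriv (\<lambda>z. snd c (chart_inv k z)) (snd k m) y)"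
      using tr(3)[OF y] tr(4)[OF y] unfolding \<phi>_def Z_def by simp
    then show "y \<in> ?D\<phi> ` M.E" using tr(2)[OF y] by blast
  qed
  have img: "A0 ` W.E = \<rho> ` M.E"
  proof (intro equalityI subsetI)
    fix y assume "y \<in> A0 ` W.E"
    then obtain u where u: "u \<in> W.E" "y = A0 u" by blast
    have "y = \<rho> (?D\<phi> (J u))" using Ap[OF sc.J_mem[of u]] sc.pJ[OF u(1)] u(2) by simp
    then show "y \<in> \<rho> ` M.E" using D\<phi> sc.J_mem[of u] by blast
  next
    fix y assume "y \<in> \<rho> ` M.E"
    then obtain v where v: "v \<in> M.E" "y = \<rho> (?D\<phi> v)" using D\<phi> by (metis imageE)
    then show "y \<in> A0 ` W.E" using Ap[OF v(1)] sc.p_mem[OF v(1)] by (metis imageI)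
  qed
  define K where "K = {y \<in> W.E. A0 y = 0}"
  have K: "subspace K" "K \<subseteq> W.E"
    unfolding K_def using W.subspace_E by (auto simp: subspace_def linear_0[OF lA] linear_add[OF lA] linear_scale[OF lA])
  have dimK: "dim K + q = dim W.E"
  proof -
    have "{x \<in> M.E. \<rho> x = 0} = V" using lV V(2) by auto
    then have "dim V + dim (\<rho> ` M.E) = dim M.E" using rank_nullity_subspace[OF M.subspace_E l] by simp
    then have "dim (A0 ` W.E) = q" using dimV img by simp
    then show ?thesis using rank_nullity_subspace[OF W.subspace_E A] unfolding K_def by simp
  qed
  obtain R where R: "range R \<subseteq> W.E" "linear R" "\<forall>v\<in>A0 ` W.E. A0 (R v) = v"
    using linear_exists_right_inverse_on[OF lA W.subspace_E] by auto
  have Rb: "bounded_linear R" "\<And>y. R y \<in> W.E" using R by (auto simp: linear_conv_bounded_linear)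
  obtain S1 T1 g where ST: "openin (top_of_set W.E) S1" "z0 \<in> S1" "S1 \<subseteq> S" "openin (top_of_set W.E) T1" "convex T1"
    "(\<lambda>z. z + R (\<eta> z - A0 z)) ` S1 = T1" "\<forall>z\<in>S1. g (z + R (\<eta> z - A0 z)) = z" "smooth_on T1 g"
    by (rule smooth_straightening[OF W.subspace_E Sop z0S sm\<eta> Rb A Av])
  define \<theta> where "\<theta> z = z + R (\<eta> z - A0 z)" for z
  have S1E: "S1 \<subseteq> W.E" by (rule openin_imp_subset[OF ST(1)])
  \<comment> \<open>Values of \<open>\<eta>\<close> and of \<open>A0\<close> both lie in the image
    of \<open>A0\<close>, where \<open>R\<close> is a right inverse; hence \<open>\<theta>\<close>
    turns \<open>\<eta>\<close> into a linear map.\<close>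
  have A\<theta>: "A0 (\<theta> z) = \<eta> z" if z: "z \<in> S1" for z
  proof -
    have "z \<in> W.E" "sc.sec m z \<in> BE" using z ST(3) by (auto simp: S_def)
    then have "\<phi> (sc.sec m z) \<in> M.E" using M.c_model[OF k(1)] ciB(2) unfolding \<phi>_def by blast
    then have "\<eta> z \<in> A0 ` W.E" unfolding \<eta>_def img by blast
    moreover have "A0 z \<in> A0 ` W.E" using \<open>z \<in> W.E\<close> by blast
    ultimately have "\<eta> z - A0 z \<in> A0 ` W.E" using subspace_diff[OF linear_subspace_image[OF lA W.subspace_E]] by blast
    then have "A0 (R (\<eta> z - A0 z)) = \<eta> z - A0 z" using R(3) by blast
    then show ?thesis unfolding \<theta>_def by (simp add: linear_add[OF lA])
  qed
  have S1d: "S1 \<subseteq> snd d ` fst d"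
  proof
    fix z assume "z \<in> S1"
    then have z: "z \<in> W.E" "sc.sec m z \<in> BE" using ST(3) by (auto simp: S_def)
    have "snd d (h (chart_inv c (sc.sec m z))) = z"
      using sc.h_snd[OF ciB(1)[OF z(2)]] ciB(3)[OF z(2)] sc.p_sec[OF sf(2) z(1)] by simp
    then show "z \<in> snd d ` fst d" using sc.h_fst[OF ciB(1)[OF z(2)]] by (metis imageI)
  qed
  let ?d = "({x \<in> fst d. snd d x \<in> S1}, \<lambda>x. \<theta> (snd d x))"
  have \<theta>S1: "\<theta> ` S1 = T1" using ST(6) by (simp add: \<theta>_def[abs_def])
  have g\<theta>: "g (\<theta> z) = z" if "z \<in> S1" for z using ST(7) that by (simp add: \<theta>_def)
  have sm\<theta>: "smooth_on S1 \<theta>"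
    unfolding \<theta>_def
    by (intro smooth_on_add smooth_on_id smooth_on_bounded_linear_comp[OF Rb(1)] smooth_on_diff smooth_on_subset[OF sm\<eta> ST(3)] smooth_on_bounded_linear[OF A])
  have dch: "?d \<in> charts W" by (rule W.chart_change[OF sc.d ST(1) S1d ST(4) \<theta>S1 g\<theta> sm\<theta> ST(8)])
  define \<sigma> where "\<sigma> x = chart_inv c (sc.sec m (snd d x))" for x
  have \<sigma>: "\<sigma> x \<in> fst c" "\<sigma> x \<in> fst k" "h (\<sigma> x) = x" if x: "x \<in> fst ?d" for x
  proof -
    have xd: "x \<in> fst d" "snd d x \<in> W.E" "sc.sec m (snd d x) \<in> BE" using x ST(3) by (auto simp: S_def)
    show 1: "\<sigma> x \<in> fst c" "\<sigma> x \<in> fst k" unfolding \<sigma>_def using ciB(1,2)[OF xd(3)] by auto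
    have "snd d (h (\<sigma> x)) = snd d x"
      using sc.h_snd[OF 1(1)] ciB(3)[OF xd(3)] sc.p_sec[OF sf(2) xd(2)] by (simp add: \<sigma>_def)
    then show "h (\<sigma> x) = x" using inj_onD[OF W.c_inj[OF sc.d]] sc.h_fst[OF 1(1)] xd(1) by blast
  qed
  \<comment> \<open>Lying in one slice of the new chart corresponds, through the section
    \<open>\<sigma>\<close>, to lying in one slice of the foliated chart of
    \<open>M\<close>.\<close>
  have slice: "\<theta> (snd d y) - \<theta> (snd d x) \<in> K \<longleftrightarrow> snd k (\<sigma> y) - snd k (\<sigma> x) \<in> V" if xy: "x \<in> fst ?d" "y \<in> fst ?d" for x y
  proof -
    have S1: "snd d x \<in> S1" "snd d y \<in> S1" using xy by auto
    have E: "\<theta> (snd d y) - \<theta> (snd d x) \<in> W.E"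
      using subspace_diff[OF W.subspace_E] S1 \<theta>S1 openin_imp_subset[OF ST(4)] by blast
    have "\<theta> (snd d y) - \<theta> (snd d x) \<in> K \<longleftrightarrow> \<eta> (snd d y) = \<eta> (snd d x)"
      unfolding K_def using E A\<theta>[OF S1(1)] A\<theta>[OF S1(2)] by (simp add: linear_diff[OF lA])
    also have "\<dots> \<longleftrightarrow> \<rho> (snd k (\<sigma> y) - snd k (\<sigma> x)) = 0"
      unfolding \<eta>_def \<phi>_def \<sigma>_def by (simp add: linear_diff[OF ll])
    finally show ?thesis using lV by simp
  qed
  have \<sigma>cont: "continuous_map (subtopology (points W) (fst ?d)) (points M) \<sigma>"
  proof -
    have "continuous_map (subtopology (points W) (fst ?d)) (top_of_set S1) (snd d)"
      using continuous_map_from_subtopology_mono[OF W.c_cont[OF sc.d], of "fst ?d"] W.c_open[OF dch] openin_subset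
      by (auto simp: continuous_map_in_subtopology topspace_subtopology)
    moreover have "continuous_map (top_of_set S1) (top_of_set (snd c ` fst c)) (sc.sec m)"
      using smooth_on_continuous_on[OF sc.sec_smooth] ST(3) BEck by (auto simp: S_def)
    ultimately have "continuous_map (subtopology (points W) (fst ?d)) (top_of_set (snd c ` fst c)) (sc.sec m \<circ> snd d)"
      by (rule continuous_map_compose)
    from continuous_map_compose[OF this M.c_inv_cont[OF sc.c]] show ?thesis unfolding \<sigma>_def o_def .
  qed
  have "W.foliated_chart FW ?d K"
    unfolding W.foliated_chart_def
  proof (intro conjI dch K ballI)
    fix Lw x assume Lw: "Lw \<in> FW" and x: "x \<in> Lw \<inter> fst ?d"
    obtain L where L: "L \<in> F" "Lw = h ` L" using Lw unfolding FW_def by blast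
    have xd: "x \<in> fst ?d" using x by blast
    have \<sigma>L: "\<sigma> y \<in> L" if "y \<in> Lw" "y \<in> fst ?d" for y
      by (rule in_image_leaf[OF L(1) sc.in_X[OF \<sigma>(1)[OF that(2)]]]) (use \<sigma>(3)[OF that(2)] that(1) L(2) in simp)
    show "path_component_of_set (subtopology (points W) (Lw \<inter> fst ?d)) x = {y \<in> fst ?d. snd ?d y - snd ?d x \<in> K}"
    proof (intro equalityI subsetI)
      fix y assume y: "y \<in> path_component_of_set (subtopology (points W) (Lw \<inter> fst ?d)) x"
      \<comment> \<open>The section carries this component into \<open>L\<close> inside the foliated
        chart, where a path connected set stays in one plaque.\<close>
      let ?C = "path_component_of_set (subtopology (points W) (Lw \<inter> fst ?d)) x"
      have pcC: "path_connectedin (subtopology (points W) (Lw \<inter> fst ?d)) ?C" by (rule path_connectedin_path_component_of)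
      then have C: "path_connectedin (points W) ?C" "?C \<subseteq> Lw \<inter> fst ?d" by (simp_all add: path_connectedin_subtopology)
      have xC: "x \<in> ?C" using y by (metis (no_types) mem_Collect_eq path_component_of_sym path_component_of_trans)
      have "path_connectedin (subtopology (points W) (fst ?d)) ?C" using C by (simp add: path_connectedin_subtopology)
      then have "path_connectedin (points M) (\<sigma> ` ?C)" by (rule path_connectedin_continuous_map_image[OF \<sigma>cont])
      then have "snd k (\<sigma> y) - snd k (\<sigma> x) \<in> V"
        by (rule M.foliated_chart_connected[OF fk L(1)]) (use \<sigma>L \<sigma>(2) C(2) xC y in blast)+
      then show "y \<in> {y \<in> fst ?d. snd ?d y - snd ?d x \<in> K}" using slice[OF xd, of y] C(2) y by auto
    next
      fix y assume y: "y \<in> {y \<in> fst ?d. snd ?d y - snd ?d x \<in> K}"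
      \<comment> \<open>The slice of the convex set \<open>T1\<close> through \<open>x\<close> is
        convex, so its preimage in \<open>W\<close> is path connected; by \<open>slice\<close> it
        lies in the leaf.\<close>
      let ?H = "T1 \<inter> (\<lambda>v. v + \<theta> (snd d x)) ` K"
      have "snd d ` {x \<in> fst d. snd d x \<in> S1} = S1" using S1d by blast
      then have "\<theta> ` snd d ` {x \<in> fst d. snd d x \<in> S1} = T1" using \<theta>S1 by simp
      then have Himg: "snd ?d ` fst ?d = T1" by (simp add: image_image)
      have "convex ?H"
      proof (rule convex_Int[OF ST(5)])
        have "(\<lambda>v. v + \<theta> (snd d x)) = (+) (\<theta> (snd d x))" by (rule ext) (simp add: add.commute)
        then show "convex ((\<lambda>v. v + \<theta> (snd d x)) ` K)" by (simp only: convex_translation[OF subspace_imp_convex[OF K(1)]])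
      qed
      then have "path_connectedin (top_of_set (snd ?d ` fst ?d)) ?H"
        unfolding Himg by (simp add: path_connectedin_subtopology path_connectedin_euclidean convex_imp_path_connected)
      then have pc: "path_connectedin (points W) (chart_inv ?d ` ?H)"
        by (rule path_connectedin_continuous_map_image[OF W.c_inv_cont[OF dch]])
      have mem: "s \<in> chart_inv ?d ` ?H" if s: "s \<in> fst ?d" "snd ?d s - snd ?d x \<in> K" for s
      proof -
        have "snd ?d s \<in> T1" using s(1) Himg by blast
        moreover have "snd ?d s = (snd ?d s - snd ?d x) + \<theta> (snd d x)" by simp
        ultimately have "snd ?d s \<in> ?H" using s(2) by blast
        moreover have "s = chart_inv ?d (snd ?d s)" using W.c_left[OF dch s(1)] by simp
        ultimately show ?thesis by blast
      qed
      have sub: "chart_inv ?d ` ?H \<subseteq> Lw \<inter> fst ?d"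
      proof
        fix s assume "s \<in> chart_inv ?d ` ?H"
        then obtain v where v: "v \<in> K" "v + \<theta> (snd d x) \<in> T1" "s = chart_inv ?d (v + \<theta> (snd d x))" by blast
        have img: "v + \<theta> (snd d x) \<in> snd ?d ` fst ?d" using v(2) Himg by simp
        have s: "s \<in> fst ?d" using W.c_inv_mem[OF dch img] v(3) by blast
        have "snd ?d s = v + \<theta> (snd d x)" using chart_inv_right[OF img] v(3) by blast
        then have "\<theta> (snd d s) - \<theta> (snd d x) \<in> K" using v(1) by simp
        then have "snd k (\<sigma> s) - snd k (\<sigma> x) \<in> V" using slice[OF xd s] by blast
        then have "\<sigma> s \<in> L"
          using M.foliated_chart_leaf[OF fk L(1) \<sigma>L[OF _ xd] \<sigma>(2)[OF xd] \<sigma>(2)[OF s]] x by blast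
        then have "s \<in> Lw" using \<sigma>(3)[OF s] L(2) by (metis imageI)
        then show "s \<in> Lw \<inter> fst ?d" using s by blast
      qed
      have "path_connectedin (subtopology (points W) (Lw \<inter> fst ?d)) (chart_inv ?d ` ?H)"
        using pc sub by (simp add: path_connectedin_subtopology)
      moreover have "x \<in> chart_inv ?d ` ?H" by (rule mem[OF xd]) (simp add: subspace_0[OF K(1)])
      ultimately have "chart_inv ?d ` ?H \<subseteq> path_component_of_set (subtopology (points W) (Lw \<inter> fst ?d)) x"
        by (rule path_component_of_maximal)
      then show "y \<in> path_component_of_set (subtopology (points W) (Lw \<inter> fst ?d)) x" using mem y by blast
    qed
  qed
  moreover have "?d \<in> charts_at W w"
    using W.charts_atI[OF dch] sc.h_fst[OF sf(2)] m(2) ST(2) by (simp add: z0_def)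
  ultimately show thesis using that dimK by blast
qed

lemma FW_foliation: "foliation W q FW"
  unfolding foliation_def
proof (intro conjI ballI FW_partition FW_path_connected)
  fix w assume "w \<in> W.X"
  then obtain d' K where *: "d' \<in> charts_at W w" "W.foliated_chart FW d' K" "dim K + q = dim W.E"
    by (rule foliated_chart_image)
  then show "\<exists>c\<in>charts_at W w. \<exists>V. subspace V \<and> V \<subseteq> W.E \<and> dim V + q = dim W.E \<and>
        (\<forall>L\<in>FW. \<forall>x\<in>L \<inter> fst c.
           path_component_of_set (subtopology (points W) (L \<inter> fst c)) x = {y \<in> fst c. snd c y - snd c x \<in> V})"
    unfolding W.foliated_chart_def by blast
qed

end

section \<open>Projecting leaf tangent vectors and normal classes\<close>

lemma (in smooth_mfd) velocity_cong:
  assumes \<gamma>: "smooth_curve M I \<gamma>" and \<gamma>': "smooth_curve M I \<gamma>'" and I: "open I" "0 \<in> I"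
    and eq: "\<And>t. t \<in> I \<Longrightarrow> \<gamma> t = \<gamma>' t"
  shows "velocity M \<gamma> 0 = velocity M \<gamma>' 0"
proof -
  have "\<gamma> 0 \<in> X" using \<gamma> I(2) by (auto simp: smooth_curve_def continuous_map_def)
  then obtain c where cc: "c \<in> charts_at M (\<gamma> 0)" using ex_chart_at by blast
  have 0: "\<gamma> 0 = \<gamma>' 0" by (rule eq[OF I(2)])
  have cc': "c \<in> charts_at M (\<gamma>' 0)" using cc 0 by simp
  show ?thesis
  proof (rule tangent_eqI[OF velocity_tangent[OF \<gamma> I] _ cc])
    show "velocity M \<gamma>' 0 \<in> tangent_space M (\<gamma> 0)" unfolding 0 by (rule velocity_tangent[OF \<gamma>' I])
    show "velocity M \<gamma> 0 c = velocity M \<gamma>' 0 c"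
      unfolding velocity_rep[of c \<gamma>, OF cc] velocity_rep[of c \<gamma>', OF cc']
      by (rule dir_deriv_cong[OF subspace_UNIV _ I(2) UNIV_I]) (use I eq in auto)
  qed
qed

locale foliated_mfd = smooth_mfd M for M :: "('a, 'e::euclidean_space) manifold" +
  fixes q :: nat and F :: "'a set set"
  assumes foliation: "foliation M q F"
begin

abbreviation "T \<equiv> leaf_tangent M F"
abbreviation "nc \<equiv> normal_class M F"

lemma T_chart:
  assumes "m \<in> X"
  obtains k V where "k \<in> charts_at M m" "subspace V" "V \<subseteq> E" "dim V + q = dim E" "T m = {v \<in> tangent_space M m. v k \<in> V}"
proof -
  obtain k V where k: "k \<in> charts_at M m" "subspace V \<and> V \<subseteq> E \<and> dim V + q = dim E \<and>
        (\<forall>L\<in>F. \<forall>x\<in>L \<inter> fst k.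
           path_component_of_set (subtopology (points M) (L \<inter> fst k)) x
             = {y \<in> fst k. snd k y - snd k x \<in> V})"
    using foliation assms unfolding foliation_def by blast
  then have fk: "foliated_chart F k V" unfolding foliated_chart_def using charts_at_chart(1)[OF k(1)] by blast
  have "m \<in> \<Union>F" using foliation assms unfolding foliation_def partition_on_def by blast
  from leaf_tangent_foliated_chart[OF k(1) fk this] show thesis using that[of k V] k by blast
qed

lemma T_tangent: "m \<in> X \<Longrightarrow> v \<in> T m \<Longrightarrow> v \<in> tangent_space M m"
  by (rule T_chart) blast+

lemma T_lincomb:
  assumes m: "m \<in> X" and uv: "u \<in> T m" "v \<in> T m"
  shows "lincomb a u b v \<in> T m"
proof -
  obtain k V where k: "k \<in> charts_at M m" "subspace V" "V \<subseteq> E" "dim V + q = dim E" "T m = {v \<in> tangent_space M m. v k \<in> V}"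
    by (rule T_chart[OF m])
  have "a *\<^sub>R u k + b *\<^sub>R v k \<in> V" using uv k(5) by (intro subspace_add[OF k(2)] subspace_scale[OF k(2)]) auto
  then show ?thesis
    unfolding k(5) using lincomb_tangent[OF T_tangent[OF m uv(1)] T_tangent[OF m uv(2)] m] by (simp add: lincomb_def)
qed

lemma T_zero:
  assumes m: "m \<in> X" shows "(\<lambda>c. 0) \<in> T m"
proof -
  obtain k V where k: "k \<in> charts_at M m" "subspace V" "V \<subseteq> E" "dim V + q = dim E" "T m = {v \<in> tangent_space M m. v k \<in> V}"
    by (rule T_chart[OF m])
  show ?thesis unfolding k(5) using zero_tangent[OF m] subspace_0[OF k(2)] by simp
qed

lemma nc_eq_iff:
  assumes m: "m \<in> X" and u: "u \<in> tangent_space M m" and v: "v \<in> tangent_space M m"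
  shows "nc m u = nc m v \<longleftrightarrow> lincomb 1 u (-1) v \<in> T m"
proof
  have "lincomb 1 u (-1) u = (\<lambda>c. 0)" by (simp add: lincomb_def)
  then have "u \<in> nc m u" using u T_zero[OF m] by (simp add: normal_class_def)
  moreover assume "nc m u = nc m v"
  ultimately have "u \<in> nc m v" by (simp only:)
  then show "lincomb 1 u (-1) v \<in> T m" by (simp add: normal_class_def)
next
  assume uv: "lincomb 1 u (-1) v \<in> T m"
  show "nc m u = nc m v"
  proof (intro equalityI subsetI)
    fix w assume w: "w \<in> nc m u"
    have "lincomb 1 (lincomb 1 w (-1) u) 1 (lincomb 1 u (-1) v) \<in> T m"
      by (rule T_lincomb[OF m _ uv]) (use w in \<open>simp add: normal_class_def\<close>)
    then show "w \<in> nc m v" using w by (simp add: normal_class_def lincomb_def)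
  next
    fix w assume w: "w \<in> nc m v"
    have "lincomb 1 (lincomb 1 w (-1) v) (-1) (lincomb 1 u (-1) v) \<in> T m"
      by (rule T_lincomb[OF m _ uv]) (use w in \<open>simp add: normal_class_def\<close>)
    then show "w \<in> nc m u" using w by (simp add: normal_class_def lincomb_def)
  qed
qed

end

context saturated_foliation
begin

sublocale MF: foliated_mfd M q F by unfold_locales (rule fol)
sublocale WF: foliated_mfd W q FW by unfold_locales (rule FW_foliation)

text \<open>Curves in leaves project to curves in their images. Conversely a curve in the image of
  \<open>L\<close> is lifted by the affine local section through \<open>m\<close>, and saturation
  puts the lift into \<open>L\<close>.\<close>

lemma dh_leaf_tangent:
  assumes m: "m \<in> M.X"
  shows "differential M W h m ` leaf_tangent M F m = leaf_tangent W FW (h m)"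
proof (intro equalityI subsetI)
  fix u assume "u \<in> differential M W h m ` leaf_tangent M F m"
  then obtain v where v: "v \<in> leaf_tangent M F m" "u = differential M W h m v" by blast
  obtain \<gamma> \<epsilon> L where \<gamma>: "v = velocity M \<gamma> 0" "0 < \<epsilon>" "L \<in> F" "\<gamma> 0 = m" "\<gamma> ` {-\<epsilon><..<\<epsilon>} \<subseteq> L"
     "smooth_curve M {-\<epsilon><..<\<epsilon>} \<gamma>"
    using v(1) unfolding M.leaf_tangent_iff by blast
  have "u = velocity W (\<lambda>t. h (\<gamma> t)) 0"
    using dh_velocity[OF \<gamma>(6)] \<gamma>(1,2,4) v(2) by simp
  moreover have "(\<lambda>t. h (\<gamma> t)) ` {-\<epsilon><..<\<epsilon>} \<subseteq> h ` L" using \<gamma>(5) by blast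
  moreover have "h ` L \<in> FW" unfolding FW_def using \<gamma>(3) by blast
  ultimately show "u \<in> leaf_tangent W FW (h m)"
    unfolding W.leaf_tangent_iff using \<gamma>(2,4) h_curve[OF \<gamma>(6) open_greaterThanLessThan]
    by (intro exI[of _ "\<lambda>t. h (\<gamma> t)"] exI[of _ \<epsilon>] exI[of _ "h ` L"]) simp
next
  fix u assume "u \<in> leaf_tangent W FW (h m)"
  then obtain \<gamma> \<epsilon> Lw where \<gamma>: "u = velocity W \<gamma> 0" "0 < \<epsilon>" "Lw \<in> FW" "\<gamma> 0 = h m" "\<gamma> ` {-\<epsilon><..<\<epsilon>} \<subseteq> Lw"
     "smooth_curve W {-\<epsilon><..<\<epsilon>} \<gamma>"
    unfolding W.leaf_tangent_iff by blast
  obtain L where L: "L \<in> F" "Lw = h ` L" using \<gamma>(3) unfolding FW_def by blast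
  obtain c d p J where sf: "submersion_form M W h c d p J" "m \<in> fst c" using form_at[OF m] by blast
  interpret sc: submersion_chart M W h c d p J by unfold_locales (rule sf(1))
  have cont: "continuous_map (top_of_set {-\<epsilon><..<\<epsilon>}) (points W) \<gamma>" using \<gamma>(6) by (simp add: smooth_curve_def)
  have D: "openin (points W) (sc.sdom m (fst c))" by (rule sc.sdom_open[OF sf(2) M.c_open[OF sc.c]])
  have "\<gamma> 0 \<in> sc.sdom m (fst c)" using sc.sdom_base[OF sf(2) sf(2)] \<gamma>(4) by simp
  then obtain \<delta> where \<delta>: "\<delta> > 0" "{-\<delta><..<\<delta>} \<subseteq> {-\<epsilon><..<\<epsilon>}" "\<gamma> ` {-\<delta><..<\<delta>} \<subseteq> sc.sdom m (fst c)"
    using W.curve_segment[OF cont _ _ D] \<gamma>(2) by auto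
  let ?J = "{-\<delta><..<\<delta>}"
  have J: "open ?J" "0 \<in> ?J" using \<delta>(1) by auto
  have sD: "\<gamma> t \<in> sc.sdom m (fst c)" if "t \<in> ?J" for t using \<delta>(3) that by blast
  have sm\<gamma>: "smooth_curve W ?J \<gamma>" by (rule W.smooth_curve_subset[OF \<gamma>(6) \<delta>(2)])
  have smd: "smooth_on ?J (\<lambda>t. snd d (\<gamma> t))"
  proof -
    have "{t \<in> ?J. \<gamma> t \<in> fst d} = ?J" using sc.section_at(5)[OF sf(2) sD] by blast
    moreover have "smooth_on {t \<in> ?J. \<gamma> t \<in> fst d} (\<lambda>t. snd d (\<gamma> t))"
      using sm\<gamma> sc.d unfolding smooth_curve_def by blast
    ultimately show ?thesis by (simp only:)
  qed
  let ?\<gamma> = "\<lambda>t. sc.section_at m (\<gamma> t)"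
  have sec: "sc.sec m (snd d (\<gamma> t)) \<in> snd c ` fst c" if "t \<in> ?J" for t
    using sD[OF that] unfolding sc.sdom_def by blast
  have sm: "smooth_curve M ?J ?\<gamma>"
    unfolding sc.section_at_def
    by (rule M.smooth_curve_chartI[OF sc.c J(1) sec smooth_on_comp[OF smd sc.sec_smooth[of UNIV]]]) auto
  have \<gamma>0: "?\<gamma> 0 = m" using sc.section_base[OF sf(2)] \<gamma>(4) by simp
  have h\<gamma>: "h (?\<gamma> t) = \<gamma> t" if "t \<in> ?J" for t by (rule sc.section_at(3)[OF sf(2) sD[OF that]])
  have inL: "?\<gamma> ` ?J \<subseteq> L"
  proof
    fix y assume "y \<in> ?\<gamma> ` ?J"
    then obtain t where t: "t \<in> ?J" "y = ?\<gamma> t" by blast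
    have "\<gamma> t \<in> Lw" using t(1) \<gamma>(5) \<delta>(2) by blast
    then have "h y \<in> h ` L" using h\<gamma>[OF t(1)] t(2) L(2) by (simp only:)
    then show "y \<in> L" using in_image_leaf[OF L(1)] sc.in_X[OF sc.section_at(1)[OF sf(2) sD[OF t(1)]]] t(2) by blast
  qed
  have "velocity M ?\<gamma> 0 \<in> leaf_tangent M F m"
    unfolding M.leaf_tangent_iff using \<delta>(1) L(1) \<gamma>0 inL sm
    by (intro exI[of _ ?\<gamma>] exI[of _ \<delta>] exI[of _ L]) simp
  moreover have "u = differential M W h m (velocity M ?\<gamma> 0)"
  proof -
    have "differential M W h m (velocity M ?\<gamma> 0) = velocity W (\<lambda>t. h (?\<gamma> t)) 0"
      using dh_velocity[OF sm J] unfolding \<gamma>0 .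
    also have "\<dots> = velocity W \<gamma> 0" by (rule W.velocity_cong[OF h_curve[OF sm J(1)] sm\<gamma> J h\<gamma>])
    finally show ?thesis using \<gamma>(1) by simp
  qed
  ultimately show "u \<in> differential M W h m ` leaf_tangent M F m" by blast
qed

text \<open>The coordinate line in a direction of the kernel of \<open>p\<close> stays in a fibre,
  hence in a leaf.\<close>

lemma vertical_leaf_tangent:
  assumes m: "m \<in> M.X" and v: "v \<in> tangent_space M m" and 0: "differential M W h m v = (\<lambda>c. 0)"
  shows "v \<in> leaf_tangent M F m"
proof -
  obtain L where L: "L \<in> F" "m \<in> L" using leaf_exists[OF m] by blast
  obtain c d p J where sf: "submersion_form M W h c d p J" "m \<in> fst c" using form_at[OF m] by blast
  interpret sc: submersion_chart M W h c d p J by unfold_locales (rule sf(1))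
  obtain \<gamma> \<delta> where \<gamma>: "0 < \<delta>" "smooth_curve M {-\<delta><..<\<delta>} \<gamma>" "\<gamma> 0 = m" "velocity M \<gamma> 0 = v"
    "\<forall>t\<in>{-\<delta><..<\<delta>}. \<gamma> t \<in> fst c \<and> snd c (\<gamma> t) = snd c m + t *\<^sub>R v c"
    by (rule M.line_curve[OF sc.c_at[OF sf(2)] v])
  have pv: "p (v c) = 0" using sc.dh_chart[OF v sf(2)] 0 by simp
  have lin: "linear p" by (rule bounded_linear.linear[OF sc.p])
  have "\<gamma> ` {-\<delta><..<\<delta>} \<subseteq> L"
  proof
    fix y assume "y \<in> \<gamma> ` {-\<delta><..<\<delta>}"
    then obtain t where t: "t \<in> {-\<delta><..<\<delta>}" "y = \<gamma> t" by blast
    have y: "y \<in> fst c" "snd c y = snd c m + t *\<^sub>R v c" using \<gamma>(5) t by auto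
    have "snd d (h y) = snd d (h m)"
      using sc.h_snd[OF y(1)] sc.h_snd[OF sf(2)] y(2) pv by (simp add: linear_add[OF lin] linear_scale[OF lin])
    then have "h y = h m" using inj_onD[OF W.c_inj[OF sc.d]] sc.h_fst[OF y(1)] sc.h_fst[OF sf(2)] by blast
    then show "y \<in> L" using sat[OF L sc.in_X[OF y(1)]] by blast
  qed
  then show ?thesis
    unfolding M.leaf_tangent_iff using \<gamma> L(1) by (intro exI[of _ \<gamma>] exI[of _ \<delta>] exI[of _ L]) simp
qed

text \<open>If the projection of \<open>v\<close> is tangent to a leaf, it is also the projection of
  a leaf tangent vector \<open>v'\<close>; then \<open>v - v'\<close> is vertical and so tangent to
  the leaf. This is what identifies the normal spaces.\<close>

lemma leaf_tangent_iff_dh: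
  assumes m: "m \<in> M.X" and v: "v \<in> tangent_space M m"
  shows "v \<in> leaf_tangent M F m \<longleftrightarrow> differential M W h m v \<in> leaf_tangent W FW (h m)"
proof
  show "differential M W h m v \<in> leaf_tangent W FW (h m)" if "v \<in> leaf_tangent M F m"
    using dh_leaf_tangent[OF m] that by blast
  assume "differential M W h m v \<in> leaf_tangent W FW (h m)"
  then obtain v' where v': "v' \<in> leaf_tangent M F m" "differential M W h m v = differential M W h m v'"
    using dh_leaf_tangent[OF m] by (metis imageE)
  note v'T = MF.T_tangent[OF m v'(1)]
  have "differential M W h m (lincomb 1 v (-1) v') = (\<lambda>c. 0)"
    unfolding dh_lincomb[OF v v'T m] v'(2) by (simp add: lincomb_def)
  then have "lincomb 1 v (-1) v' \<in> leaf_tangent M F m"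
    by (rule vertical_leaf_tangent[OF m M.lincomb_tangent[OF v v'T m]])
  from MF.T_lincomb[OF m this v'(1), of 1 1] show "v \<in> leaf_tangent M F m" by (simp add: lincomb_def)
qed

text \<open>The inverse of the isomorphism of normal spaces induced by the differential. Normal
  vectors are cosets, so a preimage expresses it without a choice of representatives.\<close>

definition pull :: "'a \<Rightarrow> ('b, 'f) tvec set \<Rightarrow> ('a, 'e) tvec set" where
  "pull m n = {v \<in> tangent_space M m. differential M W h m v \<in> n}"

lemma pull_normal_class:
  assumes m: "m \<in> M.X" and v: "v \<in> tangent_space M m"
  shows "pull m (normal_class W FW (h m) (differential M W h m v)) = normal_class M F m v"
proof -
  have "differential M W h m x \<in> normal_class W FW (h m) (differential M W h m v) \<longleftrightarrow> lincomb 1 x (-1) v \<in> leaf_tangent M F m"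
    if x: "x \<in> tangent_space M m" for x
    unfolding leaf_tangent_iff_dh[OF m M.lincomb_tangent[OF x v m]] dh_lincomb[OF x v m]
    using dh_tangent[OF x m] by (simp add: normal_class_def)
  then show ?thesis unfolding pull_def normal_class_def[of M] by blast
qed

lemma dh_surj:
  assumes m: "m \<in> M.X" and u: "u \<in> tangent_space W (h m)"
  obtains v where "v \<in> tangent_space M m" "differential M W h m v = u"
proof -
  obtain c d p J where sf: "submersion_form M W h c d p J" "m \<in> fst c" using form_at[OF m] by blast
  interpret sc: submersion_chart M W h c d p J by unfold_locales (rule sf(1))
  show thesis by (rule that[OF sc.lift_tangent[OF sf(2)] sc.dh_lift[OF sf(2) u]])
qed

lemma pull_normal_space:
  assumes m: "m \<in> M.X" and n: "n \<in> normal_space W FW (h m)"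
  shows "pull m n \<in> normal_space M F m"
proof -
  obtain u where u: "u \<in> tangent_space W (h m)" "n = normal_class W FW (h m) u" using n unfolding normal_space_def by blast
  obtain v where v: "v \<in> tangent_space M m" "differential M W h m v = u" by (rule dh_surj[OF m u(1)])
  show ?thesis using pull_normal_class[OF m v(1)] u(2) v unfolding normal_space_def by auto
qed

lemma pull_inj:
  assumes m: "m \<in> M.X" and n: "n \<in> normal_space W FW (h m)" "n' \<in> normal_space W FW (h m)" and eq: "pull m n = pull m n'"
  shows "n = n'"
proof -
  obtain u where u: "u \<in> tangent_space W (h m)" "n = normal_class W FW (h m) u" using n unfolding normal_space_def by blast
  obtain v where v: "v \<in> tangent_space M m" "differential M W h m v = u" by (rule dh_surj[OF m u(1)])
  obtain u' where u': "u' \<in> tangent_space W (h m)" "n' = normal_class W FW (h m) u'" using n unfolding normal_space_def by blast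
  obtain v' where v': "v' \<in> tangent_space M m" "differential M W h m v' = u'" by (rule dh_surj[OF m u'(1)])
  have "normal_class M F m v = normal_class M F m v'"
    using eq pull_normal_class[OF m v(1)] pull_normal_class[OF m v'(1)] u(2) v(2) u'(2) v'(2) by simp
  then have "lincomb 1 v (-1) v' \<in> leaf_tangent M F m" using MF.nc_eq_iff[OF m v(1) v'(1)] by simp
  then have "lincomb 1 u (-1) u' \<in> leaf_tangent W FW (h m)"
    unfolding leaf_tangent_iff_dh[OF m M.lincomb_tangent[OF v(1) v'(1) m]] dh_lincomb[OF v(1) v'(1) m] v(2) v'(2) .
  then show ?thesis using WF.nc_eq_iff[OF h_mem[OF m] u(1) u'(1)] u(2) u'(2) by simp
qed

end

section \<open>Alternating forms and cutoff functions\<close>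

text \<open>Expanding \<open>f\<close> with \<open>x + y\<close> in both places leaves only the two
  mixed terms, which must cancel.\<close>

lemma list_update_swap_additive:
  fixes f :: "'v::ab_group_add list \<Rightarrow> real"
  assumes S: "\<And>x y. x \<in> S \<Longrightarrow> y \<in> S \<Longrightarrow> x + y \<in> S"
    and add: "\<And>xs i x y. length xs = n \<Longrightarrow> set xs \<subseteq> S \<Longrightarrow> i < n \<Longrightarrow> x \<in> S \<Longrightarrow> y \<in> S \<Longrightarrow>
        f (xs[i := x + y]) = f (xs[i := x]) + f (xs[i := y])"
    and alt: "\<And>xs i j. length xs = n \<Longrightarrow> set xs \<subseteq> S \<Longrightarrow> i < n \<Longrightarrow> j < n \<Longrightarrow> i \<noteq> j \<Longrightarrow> xs ! i = xs ! j \<Longrightarrow> f xs = 0"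
    and xs: "length xs = n" "set xs \<subseteq> S" "i < n" "j < n" "i \<noteq> j"
  shows "f (xs[i := xs ! j, j := xs ! i]) = - f xs"
proof -
  let ?x = "xs ! i" and ?y = "xs ! j"
  have xy: "?x \<in> S" "?y \<in> S" using xs by (auto simp: subset_iff)
  have sub: "set (ys[k := z]) \<subseteq> S" if "set ys \<subseteq> S" "z \<in> S" for ys k z
    using set_update_subset_insert[of ys k z] that by blast
  have e: "f (xs[i := ?x + ?y, j := ?x + ?y]) = f (xs[i := ?x, j := ?x]) + f (xs[i := ?x, j := ?y])
      + (f (xs[i := ?y, j := ?x]) + f (xs[i := ?y, j := ?y]))"
  proof -
    have "f (xs[i := ?x + ?y, j := ?x + ?y]) = f (xs[i := ?x + ?y, j := ?x]) + f (xs[i := ?x + ?y, j := ?y])"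
      by (rule add) (use xs xy S sub in auto)
    moreover have "f (xs[i := ?x + ?y, j := z]) = f (xs[i := ?x, j := z]) + f (xs[i := ?y, j := z])" if "z \<in> S" for z
      unfolding list_update_swap[OF xs(5)] by (rule add) (use xs xy S sub that in auto)
    ultimately show ?thesis using xy by simp
  qed
  have z: "f (xs[i := z, j := z]) = 0" if z: "z \<in> S" for z
  proof (rule alt[of _ i j])
    show "set (xs[i := z, j := z]) \<subseteq> S" by (rule sub[OF sub[OF xs(2) z] z])
  qed (use xs in auto)
  have "xs[i := ?x, j := ?y] = xs" by simp
  then show ?thesis using e z[OF S[OF xy]] z[OF xy(1)] z[OF xy(2)] by simp
qed

text \<open>Selection sort: once the first \<open>k\<close> entries agree with those of
  \<open>ys\<close>, at most one transposition brings the entry \<open>ys ! k\<close> into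
  place.\<close>

lemma mset_eq_swap_closed:
  assumes P: "\<And>xs i j. mset xs = mset ys \<Longrightarrow> P xs \<Longrightarrow> i < length xs \<Longrightarrow> j < length xs \<Longrightarrow> i \<noteq> j \<Longrightarrow> P (xs[i := xs ! j, j := xs ! i])"
    and xs: "mset xs = mset ys" "P xs"
  shows "P ys"
proof -
  have len: "length zs = length ys" if "mset zs = mset ys" for zs using that mset_eq_length by blast
  have "\<exists>zs. mset zs = mset ys \<and> P zs \<and> take k zs = take k ys" if "k \<le> length ys" for k
    using that
  proof (induction k)
    case 0
    then show ?case using xs by auto
  next
    case (Suc k)
    then obtain zs where zs: "mset zs = mset ys" "P zs" "take k zs = take k ys" by auto
    have k: "k < length ys" "k < length zs" using Suc.prems len[OF zs(1)] by auto
    have "mset (take k zs) + mset (drop k zs) = mset (take k ys) + mset (drop k ys)"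
      using zs(1) by (simp flip: mset_append)
    then have "mset (drop k zs) = mset (drop k ys)" using zs(3) by simp
    then have "set (drop k zs) = set (drop k ys)" by (rule mset_eq_setD)
    moreover have "ys ! k \<in> set (drop k ys)" using k(1) by (metis Cons_nth_drop_Suc list.set_intros(1))
    ultimately obtain i where i: "i < length (drop k zs)" "drop k zs ! i = ys ! k" by (metis in_set_conv_nth)
    define j where "j = k + i"
    have j: "j < length zs" "k \<le> j" "zs ! j = ys ! k" using i by (auto simp: j_def)
    show ?case
    proof (cases "j = k")
      case True
      then have "take (Suc k) zs = take (Suc k) ys" using zs(3) j(3) k by (simp add: take_Suc_conv_app_nth)
      then show ?thesis using zs by blast
    next
      case False
      let ?z = "zs[k := zs ! j, j := zs ! k]"
      have "mset ?z = mset ys" using zs(1) mset_swap[OF j(1) k(2)] list_update_swap[OF False[symmetric]] by metis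
      moreover have "P ?z" by (rule P[OF zs(1,2) k(2) j(1) False[symmetric]])
      moreover have "take (Suc k) ?z = take (Suc k) ys"
        using zs(3) j k False by (simp add: take_Suc_conv_app_nth take_update_cancel nth_list_update)
      ultimately show ?thesis by blast
    qed
  qed
  then obtain zs where zs: "mset zs = mset ys" "P zs" "take (length ys) zs = take (length ys) ys" by blast
  then have "zs = ys" using len[OF zs(1)] by simp
  then show ?thesis using zs by simp
qed

text \<open>\<open>f\<close> is an alternating form on the quotient of \<open>E\<close> by
  \<open>V\<close>, and \<open>bs\<close> spans that quotient. If \<open>f\<close> vanished on
  \<open>bs\<close>, it would vanish on all lists from \<open>bs\<close>, because permutations
  change only the sign and repetitions give 0, and then by multilinearity everywhere.\<close>

lemma alternating_nonzero_on_basis: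
  fixes f :: "'e::real_vector list \<Rightarrow> real"
  assumes E: "subspace E" and V: "V \<subseteq> E"
    and lin: "\<And>xs i x y a b. length xs = n \<Longrightarrow> set xs \<subseteq> E \<Longrightarrow> i < n \<Longrightarrow> x \<in> E \<Longrightarrow> y \<in> E \<Longrightarrow>
        f (xs[i := a *\<^sub>R x + b *\<^sub>R y]) = a * f (xs[i := x]) + b * f (xs[i := y])"
    and alt: "\<And>xs i j. length xs = n \<Longrightarrow> set xs \<subseteq> E \<Longrightarrow> i < n \<Longrightarrow> j < n \<Longrightarrow> i \<noteq> j \<Longrightarrow> xs ! i = xs ! j \<Longrightarrow> f xs = 0"
    and van: "\<And>xs i v. length xs = n \<Longrightarrow> set xs \<subseteq> E \<Longrightarrow> i < n \<Longrightarrow> v \<in> V \<Longrightarrow> f (xs[i := v]) = 0"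
    and nz: "length zs = n" "set zs \<subseteq> E" "f zs \<noteq> 0"
    and bs: "length bs = n" "set bs \<subseteq> E" "E \<subseteq> span (set bs \<union> V)"
  shows "f bs \<noteq> 0"
proof
  assume 0: "f bs = 0"
  have E_add: "x + y \<in> E" if "x \<in> E" "y \<in> E" for x y using that by (rule subspace_add[OF E])
  have add: "f (xs[i := x + y]) = f (xs[i := x]) + f (xs[i := y])"
    if "length xs = n" "set xs \<subseteq> E" "i < n" "x \<in> E" "y \<in> E" for xs i x y
    using lin[OF that, of 1 1] by simp
  have basis: "f xs = 0" if xs: "length xs = n" "set xs \<subseteq> set bs" for xs
  proof (cases "distinct xs")
    case True
    have "card (set xs) = n" using True xs(1) distinct_card by metis
    moreover have "card (set bs) \<le> n" using bs(1) card_length by metis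
    ultimately have "set xs = set bs" using card_subset_eq[OF _ xs(2)] card_mono[OF _ xs(2)] by auto
    moreover from this have "distinct bs" using \<open>card (set xs) = n\<close> bs(1) by (metis card_distinct)
    ultimately have "mset xs = mset bs" using True by (simp add: set_eq_iff_mset_eq_distinct)
    then show ?thesis
    proof (intro mset_eq_swap_closed[where P="\<lambda>xs. f xs = 0" and ys=xs and xs=bs])
      fix ys i j assume ys: "mset ys = mset xs" "f ys = 0" "i < length ys" "j < length ys" "i \<noteq> j"
      have "length ys = n" "set ys \<subseteq> E" using mset_eq_length[OF ys(1)] mset_eq_setD[OF ys(1)] xs bs(2) by auto
      from list_update_swap_additive[where f=f and S=E and n=n, OF E_add add alt this _ _ ys(5)]
      show "f (ys[i := ys ! j, j := ys ! i]) = 0" using ys \<open>length ys = n\<close> by simp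
    qed (use 0 in simp_all)
  next
    case False
    then obtain i j where "i < length xs" "j < length xs" "i \<noteq> j" "xs ! i = xs ! j" by (auto simp: distinct_conv_nth)
    then show ?thesis using alt[of xs i j] xs bs(2) by blast
  qed
  \<comment> \<open>Induction on the number \<open>k\<close> of leading entries that may be
    arbitrary in \<open>E\<close>; the remaining ones belong to \<open>bs\<close>.\<close>
  have "f xs = 0" if "k \<le> n" "length xs = n" "set xs \<subseteq> E" "set (drop k xs) \<subseteq> set bs" for k xs
    using that
  proof (induction k arbitrary: xs)
    case 0
    then show ?case using basis by simp
  next
    case (Suc k)
    have k: "k < n" using Suc.prems by simp
    \<comment> \<open>The values of entry \<open>k\<close> at which \<open>f\<close> vanishes form a
      subspace containing \<open>bs\<close> and \<open>V\<close>, hence all of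
      \<open>E\<close>.\<close>
    let ?G = "{x \<in> E. f (xs[k := x]) = 0}"
    have inE: "set (xs[k := x]) \<subseteq> E" if "x \<in> E" for x
      using set_update_subset_insert[of xs k x] that Suc.prems(3) by blast
    have "subspace ?G"
    proof (rule subspaceI)
      have "f (xs[k := 0]) = 0" using lin[OF Suc.prems(2,3) k subspace_0[OF E] subspace_0[OF E], of 0 0] by simp
      then show "0 \<in> ?G" using subspace_0[OF E] by simp
      show "x + y \<in> ?G" if "x \<in> ?G" "y \<in> ?G" for x y
        using that add[OF Suc.prems(2,3) k, of x y] E_add by simp
      show "a *\<^sub>R x \<in> ?G" if "x \<in> ?G" for a x
        using that lin[OF Suc.prems(2,3) k, of x x a 0] subspace_scale[OF E] by simp
    qed
    moreover have "set bs \<union> V \<subseteq> ?G"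
    proof
      fix x assume x: "x \<in> set bs \<union> V"
      then have xE: "x \<in> E" using bs(2) V by blast
      have "f (xs[k := x]) = 0"
      proof (cases "x \<in> V")
        case True
        then show ?thesis by (rule van[OF Suc.prems(2,3) k])
      next
        case False
        have "drop k (xs[k := x]) = x # drop (Suc k) xs"
          using k Suc.prems(2) by (simp add: Cons_nth_drop_Suc[symmetric] drop_update_cancel)
        then have "set (drop k (xs[k := x])) \<subseteq> set bs" using False x Suc.prems(4) by auto
        then show ?thesis using Suc.IH[of "xs[k := x]"] k Suc.prems(2) inE[OF xE] by simp
      qed
      then show "x \<in> ?G" using xE by simp
    qed
    ultimately have "span (set bs \<union> V) \<subseteq> ?G" by (rule span_minimal[rotated])
    then have "xs ! k \<in> ?G" using bs(3) Suc.prems(2,3) k nth_mem by blast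
    then show ?case by simp
  qed
  from this[of n zs] nz show False by simp
qed

text \<open>The vectors added when a basis of \<open>V\<close> is extended to one of
  \<open>E\<close>.\<close>

lemma complementary_basis:
  fixes E :: "'e::euclidean_space set"
  assumes E: "subspace E" and V: "V \<subseteq> E" "dim V + n = dim E"
  obtains bs where "length bs = n" "set bs \<subseteq> E" "E \<subseteq> span (set bs \<union> V)"
proof -
  obtain B where B: "B \<subseteq> V" "independent B" "V \<subseteq> span B" "card B = dim V" by (rule basis_exists)
  have BE: "B \<subseteq> E" using B(1) V(1) by blast
  obtain C where C: "B \<subseteq> C" "C \<subseteq> E" "independent C" "E \<subseteq> span C"
    by (rule maximal_independent_subset_extend[OF BE B(2)])
  have fin: "finite C" using C(3) independent_imp_finite by blast
  have "card C = dim E" using C basis_card_eq_dim by blast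
  then have "card (C - B) = n" using card_Diff_subset[of B C] finite_subset[OF C(1) fin] C(1) B(4) V(2) by simp
  moreover obtain bs where "set bs = C - B" "distinct bs" using finite_distinct_list[of "C - B"] fin by blast
  ultimately have "length bs = n" using distinct_card by metis
  moreover have "E \<subseteq> span (set bs \<union> V)"
    using C(4) span_mono[of C "set bs \<union> V"] B(1) \<open>set bs = C - B\<close> by blast
  ultimately show thesis using that[of bs] C(2) \<open>set bs = C - B\<close> by blast
qed

section \<open>Bump functions on manifolds and extension by zero\<close>

context smooth_mfd
begin

lemma smooth_fun_cong:
  assumes f: "smooth_fun M U f" and U: "openin (points M) U" and eq: "\<And>x. x \<in> U \<Longrightarrow> g x = f x"
  shows "smooth_fun M U g"
proof (rule smooth_funI[OF U])
  fix m assume m: "m \<in> U"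
  then obtain d where d: "d \<in> charts_at M m" using ex_chart_at openin_subset[OF U] by blast
  have "smooth_on (snd d ` (fst d \<inter> U)) (\<lambda>z. g (chart_inv d z))"
  proof (rule smooth_on_cong[OF smooth_fun_rep[OF f U charts_at_chart(1)[OF d]]])
    fix z assume "z \<in> snd d ` (fst d \<inter> U)"
    then have "chart_inv d z \<in> U" using c_inv_mem[OF charts_at_chart(1)[OF d], of z "fst d \<inter> U"] by blast
    then show "g (chart_inv d z) = f (chart_inv d z)" by (rule eq)
  qed
  then have "smooth_on (snd d ` (fst d \<inter> U \<inter> U)) (\<lambda>z. g (chart_inv d z))" by (simp add: Int_assoc)
  then show "\<exists>d B. d \<in> charts_at M m \<and> openin (points M) B \<and> m \<in> B \<and>
      smooth_on (snd d ` (fst d \<inter> U \<inter> B)) (\<lambda>z. g (chart_inv d z))"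
    using d U m by blast
qed

lemma smooth_fun_local:
  assumes U: "openin (points M) U"
    and loc: "\<And>m. m \<in> U \<Longrightarrow> \<exists>B. openin (points M) B \<and> m \<in> B \<and> smooth_fun M (U \<inter> B) f"
  shows "smooth_fun M U f"
proof (rule smooth_funI[OF U])
  fix m assume m: "m \<in> U"
  then obtain d where d: "d \<in> charts_at M m" using ex_chart_at openin_subset[OF U] by blast
  obtain B where B: "openin (points M) B" "m \<in> B" "smooth_fun M (U \<inter> B) f" using loc[OF m] by blast
  have "smooth_on (snd d ` (fst d \<inter> (U \<inter> B))) (\<lambda>z. f (chart_inv d z))"
    by (rule smooth_fun_rep[OF B(3) openin_Int[OF U B(1)] charts_at_chart(1)[OF d]])
  then show "\<exists>d B. d \<in> charts_at M m \<and> openin (points M) B \<and> m \<in> B \<and>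
      smooth_on (snd d ` (fst d \<inter> U \<inter> B)) (\<lambda>z. f (chart_inv d z))"
    using d B by (intro exI[of _ d] exI[of _ B]) (simp add: Int_assoc)
qed

lemma smooth_fun_subset:
  assumes f: "smooth_fun M U f" and U: "openin (points M) U" "openin (points M) V" "V \<subseteq> U"
  shows "smooth_fun M V f"
proof (rule smooth_funI[OF U(2)])
  fix m assume m: "m \<in> V"
  then obtain d where d: "d \<in> charts_at M m" using ex_chart_at openin_subset[OF U(2)] by blast
  have "smooth_on (snd d ` (fst d \<inter> V \<inter> V)) (\<lambda>z. f (chart_inv d z))"
    by (rule smooth_on_subset[OF smooth_fun_rep[OF f U(1) charts_at_chart(1)[OF d]]]) (use U(3) in auto)
  then show "\<exists>d B. d \<in> charts_at M m \<and> openin (points M) B \<and> m \<in> B \<and>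
      smooth_on (snd d ` (fst d \<inter> V \<inter> B)) (\<lambda>z. f (chart_inv d z))"
    using d U(2) m by blast
qed

lemma smooth_fun_combine:
  assumes U: "openin (points M) U"
    and rep: "\<And>d. d \<in> charts M \<Longrightarrow> smooth_on (snd d ` (fst d \<inter> U)) (\<lambda>z. f (chart_inv d z))"
  shows "smooth_fun M U f"
proof (rule smooth_funI[OF U])
  fix m assume m: "m \<in> U"
  then obtain d where d: "d \<in> charts_at M m" using ex_chart_at openin_subset[OF U] by blast
  have "smooth_on (snd d ` (fst d \<inter> U \<inter> U)) (\<lambda>z. f (chart_inv d z))"
    using rep[OF charts_at_chart(1)[OF d]] by (simp add: Int_assoc)
  then show "\<exists>d B. d \<in> charts_at M m \<and> openin (points M) B \<and> m \<in> B \<and>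
      smooth_on (snd d ` (fst d \<inter> U \<inter> B)) (\<lambda>z. f (chart_inv d z))"
    using d U m by blast
qed

lemma smooth_fun_const: "openin (points M) U \<Longrightarrow> smooth_fun M U (\<lambda>x. a)"
  by (rule smooth_fun_combine[where f="\<lambda>x. a"]) (auto intro: smooth_on_const)

lemma smooth_fun_mult:
  assumes U: "openin (points M) U" and fg: "smooth_fun M U f" "smooth_fun M U g"
  shows "smooth_fun M U (\<lambda>x. f x * g x)"
  by (rule smooth_fun_combine[where f="\<lambda>x. f x * g x", OF U])
    (rule smooth_on_bilinear[OF bounded_bilinear_mult smooth_fun_rep[OF fg(1) U] smooth_fun_rep[OF fg(2) U]])

lemma smooth_fun_sum:
  assumes U: "openin (points M) U" and I: "finite I" and f: "\<And>i. i \<in> I \<Longrightarrow> smooth_fun M U (f i)"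
  shows "smooth_fun M U (\<lambda>x. \<Sum>i\<in>I. f i x)"
  by (rule smooth_fun_combine[where f="\<lambda>x. \<Sum>i\<in>I. f i x", OF U])
    (rule smooth_on_sum[OF I smooth_fun_rep[OF f U]])

text \<open>A bump function of the coordinate space is transported by a chart and extended by 0. The
  set \<open>K\<close> is compact, hence closed in a Hausdorff space, so the extension vanishes on
  an open set that together with the chart domain covers the manifold.\<close>

lemma bump_function:
  assumes haus: "Hausdorff_space (points M)" and A: "openin (points M) A" "m \<in> A"
  obtains \<beta> B K where "openin (points M) B" "m \<in> B" "B \<subseteq> A" "closedin (points M) K" "K \<subseteq> A"
    "\<forall>x\<in>B. \<beta> x = 1" "\<forall>x. x \<notin> K \<longrightarrow> \<beta> x = 0" "\<forall>x. 0 \<le> \<beta> x" "smooth_fun M X \<beta>"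
proof -
  have mX: "m \<in> X" using A openin_subset by blast
  obtain c where cc: "c \<in> charts_at M m" using ex_chart_at[OF mX] by blast
  note c = charts_at_chart[OF cc]
  define Z where "Z = snd c m"
  obtain O1 where O1: "open O1" "snd c ` (fst c \<inter> A) = E \<inter> O1"
    using c_open_image[OF c(1) A(1)] openin_open by blast
  have ZE: "Z \<in> E" unfolding Z_def by (rule c_model[OF c])
  have "Z \<in> O1" using O1(2) c(2) A(2) unfolding Z_def by blast
  then obtain r0 where r0: "r0 > 0" "ball Z r0 \<subseteq> O1" using O1(1) openE by blast
  \<comment> \<open>The bump lives in a closed ball of radius \<open>2 * r\<close>, which is smaller
    than \<open>r0\<close>.\<close>
  define r where "r = r0 / 3"
  have r: "r > 0" "cball Z (2 * r) \<subseteq> O1" using r0 by (auto simp: r_def subset_iff)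
  obtain b :: "'e \<Rightarrow> real" where b: "\<forall>k. Ck_on k UNIV b" "\<forall>z\<in>ball Z r. b z = 1"
    "\<forall>z. z \<notin> cball Z (2 * r) \<longrightarrow> b z = 0" "\<forall>z. b z \<ge> 0" by (rule bump_exists[OF r(1)])
  define K where "K = chart_inv c ` (E \<inter> cball Z (2 * r))"
  define B where "B = {x \<in> fst c. snd c x \<in> E \<inter> ball Z r}"
  define \<beta> where "\<beta> x = (if x \<in> fst c \<inter> A then b (snd c x) else 0)" for x
  have Ec: "E \<inter> cball Z (2 * r) \<subseteq> snd c ` (fst c \<inter> A)" using O1(2) r(2) by blast
  have inA: "x \<in> A" if x: "x \<in> fst c" "snd c x \<in> E \<inter> cball Z (2 * r)" for x
  proof -
    obtain y where y: "y \<in> fst c \<inter> A" "snd c x = snd c y" using Ec x(2) by blast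
    then have "x = y" using inj_onD[OF c_inj[OF c(1)] y(2) x(1)] by blast
    then show ?thesis using y by blast
  qed
  have Kop: "closedin (points M) K"
  proof (rule compactin_imp_closedin[OF haus])
    have "compact (E \<inter> cball Z (2 * r))" by (intro closed_Int_compact closed_subspace subspace_E compact_cball)
    then have "compactin (top_of_set (snd c ` fst c)) (E \<inter> cball Z (2 * r))"
      using Ec by (auto simp: compactin_subtopology)
    then show "compactin (points M) K" unfolding K_def by (rule image_compactin[OF _ c_inv_cont[OF c(1)]])
  qed
  have K: "K \<subseteq> fst c \<inter> A"
  proof
    fix x assume "x \<in> K"
    then obtain z where z: "z \<in> E \<inter> cball Z (2 * r)" "x = chart_inv c z" unfolding K_def by blast
    then show "x \<in> fst c \<inter> A" using c_inv_mem[OF c(1) subsetD[OF Ec z(1)]] by blast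
  qed
  have off: "\<beta> x = 0" if x: "x \<notin> K" for x
  proof (cases "x \<in> fst c \<inter> A")
    case True
    have "snd c x \<notin> cball Z (2 * r)"
    proof
      assume "snd c x \<in> cball Z (2 * r)"
      then have "chart_inv c (snd c x) \<in> K" unfolding K_def using c_model[OF c(1), of x] True by blast
      then show False using x c_left[OF c(1), of x] True by simp
    qed
    then have "b (snd c x) = 0" using b(3) by blast
    then show ?thesis by (simp add: \<beta>_def)
  next
    case False
    then show ?thesis unfolding \<beta>_def by (rule if_not_P)
  qed
  have sm: "smooth_fun M X \<beta>"
  proof (rule smooth_fun_local[OF openin_topspace])
    fix y assume y: "y \<in> X"
    show "\<exists>B. openin (points M) B \<and> y \<in> B \<and> smooth_fun M (X \<inter> B) \<beta>"
    proof (cases "y \<in> K")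
      case True
      have cA: "openin (points M) (fst c \<inter> A)" by (rule openin_Int[OF c_open[OF c(1)] A(1)])
      have "smooth_fun M (fst c \<inter> A) \<beta>"
      proof (rule smooth_funI[OF cA])
        fix y assume y: "y \<in> fst c \<inter> A"
        have "smooth_on (snd c ` (fst c \<inter> (fst c \<inter> A) \<inter> A)) (\<lambda>z. \<beta> (chart_inv c z))"
        proof (rule smooth_on_cong[OF smooth_on_subset[OF smooth_on_open[OF open_UNIV b(1)[rule_format]]]])
          fix z assume "z \<in> snd c ` (fst c \<inter> (fst c \<inter> A) \<inter> A)"
          then obtain x where "x \<in> fst c \<inter> A" "z = snd c x" by blast
          then show "\<beta> (chart_inv c z) = b z" using c_left[OF c(1), of x] by (simp add: \<beta>_def)
        qed simp
        then show "\<exists>d B. d \<in> charts_at M y \<and> openin (points M) B \<and> y \<in> B \<and>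
            smooth_on (snd d ` (fst d \<inter> (fst c \<inter> A) \<inter> B)) (\<lambda>z. \<beta> (chart_inv d z))"
          using A(1) y charts_atI[OF c(1)] by blast
      qed
      moreover have "X \<inter> (fst c \<inter> A) = fst c \<inter> A" using openin_subset[OF cA] by blast
      ultimately show ?thesis using cA True K by (intro exI[of _ "fst c \<inter> A"]) auto
    next
      case False
      have op: "openin (points M) (X - K)" using Kop by (simp add: openin_diff)
      have "smooth_fun M (X - K) \<beta>"
        by (rule smooth_fun_cong[OF smooth_fun_const[OF op, of 0] op]) (use off in blast)
      moreover have "X \<inter> (X - K) = X - K" by blast
      ultimately show ?thesis using op y False by (intro exI[of _ "X - K"]) auto
    qed
  qed
  show thesis
  proof (rule that[of B K \<beta>])
    show "openin (points M) B"
      unfolding B_def by (rule c_open_preimage[OF c(1) openin_open_Int[OF open_ball]])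
    show "m \<in> B" using c(2) ZE r(1) by (simp add: B_def Z_def)
    have Bin: "x \<in> fst c" "snd c x \<in> E \<inter> cball Z (2 * r)" "snd c x \<in> ball Z r" if "x \<in> B" for x
      using that r(1) by (auto simp: B_def)
    show "B \<subseteq> A" using inA[OF Bin(1,2)] by blast
    show "closedin (points M) K" by (rule Kop)
    show "K \<subseteq> A" using K by blast
    show "\<forall>x\<in>B. \<beta> x = 1" using Bin inA[OF Bin(1,2)] b(2) by (simp add: \<beta>_def)
    show "\<forall>x. x \<notin> K \<longrightarrow> \<beta> x = 0" using off by blast
    show "\<forall>x. 0 \<le> \<beta> x" using b(4) by (simp add: \<beta>_def)
    show "smooth_fun M X \<beta>" by (rule sm)
  qed
qed

text \<open>The factor \<open>\<beta>\<close> vanishes off the closed set \<open>K\<close> inside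
  \<open>A\<close>, so near points outside \<open>A\<close> the extension by 0 is identically
  0.\<close>

lemma smooth_fun_cutoff:
  assumes \<beta>: "smooth_fun M X \<beta>" "closedin (points M) K" "K \<subseteq> A" "\<forall>x. x \<notin> K \<longrightarrow> \<beta> x = 0"
    and A: "openin (points M) A" and U: "openin (points M) U" and f: "smooth_fun M (U \<inter> A) f"
  shows "smooth_fun M U (\<lambda>x. if x \<in> A then \<beta> x * f x else 0)"
proof (rule smooth_fun_local[OF U])
  let ?f = "\<lambda>x. if x \<in> A then \<beta> x * f x else 0"
  fix m assume m: "m \<in> U"
  show "\<exists>B. openin (points M) B \<and> m \<in> B \<and> smooth_fun M (U \<inter> B) ?f"
  proof (cases "m \<in> A")
    case True
    have UA: "openin (points M) (U \<inter> A)" by (rule openin_Int[OF U A])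
    have "smooth_fun M (U \<inter> A) \<beta>" by (rule smooth_fun_subset[OF \<beta>(1) openin_topspace UA openin_subset[OF UA]])
    then have "smooth_fun M (U \<inter> A) (\<lambda>x. \<beta> x * f x)" by (rule smooth_fun_mult[OF UA _ f])
    then have "smooth_fun M (U \<inter> A) ?f" by (rule smooth_fun_cong[OF _ UA]) simp
    then show ?thesis using A True by blast
  next
    case False
    have op: "openin (points M) (X - K)" using \<beta>(2) by (simp add: openin_diff)
    have op': "openin (points M) (U \<inter> (X - K))" by (rule openin_Int[OF U op])
    have "smooth_fun M (U \<inter> (X - K)) ?f"
      by (rule smooth_fun_cong[OF smooth_fun_const[OF op', of 0] op']) (use \<beta>(4) in auto)
    moreover have "m \<in> X - K" using m False \<beta>(3) openin_subset[OF U] by blast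
    ultimately show ?thesis using op by blast
  qed
qed

text \<open>Turns a field given on \<open>A\<close> into one on all of \<open>M\<close>, as the
  quantification in \<open>transverse_metric\<close> requires. The combination with coefficients
  \<open>\<beta> m\<close> and 0 is scalar multiplication expressed by
  \<open>lincomb\<close>.\<close>

lemma field_cutoff:
  assumes \<beta>: "smooth_fun M X \<beta>" "closedin (points M) K" "K \<subseteq> A" "\<forall>x. x \<notin> K \<longrightarrow> \<beta> x = 0"
    and A: "openin (points M) A" and Y: "vector_field_on M A Y"
  shows "vector_field_on M X (\<lambda>m. if m \<in> A then lincomb (\<beta> m) (Y m) 0 (Y m) else (\<lambda>c. 0))"
proof (rule vector_fieldI[OF openin_topspace])
  let ?Y = "\<lambda>m. if m \<in> A then lincomb (\<beta> m) (Y m) 0 (Y m) else (\<lambda>c. 0)"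
  fix m assume m: "m \<in> X"
  show "?Y m \<in> tangent_space M m"
    using lincomb_tangent[OF vector_field_tangent[OF Y] vector_field_tangent[OF Y] m] zero_tangent[OF m] by simp
  obtain d where dd: "d \<in> charts_at M m" using ex_chart_at[OF m] by blast
  note d = charts_at_chart[OF dd]
  show "\<exists>d B. d \<in> charts_at M m \<and> openin (points M) B \<and> m \<in> B \<and>
      smooth_on (snd d ` (fst d \<inter> X \<inter> B)) (\<lambda>z. ?Y (chart_inv d z) d)"
  proof (cases "m \<in> A")
    case True
    let ?S = "snd d ` (fst d \<inter> X \<inter> A)"
    have 1: "smooth_on ?S (\<lambda>z. \<beta> (chart_inv d z))"
      by (rule smooth_on_subset[OF smooth_fun_rep[OF \<beta>(1) openin_topspace d(1)]]) auto
    have 2: "smooth_on ?S (\<lambda>z. Y (chart_inv d z) d)"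
      by (rule smooth_on_subset[OF vector_field_rep[OF Y d(1)]]) auto
    have "smooth_on ?S (\<lambda>z. ?Y (chart_inv d z) d)"
    proof (rule smooth_on_cong[OF smooth_on_bilinear[OF bounded_bilinear_scaleR 1 2]])
      fix z assume "z \<in> ?S"
      then have "chart_inv d z \<in> A" using c_inv_mem[OF d(1), of z "fst d \<inter> X \<inter> A"] by blast
      then show "?Y (chart_inv d z) d = \<beta> (chart_inv d z) *\<^sub>R Y (chart_inv d z) d" by (simp add: lincomb_def)
    qed
    then show ?thesis using dd A True by blast
  next
    case False
    have op: "openin (points M) (X - K)" using \<beta>(2) by (simp add: openin_diff)
    have "smooth_on (snd d ` (fst d \<inter> X \<inter> (X - K))) (\<lambda>z. ?Y (chart_inv d z) d)"
    proof (rule smooth_on_cong[OF smooth_on_const[of _ 0]])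
      fix z assume "z \<in> snd d ` (fst d \<inter> X \<inter> (X - K))"
      then have "chart_inv d z \<notin> K" using c_inv_mem[OF d(1), of z "fst d \<inter> X \<inter> (X - K)"] by blast
      then have "\<beta> (chart_inv d z) = 0" using \<beta>(4) by blast
      then show "?Y (chart_inv d z) d = 0" by (simp add: lincomb_def)
    qed
    moreover have "m \<in> X - K" using m False \<beta>(3) by blast
    ultimately show ?thesis using dd op by blast
  qed
qed

end

section \<open>Descent of the transverse orientation\<close>

lemma connectedin_locally_constant:
  assumes S: "connectedin T S"
    and loc: "\<And>x. x \<in> S \<Longrightarrow> \<exists>U. openin T U \<and> x \<in> U \<and> (\<forall>y\<in>S \<inter> U. Q y \<longleftrightarrow> Q x)"
    and xy: "x \<in> S" "y \<in> S" "Q x"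
  shows "Q y"
proof (rule ccontr)
  assume ny: "\<not> Q y"
  define E1 where "E1 = \<Union>{U. openin T U \<and> (\<forall>y\<in>S \<inter> U. Q y)}"
  define E2 where "E2 = \<Union>{U. openin T U \<and> (\<forall>y\<in>S \<inter> U. \<not> Q y)}"
  have "openin T E1" "openin T E2" unfolding E1_def E2_def by (rule openin_Union, blast)+
  moreover have "S \<subseteq> E1 \<union> E2"
  proof
    fix z assume z: "z \<in> S"
    obtain U where U: "openin T U" "z \<in> U" "\<forall>y\<in>S \<inter> U. Q y \<longleftrightarrow> Q z" using loc[OF z] by blast
    show "z \<in> E1 \<union> E2"
    proof (cases "Q z")
      case True
      then have "U \<in> {U. openin T U \<and> (\<forall>y\<in>S \<inter> U. Q y)}" using U by simp
      then show ?thesis using U(2) unfolding E1_def by blast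
    next
      case False
      then have "U \<in> {U. openin T U \<and> (\<forall>y\<in>S \<inter> U. \<not> Q y)}" using U by simp
      then show ?thesis using U(2) unfolding E2_def by blast
    qed
  qed
  moreover have 1: "Q z" if "z \<in> S" "z \<in> E1" for z using that unfolding E1_def by blast
  moreover have 2: "\<not> Q z" if "z \<in> S" "z \<in> E2" for z using that unfolding E2_def by blast
  moreover have "E1 \<inter> E2 \<inter> S = {}" using 1 2 by blast
  moreover have "x \<in> E1" "y \<in> E2" using \<open>S \<subseteq> E1 \<union> E2\<close> 1[of y] 2[of x] xy ny by blast+
  ultimately show False using S xy unfolding connectedin by blast
qed

lemma transverse_volume_formD:
  assumes "transverse_volume_form M q F \<omega>"
  shows volume_form_linear: "m \<in> topspace (points M) \<Longrightarrow> length ns = q \<Longrightarrow> set ns \<subseteq> normal_space M F m \<Longrightarrow> i < q \<Longrightarrow>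
      u \<in> tangent_space M m \<Longrightarrow> v \<in> tangent_space M m \<Longrightarrow> \<omega> m (ns[i := normal_class M F m (lincomb a u b v)]) =
        a * \<omega> m (ns[i := normal_class M F m u]) + b * \<omega> m (ns[i := normal_class M F m v])"
    and volume_form_alternating: "m \<in> topspace (points M) \<Longrightarrow> length ns = q \<Longrightarrow> set ns \<subseteq> normal_space M F m \<Longrightarrow> i < q \<Longrightarrow>
      j < q \<Longrightarrow> i \<noteq> j \<Longrightarrow> ns ! i = ns ! j \<Longrightarrow> \<omega> m ns = 0"
    and volume_form_nonzero: "m \<in> topspace (points M) \<Longrightarrow> \<exists>ns. length ns = q \<and> set ns \<subseteq> normal_space M F m \<and> \<omega> m ns \<noteq> 0"
    and volume_form_smooth: "openin (points M) U \<Longrightarrow> (\<And>i. i < q \<Longrightarrow> vector_field_on M U (Y i)) \<Longrightarrow>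
      smooth_fun M U (\<lambda>m. \<omega> m (map (\<lambda>i. normal_class M F m (Y i m)) [0..<q]))"
proof -
  note * = assms[unfolded transverse_volume_form_def]
  show "smooth_fun M U (\<lambda>m. \<omega> m (map (\<lambda>i. normal_class M F m (Y i m)) [0..<q]))"
    if "openin (points M) U" "\<And>i. i < q \<Longrightarrow> vector_field_on M U (Y i)"
    by (rule conjunct2[OF *, rule_format]) (use that in blast)
  show "\<exists>ns. length ns = q \<and> set ns \<subseteq> normal_space M F m \<and> \<omega> m ns \<noteq> 0" if "m \<in> topspace (points M)"
    by (rule conjunct2[OF bspec[OF conjunct1[OF *] that]])
  show "\<omega> m (ns[i := normal_class M F m (lincomb a u b v)]) =
        a * \<omega> m (ns[i := normal_class M F m u]) + b * \<omega> m (ns[i := normal_class M F m v])"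
    if m: "m \<in> topspace (points M)" and "length ns = q" "set ns \<subseteq> normal_space M F m" "i < q" "u \<in> tangent_space M m" "v \<in> tangent_space M m"
    using conjunct1[OF bspec[OF conjunct1[OF *] m], rule_format, of ns, THEN conjunct1] that by blast
  show "\<omega> m ns = 0" if m: "m \<in> topspace (points M)" and "length ns = q" "set ns \<subseteq> normal_space M F m" "i < q" "j < q" "i \<noteq> j" "ns ! i = ns ! j"
    using conjunct1[OF bspec[OF conjunct1[OF *] m], rule_format, of ns, THEN conjunct2] that by blast
qed

lemma (in submersion_chart) section_smooth_funI:
  assumes m0: "m0 \<in> fst c" and A: "openin (points M) A" and G: "smooth_fun M A G"
    and f: "\<And>w. w \<in> sdom m0 A \<Longrightarrow> f w = G (section_at m0 w)"
  shows "smooth_fun W (sdom m0 A) f"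
proof (rule W.smooth_fun_cong[OF _ sdom_open[OF m0 A] f])
  show "smooth_fun W (sdom m0 A) (\<lambda>w. G (section_at m0 w))"
  proof (rule W.smooth_funI[OF sdom_open[OF m0 A]])
    fix w assume w: "w \<in> sdom m0 A"
    have "fst d \<inter> sdom m0 A \<inter> sdom m0 A = sdom m0 A" by (auto simp: sdom_def)
    then show "\<exists>d B. d \<in> charts_at W w \<and> openin (points W) B \<and> w \<in> B \<and>
      smooth_on (snd d ` (fst d \<inter> sdom m0 A \<inter> B)) (\<lambda>z. G (section_at m0 (chart_inv d z)))"
      using section_smooth_fun[OF m0 A G] sdom_open[OF m0 A] w W.charts_atI[OF d section_at(5)[OF m0 w]]
      by (intro exI[of _ d] exI[of _ "sdom m0 A"]) simp
  qed
qed

lemma (in submersion_chart) sdom_restrict: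
  assumes m0: "m0 \<in> fst c"
  shows "sdom m0 {x \<in> fst c. h x \<in> U} = U \<inter> sdom m0 (fst c)"
proof (intro equalityI subsetI)
  fix w assume w: "w \<in> sdom m0 {x \<in> fst c. h x \<in> U}"
  have "w \<in> sdom m0 (fst c)" using w unfolding sdom_def by blast
  then show "w \<in> U \<inter> sdom m0 (fst c)" using section_at(2,3)[OF m0 w] by auto
next
  fix w assume w: "w \<in> U \<inter> sdom m0 (fst c)"
  then have wD: "w \<in> sdom m0 (fst c)" by blast
  note s = section_at[OF m0 wD]
  have "section_at m0 w \<in> fst c \<inter> {x \<in> fst c. h x \<in> U}" using s w by simp
  from imageI[OF this, of "snd c"]
  have "sec m0 (snd d w) \<in> snd c ` (fst c \<inter> {x \<in> fst c. h x \<in> U})" unfolding s(4) .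
  then show "w \<in> sdom m0 {x \<in> fst c. h x \<in> U}" using s(5) by (simp add: sdom_def)
qed

context saturated_foliation
begin

text \<open>In an adapted chart the pulled back class of a fixed \<open>u\<close> is represented by
  coordinates \<open>J (u d)\<close> that are the same at all points of the fibre; continuity and
  derivatives along the fibre thereby become computable.\<close>

lemma lift_class:
  assumes sf: "submersion_form M W h c d p J" and m: "m \<in> fst c" and u: "u \<in> tangent_space W (h m)"
  shows "pull m (normal_class W FW (h m) u) = normal_class M F m (M.vec m c (J (u d)))"
proof -
  interpret sc: submersion_chart M W h c d p J by unfold_locales (rule sf)
  show ?thesis
    using pull_normal_class[OF sc.in_X[OF m] sc.lift_tangent[OF m, of u]] sc.dh_lift[OF m u]
    by (simp add: sc.lift_def)
qed

text \<open>The list \<open>us\<close> complements the leaf directions at \<open>w\<close> and is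
  chosen on \<open>W\<close>, so it serves all points of the fibre at once. Its lifts to
  \<open>m\<close> complement the leaf directions there, since vertical vectors are tangent to
  leaves; a form that is nonzero somewhere is then nonzero on them.\<close>

lemma volume_nonzero_on_basis:
  assumes \<omega>: "transverse_volume_form M q F \<omega>" and w: "w \<in> W.X"
  obtains us where "length us = q" "set us \<subseteq> tangent_space W w"
    "\<forall>m\<in>M.X. h m = w \<longrightarrow> \<omega> m (map (\<lambda>u. pull m (normal_class W FW w u)) us) \<noteq> 0"
proof -
  obtain k' K where k': "k' \<in> charts_at W w" "subspace K" "K \<subseteq> W.E" "dim K + q = dim W.E"
    "leaf_tangent W FW w = {u \<in> tangent_space W w. u k' \<in> K}" by (rule WF.T_chart[OF w])
  obtain bs where bs: "length bs = q" "set bs \<subseteq> W.E" "W.E \<subseteq> span (set bs \<union> K)"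
    by (rule complementary_basis[OF W.subspace_E k'(3,4)])
  let ?us = "map (W.vec w k') bs"
  have "\<omega> m (map (\<lambda>u. pull m (normal_class W FW w u)) ?us) \<noteq> 0" if m: "m \<in> M.X" "h m = w" for m
  proof -
    obtain k V where k: "k \<in> charts_at M m" "subspace V" "V \<subseteq> M.E" "dim V + q = dim M.E"
      "leaf_tangent M F m = {v \<in> tangent_space M m. v k \<in> V}" by (rule MF.T_chart[OF m(1)])
    have k'm: "k' \<in> charts_at W (h m)" using k'(1) m(2) by simp
    let ?N = "\<lambda>x. normal_class M F m (M.vec m k x)"
    define f where "f xs = \<omega> m (map ?N xs)" for xs
    have NS: "set (map ?N xs) \<subseteq> normal_space M F m" if "set xs \<subseteq> M.E" for xs
      using that M.vec_tangent(1)[OF k(1)] unfolding normal_space_def by auto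
    have lin: "\<omega> m (ns[i := normal_class M F m (lincomb a u b v)]) =
                a * \<omega> m (ns[i := normal_class M F m u]) + b * \<omega> m (ns[i := normal_class M F m v])"
      if "length ns = q" "set ns \<subseteq> normal_space M F m" "i < q" "u \<in> tangent_space M m" "v \<in> tangent_space M m" for ns i u v a b
      by (rule volume_form_linear[OF \<omega> m(1) that])
    have alt: "\<omega> m ns = 0" if "length ns = q" "set ns \<subseteq> normal_space M F m" "i < q" "j < q" "i \<noteq> j" "ns ! i = ns ! j" for ns i j
      by (rule volume_form_alternating[OF \<omega> m(1) that])
    \<comment> \<open>Some lift of the vector with coordinates \<open>b\<close>; its normal class is
      determined by \<open>b\<close>, which is all that counts.\<close>
    define lf where "lf b = (SOME v. v \<in> tangent_space M m \<and> differential M W h m v = W.vec w k' b)" for b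
    have lf: "lf b \<in> tangent_space M m" "differential M W h m (lf b) = W.vec w k' b" if b: "b \<in> W.E" for b
    proof -
      have "W.vec w k' b \<in> tangent_space W (h m)" using W.vec_tangent(1)[OF k'(1) b] m(2) by simp
      then obtain v where "v \<in> tangent_space M m" "differential M W h m v = W.vec w k' b" by (rule dh_surj[OF m(1)])
      then have "\<exists>v. v \<in> tangent_space M m \<and> differential M W h m v = W.vec w k' b" by blast
      from someI_ex[OF this] show "lf b \<in> tangent_space M m" "differential M W h m (lf b) = W.vec w k' b"
        unfolding lf_def by auto
    qed
    let ?bs = "map (\<lambda>b. lf b k) bs"
    have bsE: "set ?bs \<subseteq> M.E" using bs(2) M.tangent_mem[OF lf(1) k(1)] by auto
    obtain D where D: "((\<lambda>z. snd k' (h (chart_inv k z))) has_derivative D) (at (snd k m) within snd k ` (fst k \<inter> {m \<in> M.X. h m \<in> fst k'}))"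
      by (rule smooth_on_has_derivative[OF h_rep[OF M.charts_at_chart(1)[OF k(1)] W.charts_at_chart(1)[OF k'm]] h_rep_domain(2)[OF k(1) k'm]])
    have lD: "linear D" by (rule bounded_linear.linear[OF has_derivative_bounded_linear[OF D]])
    have Dv: "D (v k) = differential M W h m v k'" if "v \<in> tangent_space M m" for v
      using has_derivative_along_line(2)[OF M.subspace_E h_rep_domain[OF k(1) k'm] M.tangent_mem[OF that k(1)] D] dh_rep[OF that k(1) k'm] by simp
    have Dx: "D x = differential M W h m (M.vec m k x) k'" if "x \<in> M.E" for x
      using Dv[OF M.vec_tangent(1)[OF k(1) that]] M.vec_tangent(2)[OF k(1) that] by simp
    have DE: "D x \<in> W.E" if "x \<in> M.E" for x
      unfolding Dx[OF that] by (rule W.tangent_mem[OF dh_tangent[OF M.vec_tangent(1)[OF k(1) that] m(1)] k'm])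
    \<comment> \<open>Lifts are mapped to \<open>bs\<close>, and leaf tangent vectors at
      \<open>m\<close> are mapped onto those at \<open>w\<close>, which have coordinates in
      \<open>K\<close>.\<close>
    have sub: "set bs \<union> K \<subseteq> D ` (set ?bs \<union> V)"
    proof
      fix y assume y: "y \<in> set bs \<union> K"
      then have yE: "y \<in> W.E" using bs(2) k'(3) by blast
      show "y \<in> D ` (set ?bs \<union> V)"
      proof (cases "y \<in> K")
        case True
        then have "W.vec w k' y \<in> leaf_tangent W FW (h m)" using W.vec_tangent[OF k'(1) yE] k'(5) m(2) by simp
        then obtain v where v: "v \<in> leaf_tangent M F m" "W.vec w k' y = differential M W h m v"
          using dh_leaf_tangent[OF m(1)] by blast
        have "v \<in> tangent_space M m" "v k \<in> V" using v(1) k(5) by auto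
        then show ?thesis using Dv[of v] v(2) W.vec_tangent(2)[OF k'(1) yE] by (metis UnI2 imageI)
      next
        case False
        then have "lf y k \<in> set ?bs" using y by auto
        moreover have "D (lf y k) = y" using Dv[OF lf(1)[OF yE]] lf(2)[OF yE] W.vec_tangent(2)[OF k'(1) yE] by simp
        ultimately show ?thesis by (metis UnI1 imageI)
      qed
    qed
    \<comment> \<open>\<open>x\<close> agrees under \<open>D\<close> with some \<open>y\<close> of
      the span, and the difference is vertical, hence in \<open>V\<close>.\<close>
    have spanE: "M.E \<subseteq> span (set ?bs \<union> V)"
    proof
      fix x assume x: "x \<in> M.E"
      have "D x \<in> span (D ` (set ?bs \<union> V))" using DE[OF x] bs(3) span_mono[OF sub] by blast
      then obtain y where y: "y \<in> span (set ?bs \<union> V)" "D x = D y" unfolding linear_span_image[OF lD] by blast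
      have "span (set ?bs \<union> V) \<subseteq> M.E" by (rule span_minimal[OF _ M.subspace_E]) (use bsE k(3) in blast)
      then have xy: "x - y \<in> M.E" using subspace_diff[OF M.subspace_E x] y(1) by blast
      note vT = M.vec_tangent[OF k(1) xy]
      have "differential M W h m (M.vec m k (x - y)) = (\<lambda>c. 0)"
      proof (rule W.tangent_eqI[OF dh_tangent[OF vT(1) m(1)] W.zero_tangent[OF h_mem[OF m(1)]] k'm])
        show "differential M W h m (M.vec m k (x - y)) k' = 0" using Dx[OF xy] y(2) by (simp add: linear_diff[OF lD])
      qed
      then have "M.vec m k (x - y) \<in> leaf_tangent M F m" by (rule vertical_leaf_tangent[OF m(1) vT(1)])
      then have "x - y \<in> V" using k(5) vT(2) by simp
      then have "x - y + y \<in> span (set ?bs \<union> V)" using y(1) by (intro span_add) (auto intro: span_base)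
      then show "x \<in> span (set ?bs \<union> V)" by simp
    qed
    obtain ns where ns: "length ns = q" "set ns \<subseteq> normal_space M F m" "\<omega> m ns \<noteq> 0"
      using volume_form_nonzero[OF \<omega> m(1)] by blast
    \<comment> \<open>Representatives turn the normal vectors on which \<open>\<omega>\<close> is
      nonzero into a list of coordinate vectors.\<close>
    define co where "co n = (SOME u. u \<in> tangent_space M m \<and> normal_class M F m u = n)" for n
    have co: "co n \<in> tangent_space M m" "normal_class M F m (co n) = n" if "n \<in> normal_space M F m" for n
    proof -
      have "\<exists>u. u \<in> tangent_space M m \<and> normal_class M F m u = n" using that unfolding normal_space_def by auto
      from someI_ex[OF this] show "co n \<in> tangent_space M m" "normal_class M F m (co n) = n" unfolding co_def by auto
    qed
    let ?zs = "map (\<lambda>n. co n k) ns"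
    have zsE: "set ?zs \<subseteq> M.E" using ns(2) M.tangent_mem[OF co(1) k(1)] by auto
    have "?N (co n k) = n" if "n \<in> normal_space M F m" for n
      using co[OF that] M.tangent_vec[OF co(1)[OF that] k(1)] by simp
    then have "map ?N ?zs = ns" unfolding map_map o_def using ns(2) by (intro map_idI) blast
    then have nz: "f ?zs \<noteq> 0" using ns(3) by (simp add: f_def)
    have "f ?bs \<noteq> 0"
    proof (rule alternating_nonzero_on_basis[where f=f and E=M.E and V=V and zs="?zs" and bs="?bs" and n=q, OF M.subspace_E k(3) _ _ _ _ zsE nz _ bsE spanE])
      fix xs i x y a b assume xs: "length xs = q" "set xs \<subseteq> M.E" "i < q" "x \<in> M.E" "y \<in> M.E"
      show "f (xs[i := a *\<^sub>R x + b *\<^sub>R y]) = a * f (xs[i := x]) + b * f (xs[i := y])"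
        unfolding f_def map_update M.vec_lincomb[OF k(1) xs(4,5)]
        by (rule lin) (use xs NS M.vec_tangent(1)[OF k(1)] in auto)
    next
      fix xs i j assume xs: "length xs = q" "set xs \<subseteq> M.E" "i < q" "j < q" "i \<noteq> j" "xs ! i = xs ! j"
      show "f xs = 0" unfolding f_def by (rule alt[OF _ NS[OF xs(2)] xs(3-5)]) (use xs in simp_all)
    next
      fix xs i v assume xs: "length xs = q" "set xs \<subseteq> M.E" "i < q" "v \<in> V"
      have vE: "v \<in> M.E" using xs(4) k(3) by blast
      note vT = M.vec_tangent[OF k(1) vE]
      \<comment> \<open>The zero vector is written as a combination with coefficients 0, so that
        linearity of \<open>\<omega>\<close> in one slot applies to it.\<close>
      have "lincomb 1 (M.vec m k v) (-1) (lincomb 0 (M.vec m k v) 0 (M.vec m k v)) = M.vec m k v"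
        by (simp add: lincomb_def)
      moreover have "M.vec m k v \<in> leaf_tangent M F m" using k(5) vT xs(4) by simp
      ultimately have "?N v = normal_class M F m (lincomb 0 (M.vec m k v) 0 (M.vec m k v))"
        using MF.nc_eq_iff[OF m(1) vT(1) M.lincomb_tangent[OF vT(1) vT(1) m(1)], of 0 0] by simp
      then show "f (xs[i := v]) = 0"
        unfolding f_def map_update using lin[OF _ NS[OF xs(2)] xs(3) vT(1) vT(1), of 0 0] xs(1) by simp
    qed (use bs(1) ns(1) in simp_all)
    moreover have "map ?N ?bs = map (\<lambda>u. pull m (normal_class W FW w u)) ?us"
    proof -
      have "?N (lf b k) = pull m (normal_class W FW w (W.vec w k' b))" if "b \<in> W.E" for b
        using pull_normal_class[OF m(1) lf(1)[OF that]] lf[OF that] M.tangent_vec[OF lf(1)[OF that] k(1)] m(2) by simp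
      then show ?thesis using bs(2) by (auto simp: subset_iff)
    qed
    ultimately show ?thesis unfolding f_def by (simp only: not_False_eq_True)
  qed
  moreover have "set ?us \<subseteq> tangent_space W w" using bs(2) W.vec_tangent(1)[OF k'(1)] by auto
  ultimately show thesis using that[of ?us] bs(1) by simp
qed

text \<open>In an adapted chart, fields with the constant coordinates \<open>J ((us ! i) d)\<close>
  represent the pulled back classes along the fibre, so the value of \<open>\<omega>\<close> on them
  is continuous. It has no zero on the connected fibre, hence keeps its sign.\<close>

lemma volume_sign_constant:
  assumes \<omega>: "transverse_volume_form M q F \<omega>" and conn: "connectedin (points M) (fibre M h w)"
    and us: "length us = q" "set us \<subseteq> tangent_space W w"
    and nz: "\<forall>m\<in>M.X. h m = w \<longrightarrow> \<omega> m (map (\<lambda>u. pull m (normal_class W FW w u)) us) \<noteq> 0"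
    and m: "m \<in> M.X" "h m = w" "m' \<in> M.X" "h m' = w"
    and pos: "0 < \<omega> m (map (\<lambda>u. pull m (normal_class W FW w u)) us)"
  shows "0 < \<omega> m' (map (\<lambda>u. pull m' (normal_class W FW w u)) us)"
proof (rule connectedin_locally_constant[OF conn, where Q="\<lambda>m. 0 < \<omega> m (map (\<lambda>u. pull m (normal_class W FW w u)) us)" and x=m])
  show "m \<in> fibre M h w" "m' \<in> fibre M h w" using m by (auto simp: fibre_def)
  fix x assume "x \<in> fibre M h w"
  then have x: "x \<in> M.X" "h x = w" by (auto simp: fibre_def)
  obtain c d p J where sf: "submersion_form M W h c d p J" "x \<in> fst c" using form_at[OF x(1)] by blast
  interpret sc: submersion_chart M W h c d p J by unfold_locales (rule sf(1))
  note cop = M.c_open[OF sc.c]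
  define Y where "Y i y = M.vec y c (J ((us ! i) d))" for i y
  define G where "G y = \<omega> y (map (\<lambda>i. normal_class M F y (Y i y)) [0..<q])" for y
  have "vector_field_on M (fst c) (Y i)" for i
    unfolding Y_def by (rule M.coordinate_field[where \<xi>="\<lambda>_. J ((us ! i) d)", OF sc.c cop order_refl smooth_on_const sc.J_mem])
  then have "smooth_fun M (fst c) G"
    unfolding G_def by (rule volume_form_smooth[OF \<omega> cop])
  then have cont: "continuous_map (subtopology (points M) (fst c)) euclidean G"
    by (simp add: smooth_map_def open_submanifold_def euclidean_manifold_def)
  have G: "G y = \<omega> y (map (\<lambda>u. pull y (normal_class W FW w u)) us)" if y: "y \<in> fst c" "h y = w" for y
  proof -
    have "map (\<lambda>i. normal_class M F y (Y i y)) [0..<q] = map (\<lambda>u. pull y (normal_class W FW w u)) us"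
    proof (intro nth_equalityI)
      fix i assume i: "i < length (map (\<lambda>i. normal_class M F y (Y i y)) [0..<q])"
      then have "us ! i \<in> tangent_space W (h y)" using us y(2) nth_mem by auto
      from lift_class[OF sf(1) y(1) this]
      show "map (\<lambda>i. normal_class M F y (Y i y)) [0..<q] ! i = map (\<lambda>u. pull y (normal_class W FW w u)) us ! i"
        using i us(1) y(2) by (simp add: Y_def)
    qed (use us in simp)
    then show ?thesis by (simp add: G_def)
  qed
  have nzG: "G x \<noteq> 0" using G[OF sf(2) x(2)] nz x by simp
  \<comment> \<open>The open half-line on the side of \<open>G x\<close>; its preimage is a
    neighbourhood of constant sign on the fibre.\<close>
  define O1 :: "real set" where "O1 = (if 0 < G x then {0<..} else {..<0})"
  have O1: "open O1" "G x \<in> O1" using nzG by (auto simp: O1_def)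
  let ?U = "{y \<in> topspace (subtopology (points M) (fst c)). G y \<in> O1}"
  have "openin (subtopology (points M) (fst c)) ?U" by (rule openin_continuous_map_preimage[OF cont]) (use O1 in simp)
  then have "openin (points M) ?U" by (rule openin_trans_full[OF _ cop])
  moreover have "x \<in> ?U" using x(1) sf(2) O1(2) by (simp add: topspace_subtopology)
  moreover have "0 < \<omega> y (map (\<lambda>u. pull y (normal_class W FW w u)) us) \<longleftrightarrow> 0 < \<omega> x (map (\<lambda>u. pull x (normal_class W FW w u)) us)"
    if y: "y \<in> fibre M h w \<inter> ?U" for y
  proof -
    have yy: "y \<in> fst c" "h y = w" "G y \<in> O1" using y by (auto simp: fibre_def topspace_subtopology)
    show ?thesis using yy(3) unfolding O1_def G[OF yy(1,2), symmetric] G[OF sf(2) x(2), symmetric] by (auto split: if_splits)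
  qed
  ultimately show "\<exists>U. openin (points M) U \<and> x \<in> U \<and> (\<forall>y\<in>fibre M h w \<inter> U.
     (0 < \<omega> y (map (\<lambda>u. pull y (normal_class W FW w u)) us)) = (0 < \<omega> x (map (\<lambda>u. pull x (normal_class W FW w u)) us)))"
    by (intro exI[of _ ?U]) blast
qed (rule pos)

text \<open>Different sections through the same fibre see the same sign of \<open>\<omega>\<close>
  on a common list of vectors at \<open>w\<close>. As the weights are nonnegative and one of them is
  1, their combination cannot cancel.\<close>

lemma transversely_orientable_FW:
  assumes \<omega>: "transverse_volume_form M q F \<omega>" and cpt: "compact_space (points W)"
    and conn: "\<And>w. w \<in> W.X \<Longrightarrow> connectedin (points M) (fibre M h w)"
  shows "transversely_orientable W q FW"
proof -
  have haus: "Hausdorff_space (points W)" using W.smooth_mfd by (simp add: smooth_manifold_def)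
  \<comment> \<open>Collects the data chosen for \<open>w\<close>: a section \<open>\<sigma>\<close>
    over \<open>D\<close>, a cutoff \<open>\<beta>\<close> that is 1 on \<open>B\<close> and 0 off
    \<open>K\<close>, and smoothness of the pullback of \<open>\<omega>\<close> by
    \<open>\<sigma>\<close>, tested on vector fields.\<close>
  define Q where "Q w D \<sigma> \<beta> B K \<longleftrightarrow> openin (points W) B \<and> w \<in> B \<and> openin (points W) D \<and> closedin (points W) K \<and> K \<subseteq> D \<and>
      (\<forall>x\<in>B. \<beta> x = (1::real)) \<and> (\<forall>x. x \<notin> K \<longrightarrow> \<beta> x = 0) \<and> (\<forall>x. 0 \<le> \<beta> x) \<and> smooth_fun W W.X \<beta> \<and> B \<subseteq> D \<and>
      (\<forall>x\<in>D. \<sigma> x \<in> M.X \<and> h (\<sigma> x) = x) \<and>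
      (\<forall>U Y. openin (points W) U \<longrightarrow> (\<forall>i<q. vector_field_on W U (Y i)) \<longrightarrow>
         smooth_fun W (U \<inter> D) (\<lambda>x. \<omega> (\<sigma> x) (map (pull (\<sigma> x)) (map (\<lambda>i. normal_class W FW x (Y i x)) [0..<q]))))" for w D \<sigma> \<beta> B K
  have "\<forall>w\<in>W.X. \<exists>D \<sigma> \<beta> B K. Q w D \<sigma> \<beta> B K"
  proof
    fix w assume w: "w \<in> W.X"
    obtain m where m: "m \<in> M.X" "h m = w" using surj w by (metis imageE)
    obtain c d p J where sf: "submersion_form M W h c d p J" "m \<in> fst c" using form_at[OF m(1)] by blast
    interpret sc: submersion_chart M W h c d p J by unfold_locales (rule sf(1))
    let ?D = "sc.sdom m (fst c)" and ?s = "sc.section_at m"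
    have D: "openin (points W) ?D" by (rule sc.sdom_open[OF sf(2) M.c_open[OF sc.c]])
    have wD: "w \<in> ?D" using sc.sdom_base[OF sf(2) sf(2)] m(2) by simp
    obtain \<beta> B K where \<beta>: "openin (points W) B" "w \<in> B" "B \<subseteq> ?D" "closedin (points W) K" "K \<subseteq> ?D"
      "\<forall>x\<in>B. \<beta> x = 1" "\<forall>x. x \<notin> K \<longrightarrow> \<beta> x = 0" "\<forall>x. 0 \<le> \<beta> x" "smooth_fun W W.X \<beta>"
      by (rule W.bump_function[OF haus D wD])
    have sm: "smooth_fun W (U \<inter> ?D) (\<lambda>x. \<omega> (?s x) (map (pull (?s x)) (map (\<lambda>i. normal_class W FW x (Y i x)) [0..<q])))"
      if U: "openin (points W) U" and Y: "\<forall>i<q. vector_field_on W U (Y i)" for U Y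
    proof -
      define A where "A = {x \<in> fst c. h x \<in> U}"
      have "A = fst c \<inter> {x \<in> M.X. h x \<in> U}" using sc.in_X by (auto simp: A_def)
      then have A: "openin (points M) A" "A \<subseteq> fst c" "h ` A \<subseteq> U"
        using openin_Int[OF M.c_open[OF sc.c] h_preimage[OF U]] by (auto simp: A_def)
      define G where "G x = \<omega> x (map (\<lambda>i. normal_class M F x (sc.lift x (Y i (h x)))) [0..<q])" for x
      have G: "smooth_fun M A G"
        unfolding G_def
        by (rule volume_form_smooth[OF \<omega> A(1)]) (rule sc.lift_field[OF U _ A], use Y in blast)
      show ?thesis
        unfolding sc.sdom_restrict[OF sf(2), symmetric] A_def[symmetric]
      proof (rule sc.section_smooth_funI[OF sf(2) A(1) G])
        fix x assume x: "x \<in> sc.sdom m A"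
        note s = sc.section_at[OF sf(2) x]
        have xU: "x \<in> U" using s(2,3) A(3) by auto
        have "pull (?s x) (normal_class W FW x (Y i x)) = normal_class M F (?s x) (sc.lift (?s x) (Y i (h (?s x))))" if "i < q" for i
        proof -
          have "vector_field_on W U (Y i)" using Y that by blast
          then have "Y i x \<in> tangent_space W (h (?s x))" using W.vector_field_tangent[OF _ xU] s(3) by simp
          from lift_class[OF sf(1) s(1) this] show ?thesis using s(3) by (simp add: sc.lift_def)
        qed
        then show "\<omega> (?s x) (map (pull (?s x)) (map (\<lambda>i. normal_class W FW x (Y i x)) [0..<q])) = G (?s x)"
          unfolding G_def by (intro arg_cong[where f="\<omega> (?s x)"]) simp
      qed
    qed
    have sec: "\<forall>x\<in>?D. ?s x \<in> M.X \<and> h (?s x) = x"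
      using sc.section_at(1,3)[OF sf(2)] sc.in_X by blast
    have "Q w ?D ?s \<beta> B K"
      unfolding Q_def
    proof (intro conjI)
      show "\<forall>U Y. openin (points W) U \<longrightarrow> (\<forall>i<q. vector_field_on W U (Y i)) \<longrightarrow>
         smooth_fun W (U \<inter> ?D) (\<lambda>x. \<omega> (?s x) (map (pull (?s x)) (map (\<lambda>i. normal_class W FW x (Y i x)) [0..<q])))"
        by (intro allI impI) (rule sm)
    qed (rule \<beta> D sec)+
    then show "\<exists>D \<sigma> \<beta> B K. Q w D \<sigma> \<beta> B K" by blast
  qed
  then obtain D \<sigma> \<beta> B K where cov: "\<forall>w\<in>W.X. Q w (D w) (\<sigma> w) (\<beta> w) (B w) (K w)"
    by metis
  have Q: "openin (points W) (B w)" "w \<in> B w" "openin (points W) (D w)" "closedin (points W) (K w)" "K w \<subseteq> D w"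
    "\<And>x. x \<in> B w \<Longrightarrow> \<beta> w x = 1" "\<forall>x. x \<notin> K w \<longrightarrow> \<beta> w x = 0" "\<And>x. 0 \<le> \<beta> w x" "smooth_fun W W.X (\<beta> w)" "B w \<subseteq> D w"
    "\<And>x. x \<in> D w \<Longrightarrow> \<sigma> w x \<in> M.X \<and> h (\<sigma> w x) = x" if "w \<in> W.X" for w
    using bspec[OF cov that] unfolding Q_def by simp_all
  have Qs: "smooth_fun W (U \<inter> D w) (\<lambda>x. \<omega> (\<sigma> w x) (map (pull (\<sigma> w x)) (map (\<lambda>i. normal_class W FW x (Y i x)) [0..<q])))"
    if "w \<in> W.X" "openin (points W) U" "\<forall>i<q. vector_field_on W U (Y i)" for w U Y
    using bspec[OF cov that(1), unfolded Q_def, THEN conjunct2, THEN conjunct2, THEN conjunct2, THEN conjunct2, THEN conjunct2,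
        THEN conjunct2, THEN conjunct2, THEN conjunct2, THEN conjunct2, THEN conjunct2, THEN conjunct2] that(2,3) by simp
  obtain I where I: "finite I" "I \<subseteq> W.X" "W.X \<subseteq> \<Union>(B ` I)"
  proof -
    have "\<exists>\<F>. finite \<F> \<and> \<F> \<subseteq> B ` W.X \<and> W.X \<subseteq> \<Union>\<F>"
    proof -
      have "(\<forall>U\<in>B ` W.X. openin (points W) U) \<and> W.X \<subseteq> \<Union>(B ` W.X)" using Q(1,2) by blast
      then show ?thesis using cpt[unfolded compact_space_alt, rule_format, of "B ` W.X"] by blast
    qed
    then obtain \<F> where \<F>: "finite \<F>" "\<F> \<subseteq> B ` W.X" "W.X \<subseteq> \<Union>\<F>" by blast
    obtain I where "I \<subseteq> W.X" "finite I" "\<F> = B ` I" using finite_subset_image[OF \<F>(1,2)] by blast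
    then show thesis using that \<F>(3) by blast
  qed
  \<comment> \<open>Outside \<open>D i\<close> the section is meaningless; the default 0 agrees with
    the vanishing of the weight there.\<close>
  define \<Omega> where "\<Omega> w ns = (\<Sum>i\<in>I. if w \<in> D i then \<beta> i w * \<omega> (\<sigma> i w) (map (pull (\<sigma> i w)) ns) else 0)" for w ns
  have sec: "\<sigma> i w \<in> M.X" "h (\<sigma> i w) = w" if "i \<in> I" "w \<in> D i" for i w
    using Q(11)[of i w] I(2) that by blast+
  have lin: "\<omega> m (map (pull m) (ns[i := normal_class W FW (h m) (lincomb a u b v)])) =
      a * \<omega> m (map (pull m) (ns[i := normal_class W FW (h m) u])) + b * \<omega> m (map (pull m) (ns[i := normal_class W FW (h m) v]))"
    if m: "m \<in> M.X" and ns: "length ns = q" "set ns \<subseteq> normal_space W FW (h m)" "i < q"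
      and u: "u \<in> tangent_space W (h m)" and v: "v \<in> tangent_space W (h m)" for m ns i u v a b
  proof -
    obtain u' where u': "u' \<in> tangent_space M m" "differential M W h m u' = u" by (rule dh_surj[OF m u])
    obtain v' where v': "v' \<in> tangent_space M m" "differential M W h m v' = v" by (rule dh_surj[OF m v])
    have P: "pull m (normal_class W FW (h m) u) = normal_class M F m u'" "pull m (normal_class W FW (h m) v) = normal_class M F m v'"
      "pull m (normal_class W FW (h m) (lincomb a u b v)) = normal_class M F m (lincomb a u' b v')"
      using pull_normal_class[OF m u'(1)] pull_normal_class[OF m v'(1)] pull_normal_class[OF m M.lincomb_tangent[OF u'(1) v'(1) m], of a b]
        dh_lincomb[OF u'(1) v'(1) m] u'(2) v'(2) by simp_all
    have "length (map (pull m) ns) = q" "set (map (pull m) ns) \<subseteq> normal_space M F m"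
      using ns pull_normal_space[OF m] by auto
    then show ?thesis
      unfolding map_update P by (intro volume_form_linear[OF \<omega> m _ _ ns(3) u'(1) v'(1)])
  qed
  have alt: "\<omega> m (map (pull m) ns) = 0"
    if m: "m \<in> M.X" and ns: "length ns = q" "set ns \<subseteq> normal_space W FW (h m)" "i < q" "j < q" "i \<noteq> j" "ns ! i = ns ! j" for m ns i j
  proof -
    have "length (map (pull m) ns) = q" "set (map (pull m) ns) \<subseteq> normal_space M F m" "map (pull m) ns ! i = map (pull m) ns ! j"
      using ns pull_normal_space[OF m] by auto
    then show ?thesis by (intro volume_form_alternating[OF \<omega> m _ _ ns(3-5)])
  qed
  have "transverse_volume_form W q FW \<Omega>"
    unfolding transverse_volume_form_def
  proof (intro conjI ballI allI impI; (elim conjE)?)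
    fix w ns i u v a b assume w: "w \<in> W.X" and ns: "length ns = q" "set ns \<subseteq> normal_space W FW w" "i < q"
      and uv: "u \<in> tangent_space W w" "v \<in> tangent_space W w"
    have "(if w \<in> D j then \<beta> j w * \<omega> (\<sigma> j w) (map (pull (\<sigma> j w)) (ns[i := normal_class W FW w (lincomb a u b v)])) else 0)
      = a * (if w \<in> D j then \<beta> j w * \<omega> (\<sigma> j w) (map (pull (\<sigma> j w)) (ns[i := normal_class W FW w u])) else 0)
      + b * (if w \<in> D j then \<beta> j w * \<omega> (\<sigma> j w) (map (pull (\<sigma> j w)) (ns[i := normal_class W FW w v])) else 0)" if j: "j \<in> I" for j
    proof (cases "w \<in> D j")
      case True
      from lin[of "\<sigma> j w" ns i u v a b] sec[OF j True] ns uv show ?thesis using True by (simp add: algebra_simps)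
    qed simp
    then show "\<Omega> w (ns[i := normal_class W FW w (lincomb a u b v)]) =
        a * \<Omega> w (ns[i := normal_class W FW w u]) + b * \<Omega> w (ns[i := normal_class W FW w v])"
      unfolding \<Omega>_def sum_distrib_left sum.distrib[symmetric] by (intro sum.cong refl)
  next
    fix w ns i j assume w: "w \<in> W.X" and ns: "length ns = q" "set ns \<subseteq> normal_space W FW w" "i < q" "j < q" "i \<noteq> j" "ns ! i = ns ! j"
    have "(if w \<in> D k then \<beta> k w * \<omega> (\<sigma> k w) (map (pull (\<sigma> k w)) ns) else 0) = 0" if k: "k \<in> I" for k
      using alt[of "\<sigma> k w" ns i j] sec[OF k] ns by simp
    then show "\<Omega> w ns = 0" unfolding \<Omega>_def by (intro sum.neutral ballI)
  next
    fix w assume w: "w \<in> W.X"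
    obtain us where us: "length us = q" "set us \<subseteq> tangent_space W w"
      "\<forall>m\<in>M.X. h m = w \<longrightarrow> \<omega> m (map (\<lambda>u. pull m (normal_class W FW w u)) us) \<noteq> 0"
      by (rule volume_nonzero_on_basis[OF \<omega> w])
    let ?ns = "map (normal_class W FW w) us"
    let ?v = "\<lambda>m. \<omega> m (map (pull m) ?ns)"
    have mm: "map (pull m) ?ns = map (\<lambda>u. pull m (normal_class W FW w u)) us" for m by simp
    have nz: "?v m \<noteq> 0" if "m \<in> M.X" "h m = w" for m unfolding mm using us(3) that by blast
    have sgn: "0 < ?v m \<Longrightarrow> 0 < ?v m'" if "m \<in> M.X" "h m = w" "m' \<in> M.X" "h m' = w" for m m'
      unfolding mm by (rule volume_sign_constant[OF \<omega> conn[OF w] us that])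
    obtain i where i: "i \<in> I" "w \<in> B i" using I(3) w by blast
    have iW: "i \<in> W.X" using i I(2) by blast
    have iD: "w \<in> D i" and b1: "\<beta> i w = 1" using Q(6,10)[OF iW] i(2) by blast+
    have b0: "0 \<le> \<beta> j w" if "j \<in> I" for j using Q(8)[of j w] I(2) that by blast
    \<comment> \<open>The reference sign: after multiplication by \<open>s\<close> every term is
      nonnegative and the one at \<open>i\<close> is positive.\<close>
    define s where "s = sgn (?v (\<sigma> i w))"
    note iS = sec[OF i(1) iD]
    have s: "s \<noteq> 0" using nz[OF iS] by (simp add: s_def sgn_eq_0_iff)
    have pos: "0 < s * ?v (\<sigma> j w)" if j: "j \<in> I" "w \<in> D j" for j
    proof (cases "0 < ?v (\<sigma> i w)")
      case True
      then show ?thesis using sgn[OF iS sec[OF j]] by (simp add: s_def)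
    next
      case False
      then have "?v (\<sigma> i w) < 0" using nz[OF iS] by linarith
      moreover have "?v (\<sigma> j w) < 0" using sgn[OF sec[OF j] iS] nz[OF sec[OF j]] False by linarith
      ultimately show ?thesis by (simp add: s_def)
    qed
    have "0 < (\<Sum>j\<in>I. s * (if w \<in> D j then \<beta> j w * ?v (\<sigma> j w) else 0))"
    proof (rule sum_pos2[OF I(1) i(1)])
      show "0 < s * (if w \<in> D i then \<beta> i w * ?v (\<sigma> i w) else 0)" using iD b1 pos[OF i(1) iD] by simp
      show "0 \<le> s * (if w \<in> D j then \<beta> j w * ?v (\<sigma> j w) else 0)" if "j \<in> I" for j
      proof (cases "w \<in> D j")
        case True
        have "0 \<le> \<beta> j w * (s * ?v (\<sigma> j w))" using b0[OF that] pos[OF that True] by simp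
        then show ?thesis using True by (simp add: ac_simps)
      qed simp
    qed
    then have "\<Omega> w ?ns \<noteq> 0" unfolding \<Omega>_def sum_distrib_left[symmetric] by auto
    moreover have "set ?ns \<subseteq> normal_space W FW w" using us(2) unfolding normal_space_def by auto
    ultimately show "\<exists>ns. length ns = q \<and> set ns \<subseteq> normal_space W FW w \<and> \<Omega> w ns \<noteq> 0"
      using us(1) by (intro exI[of _ ?ns]) simp
  next
    fix U Y assume U: "openin (points W) U" and Y: "\<forall>i<q. vector_field_on W U (Y i)"
    show "smooth_fun W U (\<lambda>m. \<Omega> m (map (\<lambda>i. normal_class W FW m (Y i m)) [0..<q]))"
      unfolding \<Omega>_def
    proof (rule W.smooth_fun_sum[OF U I(1)])
      fix i assume "i \<in> I"
      then have iW: "i \<in> W.X" using I(2) by blast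
      show "smooth_fun W U (\<lambda>x. if x \<in> D i then \<beta> i x * \<omega> (\<sigma> i x) (map (pull (\<sigma> i x)) (map (\<lambda>j. normal_class W FW x (Y j x)) [0..<q])) else 0)"
        by (rule W.smooth_fun_cutoff[OF Q(9,4,5,7,3)[OF iW] U Qs[OF iW U Y]])
    qed
  qed
  then show ?thesis unfolding transversely_orientable_def by blast
qed

end

section \<open>Descent of the transverse metric\<close>

lemma normal_metricD:
  assumes "normal_metric M F g"
  shows metric_linear: "m \<in> topspace (points M) \<Longrightarrow> u \<in> tangent_space M m \<Longrightarrow> v \<in> tangent_space M m \<Longrightarrow> w \<in> tangent_space M m \<Longrightarrow>
      g m (normal_class M F m (lincomb a u b v)) (normal_class M F m w) =
        a * g m (normal_class M F m u) (normal_class M F m w) + b * g m (normal_class M F m v) (normal_class M F m w)"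
    and metric_sym: "m \<in> topspace (points M) \<Longrightarrow> n \<in> normal_space M F m \<Longrightarrow> n' \<in> normal_space M F m \<Longrightarrow> g m n n' = g m n' n"
    and metric_pos: "m \<in> topspace (points M) \<Longrightarrow> n \<in> normal_space M F m \<Longrightarrow> n \<noteq> normal_class M F m (\<lambda>c. 0) \<Longrightarrow> 0 < g m n n"
    and metric_smooth: "openin (points M) U \<Longrightarrow> vector_field_on M U Y \<Longrightarrow> vector_field_on M U Z \<Longrightarrow>
      smooth_fun M U (\<lambda>m. g m (normal_class M F m (Y m)) (normal_class M F m (Z m)))"
proof -
  note * = assms[unfolded normal_metric_def]
  show "smooth_fun M U (\<lambda>m. g m (normal_class M F m (Y m)) (normal_class M F m (Z m)))"
    if "openin (points M) U" "vector_field_on M U Y" "vector_field_on M U Z"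
    by (rule conjunct2[OF *, rule_format]) (use that in blast)
  show "0 < g m n n" if m: "m \<in> topspace (points M)" and n: "n \<in> normal_space M F m" "n \<noteq> normal_class M F m (\<lambda>c. 0)"
    by (rule conjunct2[OF conjunct2[OF bspec[OF conjunct1[OF *] m]], rule_format]) (rule n)+
  show "g m n n' = g m n' n" if m: "m \<in> topspace (points M)" and n: "n \<in> normal_space M F m" "n' \<in> normal_space M F m"
    by (rule conjunct1[OF conjunct2[OF bspec[OF conjunct1[OF *] m]], rule_format]) (rule n)+
  show "g m (normal_class M F m (lincomb a u b v)) (normal_class M F m w) =
        a * g m (normal_class M F m u) (normal_class M F m w) + b * g m (normal_class M F m v) (normal_class M F m w)"
    if m: "m \<in> topspace (points M)" and u: "u \<in> tangent_space M m" "v \<in> tangent_space M m" "w \<in> tangent_space M m"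
    by (rule conjunct1[OF bspec[OF conjunct1[OF *] m], rule_format]) (rule u)+
qed

context foliated_mfd
begin

lemma nc_zero_cong:
  assumes m: "m \<in> X" and g: "normal_metric M F g" and w: "w \<in> tangent_space M m"
  shows "g m (nc m (\<lambda>c. 0)) (nc m w) = 0" "g m (nc m w) (nc m (\<lambda>c. 0)) = 0"
proof -
  have "lincomb 0 w 0 w = (\<lambda>c. 0)" by (simp add: lincomb_def)
  then show 1: "g m (nc m (\<lambda>c. 0)) (nc m w) = 0" using metric_linear[OF g m w w w, of 0 0] by simp
  have "nc m (\<lambda>c. 0) \<in> normal_space M F m" "nc m w \<in> normal_space M F m"
    using zero_tangent[OF m] w unfolding normal_space_def by blast+
  then show "g m (nc m w) (nc m (\<lambda>c. 0)) = 0" using 1 metric_sym[OF g m] by simp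
qed

end

lemma dir_deriv_const:
  assumes "subspace E" "openin (top_of_set E) S" "x \<in> S" "v \<in> E" "\<And>y. y \<in> S \<Longrightarrow> f y = k"
  shows "dir_deriv f x v = 0"
proof -
  have "dir_deriv f x v = dir_deriv (\<lambda>y. k) x v" by (rule dir_deriv_cong[OF assms])
  also have "\<dots> = 0" by (rule has_derivative_along_line(2)[OF assms(1-4) has_derivative_const])
  finally show ?thesis .
qed

context saturated_foliation
begin

text \<open>Coordinate fields of an adapted chart commute. Hence for a vertical coordinate field the
  condition \<open>L_X g = 0\<close>, evaluated on coordinate fields, says that the coefficients of
  \<open>g\<close> have derivative 0 in its direction. Two points of a fibre in a coordinate ball
  are joined by a segment of vertical direction, along which the coefficients are therefore
  constant.\<close>

lemma metric_constant_in_chart: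
  assumes g: "transverse_metric M F g" and haus: "Hausdorff_space (points M)"
    and sf: "submersion_form M W h c d p J" and m0: "m0 \<in> fst c" and \<xi>: "\<xi> \<in> M.E" "\<xi>' \<in> M.E"
  obtains U where "openin (points M) U" "m0 \<in> U" "U \<subseteq> fst c"
    "\<forall>y\<in>U. h y = h m0 \<longrightarrow> g y (normal_class M F y (M.vec y c \<xi>)) (normal_class M F y (M.vec y c \<xi>'))
        = g m0 (normal_class M F m0 (M.vec m0 c \<xi>)) (normal_class M F m0 (M.vec m0 c \<xi>'))"
proof -
  interpret sc: submersion_chart M W h c d p J by unfold_locales (rule sf)
  note cop = M.c_open[OF sc.c]
  have nm: "normal_metric M F g" using g by (simp add: transverse_metric_def)
  obtain \<beta> B K where \<beta>: "openin (points M) B" "m0 \<in> B" "B \<subseteq> fst c" "closedin (points M) K" "K \<subseteq> fst c"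
      "\<forall>x\<in>B. \<beta> x = 1" "\<forall>x. x \<notin> K \<longrightarrow> \<beta> x = 0" "\<forall>x. 0 \<le> \<beta> x" "smooth_fun M M.X \<beta>"
    by (rule M.bump_function[OF haus cop m0])
  have cB: "openin (top_of_set M.E) (snd c ` (fst c \<inter> B))" by (rule M.c_open_image[OF sc.c \<beta>(1)])
  obtain O1 where O1: "open O1" "snd c ` (fst c \<inter> B) = M.E \<inter> O1" using cB openin_open by blast
  define Z where "Z = snd c m0"
  have "Z \<in> O1" using O1(2) m0 \<beta>(2) unfolding Z_def by blast
  then obtain r where r: "r > 0" "ball Z r \<subseteq> O1" using O1(1) openE by blast
  define U where "U = {x \<in> fst c. snd c x \<in> M.E \<inter> ball Z r}"
  define Y where "Y \<zeta> x = M.vec x c \<zeta>" for \<zeta> x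
  define G where "G x = g x (normal_class M F x (Y \<xi> x)) (normal_class M F x (Y \<xi>' x))" for x
  have field: "vector_field_on M (fst c) (Y \<zeta>)" if "\<zeta> \<in> M.E" for \<zeta>
    unfolding Y_def by (rule M.coordinate_field[where \<xi>="\<lambda>_. \<zeta>", OF sc.c cop order_refl smooth_on_const that])
  have smG: "smooth_fun M (fst c) G" unfolding G_def by (rule metric_smooth[OF nm cop field[OF \<xi>(1)] field[OF \<xi>(2)]])
  have repG: "smooth_on (snd c ` (fst c \<inter> fst c)) (\<lambda>z. G (chart_inv c z))" by (rule M.smooth_fun_rep[OF smG cop sc.c])
  have Yc: "Y \<zeta> x c = \<zeta>" if "x \<in> fst c" "\<zeta> \<in> M.E" for x \<zeta>
    unfolding Y_def by (rule M.vec_tangent(2)[OF sc.c_at[OF that(1)] that(2)])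
  have deriv0: "dir_deriv (\<lambda>z. G (chart_inv c z)) (snd c x) \<kappa> = 0" if x: "x \<in> B" and \<kappa>: "\<kappa> \<in> M.E" "p \<kappa> = 0" for x \<kappa>
  proof -
    \<comment> \<open>The cutoff extends the vertical coordinate field to all of \<open>M\<close>.
      It is 1 on the open set \<open>B\<close>, so at \<open>x\<close> brackets and derivatives are
      those of the coordinate field.\<close>
    define V where "V y = (if y \<in> fst c then lincomb (\<beta> y) (Y \<kappa> y) 0 (Y \<kappa> y) else (\<lambda>c. 0))" for y
    have Vf: "vector_field_on M M.X V"
      unfolding V_def by (rule M.field_cutoff[OF \<beta>(9,4,5,7) cop field[OF \<kappa>(1)]])
    have VT: "V y \<in> leaf_tangent M F y" if y: "y \<in> M.X" for y
    proof (cases "y \<in> fst c")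
      case True
      note vT = M.vec_tangent[OF sc.c_at[OF True] \<kappa>(1)]
      have "differential M W h y (M.vec y c \<kappa>) = (\<lambda>c. 0)"
      proof (rule W.tangent_eqI[OF dh_tangent[OF vT(1) y] W.zero_tangent[OF h_mem[OF y]] sc.d_at[OF True]])
        show "differential M W h y (M.vec y c \<kappa>) d = 0" using sc.dh_chart[OF vT(1) True] vT(2) \<kappa>(2) by simp
      qed
      then have "Y \<kappa> y \<in> leaf_tangent M F y" unfolding Y_def by (rule vertical_leaf_tangent[OF y vT(1)])
      then show ?thesis unfolding V_def using MF.T_lincomb[OF y] True by simp
    next
      case False
      then show ?thesis unfolding V_def using MF.T_zero[OF y] by simp
    qed
    have xc: "x \<in> fst c" using x \<beta>(3) by blast
    note xX = sc.in_X[OF xc] and cx = sc.c_at[OF xc]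
    have dom: "openin (top_of_set M.E) (snd c ` (fst c \<inter> B))" "snd c x \<in> snd c ` (fst c \<inter> B)"
      using M.rep_domain[OF cx \<beta>(1) x] .
    have Vc: "V y c = \<kappa>" if "y \<in> B" for y
      using that \<beta>(3,6) Yc[OF _ \<kappa>(1), of y] unfolding V_def by (auto simp: lincomb_def)
    have lb: "lie_bracket M V (Y \<zeta>) x = (\<lambda>c. 0)" if \<zeta>: "\<zeta> \<in> M.E" for \<zeta>
    proof (rule M.tangent_eqI[OF _ M.zero_tangent[OF xX] cx])
      show "lie_bracket M V (Y \<zeta>) x \<in> tangent_space M x"
        by (rule M.lie_bracket_tangent[OF cop xc M.vector_field_subset[OF Vf M.c_subset[OF sc.c]] field[OF \<zeta>]])
      have "dir_deriv (\<lambda>z. Y \<zeta> (chart_inv c z) c) (snd c x) (V x c) = 0"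
      proof (rule dir_deriv_const[OF M.subspace_E dom])
        show "V x c \<in> M.E" using Vc[OF x] \<kappa>(1) by simp
        show "Y \<zeta> (chart_inv c z) c = \<zeta>" if "z \<in> snd c ` (fst c \<inter> B)" for z
          using Yc[OF _ \<zeta>] M.c_inv_mem[OF sc.c that] by blast
      qed
      moreover have "dir_deriv (\<lambda>z. V (chart_inv c z) c) (snd c x) (Y \<zeta> x c) = 0"
      proof (rule dir_deriv_const[OF M.subspace_E dom])
        show "Y \<zeta> x c \<in> M.E" using Yc[OF xc \<zeta>] \<zeta> by simp
        show "V (chart_inv c z) c = \<kappa>" if "z \<in> snd c ` (fst c \<inter> B)" for z
          using Vc M.c_inv_mem[OF sc.c that] by blast
      qed
      ultimately show "lie_bracket M V (Y \<zeta>) x c = 0" unfolding M.lie_bracket_rep[OF cx] by simp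
    qed
    have "lie_deriv_metric M F g V (Y \<xi>) (Y \<xi>') x = 0"
    proof -
      have "vector_field_on M (topspace (points M)) V \<and> (\<forall>m\<in>topspace (points M). V m \<in> leaf_tangent M F m)"
        using Vf VT by blast
      from conjunct2[OF g[unfolded transverse_metric_def], THEN spec, THEN mp, OF this]
      show ?thesis using cop field[OF \<xi>(1)] field[OF \<xi>(2)] xc by (elim allE[of _ "fst c"] allE[of _ "Y \<xi>"] allE[of _ "Y \<xi>'"]) blast
    qed
    then have "deriv_along M x (V x) G = 0"
      unfolding lie_deriv_metric_def lb[OF \<xi>(1)] lb[OF \<xi>(2)] G_def[symmetric, abs_def]
      using MF.nc_zero_cong[OF xX nm M.vector_field_tangent[OF field[OF \<xi>(1)] xc]] MF.nc_zero_cong[OF xX nm M.vector_field_tangent[OF field[OF \<xi>(2)] xc]]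
      by simp
    moreover have "deriv_along M x (V x) G = dir_deriv (\<lambda>z. G (chart_inv c z)) (snd c x) (V x c)"
      by (rule M.deriv_along_rep[where f=G, OF M.vector_field_tangent[OF Vf xX] cx cop xc repG])
    ultimately show ?thesis using Vc[OF x] by simp
  qed
  show thesis
  proof (rule that[of U])
    show "openin (points M) U"
      unfolding U_def by (rule M.c_open_preimage[OF sc.c openin_open_Int[OF open_ball]])
    show "m0 \<in> U" using m0 r(1) M.c_model[OF sc.c m0] by (simp add: U_def Z_def)
    show "U \<subseteq> fst c" by (auto simp: U_def)
    have "G y = G m0" if y: "y \<in> U" "h y = h m0" for y
    proof -
      have yc: "y \<in> fst c" "snd c y \<in> ball Z r" using y(1) by (auto simp: U_def)
      define \<kappa> where "\<kappa> = snd c y - Z"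
      have \<kappa>E: "\<kappa> \<in> M.E" unfolding \<kappa>_def Z_def by (rule subspace_diff[OF M.subspace_E M.c_model[OF sc.c yc(1)] M.c_model[OF sc.c m0]])
      have p\<kappa>: "p \<kappa> = 0"
        unfolding \<kappa>_def Z_def linear_diff[OF bounded_linear.linear[OF sc.p]]
        using sc.h_snd[OF yc(1)] sc.h_snd[OF m0] y(2) by simp
      let ?z = "\<lambda>t::real. Z + t *\<^sub>R \<kappa>"
      have zin: "?z t \<in> snd c ` (fst c \<inter> B)" if t: "t \<in> {0..1}" for t
      proof -
        have "norm (t *\<^sub>R \<kappa>) \<le> norm \<kappa>" using t by (simp add: mult_left_le_one_le)
        also have "norm \<kappa> < r" using yc(2) unfolding \<kappa>_def by (simp add: dist_norm norm_minus_commute)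
        finally have "?z t \<in> ball Z r" by (simp add: dist_norm)
        moreover have "?z t \<in> M.E" unfolding Z_def
          by (intro subspace_add[OF M.subspace_E] subspace_scale[OF M.subspace_E] \<kappa>E M.c_model[OF sc.c m0])
        ultimately show ?thesis using r(2) O1(2) by blast
      qed
      let ?\<phi> = "\<lambda>t. G (chart_inv c (?z t))"
      have "(?\<phi> has_real_derivative 0) (at t within {0..1})" if t: "t \<in> {0..1}" for t
      proof -
        obtain x where x: "x \<in> fst c" "x \<in> B" "?z t = snd c x" using zin[OF t] by blast
        have dom: "openin (top_of_set M.E) (snd c ` (fst c \<inter> fst c))" "snd c x \<in> snd c ` (fst c \<inter> fst c)"
          using M.rep_domain[OF sc.c_at[OF x(1)] cop x(1)] .
        obtain L where L: "((\<lambda>z. G (chart_inv c z)) has_derivative L) (at (snd c x) within snd c ` (fst c \<inter> fst c))"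
          by (rule smooth_on_has_derivative[OF repG dom(2)])
        note hl = has_derivative_along_line[OF M.subspace_E dom \<kappa>E L]
        have "((\<lambda>s. G (chart_inv c (snd c x + s *\<^sub>R \<kappa>))) has_vector_derivative 0) (at 0)"
          using hl deriv0[OF x(2) \<kappa>E p\<kappa>] by simp
        then have "((\<lambda>s. ?\<phi> (s + t)) has_real_derivative 0) (at 0)"
          unfolding x(3)[symmetric] by (simp add: has_real_derivative_iff_has_vector_derivative algebra_simps)
        then have "(?\<phi> has_real_derivative 0) (at t)" using DERIV_shift[of ?\<phi> 0 0 t] by simp
        then show ?thesis by (rule has_field_derivative_at_within)
      qed
      then have "\<exists>k. \<forall>t\<in>{0..1}. ?\<phi> t = k"
        by (intro has_field_derivative_zero_constant) auto
      then obtain k where k: "\<forall>t\<in>{0..1}. ?\<phi> t = k" ..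
      then have "?\<phi> 1 = ?\<phi> 0" using bspec[OF k, of 1] bspec[OF k, of 0] by simp
      moreover have "chart_inv c (?z 0) = m0" "chart_inv c (?z 1) = y"
        using M.c_left[OF sc.c m0] M.c_left[OF sc.c yc(1)] by (simp_all add: \<kappa>_def Z_def)
      ultimately show ?thesis by simp
    qed
    then show "\<forall>y\<in>U. h y = h m0 \<longrightarrow> g y (normal_class M F y (M.vec y c \<xi>)) (normal_class M F y (M.vec y c \<xi>'))
        = g m0 (normal_class M F m0 (M.vec m0 c \<xi>)) (normal_class M F m0 (M.vec m0 c \<xi>'))"
      unfolding G_def Y_def by blast
  qed
qed

text \<open>Along the fibre, \<open>u\<close> and \<open>u'\<close> are represented in an adapted
  chart by the fixed coordinates \<open>J (u d)\<close> and \<open>J (u' d)\<close>, for which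
  constancy in a chart is known; connectedness makes it global.\<close>

lemma metric_constant_on_fibre:
  assumes g: "transverse_metric M F g" and haus: "Hausdorff_space (points M)"
    and conn: "connectedin (points M) (fibre M h w)"
    and u: "u \<in> tangent_space W w" "u' \<in> tangent_space W w"
    and m: "m \<in> M.X" "h m = w" "m' \<in> M.X" "h m' = w"
  shows "g m' (pull m' (normal_class W FW w u)) (pull m' (normal_class W FW w u'))
    = g m (pull m (normal_class W FW w u)) (pull m (normal_class W FW w u'))"
proof (rule connectedin_locally_constant[OF conn, where x=m and
    Q="\<lambda>x. g x (pull x (normal_class W FW w u)) (pull x (normal_class W FW w u')) = g m (pull m (normal_class W FW w u)) (pull m (normal_class W FW w u'))"])
  show "m \<in> fibre M h w" "m' \<in> fibre M h w" using m by (auto simp: fibre_def)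
  fix x assume "x \<in> fibre M h w"
  then have x: "x \<in> M.X" "h x = w" by (auto simp: fibre_def)
  obtain c d p J where sf: "submersion_form M W h c d p J" "x \<in> fst c" using form_at[OF x(1)] by blast
  interpret sc: submersion_chart M W h c d p J by unfold_locales (rule sf(1))
  obtain U where U: "openin (points M) U" "x \<in> U" "U \<subseteq> fst c"
    "\<forall>y\<in>U. h y = h x \<longrightarrow> g y (normal_class M F y (M.vec y c (J (u d)))) (normal_class M F y (M.vec y c (J (u' d))))
        = g x (normal_class M F x (M.vec x c (J (u d)))) (normal_class M F x (M.vec x c (J (u' d))))"
    by (rule metric_constant_in_chart[OF g haus sf sc.J_mem sc.J_mem])
  have eq: "g y (pull y (normal_class W FW w u)) (pull y (normal_class W FW w u'))
    = g x (pull x (normal_class W FW w u)) (pull x (normal_class W FW w u'))" if y: "y \<in> fibre M h w \<inter> U" for y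
  proof -
    have yy: "y \<in> fst c" "h y = w" using y U(3) by (auto simp: fibre_def)
    have P: "pull z (normal_class W FW w v) = normal_class M F z (M.vec z c (J (v d)))"
      if "z \<in> fst c" "h z = w" "v \<in> tangent_space W w" for z v
      using lift_class[OF sf(1) that(1), of v] that by simp
    show ?thesis
      unfolding P[OF yy u(1)] P[OF yy u(2)] P[OF sf(2) x(2) u(1)] P[OF sf(2) x(2) u(2)]
      using U(4) y yy x(2) by simp
  qed
  then show "\<exists>U. openin (points M) U \<and> x \<in> U \<and> (\<forall>y\<in>fibre M h w \<inter> U.
      (g y (pull y (normal_class W FW w u)) (pull y (normal_class W FW w u')) = g m (pull m (normal_class W FW w u)) (pull m (normal_class W FW w u')))
    = (g x (pull x (normal_class W FW w u)) (pull x (normal_class W FW w u')) = g m (pull m (normal_class W FW w u)) (pull m (normal_class W FW w u'))))"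
    using U(1,2) by (intro exI[of _ U]) simp
qed (rule refl)

text \<open>In adapted coordinates the lifted field is \<open>J\<close> after \<open>Y\<close> after
  \<open>p\<close>, with \<open>p\<close> and \<open>J\<close> linear and
  \<open>p (J v) = v\<close>. This is one half of the bracket of two lifts. \<open>L\<close> is
  compared with the lift only on \<open>B\<close>, which admits lifts that are cut off.\<close>

lemma lift_field_derivative:
  assumes sf: "submersion_form M W h c d p J" and m: "m \<in> fst c" and U: "openin (points W) U" "h m \<in> U"
    and Y: "vector_field_on W U Y" and v: "v \<in> W.E" and B: "openin (points M) B" "m \<in> B"
    and L: "\<And>x. x \<in> fst c \<inter> B \<Longrightarrow> h x \<in> U \<Longrightarrow> L x c = J (Y (h x) d)"
  shows "dir_deriv (\<lambda>z. L (chart_inv c z) c) (snd c m) (J v) = J (dir_deriv (\<lambda>z. Y (chart_inv d z) d) (snd d (h m)) v)"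
proof -
  interpret sc: submersion_chart M W h c d p J by unfold_locales (rule sf)
  have BU: "openin (points M) (B \<inter> {x \<in> M.X. h x \<in> U})" by (rule openin_Int[OF B(1) h_preimage[OF U(1)]])
  let ?S = "snd c ` (fst c \<inter> (B \<inter> {x \<in> M.X. h x \<in> U}))" and ?T = "snd d ` (fst d \<inter> U)"
  have S: "openin (top_of_set M.E) ?S" "snd c m \<in> ?S"
    using M.rep_domain[OF sc.c_at[OF m] BU] B(2) U(2) sc.in_X[OF m] by blast+
  have T: "openin (top_of_set W.E) ?T" "snd d (h m) \<in> ?T" by (rule W.rep_domain[OF sc.d_at[OF m] U])+
  have smY: "smooth_on ?T (\<lambda>z. Y (chart_inv d z) d)" by (rule W.vector_field_rep[OF Y sc.d])
  have pT: "p z \<in> ?T" if z: "z \<in> ?S" for z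
  proof -
    obtain x where x: "x \<in> fst c" "h x \<in> U" "z = snd c x" using z by blast
    have "p z = snd d (h x)" using sc.h_snd[OF x(1)] x(3) by simp
    then show ?thesis using sc.h_fst[OF x(1)] x(2) by blast
  qed
  have smp: "smooth_on ?S p" by (rule smooth_on_bounded_linear[OF sc.p])
  have pm: "p (snd c m) = snd d (h m)" using sc.h_snd[OF m] by simp
  have "dir_deriv (\<lambda>z. L (chart_inv c z) c) (snd c m) (J v) = dir_deriv (\<lambda>z. J (Y (chart_inv d (p z)) d)) (snd c m) (J v)"
  proof (rule dir_deriv_cong[OF M.subspace_E S sc.J_mem])
    fix z assume "z \<in> ?S"
    then obtain x where x: "x \<in> fst c" "x \<in> B" "h x \<in> U" "z = snd c x" by blast
    have "chart_inv d (p z) = h x" using sc.h_snd[OF x(1)] W.c_left[OF sc.d sc.h_fst[OF x(1)]] x(4) by simp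
    then show "L (chart_inv c z) c = J (Y (chart_inv d (p z)) d)" using L[of x] x M.c_left[OF sc.c x(1)] by simp
  qed
  also have "\<dots> = J (dir_deriv (\<lambda>z. Y (chart_inv d (p z)) d) (snd c m) (J v))"
    by (rule dir_deriv_bounded_linear_comp[OF M.subspace_E S sc.J_mem smooth_on_comp[OF smp smY pT] sc.J])
  also have "dir_deriv (\<lambda>z. Y (chart_inv d (p z)) d) (snd c m) (J v) = dir_deriv (\<lambda>z. Y (chart_inv d z) d) (p (snd c m)) (dir_deriv p (snd c m) (J v))"
    by (rule dir_deriv_comp[OF M.subspace_E S sc.J_mem smp W.subspace_E T(1) smY pT])
      (use dir_deriv_bounded_linear[OF sc.p] sc.p_mem[OF sc.J_mem] in simp_all)
  also have "\<dots> = dir_deriv (\<lambda>z. Y (chart_inv d z) d) (snd d (h m)) v"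
    unfolding pm dir_deriv_bounded_linear[OF sc.p] sc.pJ[OF v] ..
  finally show ?thesis .
qed

text \<open>\<open>g'\<close> is read off at one chosen point of each fibre, and constancy along
  fibres allows any other point in its place. For smoothness these are the points of a local
  section; for the Lie derivative, lifted fields near one point \<open>m\<close> are used, whose
  derivatives and brackets project to those on \<open>W\<close>.\<close>

lemma riemannian_FW:
  assumes g: "transverse_metric M F g" and haus: "Hausdorff_space (points M)"
    and conn: "\<And>w. w \<in> W.X \<Longrightarrow> connectedin (points M) (fibre M h w)"
  shows "\<exists>g'. transverse_metric W FW g'"
proof -
  have nm: "normal_metric M F g" using g by (simp add: transverse_metric_def)
  define pt where "pt w = (SOME m. m \<in> M.X \<and> h m = w)" for w
  have pt: "pt w \<in> M.X" "h (pt w) = w" if w: "w \<in> W.X" for w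
  proof -
    have "\<exists>m. m \<in> M.X \<and> h m = w" using surj w by (metis imageE)
    from someI_ex[OF this] show "pt w \<in> M.X" "h (pt w) = w" unfolding pt_def by auto
  qed
  define g' where "g' w n n' = g (pt w) (pull (pt w) n) (pull (pt w) n')" for w n n'
  \<comment> \<open>Frees \<open>g'\<close> from the choice made by \<open>pt\<close>.\<close>
  have g'm: "g' (h m) (normal_class W FW (h m) u) (normal_class W FW (h m) u')
      = g m (pull m (normal_class W FW (h m) u)) (pull m (normal_class W FW (h m) u'))"
    if m: "m \<in> M.X" and u: "u \<in> tangent_space W (h m)" "u' \<in> tangent_space W (h m)" for m u u'
    unfolding g'_def
    by (rule metric_constant_on_fibre[OF g haus conn[OF h_mem[OF m]] u m refl pt[OF h_mem[OF m]]])
  have g'_form: "g' (h m) (normal_class W FW (h m) u) (normal_class W FW (h m) u')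
      = g m (normal_class M F m (M.vec m c (J (u d)))) (normal_class M F m (M.vec m c (J (u' d))))"
    if sf: "submersion_form M W h c d p J" "m \<in> fst c" "m \<in> M.X" and u: "u \<in> tangent_space W (h m)" "u' \<in> tangent_space W (h m)" for c d p J m u u'
    unfolding g'm[OF sf(3) u] lift_class[OF sf(1,2) u(1)] lift_class[OF sf(1,2) u(2)] ..
  have nm': "normal_metric W FW g'"
    unfolding normal_metric_def
  proof (intro conjI ballI allI impI; (elim conjE)?)
    fix w u v x a b assume w: "w \<in> W.X" and u: "u \<in> tangent_space W w" and v: "v \<in> tangent_space W w" and x: "x \<in> tangent_space W w"
    note m = pt[OF w]
    have wm: "y \<in> tangent_space W (h (pt w))" if "y \<in> tangent_space W w" for y using that m(2) by simp
    obtain u' where u': "u' \<in> tangent_space M (pt w)" "differential M W h (pt w) u' = u" by (rule dh_surj[OF m(1) wm[OF u]])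
    obtain v' where v': "v' \<in> tangent_space M (pt w)" "differential M W h (pt w) v' = v" by (rule dh_surj[OF m(1) wm[OF v]])
    obtain x' where x': "x' \<in> tangent_space M (pt w)" "differential M W h (pt w) x' = x" by (rule dh_surj[OF m(1) wm[OF x]])
    have P: "pull (pt w) (normal_class W FW w (differential M W h (pt w) y)) = normal_class M F (pt w) y"
      if "y \<in> tangent_space M (pt w)" for y using pull_normal_class[OF m(1) that] m(2) by simp
    show "g' w (normal_class W FW w (lincomb a u b v)) (normal_class W FW w x) =
        a * g' w (normal_class W FW w u) (normal_class W FW w x) + b * g' w (normal_class W FW w v) (normal_class W FW w x)"
      unfolding g'_def u'(2)[symmetric] v'(2)[symmetric] x'(2)[symmetric] dh_lincomb[OF u'(1) v'(1) m(1), symmetric]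
        P[OF u'(1)] P[OF v'(1)] P[OF x'(1)] P[OF M.lincomb_tangent[OF u'(1) v'(1) m(1)]]
      by (rule metric_linear[OF nm m(1) u'(1) v'(1) x'(1)])
  next
    fix w n n' assume w: "w \<in> W.X" and n: "n \<in> normal_space W FW w" "n' \<in> normal_space W FW w"
    note m = pt[OF w]
    show "g' w n n' = g' w n' n"
      unfolding g'_def by (rule metric_sym[OF nm m(1)]) (use pull_normal_space[OF m(1)] n m(2) in simp_all)
  next
    fix w n assume w: "w \<in> W.X" and n: "n \<in> normal_space W FW w" "n \<noteq> normal_class W FW w (\<lambda>c. 0)"
    note m = pt[OF w]
    have z: "(\<lambda>c. 0) \<in> tangent_space M (pt w)" by (rule M.zero_tangent[OF m(1)])
    have "lincomb 0 (\<lambda>c. 0) 0 (\<lambda>c. 0) = ((\<lambda>c. 0) :: ('a, 'e) tvec)" by (simp add: lincomb_def)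
    then have "differential M W h (pt w) (\<lambda>c. 0) = (\<lambda>c. 0)"
      using dh_lincomb[OF z z m(1), of 0 0] by (simp add: lincomb_def)
    then have P0: "pull (pt w) (normal_class W FW w (\<lambda>c. 0)) = normal_class M F (pt w) (\<lambda>c. 0)"
      using pull_normal_class[OF m(1) z] m(2) by simp
    have n0: "normal_class W FW w (\<lambda>c. 0) \<in> normal_space W FW w"
      unfolding normal_space_def using W.zero_tangent[OF w] by blast
    \<comment> \<open>Positivity descends because \<open>pull\<close> is injective and carries the
      zero class to the zero class.\<close>
    have "pull (pt w) n \<noteq> normal_class M F (pt w) (\<lambda>c. 0)"
      unfolding P0[symmetric] using pull_inj[OF m(1), of n "normal_class W FW w (\<lambda>c. 0)"] n n0 m(2) by auto
    then show "0 < g' w n n"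
      unfolding g'_def by (intro metric_pos[OF nm m(1)]) (use pull_normal_space[OF m(1)] n m(2) in simp)
  next
    fix U Y Z assume U: "openin (points W) U" and Y: "vector_field_on W U Y" and Z: "vector_field_on W U Z"
    show "smooth_fun W U (\<lambda>m. g' m (normal_class W FW m (Y m)) (normal_class W FW m (Z m)))"
    proof (rule W.smooth_fun_local[OF U])
      fix w assume w: "w \<in> U"
      then have wX: "w \<in> W.X" using openin_subset[OF U] by blast
      note m = pt[OF wX]
      obtain c d p J where sf: "submersion_form M W h c d p J" "pt w \<in> fst c" using form_at[OF m(1)] by blast
      interpret sc: submersion_chart M W h c d p J by unfold_locales (rule sf(1))
      define A where "A = {x \<in> fst c. h x \<in> U}"
      have "A = fst c \<inter> {x \<in> M.X. h x \<in> U}" using sc.in_X by (auto simp: A_def)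
      then have A: "openin (points M) A" "A \<subseteq> fst c" "h ` A \<subseteq> U"
        using openin_Int[OF M.c_open[OF sc.c] h_preimage[OF U]] by (auto simp: A_def)
      define G where "G x = g x (normal_class M F x (sc.lift x (Y (h x)))) (normal_class M F x (sc.lift x (Z (h x))))" for x
      have G: "smooth_fun M A G"
        unfolding G_def by (rule metric_smooth[OF nm A(1) sc.lift_field[OF U Y A] sc.lift_field[OF U Z A]])
      let ?D = "sc.sdom (pt w) (fst c)"
      have "smooth_fun W (U \<inter> ?D) (\<lambda>m. g' m (normal_class W FW m (Y m)) (normal_class W FW m (Z m)))"
        unfolding sc.sdom_restrict[OF sf(2), symmetric] A_def[symmetric]
      proof (rule sc.section_smooth_funI[OF sf(2) A(1) G])
        fix x assume x: "x \<in> sc.sdom (pt w) A"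
        note s = sc.section_at[OF sf(2) x]
        let ?s = "sc.section_at (pt w) x"
        have xU: "x \<in> U" using s(2,3) A(3) by auto
        have "Y x \<in> tangent_space W (h ?s)" "Z x \<in> tangent_space W (h ?s)"
          using W.vector_field_tangent[OF Y xU] W.vector_field_tangent[OF Z xU] s(3) by simp_all
        from g'_form[OF sf(1) s(1) sc.in_X[OF s(1)] this]
        show "g' x (normal_class W FW x (Y x)) (normal_class W FW x (Z x)) = G ?s"
          unfolding G_def sc.lift_def s(3) .
      qed
      then show "\<exists>B. openin (points W) B \<and> w \<in> B \<and> smooth_fun W (U \<inter> B) (\<lambda>m. g' m (normal_class W FW m (Y m)) (normal_class W FW m (Z m)))"
        using sc.sdom_open[OF sf(2) M.c_open[OF sc.c]] sc.sdom_base[OF sf(2) sf(2)] m(2) by (intro exI[of _ ?D]) simp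
    qed
  qed
  have "lie_deriv_metric W FW g' V Y Z w = 0"
    if V: "vector_field_on W W.X V" "\<forall>m\<in>W.X. V m \<in> leaf_tangent W FW m"
      and U: "openin (points W) U" and Y: "vector_field_on W U Y" and Z: "vector_field_on W U Z" and w: "w \<in> U" for V U Y Z w
  proof -
    have wX: "w \<in> W.X" using w openin_subset[OF U] by blast
    define m where "m = pt w"
    have m: "m \<in> M.X" "h m = w" using pt[OF wX] by (simp_all add: m_def)
    obtain c d p J where sf: "submersion_form M W h c d p J" "m \<in> fst c" using form_at[OF m(1)] by blast
    interpret sc: submersion_chart M W h c d p J by unfold_locales (rule sf(1))
    note cop = M.c_open[OF sc.c]
    define A where "A = {x \<in> fst c. h x \<in> U}"
    have "A = fst c \<inter> {x \<in> M.X. h x \<in> U}" using sc.in_X by (auto simp: A_def)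
    then have A: "openin (points M) A" "A \<subseteq> fst c" "h ` A \<subseteq> U"
      using openin_Int[OF cop h_preimage[OF U]] by (auto simp: A_def)
    have mA: "m \<in> A" using sf(2) w m(2) by (simp add: A_def)
    have hX: "h ` fst c \<subseteq> W.X" using h_mem sc.in_X by blast
    define LV where "LV x = sc.lift x (V (h x))" for x
    define LY where "LY x = sc.lift x (Y (h x))" for x
    define LZ where "LZ x = sc.lift x (Z (h x))" for x
    have fV: "vector_field_on M (fst c) LV" unfolding LV_def by (rule sc.lift_field[OF openin_topspace V(1) cop order_refl hX])
    have fY: "vector_field_on M A LY" unfolding LY_def by (rule sc.lift_field[OF U Y A])
    have fZ: "vector_field_on M A LZ" unfolding LZ_def by (rule sc.lift_field[OF U Z A])
    obtain \<beta> B K where \<beta>: "openin (points M) B" "m \<in> B" "B \<subseteq> fst c" "closedin (points M) K" "K \<subseteq> fst c"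
        "\<forall>x\<in>B. \<beta> x = 1" "\<forall>x. x \<notin> K \<longrightarrow> \<beta> x = 0" "\<forall>x. 0 \<le> \<beta> x" "smooth_fun M M.X \<beta>"
      by (rule M.bump_function[OF haus cop sf(2)])
    \<comment> \<open>The lift of \<open>V\<close> lives in one adapted chart. The cutoff makes it a
      field on all of \<open>M\<close>, still tangent to the leaves and equal to the lift on the
      neighbourhood \<open>B\<close> of \<open>m\<close>.\<close>
    define CV where "CV x = (if x \<in> fst c then lincomb (\<beta> x) (LV x) 0 (LV x) else (\<lambda>c. 0))" for x
    have fC: "vector_field_on M M.X CV" unfolding CV_def by (rule M.field_cutoff[OF \<beta>(9,4,5,7) cop fV])
    have CT: "CV x \<in> leaf_tangent M F x" if x: "x \<in> M.X" for x
    proof (cases "x \<in> fst c")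
      case True
      have Vh: "V (h x) \<in> tangent_space W (h x)" by (rule W.vector_field_tangent[OF V(1) h_mem[OF x]])
      have "differential M W h x (LV x) \<in> leaf_tangent W FW (h x)"
        unfolding LV_def sc.dh_lift[OF True Vh] using V(2) h_mem[OF x] by blast
      then have "LV x \<in> leaf_tangent M F x"
        using leaf_tangent_iff_dh[OF x M.vector_field_tangent[OF fV True]] by simp
      then show ?thesis unfolding CV_def using MF.T_lincomb[OF x] True by simp
    next
      case False
      then show ?thesis unfolding CV_def using MF.T_zero[OF x] by simp
    qed
    have Lc: "LV x c = J (V (h x) d)" "LY x c = J (Y (h x) d)" "LZ x c = J (Z (h x) d)" if "x \<in> fst c" for x
      unfolding LV_def LY_def LZ_def by (rule sc.lift_c[OF that])+
    have CB: "CV x c = J (V (h x) d)" if "x \<in> fst c \<inter> B" for x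
      using that \<beta>(6) Lc(1)[of x] unfolding CV_def by (simp add: lincomb_def)
    note cm = sc.c_at[OF sf(2)] and dm = sc.d_at[OF sf(2)]
    have dw: "d \<in> charts_at W w" using dm m(2) by simp
    have tE: "V w d \<in> W.E" "Y w d \<in> W.E" "Z w d \<in> W.E"
      using W.tangent_mem[OF W.vector_field_tangent[OF V(1) wX] dw] W.tangent_mem[OF W.vector_field_tangent[OF Y w] dw]
        W.tangent_mem[OF W.vector_field_tangent[OF Z w] dw] .
    \<comment> \<open>The lifts are related to the fields on \<open>W\<close> by \<open>h\<close>,
      hence so are the brackets at \<open>m\<close>; in coordinates this follows from linearity of
      \<open>p\<close> and \<open>p (J v) = v\<close>.\<close>
    have bracket: "lie_bracket M CV L m \<in> tangent_space M m \<and> differential M W h m (lie_bracket M CV L m) = lie_bracket W V Q w"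
      if fL: "vector_field_on M A L" and fQ: "vector_field_on W U Q" and LQ: "\<And>x. x \<in> fst c \<Longrightarrow> L x c = J (Q (h x) d)" for L Q
    proof -
      have T: "lie_bracket M CV L m \<in> tangent_space M m"
        by (rule M.lie_bracket_tangent[OF A(1) mA M.vector_field_subset[OF fC openin_subset[OF A(1)]] fL])
      have T': "lie_bracket W V Q w \<in> tangent_space W w"
        by (rule W.lie_bracket_tangent[OF U w W.vector_field_subset[OF V(1) openin_subset[OF U]] fQ])
      have QE: "Q w d \<in> W.E" by (rule W.tangent_mem[OF W.vector_field_tangent[OF fQ w] dw])
      have C: "CV m c = J (V w d)" using CB[of m] sf(2) \<beta>(2) m(2) by simp
      have L: "L m c = J (Q w d)" using LQ[OF sf(2)] m(2) by simp
      have hU: "h m \<in> U" using w m(2) by simp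
      have 1: "dir_deriv (\<lambda>z. L (chart_inv c z) c) (snd c m) (J (V w d)) = J (dir_deriv (\<lambda>z. Q (chart_inv d z) d) (snd d w) (V w d))"
        using lift_field_derivative[OF sf U hU fQ tE(1) \<beta>(1,2), of L] LQ m(2) by simp
      have 2: "dir_deriv (\<lambda>z. CV (chart_inv c z) c) (snd c m) (J (Q w d)) = J (dir_deriv (\<lambda>z. V (chart_inv d z) d) (snd d w) (Q w d))"
        using lift_field_derivative[OF sf openin_topspace h_mem[OF m(1)] V(1) QE \<beta>(1,2), of CV] CB m(2) by simp
      have E1: "dir_deriv (\<lambda>z. P (chart_inv d z) d) (snd d w) v \<in> W.E"
        if "vector_field_on W U P" "v \<in> W.E" for P v
      proof (rule dir_deriv_mem[OF W.subspace_E W.rep_domain[OF dw U w] that(2) W.vector_field_rep[OF that(1) sc.d] W.subspace_E])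
        fix z assume "z \<in> snd d ` (fst d \<inter> U)"
        then obtain x where x: "x \<in> fst d" "x \<in> U" "z = snd d x" by blast
        show "P (chart_inv d z) d \<in> W.E"
          using W.tangent_mem[OF W.vector_field_tangent[OF that(1) x(2)] W.charts_atI[OF sc.d x(1)]] W.c_left[OF sc.d x(1)] x(3) by simp
      qed
      let ?a = "dir_deriv (\<lambda>z. Q (chart_inv d z) d) (snd d w) (V w d)" and ?b = "dir_deriv (\<lambda>z. V (chart_inv d z) d) (snd d w) (Q w d)"
      have ab: "?a \<in> W.E" "?b \<in> W.E"
        using E1[OF fQ tE(1)] E1[OF W.vector_field_subset[OF V(1) openin_subset[OF U]] QE] .
      have "differential M W h m (lie_bracket M CV L m) d = p (J ?a - J ?b)"
        unfolding sc.dh_chart[OF T sf(2)] M.lie_bracket_rep[OF cm] C L 1 2 ..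
      also have "\<dots> = ?a - ?b"
        using sc.pJ ab by (simp add: linear_diff[OF bounded_linear.linear[OF sc.p]])
      also have "\<dots> = lie_bracket W V Q w d" unfolding W.lie_bracket_rep[OF dw] ..
      finally have eq: "differential M W h m (lie_bracket M CV L m) d = lie_bracket W V Q w d" .
      have "differential M W h m (lie_bracket M CV L m) \<in> tangent_space W w" using dh_tangent[OF T m(1)] m(2) by simp
      then have "differential M W h m (lie_bracket M CV L m) = lie_bracket W V Q w" using W.tangent_eqI[where c=d and u="differential M W h m (lie_bracket M CV L m)" and v="lie_bracket W V Q w", OF _ T' dw eq] by blast
      then show ?thesis using T by blast
    qed
    have bY: "lie_bracket M CV LY m \<in> tangent_space M m \<and> differential M W h m (lie_bracket M CV LY m) = lie_bracket W V Y w"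
      by (rule bracket[OF fY Y]) (rule Lc(2))
    have bZ: "lie_bracket M CV LZ m \<in> tangent_space M m \<and> differential M W h m (lie_bracket M CV LZ m) = lie_bracket W V Z w"
      by (rule bracket[OF fZ Z]) (rule Lc(3))
    have g'M: "g' w (normal_class W FW w (differential M W h m a)) (normal_class W FW w (differential M W h m b))
        = g m (normal_class M F m a) (normal_class M F m b)"
      if ab: "a \<in> tangent_space M m" "b \<in> tangent_space M m" for a b
      using g'm[OF m(1) dh_tangent[OF ab(1) m(1)] dh_tangent[OF ab(2) m(1)]]
      by (simp only: m(2) pull_normal_class[OF m(1) ab(1), unfolded m(2)] pull_normal_class[OF m(1) ab(2), unfolded m(2)])
    have hY: "differential M W h m (LY m) = Y w" "differential M W h m (LZ m) = Z w"
      using sc.dh_lift[OF sf(2), of "Y w"] sc.dh_lift[OF sf(2), of "Z w"] W.vector_field_tangent[OF Y w] W.vector_field_tangent[OF Z w] m(2)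
      by (simp_all add: LY_def LZ_def)
    have TY: "LY m \<in> tangent_space M m" "LZ m \<in> tangent_space M m"
      using M.vector_field_tangent[OF fY mA] M.vector_field_tangent[OF fZ mA] .
    define G where "G x = g x (normal_class M F x (LY x)) (normal_class M F x (LZ x))" for x
    define H where "H x = g' x (normal_class W FW x (Y x)) (normal_class W FW x (Z x))" for x
    \<comment> \<open>The coefficient functions correspond on all of \<open>A\<close> and not just
      at \<open>m\<close>, which allows comparing their derivatives.\<close>
    have GH: "G x = H (h x)" if x: "x \<in> A" for x
    proof -
      have xc: "x \<in> fst c" "h x \<in> U" using x by (auto simp: A_def)
      show ?thesis
        unfolding G_def H_def LY_def LZ_def sc.lift_def
        by (rule g'_form[OF sf(1) xc(1) sc.in_X[OF xc(1)] W.vector_field_tangent[OF Y xc(2)] W.vector_field_tangent[OF Z xc(2)], symmetric])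
    qed
    have smG: "smooth_fun M A G" unfolding G_def by (rule metric_smooth[OF nm A(1) fY fZ])
    have smH: "smooth_fun W U H" unfolding H_def by (rule metric_smooth[OF nm' U Y Z])
    have der: "deriv_along M m (CV m) G = deriv_along W w (V w) H"
    proof -
      have repG: "smooth_on (snd c ` (fst c \<inter> A)) (\<lambda>z. G (chart_inv c z))" by (rule M.smooth_fun_rep[OF smG A(1) sc.c])
      have repH: "smooth_on (snd d ` (fst d \<inter> U)) (\<lambda>z. H (chart_inv d z))" by (rule W.smooth_fun_rep[OF smH U sc.d])
      have S: "openin (top_of_set M.E) (snd c ` (fst c \<inter> A))" "snd c m \<in> snd c ` (fst c \<inter> A)"
        using M.rep_domain[OF cm A(1) mA] .
      have pT: "p z \<in> snd d ` (fst d \<inter> U)" "G (chart_inv c z) = H (chart_inv d (p z))" if z: "z \<in> snd c ` (fst c \<inter> A)" for z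
      proof -
        obtain x where x: "x \<in> fst c" "x \<in> A" "z = snd c x" using z by blast
        have pz: "p z = snd d (h x)" using sc.h_snd[OF x(1)] x(3) by simp
        have "h x \<in> U" using x(2) by (simp add: A_def)
        then show "p z \<in> snd d ` (fst d \<inter> U)" using pz sc.h_fst[OF x(1)] by blast
        show "G (chart_inv c z) = H (chart_inv d (p z))"
          using pz W.c_left[OF sc.d sc.h_fst[OF x(1)]] M.c_left[OF sc.c x(1)] x(3) GH[OF x(2)] by simp
      qed
      have "deriv_along M m (CV m) G = dir_deriv (\<lambda>z. G (chart_inv c z)) (snd c m) (CV m c)"
        by (rule M.deriv_along_rep[where f=G, OF M.vector_field_tangent[OF fC m(1)] cm A(1) mA repG])
      also have "CV m c = J (V w d)" using CB[of m] sf(2) \<beta>(2) m(2) by simp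
      also have "dir_deriv (\<lambda>z. G (chart_inv c z)) (snd c m) (J (V w d)) = dir_deriv (\<lambda>z. H (chart_inv d (p z))) (snd c m) (J (V w d))"
        by (rule dir_deriv_cong[OF M.subspace_E S sc.J_mem pT(2)])
      also have "\<dots> = dir_deriv (\<lambda>z. H (chart_inv d z)) (p (snd c m)) (dir_deriv p (snd c m) (J (V w d)))"
        by (rule dir_deriv_comp[OF M.subspace_E S sc.J_mem smooth_on_bounded_linear[OF sc.p] W.subspace_E W.rep_domain(1)[OF dw U w] repH pT(1)])
          (use dir_deriv_bounded_linear[OF sc.p] sc.p_mem[OF sc.J_mem] in simp_all)
      also have "\<dots> = dir_deriv (\<lambda>z. H (chart_inv d z)) (snd d w) (V w d)"
        unfolding dir_deriv_bounded_linear[OF sc.p] sc.pJ[OF tE(1)] sc.h_snd[OF sf(2), symmetric] m(2) ..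
      also have "\<dots> = deriv_along W w (V w) H"
        by (rule W.deriv_along_rep[where f=H, OF W.vector_field_tangent[OF V(1) wX] dw U w repH, symmetric])
      finally show ?thesis .
    qed
    \<comment> \<open>The derivative term and the two bracket terms correspond one by one to those
      of the lifts.\<close>
    have "lie_deriv_metric W FW g' V Y Z w = lie_deriv_metric M F g CV LY LZ m"
      unfolding lie_deriv_metric_def G_def[symmetric] H_def[symmetric] der
      using g'M[OF conjunct1[OF bY] TY(2)] g'M[OF TY(1) conjunct1[OF bZ]]
      unfolding conjunct2[OF bY] conjunct2[OF bZ] hY by simp
    also have "\<dots> = 0"
    proof -
      have "vector_field_on M (topspace (points M)) CV \<and> (\<forall>m\<in>topspace (points M). CV m \<in> leaf_tangent M F m)"
        using fC CT by blast
      from conjunct2[OF g[unfolded transverse_metric_def], THEN spec, THEN mp, OF this]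
      show ?thesis using A(1) fY fZ mA by (elim allE[of _ A] allE[of _ LY] allE[of _ LZ]) blast
    qed
    finally show ?thesis .
  qed
  then have "transverse_metric W FW g'"
    unfolding transverse_metric_def using nm' by blast
  then show ?thesis by blast
qed

end

theorem theorem1:
  fixes M :: "('a, 'e::euclidean_space) manifold"
    and W :: "('b, 'f::euclidean_space) manifold"
    and \<pi> :: "'a \<Rightarrow> 'b"
    and F F' :: "'a set set"
    and q q' :: nat
  assumes "compact_manifold M" and "compact_manifold W"
    and "fibration M W \<pi>"
    and "\<forall>w\<in>topspace (points W). connectedin (points M) (fibre M \<pi> w)"
    and "F = fibre M \<pi> ` topspace (points W)"
    and "foliation M q F" and "transversely_orientable M q F"
    and "foliation M q' F'" and "transversely_orientable M q' F'"
    and "subfoliation F F'"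
  shows "\<exists>r FW. foliation W r FW \<and> transversely_orientable W r FW \<and>
           projects_to M W \<pi> F' FW \<and>
           (riemannian_foliation M q' F' \<longrightarrow> riemannian_foliation W r FW)"
proof -
  have M: "smooth_manifold M" and W: "smooth_manifold W" and cpt: "compact_space (points W)"
    using assms(1,2) by (auto simp: compact_manifold_def)
  have haus: "Hausdorff_space (points M)" using M by (simp add: smooth_manifold_def)
  have sm: "smooth_map M W \<pi>" and surj: "\<pi> ` topspace (points M) = topspace (points W)"
    using assms(3) by (auto simp: fibration_def)
  have part: "partition_on (topspace (points M)) F'" using assms(8) by (simp add: foliation_def)
  \<comment> \<open>The fibre through \<open>x\<close> is a leaf of \<open>F\<close>, hence inside a
    leaf of \<open>F'\<close>, which by disjointness is the one containing \<open>x\<close>.\<close>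
  have sat: "y \<in> L" if L: "L \<in> F'" "x \<in> L" and y: "y \<in> topspace (points M)" "\<pi> y = \<pi> x" for L x y
  proof -
    have x: "x \<in> topspace (points M)" using part L by (auto simp: partition_on_def)
    have "fibre M \<pi> (\<pi> x) \<in> F" using assms(5) surj x by blast
    then obtain L' where L': "L' \<in> F'" "fibre M \<pi> (\<pi> x) \<subseteq> L'" using assms(10) unfolding subfoliation_def by blast
    have "x \<in> L'" "y \<in> L'" using L'(2) x y by (auto simp: fibre_def)
    moreover have "L' = L" using part L L'(1) \<open>x \<in> L'\<close> unfolding partition_on_def disjoint_def by blast
    ultimately show ?thesis by simp
  qed
  \<comment> \<open>From here on \<open>FW\<close> denotes the set of images of the leaves of
    \<open>F'\<close>; its codimension \<open>q'\<close> is the witness for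
    \<open>r\<close>.\<close>
  interpret saturated_foliation M W \<pi> F' q'
  proof unfold_locales
    show "\<exists>c d p J. submersion_form M W \<pi> c d p J \<and> m \<in> fst c" if "m \<in> topspace (points M)" for m
      using fibration_submersion_form[OF M W assms(3) that] by metis
  qed (use M W sm surj assms(8) sat in auto)
  obtain \<omega> where "transverse_volume_form M q' F' \<omega>" using assms(9) unfolding transversely_orientable_def by blast
  then have "transversely_orientable W q' FW" using transversely_orientable_FW[OF _ cpt] assms(4) by blast
  moreover have "projects_to M W \<pi> F' FW" unfolding projects_to_def using dh_leaf_tangent by blast
  moreover have "riemannian_foliation W q' FW" if "riemannian_foliation M q' F'"
    using that riemannian_FW[OF _ haus] assms(4) FW_foliation unfolding riemannian_foliation_def by blast
  ultimately show ?thesis using FW_foliation by blast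
qed

end
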